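(* Let $(u^\varepsilon)$, for some sequence $\varepsilon\to0$, be a sequence of weak solutions $u^\varepsilon\in H^1(\Omega_\varepsilon)$ of $-\Delta u^\varepsilon-\omega^2u^\varepsilon=f$ in $\Omega_\varepsilon$, $\partial_nu^\varepsilon=0$ on $\partial\Omega_\varepsilon$, with $\|u^\varepsilon\|_{H^1(\Omega_\varepsilon)}$ bounded uniformly in $\varepsilon$ and $u^\varepsilon|_{\Omega_0}\rightharpoonup u$ weakly in $H^1(\Omega_0)$ for some $u\in H^1(\Omega_0)$. With $$v^\varepsilon(x_1):=\frac1{\varepsilon V}\int_{\varepsilon L}^{\varepsilon(L+V)}u^\varepsilon(x_1,x_2)\,dx_2\quad(x_1\in I),\qquad w^\varepsilon:=\frac{u^\varepsilon-u}{\varepsilon}\ \text{ on }\Omega_0,$$ assume that: (i) $v^\varepsilon\rightharpoonup v$ weakly in $L^2(I)$ for some $v\in H^1(I)$; (ii) $w^\varepsilon$ is bounded in $W^{1,1}(\Omega_0)$ and $w^\varepsilon\rightharpoonup w$ weakly-$*$ in $BV(\bar\Omega_0)$ for some $w\in W^{1,1}(\Omega_0)$; (iii) there is a constant $C>0$ independent of $\varepsilon$ with $\frac1{\varepsilon^2}\int_{C_\varepsilon}|\partial_2u^\varepsilon|\le C$. Then $v\in W^{2,1}(I)$, and $w$ and $v$ satisfy the system $$-\Delta w-\omega^2w=0\ \text{in }\Omega_0,\qquad \partial_nw=V(\partial_1^2+\omega^2)v\ \text{on }\Gamma_0,\qquad \partial_nw=0\ \text{on }\partial\Omega_0\setminus\Gamma_0,$$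 $$\Big(-\partial_1^2+\Big(\frac{\alpha}{LV}-\omega^2\Big)\Big)v=\frac{\alpha}{LV}\,u|_{\Gamma_0}\ \text{ on } I,\qquad \partial_1v=0\ \text{ at }\partial I,$$ in the following weak sense: for every $\varphi\in C^1(\bar\Omega_0)$, $$\int_{\Omega_0}\nabla w\cdot\nabla\varphi-\omega^2\int_{\Omega_0}w\,\varphi=-V\int_{\Gamma_0}\big(\partial_1v\,\partial_1\varphi-\omega^2v\,\varphi\big),$$ and for every $\psi\in C^1(\bar\Gamma_0)$, $$\int_{\Gamma_0}\partial_1v\,\partial_1\psi+\int_{\Gamma_0}\Big(\frac{\alpha}{LV}-\omega^2\Big)v\,\psi=\int_{\Gamma_0}\frac{\alpha}{LV}\,u\,\psi .$$
   Context: Geometry. Fix real numbers $a,b,L,V,\alpha>0$. Let $I:=(0,a)$, $\Omega_0:=I\times(-b,0)\subset\mathbb{R}^2$, and $\Gamma_0:=I\times\{0\}$ (the upper boundary of $\Omega_0$). Functions on $I$ are identified with functions on $\Gamma_0$ via $x_1\leftrightarrow(x_1,0)$; integrals over $\Gamma_0$ are with respect to $dx_1$, and $u|_{\Gamma_0}$ is the trace of $u$. The parameter $\varepsilon>0$ always satisfies $a/\varepsilon\in\mathbb{N}$. Set $$S_\varepsilon:=I\times(L\varepsilon,(L+V)\varepsilon),\qquad C_\varepsilon:=\bigcup_{k=0}^{(a/\varepsilon)-1}(k\varepsilon,k\varepsilon+\alpha\varepsilon^3)\times[0,L\varepsilon],\qquad \Omega_\varepsilon:=\Omega_0\cup S_\varepsilon\cup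 C_\varepsilon .$$ Data. The frequency $\omega>0$ and $f\in L^2(\mathbb{R}^2)$ are given (independent of $\varepsilon$), and $f$ has support in $\Omega_0$. All functions are real-valued. Weak solution of the $\varepsilon$-problem means $\int_{\Omega_\varepsilon}\nabla u^\varepsilon\cdot\nabla\varphi-\omega^2\int_{\Omega_\varepsilon}u^\varepsilon\varphi=\int_{\Omega_\varepsilon}f\varphi$ for all $\varphi\in H^1(\Omega_\varepsilon)$. Weak-$*$ convergence $w^\varepsilon\rightharpoonup w$ in $BV(\bar\Omega_0)$ means: $w^\varepsilon\to w$ in $L^1(\Omega_0)$ and $\int_{\Omega_0}\nabla w^\varepsilon\cdot\phi\to\int_{\Omega_0}\nabla w\cdot\phi$ for all $\phi\in C(\bar\Omega_0;\mathbb{R}^2)$. *)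

theory Defs
  imports "HOL-Analysis.Analysis"
begin

text \<open>
  The plane is \<^typ>\<open>real \<times> real\<close>, with first coordinate $x_1$ and second coordinate $x_2$.
  Elements of the Lebesgue and Sobolev spaces are rendered by Borel representatives, that is, by
  functions whose restriction to the domain is Borel measurable; every class of Lebesgue
  measurable functions modulo null sets contains one. Values outside the domain are irrelevant.
\<close>


subsection \<open>Classical derivatives\<close>

definition pd :: "'a::euclidean_space \<Rightarrow> ('a \<Rightarrow> real) \<Rightarrow> 'a \<Rightarrow> real" where
  "pd i \<phi> x = frechet_derivative \<phi> (at x) i"

definition grad :: "('a::euclidean_space \<Rightarrow> real) \<Rightarrow> 'a \<Rightarrow> 'a" where
  "grad \<phi> x = (\<Sum>i\<in>Basis. pd i \<phi> x *\<^sub>R i)"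

primrec Ck :: "nat \<Rightarrow> ('a::euclidean_space \<Rightarrow> real) \<Rightarrow> bool" where
  "Ck 0 \<phi> \<longleftrightarrow> continuous_on UNIV \<phi>"
| "Ck (Suc k) \<phi> \<longleftrightarrow> (\<forall>x. \<phi> differentiable (at x)) \<and> (\<forall>i\<in>Basis. Ck k (pd i \<phi>))"

definition test_functions :: "'a::euclidean_space set \<Rightarrow> ('a \<Rightarrow> real) set" where
  "test_functions S = {\<phi>. (\<forall>k. Ck k \<phi>) \<and> (\<exists>K. compact K \<and> K \<subseteq> S \<and> (\<forall>x. x \<notin> K \<longrightarrow> \<phi> x = 0))}"

text \<open>
  \<open>C1_closure S\<close>, for open bounded \<open>S\<close>, is $C^1(\bar S)$: functions continuous on the closure, continuously
  differentiable in \<open>S\<close>, with a gradient that extends continuously to the closure.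
\<close>
definition C1_closure :: "'a::euclidean_space set \<Rightarrow> ('a \<Rightarrow> real) set" where
  "C1_closure S = {\<phi>. continuous_on (closure S) \<phi> \<and>
     (\<exists>D. continuous_on (closure S) D \<and> (\<forall>x\<in>S. GDERIV \<phi> x :> D x))}"


subsection \<open>Lebesgue and Sobolev spaces\<close>

text \<open>Only the exponents 1 and 2 are needed, so that the exponent can be a (positive) natural number.\<close>
definition Lp :: "nat \<Rightarrow> 'a::euclidean_space set \<Rightarrow> ('a \<Rightarrow> real) set" where
  "Lp p S = {u. set_borel_measurable lborel S u \<and> set_integrable lborel S (\<lambda>x. \<bar>u x\<bar> ^ p)}"

definition L1loc :: "'a::euclidean_space set \<Rightarrow> ('a \<Rightarrow> real) set" where
  "L1loc S = {u. set_borel_measurable lborel S u \<and>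
     (\<forall>K. compact K \<and> K \<subseteq> S \<longrightarrow> set_integrable lborel K u)}"

definition has_weak_pd :: "'a::euclidean_space set \<Rightarrow> 'a \<Rightarrow> ('a \<Rightarrow> real) \<Rightarrow> ('a \<Rightarrow> real) \<Rightarrow> bool" where
  "has_weak_pd S i u g \<longleftrightarrow> u \<in> L1loc S \<and> g \<in> L1loc S \<and>
     (\<forall>\<phi>\<in>test_functions S. (LBINT x:S. u x * pd i \<phi> x) = - (LBINT x:S. g x * \<phi> x))"

text \<open>
  The weak derivative is determined only almost everywhere; \<open>wpd\<close> selects a representative. It
  occurs below only inside integrals and in conditions invariant under changes on null sets.
\<close>
definition wpd :: "'a::euclidean_space set \<Rightarrow> 'a \<Rightarrow> ('a \<Rightarrow> real) \<Rightarrow> 'a \<Rightarrow> real" where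
  "wpd S i u = (SOME g. has_weak_pd S i u g)"

definition wgrad :: "'a::euclidean_space set \<Rightarrow> ('a \<Rightarrow> real) \<Rightarrow> 'a \<Rightarrow> 'a" where
  "wgrad S u x = (\<Sum>i\<in>Basis. wpd S i u x *\<^sub>R i)"

text \<open>\<open>sobolev k p S\<close> is $W^{k,p}(S)$.\<close>
primrec sobolev :: "nat \<Rightarrow> nat \<Rightarrow> 'a::euclidean_space set \<Rightarrow> ('a \<Rightarrow> real) set" where
  "sobolev 0 p S = Lp p S"
| "sobolev (Suc k) p S = {u \<in> Lp p S. \<forall>i\<in>Basis. \<exists>g\<in>sobolev k p S. has_weak_pd S i u g}"

abbreviation H1 :: "'a::euclidean_space set \<Rightarrow> ('a \<Rightarrow> real) set" where
  "H1 \<equiv> sobolev 1 2"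

definition H1_inner :: "'a::euclidean_space set \<Rightarrow> ('a \<Rightarrow> real) \<Rightarrow> ('a \<Rightarrow> real) \<Rightarrow> real" where
  "H1_inner S u g = (LBINT x:S. u x * g x) + (LBINT x:S. wgrad S u x \<bullet> wgrad S g x)"

definition H1_norm :: "'a::euclidean_space set \<Rightarrow> ('a \<Rightarrow> real) \<Rightarrow> real" where
  "H1_norm S u = sqrt (H1_inner S u u)"

definition W11_norm :: "'a::euclidean_space set \<Rightarrow> ('a \<Rightarrow> real) \<Rightarrow> real" where
  "W11_norm S u = (LBINT x:S. \<bar>u x\<bar>) + (LBINT x:S. norm (wgrad S u x))"


subsection \<open>Weak convergence\<close>

definition weakly_L2 :: "'a::euclidean_space set \<Rightarrow> (nat \<Rightarrow> 'a \<Rightarrow> real) \<Rightarrow> ('a \<Rightarrow> real) \<Rightarrow> bool" where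
  "weakly_L2 S u u0 \<longleftrightarrow> (\<forall>n. u n \<in> Lp 2 S) \<and> u0 \<in> Lp 2 S \<and>
     (\<forall>g\<in>Lp 2 S. (\<lambda>n. LBINT x:S. u n x * g x) \<longlonglongrightarrow> (LBINT x:S. u0 x * g x))"

definition weakly_H1 :: "'a::euclidean_space set \<Rightarrow> (nat \<Rightarrow> 'a \<Rightarrow> real) \<Rightarrow> ('a \<Rightarrow> real) \<Rightarrow> bool" where
  "weakly_H1 S u u0 \<longleftrightarrow> (\<forall>n. u n \<in> H1 S) \<and> u0 \<in> H1 S \<and>
     (\<forall>g\<in>H1 S. (\<lambda>n. H1_inner S (u n) g) \<longlonglongrightarrow> H1_inner S u0 g)"

text \<open>
  Weak-* convergence in $BV(\bar S)$ of $W^{1,1}$-functions to a $W^{1,1}$-function; the fields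
  \<open>\<Phi>\<close> need not vanish on the boundary.
\<close>
definition weakly_star_BV ::
  "'a::euclidean_space set \<Rightarrow> (nat \<Rightarrow> 'a \<Rightarrow> real) \<Rightarrow> ('a \<Rightarrow> real) \<Rightarrow> bool" where
  "weakly_star_BV S w w0 \<longleftrightarrow> (\<forall>n. w n \<in> sobolev 1 1 S) \<and> w0 \<in> sobolev 1 1 S \<and>
     (\<lambda>n. LBINT x:S. \<bar>w n x - w0 x\<bar>) \<longlonglongrightarrow> 0 \<and>
     (\<forall>\<Phi>::'a \<Rightarrow> 'a. continuous_on (closure S) \<Phi> \<longrightarrow>
        (\<lambda>n. LBINT x:S. wgrad S (w n) x \<bullet> \<Phi> x) \<longlonglongrightarrow> (LBINT x:S. wgrad S w0 x \<bullet> \<Phi> x))"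


subsection \<open>Geometry\<close>

text \<open>
  The interval \<open>interval_I a\<close> also plays the role of $\Gamma_0$, via $x_1 \leftrightarrow (x_1,0)$.
\<close>
definition interval_I :: "real \<Rightarrow> real set" where
  "interval_I a = {0<..<a}"

definition Omega0 :: "real \<Rightarrow> real \<Rightarrow> (real \<times> real) set" where
  "Omega0 a b = interval_I a \<times> {-b<..<0}"

definition S_eps :: "real \<Rightarrow> real \<Rightarrow> real \<Rightarrow> real \<Rightarrow> (real \<times> real) set" where
  "S_eps a L V \<epsilon> = interval_I a \<times> {L * \<epsilon><..<(L + V) * \<epsilon>}"

definition C_eps :: "real \<Rightarrow> real \<Rightarrow> real \<Rightarrow> real \<Rightarrow> (real \<times> real) set" where
  "C_eps a L \<alpha> \<epsilon> =
     (\<Union>k\<in>{k::nat. real k \<le> a / \<epsilon> - 1}. {real k * \<epsilon><..<real k * \<epsilon> + \<alpha> * \<epsilon> ^ 3} \<times> {0..L * \<epsilon>})"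

definition Omega_eps :: "real \<Rightarrow> real \<Rightarrow> real \<Rightarrow> real \<Rightarrow> real \<Rightarrow> real \<Rightarrow> (real \<times> real) set" where
  "Omega_eps a b L V \<alpha> \<epsilon> = Omega0 a b \<union> S_eps a L V \<epsilon> \<union> C_eps a L \<alpha> \<epsilon>"


subsection \<open>The trace on the upper boundary\<close>

text \<open>
  The trace operator $H^1(\Omega_0) \to L^2(\Gamma_0)$ is the continuous extension of the
  restriction map, defined on the dense subspace $H^1(\Omega_0) \cap C(\bar\Omega_0)$. Like the
  weak derivative it is determined almost everywhere, and \<open>trace0\<close> selects a representative.
\<close>
definition has_trace0 ::
  "real \<Rightarrow> real \<Rightarrow> (real \<times> real \<Rightarrow> real) \<Rightarrow> (real \<Rightarrow> real) \<Rightarrow> bool" where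
  "has_trace0 a b u t \<longleftrightarrow> t \<in> Lp 2 (interval_I a) \<and>
     (\<exists>U. (\<forall>n. U n \<in> H1 (Omega0 a b) \<and> continuous_on (closure (Omega0 a b)) (U n)) \<and>
          (\<lambda>n. H1_norm (Omega0 a b) (\<lambda>x. U n x - u x)) \<longlonglongrightarrow> 0 \<and>
          (\<lambda>n. LBINT s:interval_I a. (U n (s, 0) - t s)\<^sup>2) \<longlonglongrightarrow> 0)"

definition trace0 :: "real \<Rightarrow> real \<Rightarrow> (real \<times> real \<Rightarrow> real) \<Rightarrow> real \<Rightarrow> real" where
  "trace0 a b u = (SOME t. has_trace0 a b u t)"


subsection \<open>The Neumann problem for the Helmholtz equation\<close>

definition weak_solution ::
  "'a::euclidean_space set \<Rightarrow> real \<Rightarrow> ('a \<Rightarrow> real) \<Rightarrow> ('a \<Rightarrow> real) \<Rightarrow> bool" where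
  "weak_solution S \<omega> f u \<longleftrightarrow> u \<in> H1 S \<and>
     (\<forall>\<phi>\<in>H1 S. (LBINT x:S. wgrad S u x \<bullet> wgrad S \<phi> x) - \<omega>\<^sup>2 * (LBINT x:S. u x * \<phi> x)
        = (LBINT x:S. f x * \<phi> x))"

definition resonator_average ::
  "real \<Rightarrow> real \<Rightarrow> real \<Rightarrow> (real \<times> real \<Rightarrow> real) \<Rightarrow> real \<Rightarrow> real" where
  "resonator_average L V \<epsilon> u x1 =
     1 / (\<epsilon> * V) * (LBINT x2:{\<epsilon> * L<..<\<epsilon> * (L + V)}. u (x1, x2))"

end

theory Submission
	imports Defs
begin

text \<open>
Smooth functions $\psi(x_1)$ on the layer $S_\varepsilon$ are extended to test functions on $\Omega_\varepsilon$ in two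
ways. Continued constantly through the channels and matched to a $C^1$ function on $\Omega_0$, they
yield the equation for $w$: the channels contribute $O(\varepsilon^{3/2})$, so that after division
by $\varepsilon$ only the layer remains (\<open>pde_lower\<close>, \<open>lower_rate\<close>). Cut off linearly across the
channels, they balance the layer against the flux
$\frac{1}{L\varepsilon}\int_{C_\varepsilon}\partial_2u^\varepsilon\,\psi$ (\<open>pde_channel\<close>).

The heart of the matter is that
$\varepsilon^{-2}\int_{C_\varepsilon}\partial_2u^\varepsilon\,\psi\to\alpha\int(v-u|_{\Gamma_0})\psi$. Let $W(x_2)$ be the
channel width for $0\le x_2\le L\varepsilon$ and the period $\varepsilon$ away from the channels, and affine in between. The curves
$x_1=k\varepsilon+\xi W(x_2)$, $0<\xi<1$, form a fan that leads from the lower domain through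
channel number $k$ into the layer. The flux of $u^\varepsilon$ along the fans, weighted with a cutoff $G(x_2)$,
equals averages of $u^\varepsilon$ where $G$ varies (\<open>fan_identity\<close>). In the sum over $k$ these
averages turn into those of $u^\varepsilon$ over parts of the layer and of $\Omega_0$. The converging and
diverging parts of the fans are negligible by Young's inequality, since $\nabla u^\varepsilon$ is
bounded in $L^2$ and $W^{-2}$ has there an integral of order $\ln(1/\varepsilon)$ per channel; the bound on
$\varepsilon^{-2}\int_{C_\varepsilon}|\partial_2u^\varepsilon|$ allows $\psi$ to be evaluated at $x_1$ in the channels (\<open>cell_sum\<close>).

Since $w^\varepsilon$ is bounded in $W^{1,1}$, $u^\varepsilon\to u$ strongly in $W^{1,1}(\Omega_0)$, and the average over the
lower domain converges to the trace by
$\int u|_{\Gamma_0}\psi=\frac1b\int_{\Omega_0}(u+(x_2+b)\partial_2u)\psi$ (\<open>trace0_identity\<close>). That the trace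
exists is shown by mollification after a dilation (\<open>has_trace0_exists\<close>). Test functions with
$\psi'\in C_c^\infty(I)$ suffice, by approximation (\<open>C1_interval_approximation\<close>). Finally,
the equation for $v$ displays the weak derivative of $v'$, whence $v\in W^{2,1}(I)$.
\<close>

text \<open>Short names for the plane, for limits of sequences, for scalar multiples, and for integrability
and measurability with respect to Lebesgue measure.\<close>
type_synonym plane = "real \<times> real"

abbreviation tends_to :: "(nat \<Rightarrow> 'a::topological_space) \<Rightarrow> 'a \<Rightarrow> bool" (infixr "-->>" 60) where
  "X -->> l \<equiv> X \<longlonglongrightarrow> l"

abbreviation scale :: "real \<Rightarrow> 'a::real_vector \<Rightarrow> 'a" (infixr "*R" 75) where "c *R x \<equiv> c *\<^sub>R x"

abbreviation lint :: "'a::euclidean_space set \<Rightarrow> ('a \<Rightarrow> real) \<Rightarrow> bool" where "lint \<equiv> set_integrable lborel"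

abbreviation lmeas :: "'a::euclidean_space set \<Rightarrow> ('a \<Rightarrow> real) \<Rightarrow> bool" where "lmeas \<equiv> set_borel_measurable lborel"

lemmas smeas_def = set_borel_measurable_def and sint_def = set_lebesgue_integral_def

section \<open>Smooth functions\<close>

lemma pd_eq: "(f has_derivative f') (at x) ==> pd i f x = f' i"
	unfolding pd_def using frechet_derivative_at by metis

lemma Ck_SucD: "Ck (Suc k) f ==> Ck k f"
proof (induction k arbitrary: f)
	case 0
	thus ?case
		by (auto simp: continuous_on_eq_continuous_at intro: differentiable_imp_continuous_within)
next
	case (Suc k)
	thus ?case
		by (metis Ck.simps(2))
qed

lemma Ck_has_derivative: "Ck (Suc k) f ==> (f has_derivative frechet_derivative f (at x)) (at x)"
	by (simp add: frechet_derivative_works)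

lemma Ck_const: "Ck k (%x::'a::euclidean_space. c)"
proof (induction k arbitrary: c)
	case (Suc k)
	have "pd i (%x::'a. c) = (%x. 0)" for i
		using pd_eq[OF has_derivative_const] by auto
	with Suc show ?case by auto
qed auto

lemma Ck_add: "Ck k f ==> Ck k g ==> Ck k (%x. f x + g x)"
proof (induction k arbitrary: f g)
	case 0
	thus ?case by (auto intro: continuous_intros)
next
	case (Suc k)
	have "pd i (%x. f x + g x) = (%x. pd i f x + pd i g x)" for i
		by (rule ext, rule trans[OF pd_eq[OF has_derivative_add[OF Ck_has_derivative[OF Suc.prems(1)] Ck_has_derivative[OF Suc.prems(2)]]]])
			 (simp add: pd_def)
	with Suc show ?case by (auto intro: derivative_intros)
qed

lemma Ck_mult: "Ck k f ==> Ck k g ==> Ck k (%x. f x * g x)"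
proof (induction k arbitrary: f g)
	case 0
	thus ?case by (auto intro: continuous_intros)
next
	case (Suc k)
	have "pd i (%x. f x * g x) = (%x. f x * pd i g x + pd i f x * g x)" for i
		by (rule ext, rule trans[OF pd_eq[OF has_derivative_mult[OF Ck_has_derivative[OF Suc.prems(1)] Ck_has_derivative[OF Suc.prems(2)]]]])
			 (simp add: pd_def)
	moreover have "Ck k (%x. f x * pd i g x + pd i f x * g x)" if "i \<in> Basis" for i
		using Suc.prems that by (intro Ck_add Suc.IH) (auto intro: Ck_SucD)
	ultimately show ?case using Suc.prems by auto
qed

lemma Ck_compose:
	fixes F :: "real => real" and q :: "'a::euclidean_space => real"
	shows "Ck k F ==> Ck k q ==> Ck k (%x. F (q x))"
proof (induction k arbitrary: F)
	case 0
	thus ?case by (auto intro: continuous_on_compose2)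
next
	case (Suc k)
	have D: "((%x. F (q x)) has_derivative (%d. frechet_derivative F (at (q x)) (frechet_derivative q (at x) d))) (at x)" for x
		using has_derivative_compose[OF Ck_has_derivative[OF Suc.prems(2)] Ck_has_derivative[OF Suc.prems(1)]] .
	have "pd i (%x. F (q x)) = (%x. pd 1 F (q x) * pd i q x)" for i
	proof
		fix x
		have "linear (frechet_derivative F (at (q x)))"
			using Suc.prems(1) by (auto intro: linear_frechet_derivative)
		hence "frechet_derivative F (at (q x)) (pd i q x *R 1) = pd i q x *R frechet_derivative F (at (q x)) 1"
			by (rule linear_scale)
		hence "frechet_derivative F (at (q x)) (pd i q x) = pd i q x * pd 1 F (q x)"
			by (simp only: pd_def[of 1 F] real_scaleR_def mult_1_right)
		thus "pd i (%x. F (q x)) x = pd 1 F (q x) * pd i q x"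
			unfolding pd_eq[OF D, of i x] by (simp only: pd_def[of i q] mult.commute)
	qed
	moreover have "Ck k (%x. pd 1 F (q x) * pd i q x)" if "i \<in> Basis" for i
	proof (rule Ck_mult)
		show "Ck k (%x. pd 1 F (q x))" using Suc.prems by (intro Suc.IH[of "pd 1 F"]) (auto intro: Ck_SucD)
		show "Ck k (pd i q)" using Suc.prems that by simp
	qed
	ultimately show ?case using D by (auto simp: differentiable_def)
qed

lemma Ck_bounded_linear: "bounded_linear (l::'a::euclidean_space => real) ==> Ck k l"
proof (cases k)
	case (Suc j)
	assume l: "bounded_linear l"
	have "pd i l = (%x. l i)" for i
		using pd_eq[OF bounded_linear_imp_has_derivative[OF l]] by auto
	thus ?thesis using Suc l by (auto simp: Ck_const bounded_linear_imp_differentiable)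
qed (auto intro: linear_continuous_on)

lemma Ck_sum: "finite A ==> (!!j. j \<in> A ==> Ck k (f j)) ==> Ck k (%x. \<Sum>j\<in>A. f j x)"
	by (induction A rule: finite_induct) (auto intro: Ck_const Ck_add)

lemma Ck_inner_self: "Ck k (%x::'a::euclidean_space. x \<bullet> x)"
proof -
	have "Ck k (%x::'a. \<Sum>i\<in>Basis. (x \<bullet> i) * (x \<bullet> i))"
		by (intro Ck_sum Ck_mult Ck_bounded_linear bounded_linear_inner_left) auto
	thus ?thesis by (subst euclidean_inner)
qed

lemma pd_real_deriv: "DERIV f x :> d ==> pd 1 f x = d"
	using pd_eq[of f "(*) d" x 1] by (simp add: has_field_derivative_def)

subsection \<open>The flat function and mollifiers\<close>

text \<open>The functions $e^{-1/t} t^{-j}$ for $t>0$, extended by zero, form a family closed under differentiation.\<close>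

definition flat :: "nat => real => real" where
	"flat j t = (if t > 0 then exp (- 1 / t) / t ^ j else 0)"

lemma flat_tendsto_0: "((%t. flat j t) \<longlongrightarrow> 0) (at 0)"
proof (rule filterlim_split_at)
	have "((%s::real. s ^ j / exp s) \<longlongrightarrow> 0) at_top" by (rule tendsto_power_div_exp_0)
	from filterlim_compose[OF this filterlim_inverse_at_top_right]
	have "((%t::real. inverse t ^ j / exp (inverse t)) \<longlongrightarrow> 0) (at_right 0)" .
	thus "(flat j \<longlongrightarrow> 0) (at_right 0)"
		by (rule Lim_transform_eventually)
			 (auto simp: eventually_at_filter flat_def exp_minus field_simps power_inverse)
	show "(flat j \<longlongrightarrow> 0) (at_left 0)"
		by (rule Lim_transform_eventually[OF tendsto_const])
			 (auto simp: eventually_at_filter flat_def)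
qed

lemma flat_deriv: "DERIV (flat j) t :> flat (j+2) t - j * flat (j+1) t"
proof (cases t "0::real" rule: linorder_cases)
	case less
	have "\<forall>\<^sub>F s in nhds t. s \<in> {..<0}" using less by (intro eventually_nhds_in_open) auto
	hence "\<forall>\<^sub>F s in nhds t. flat j s = 0" by eventually_elim (auto simp: flat_def)
	from DERIV_cong_ev[OF refl this refl] have "DERIV (flat j) t :> 0" by simp
	thus ?thesis using less by (simp add: flat_def)
next
	case equal
	have "((%h. flat (Suc j) h) \<longlongrightarrow> 0) (at 0)" by (rule flat_tendsto_0)
	hence "((%h. (flat j (0 + h) - flat j 0) / h) \<longlongrightarrow> 0) (at 0)"
		by (rule Lim_transform_eventually) (auto simp: eventually_at_filter flat_def)
	thus ?thesis using equal by (simp add: flat_def DERIV_def)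
next
	case greater
	have "((%t. exp (- 1 / t) / t ^ j) has_real_derivative
			(exp (- 1/t) * (1 / t^2) * t ^ j - exp (- 1/t) * (j * t ^ (j - 1))) / (t ^ j * t ^ j)) (at t)"
		using greater by (auto intro!: derivative_eq_intros simp: power2_eq_square)
	moreover have "(exp (- 1/t) * (1 / t^2) * t ^ j - exp (- 1/t) * (j * t ^ (j - 1))) / (t ^ j * t ^ j)
		 = flat (j+2) t - j * flat (j+1) t"
		using greater by (cases j) (auto simp: flat_def field_simps power2_eq_square)
	moreover have "\<forall>\<^sub>F s in nhds t. s \<in> {0<..}" using greater by (intro eventually_nhds_in_open) auto
	hence "\<forall>\<^sub>F s in nhds t. flat j s = exp (- 1 / s) / s ^ j" by eventually_elim (auto simp: flat_def)
	note DERIV_cong_ev[OF refl this refl]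
	ultimately show ?thesis by simp
qed

lemma Ck_flat: "Ck k (flat j)"
proof (induction k arbitrary: j)
	case 0
	have "isCont (flat j) t" for t using flat_deriv by (rule DERIV_isCont)
	thus ?case by (simp add: continuous_at_imp_continuous_on)
next
	case (Suc k)
	have "pd 1 (flat j) = (%t. flat (j+2) t + (- real j) * flat (j+1) t)"
		using pd_real_deriv[OF flat_deriv] by auto
	moreover have "Ck k (%t. flat (j+2) t + (- real j) * flat (j+1) t)"
		by (intro Ck_add Ck_mult Ck_const Suc.IH)
	ultimately show ?case
		using flat_deriv by (auto simp: real_differentiable_def)
qed

text \<open>Smooth, positive on the ball of radius \<open>r\<close> and zero outside.\<close>
definition smooth_bump :: "real => 'a::euclidean_space => real" where
	"smooth_bump r x = flat 0 (r^2 - x \<bullet> x)"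

lemma Ck_smooth_bump: "Ck k (smooth_bump r :: 'a::euclidean_space => real)"
proof -
	have "Ck k (%x::'a. flat 0 (r^2 + (-1) * (x \<bullet> x)))"
		by (rule Ck_compose[OF Ck_flat Ck_add[OF Ck_const Ck_mult[OF Ck_const Ck_inner_self]]])
	thus ?thesis by (simp add: smooth_bump_def[abs_def])
qed

lemma smooth_bump_nonneg: "smooth_bump r x \<ge> 0"
	by (simp add: smooth_bump_def flat_def)

lemma smooth_bump_eq_0: "r \<ge> 0 ==> norm x \<ge> r ==> smooth_bump r x = 0"
	using power_mono[of r "norm x" 2] by (auto simp: smooth_bump_def flat_def dot_square_norm not_less)

lemma smooth_bump_pos: "norm x < r ==> smooth_bump r x > 0"
	by (simp add: smooth_bump_def flat_def dot_square_norm abs_le_square_iff[symmetric] power_strict_mono)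

lemma Ck_borel_measurable: "Ck k f ==> f \<in> borel_measurable borel"
	by (induction k arbitrary: f) (auto intro: borel_measurable_continuous_onI dest: Ck_SucD
			simp: differentiable_imp_continuous_within continuous_on_eq_continuous_at)

lemma continuous_compact_support_bounded:
	fixes f :: "'a::euclidean_space => real"
	assumes "continuous_on UNIV f" "compact K" "!!x. x \<notin> K ==> f x = 0"
	obtains B where "!!x. \<bar>f x\<bar> <= B" "B \<ge> 0"
proof -
	have "bounded (f ` K)" using assms(1,2) compact_continuous_image compact_imp_bounded continuous_on_subset
		by (metis subset_UNIV)
	then obtain B where "!!x. x \<in> K ==> \<bar>f x\<bar> <= B" by (auto simp: bounded_iff)
	hence "\<bar>f x\<bar> <= max B 0" for x using assms(3)[of x] by (cases "x \<in> K") (auto simp: le_max_iff_disj)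
	thus ?thesis using that by (metis max.cobounded2)
qed

lemma bounded_compact_support_integrable:
	fixes f :: "'a::euclidean_space => real"
	assumes "f \<in> borel_measurable borel" "compact K" "!!x. x \<notin> K ==> f x = 0" "!!x. \<bar>f x\<bar> <= B"
	shows "integrable lborel f"
proof (rule Bochner_Integration.integrable_bound)
	show "integrable lborel (%x. B * indicator K x :: real)"
		using assms(2) by (intro integrable_mult_right integrable_real_indicator)
			(auto simp: compact_imp_closed borel_closed emeasure_compact_finite[unfolded infinity_ennreal_def])
	show "AE x in lborel. norm (f x) <= norm (B * indicator K x)"
	proof (rule AE_I2)
		fix x show "norm (f x) <= norm (B * indicator K x)"
			using assms(3)[of x] assms(4)[of x] by (cases "x \<in> K") auto
	qed
qed (use assms in auto)

lemma smooth_bump_integrable: "r \<ge> 0 ==> integrable lborel (smooth_bump r :: 'a::euclidean_space => real)"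
proof -
	assume r: "r \<ge> 0"
	have c: "continuous_on UNIV (smooth_bump r :: 'a => real)" using Ck_smooth_bump[of 0 r] by simp
	have z: "smooth_bump r x = 0" if "x \<notin> cball (0::'a) r" for x
		using smooth_bump_eq_0[OF r, of x] that by auto
	obtain B where "!!x::'a. \<bar>smooth_bump r x\<bar> <= B"
		using continuous_compact_support_bounded[OF c compact_cball z] by blast
	thus ?thesis
		by (intro bounded_compact_support_integrable[of _ "cball 0 r"])
			 (use Ck_borel_measurable[OF Ck_smooth_bump] z in auto)
qed

lemma smooth_bump_integral_pos: "r > 0 ==> (LBINT x. smooth_bump r (x::'a::euclidean_space)) > 0"
proof -
	assume r: "r > 0"
	have "(LBINT x. smooth_bump r (x::'a)) ~= 0"
	proof
		assume "(LBINT x. smooth_bump r (x::'a)) = 0"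
		hence "AE x in lborel. smooth_bump r (x::'a) = 0"
			by (subst (asm) integral_nonneg_eq_0_iff_AE) (use smooth_bump_integrable[of r] r smooth_bump_nonneg in auto)
		hence "AE x in lborel. (x::'a) \<notin> ball 0 r"
			by eventually_elim (metis smooth_bump_pos less_irrefl mem_ball_0)
		hence "emeasure lborel (ball (0::'a) r) = 0"
			by (subst (asm) AE_iff_measurable[of "ball 0 r"]) auto
		thus False using r content_ball_pos[OF r, of "0::'a"] by (simp add: measure_def)
	qed
	moreover have "(LBINT x. smooth_bump r (x::'a)) \<ge> 0"
		by (intro integral_nonneg_AE) (auto simp: smooth_bump_nonneg)
	ultimately show ?thesis by simp
qed

text \<open>\<open>moll n\<close> is a nonnegative smooth function of integral one, supported in the ball of radius $1/(n+1)$.\<close>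
definition moll :: "nat => 'a::euclidean_space => real" where
	"moll n x = inverse (LBINT y. smooth_bump (1 / (real n + 1)) (y::'a)) * smooth_bump (1 / (real n + 1)) x"

lemma Ck_moll: "Ck k (moll n :: 'a::euclidean_space => real)"
	unfolding moll_def[abs_def] by (intro Ck_mult Ck_const Ck_smooth_bump)

lemma moll_nonneg: "moll n x \<ge> 0"
	unfolding moll_def by (intro mult_nonneg_nonneg) (auto simp: smooth_bump_nonneg integral_nonneg_AE)

lemma moll_eq_0: "norm x \<ge> 1 / (real n + 1) ==> moll n x = 0"
	unfolding moll_def by (subst smooth_bump_eq_0) auto

lemma moll_integrable: "integrable lborel (moll n :: 'a::euclidean_space => real)"
	unfolding moll_def[abs_def] by (intro integrable_mult_right smooth_bump_integrable) auto

lemma moll_integral: "(LBINT x. moll n (x::'a::euclidean_space)) = 1"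
	unfolding moll_def using smooth_bump_integral_pos[of "1 / (real n + 1)", where 'a='a] by simp

lemma moll_measurable[measurable]: "moll n \<in> borel_measurable borel"
	by (rule Ck_borel_measurable[OF Ck_moll])

subsection \<open>Convolution\<close>

definition conv :: "('a::euclidean_space => real) => ('a => real) => 'a => real" where
	"conv \<theta> g x = (LBINT y. \<theta> (x - y) * g y)"

lemma lborel_reflect: "lborel = distr lborel borel (%y::'a::euclidean_space. x - y)"
	using lborel_affine[of "-1" x] by (simp add: density_1)

lemma integral_lborel_reflect:
	fixes f :: "'a::euclidean_space => real"
	shows "f \<in> borel_measurable borel ==> (LBINT y. f (x - y)) = (LBINT y. f y)"
	by (subst (2) lborel_reflect[of x]) (simp add: integral_distr)

lemma integrable_lborel_reflect:
	fixes f :: "'a::euclidean_space => real"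
	assumes "integrable lborel f"
	shows "integrable lborel (%y. f (x - y))"
	using assms by (subst (asm) lborel_reflect[of x]) (rule integrable_distr, measurable)

lemma pd_eq_0_outside:
	assumes "closed K" "!!x. x \<notin> K ==> f x = 0" "x \<notin> K"
	shows "pd i f x = 0"
proof -
	have "((%x. 0) has_derivative (%_. 0)) (at x)" by simp
	hence "(f has_derivative (%_. 0)) (at x)"
		by (rule has_derivative_transform_within_open[where s="-K"]) (use assms in auto)
	thus ?thesis by (rule pd_eq)
qed

lemma frechet_derivative_pd:
	assumes "f differentiable (at (x::'a::euclidean_space))"
	shows "frechet_derivative f (at x) d = (\<Sum>i\<in>Basis. (d \<bullet> i) * pd i f x)"
proof -
	have l: "linear (frechet_derivative f (at x))" using assms by (rule linear_frechet_derivative)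
	have "frechet_derivative f (at x) d = frechet_derivative f (at x) (\<Sum>i\<in>Basis. (d \<bullet> i) *R i)"
		by (simp add: euclidean_representation)
	also have "... = (\<Sum>i\<in>Basis. (d \<bullet> i) * pd i f x)"
		using l by (simp add: linear_sum linear_scale pd_def)
	finally show ?thesis .
qed

lemma conv_has_derivative:
	fixes \<theta> g :: "'a::euclidean_space => real"
	assumes \<theta>: "Ck (Suc 0) \<theta>" and K: "compact K" "!!x. x \<notin> K ==> \<theta> x = 0" and g: "integrable lborel g"
	shows "(conv \<theta> g has_derivative (%d. \<Sum>i\<in>Basis. (d \<bullet> i) * conv (pd i \<theta>) g x)) (at x)"
proof -
	have meas[measurable]: "\<theta> \<in> borel_measurable borel" "g \<in> borel_measurable borel"
		using Ck_borel_measurable[OF \<theta>] g by auto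
	have pdm[measurable]: "pd i \<theta> \<in> borel_measurable borel" if "i \<in> Basis" for i
		using \<theta> that by (auto intro: borel_measurable_continuous_onI)
	have pd0: "pd i \<theta> x = 0" if "x \<notin> K" for i x
		using pd_eq_0_outside[OF compact_imp_closed[OF K(1)] K(2) that] .
	have "\<exists>B. \<forall>x. \<bar>pd i \<theta> x\<bar> <= B" if "i \<in> Basis" for i
		using continuous_compact_support_bounded[of "pd i \<theta>" K] \<theta> that K pd0 by (metis Ck.simps)
	then obtain B where B: "!!i x. i \<in> Basis ==> \<bar>pd i \<theta> x\<bar> <= B i" by metis
	obtain B0 where B0: "!!x. \<bar>\<theta> x\<bar> <= B0"
		using continuous_compact_support_bounded[of \<theta> K] Ck_SucD[OF \<theta>] K by (metis Ck.simps(1))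
	define M where "M = (\<Sum>i\<in>(Basis::'a set). B i)"
	have Dd: "frechet_derivative \<theta> (at z) d = (\<Sum>i\<in>Basis. (d \<bullet> i) * pd i \<theta> z)" for z d
		using \<theta> by (intro frechet_derivative_pd) auto
	have Dbound: "\<bar>\<Sum>i\<in>Basis. (d \<bullet> i) * pd i \<theta> z\<bar> <= M * norm d" for z d
	proof -
		have "\<bar>\<Sum>i\<in>Basis. (d \<bullet> i) * pd i \<theta> z\<bar> <= (\<Sum>i\<in>(Basis::'a set). norm d * B i)"
			using B by (intro order.trans[OF sum_abs] sum_mono) (auto simp: abs_mult Basis_le_norm intro!: mult_mono)
		thus ?thesis by (simp add: M_def sum_distrib_left mult.commute)
	qed
	have Lip: "\<bar>\<theta> (z + d) - \<theta> z\<bar> <= M * norm d" for z d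
	proof -
		have "norm (\<theta> (z + d) - \<theta> z) <= M * norm (z + d - z)"
		proof (rule differentiable_bound[of UNIV \<theta> "%x. frechet_derivative \<theta> (at x)"])
			show "onorm (frechet_derivative \<theta> (at x)) <= M" for x
				by (rule onorm_le) (use Dbound in "simp add: Dd")
		qed (use Ck_has_derivative[OF \<theta>] in auto)
		thus ?thesis by simp
	qed
	have M0: "M \<ge> 0" unfolding M_def using B by (intro sum_nonneg) (meson abs_ge_zero order_trans)
	have bl: "bounded_linear (%d. \<Sum>i\<in>Basis. (d \<bullet> i) * conv (pd i \<theta>) g x)"
		by (intro bounded_linear_sum bounded_linear_mult_const[THEN bounded_linear_compose] bounded_linear_inner_left
				bounded_linear_compose[OF bounded_linear_mult_left])
	have int1: "integrable lborel (%y. \<theta> (z - y) * g y)" for z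
		by (rule Bochner_Integration.integrable_bound[of _ "%y. B0 * g y"])
			 (use g B0 in "auto simp: abs_mult intro!: mult_right_mono AE_I2 intro: order.trans[OF _ abs_ge_self]")
	have int2: "integrable lborel (%y. pd i \<theta> (z - y) * g y)" if "i \<in> Basis" for z i
		by (rule Bochner_Integration.integrable_bound[of _ "%y. B i * g y"])
			 (use g B[OF that] pdm[OF that] in "auto simp: abs_mult intro!: mult_right_mono AE_I2 intro: order.trans[OF _ abs_ge_self]")
	have eq: "conv \<theta> g (x + d) - conv \<theta> g x - (\<Sum>i\<in>Basis. (d \<bullet> i) * conv (pd i \<theta>) g x)
		 = (LBINT y. (\<theta> (x - y + d) - \<theta> (x - y) - (\<Sum>i\<in>Basis. (d \<bullet> i) * pd i \<theta> (x - y))) * g y)" for d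
	proof -
		have "(\<Sum>i\<in>Basis. (d \<bullet> i) * conv (pd i \<theta>) g x) = (LBINT y. (\<Sum>i\<in>Basis. (d \<bullet> i) * (pd i \<theta> (x - y) * g y)))"
			unfolding conv_def by (subst Bochner_Integration.integral_sum) (auto intro!: int2)
		moreover have "integrable lborel (%y. \<Sum>i\<in>Basis. (d \<bullet> i) * (pd i \<theta> (x - y) * g y))"
			by (intro Bochner_Integration.integrable_sum integrable_mult_right int2)
		ultimately have "conv \<theta> g (x + d) - conv \<theta> g x - (\<Sum>i\<in>Basis. (d \<bullet> i) * conv (pd i \<theta>) g x)
			 = (LBINT y. \<theta> (x + d - y) * g y - \<theta> (x - y) * g y - (\<Sum>i\<in>Basis. (d \<bullet> i) * (pd i \<theta> (x - y) * g y)))"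
			using int1[of "x + d"] int1[of x] unfolding conv_def
			by (simp only: Bochner_Integration.integral_diff Bochner_Integration.integrable_diff)
		also have "... = (LBINT y. (\<theta> (x - y + d) - \<theta> (x - y) - (\<Sum>i\<in>Basis. (d \<bullet> i) * pd i \<theta> (x - y))) * g y)"
			by (simp only: left_diff_distrib sum_distrib_right mult.assoc diff_add_eq)
		finally show ?thesis .
	qed
	have "(%d. norm (conv \<theta> g (x + d) - conv \<theta> g x - (\<Sum>i\<in>Basis. (d \<bullet> i) * conv (pd i \<theta>) g x)) / norm d) \<midarrow>0\<rightarrow> 0"
		unfolding tendsto_at_iff_sequentially comp_def
	proof (intro allI impI)
		fix D :: "nat => 'a" assume D: "\<forall>i. D i \<in> UNIV - {0}" "D -->> 0"
		define R where "R n y = (\<theta> (x - y + D n) - \<theta> (x - y) - (\<Sum>i\<in>Basis. (D n \<bullet> i) * pd i \<theta> (x - y))) / norm (D n)" for n y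
		have "(%n. LBINT y. R n y * g y) -->> (\<integral>y. 0 \<partial>(lborel::'a measure))"
		proof (rule integral_dominated_convergence[where w="%y. 2 * M * \<bar>g y\<bar>"])
			show "AE y in lborel. (%n. R n y * g y) -->> 0"
			proof (rule AE_I2)
				fix y
				have "(%d. norm (\<theta> (x - y + d) - \<theta> (x - y) - frechet_derivative \<theta> (at (x - y)) d) / norm d) \<midarrow>0\<rightarrow> 0"
					using Ck_has_derivative[OF \<theta>, of "x - y"] unfolding has_derivative_at by blast
				hence "(%n. norm (\<theta> (x - y + D n) - \<theta> (x - y) - frechet_derivative \<theta> (at (x - y)) (D n)) / norm (D n)) -->> 0"
					using D unfolding tendsto_at_iff_sequentially comp_def by blast
				hence "(%n. norm (R n y)) -->> 0" by (simp add: R_def Dd)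
				hence "(%n. R n y) -->> 0" by (rule tendsto_norm_zero_cancel)
				from tendsto_mult[OF this tendsto_const, of "g y"] show "(%n. R n y * g y) -->> 0" by simp
			qed
			show "AE y in lborel. norm (R n y * g y) <= 2 * M * \<bar>g y\<bar>" for n
			proof (rule AE_I2)
				fix y
				have "\<bar>\<theta> (x - y + D n) - \<theta> (x - y) - (\<Sum>i\<in>Basis. (D n \<bullet> i) * pd i \<theta> (x - y))\<bar> <= 2 * M * norm (D n)"
					by (rule order.trans[OF abs_triangle_ineq4 order.trans[OF add_mono[OF Lip Dbound]]]) simp
				hence "\<bar>R n y\<bar> <= 2 * M" using D(1) by (simp add: R_def abs_div divide_le_eq)
				thus "norm (R n y * g y) <= 2 * M * \<bar>g y\<bar>" by (simp add: abs_mult mult_right_mono)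
			qed
			show "integrable lborel (%y. 2 * M * \<bar>g y\<bar>)" using g by auto
			show "(%y. R n y * g y) \<in> borel_measurable lborel" for n unfolding R_def by measurable
		qed auto
		hence "(%n. norm (LBINT y. R n y * g y)) -->> 0" by (intro tendsto_norm_zero) simp
		moreover have "norm (LBINT y. R n y * g y) =
				norm (conv \<theta> g (x + D n) - conv \<theta> g x - (\<Sum>i\<in>Basis. (D n \<bullet> i) * conv (pd i \<theta>) g x)) / norm (D n)" for n
			unfolding eq R_def by (simp add: abs_div)
		ultimately show "(%n. norm (conv \<theta> g (x + D n) - conv \<theta> g x - (\<Sum>i\<in>Basis. (D n \<bullet> i) * conv (pd i \<theta>) g x)) / norm (D n)) -->> 0"
			by simp
	qed
	with bl show ?thesis unfolding has_derivative_at by blast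
qed

lemma pd_conv:
	fixes \<theta> g :: "'a::euclidean_space => real"
	assumes "Ck (Suc 0) \<theta>" "compact K" "!!x. x \<notin> K ==> \<theta> x = 0" "integrable lborel g" "i \<in> Basis"
	shows "pd i (conv \<theta> g) x = conv (pd i \<theta>) g x"
proof -
	have "pd i (conv \<theta> g) x = (\<Sum>j\<in>Basis. (i \<bullet> j) * conv (pd j \<theta>) g x)"
		by (rule pd_eq[OF conv_has_derivative[OF assms(1-4)]])
	also have "... = (\<Sum>j\<in>Basis. if j = i then conv (pd j \<theta>) g x else 0)"
		using assms(5) by (intro sum.cong) (auto simp: inner_Basis)
	finally show ?thesis using assms(5) by simp
qed

lemma Ck_conv:
	fixes \<theta> g :: "'a::euclidean_space => real"
	assumes "!!k. Ck k \<theta>" "compact K" "!!x. x \<notin> K ==> \<theta> x = 0" "integrable lborel g"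
	shows "Ck k (conv \<theta> g)"
	using assms(1,3)
proof (induction k arbitrary: \<theta>)
	case 0
	have "conv \<theta> g differentiable (at x)" for x
		using conv_has_derivative[OF 0(1) assms(2) 0(2) assms(4)] by (auto simp: differentiable_def)
	thus ?case by (auto simp: continuous_on_eq_continuous_at intro: differentiable_imp_continuous_within)
next
	case (Suc k)
	have "conv \<theta> g differentiable (at x)" for x
		using conv_has_derivative[OF Suc.prems(1) assms(2) Suc.prems(2) assms(4)] by (auto simp: differentiable_def)
	moreover have "Ck k (pd i (conv \<theta> g))" if i: "i \<in> Basis" for i
	proof -
		have "pd i (conv \<theta> g) = conv (pd i \<theta>) g"
			using pd_conv[OF Suc.prems(1) assms(2) Suc.prems(2) assms(4) i] by auto
		moreover have "Ck k (conv (pd i \<theta>) g)"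
		proof (rule Suc.IH)
			show "Ck k (pd i \<theta>)" for k using Suc.prems(1)[of "Suc k"] i by simp
			show "pd i \<theta> x = 0" if "x \<notin> K" for x
				using pd_eq_0_outside[OF compact_imp_closed[OF assms(2)] Suc.prems(2) that] by simp
		qed
		ultimately show ?thesis by simp
	qed
	ultimately show ?case by simp
qed

subsection \<open>Approximation by mollification\<close>

lemma moll_minus_integral: "(LBINT y. moll n (x - y)) = 1"
	using integral_lborel_reflect[of "moll n" x] moll_integral by (simp add: moll_measurable)

lemma moll_minus_integrable: "integrable lborel (%y. moll n (x - y))"
	by (rule integrable_lborel_reflect[OF moll_integrable])

lemma integrable_mult_bounded:
	fixes f g :: "'a => real"
	assumes "integrable M f" "g \<in> borel_measurable M" "!!x. \<bar>g x\<bar> <= B"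
	shows "integrable M (%x. f x * g x)"
proof (rule Bochner_Integration.integrable_bound[of _ "%x. B * f x"])
	show "AE x in M. norm (f x * g x) <= norm (B * f x)"
	proof (rule AE_I2)
		fix x
		have "\<bar>g x\<bar> <= \<bar>B\<bar>" using assms(3)[of x] by linarith
		thus "norm (f x * g x) <= norm (B * f x)"
			by (simp add: abs_mult mult.commute[of _ "\<bar>f x\<bar>"] mult_left_mono)
	qed
qed (use assms in auto)

lemma conv_moll_near:
	fixes g :: "'a::euclidean_space => real"
	assumes g: "g \<in> borel_measurable borel" "!!x. \<bar>g x\<bar> <= B"
		and near: "!!y. dist x y < 1 / (real n + 1) ==> \<bar>g y - c\<bar> <= e"
	shows "\<bar>conv (moll n) g x - c\<bar> <= e"
proof -
	have i: "integrable lborel (%y. moll n (x - y) * g y)"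
		using g by (intro integrable_mult_bounded[OF moll_minus_integrable]) auto
	have "conv (moll n) g x - c = (LBINT y. moll n (x - y) * g y) - (LBINT y. moll n (x - y) * c)"
		by (simp add: conv_def moll_minus_integral)
	also have "... = (LBINT y. moll n (x - y) * (g y - c))"
		using i moll_minus_integrable[of n x] by (simp add: right_diff_distrib)
	also have "\<bar>...\<bar> <= (LBINT y. moll n (x - y) * e)"
	proof (rule integral_abs_bound[THEN order_trans], rule integral_mono_AE)
		show "integrable lborel (%y. \<bar>moll n (x - y) * (g y - c)\<bar>)"
			using i moll_minus_integrable[of n x] by (auto simp: right_diff_distrib)
		show "integrable lborel (%y. moll n (x - y) * e)"
			using moll_minus_integrable[of n x] by auto
		show "AE y in lborel. \<bar>moll n (x - y) * (g y - c)\<bar> <= moll n (x - y) * e"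
		proof (rule AE_I2)
			fix y show "\<bar>moll n (x - y) * (g y - c)\<bar> <= moll n (x - y) * e"
				using near[of y] moll_nonneg[of n "x - y"] moll_eq_0[of n "x - y"]
				by (cases "dist x y < 1 / (real n + 1)") (auto simp: dist_norm abs_mult mult_left_mono)
		qed
	qed
	also have "... = e" by (simp add: moll_minus_integral)
	finally show ?thesis .
qed

lemma conv_moll_bound:
	fixes g :: "'a::euclidean_space => real"
	assumes "g \<in> borel_measurable borel" "!!x. \<bar>g x\<bar> <= B"
	shows "\<bar>conv (moll n) g x\<bar> <= B"
	using conv_moll_near[OF assms, where c=0] assms by auto

lemma conv_moll_eq_0:
	fixes g :: "'a::euclidean_space => real"
	assumes "!!y. dist x y < 1 / (real n + 1) ==> g y = 0"
	shows "conv (moll n) g x = 0"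
proof -
	have "moll n (x - y) * g y = 0" for y
		using assms[of y] moll_eq_0[of n "x - y"] by (cases "dist x y < 1 / (real n + 1)") (auto simp: dist_norm)
	thus ?thesis unfolding conv_def by (simp only: Bochner_Integration.integral_zero)
qed

lemma eventually_inverse_Suc_less: "e > 0 ==> \<forall>\<^sub>F n in sequentially. 1 / (real n + 1) < e"
	using order_tendstoD(2)[OF LIMSEQ_inverse_real_of_nat, of e] by (simp add: inverse_eq_divide add.commute)

lemma conv_moll_tendsto:
	fixes g :: "'a::euclidean_space => real"
	assumes "g \<in> borel_measurable borel" "!!x. \<bar>g x\<bar> <= B" "isCont g x"
	shows "(%n. conv (moll n) g x) -->> g x"
	unfolding tendsto_iff
proof (intro allI impI)
	fix e :: real assume e: "e > 0"
	then obtain d where d: "d > 0" "!!y. dist y x < d ==> dist (g y) (g x) < e / 2"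
		using assms(3) unfolding continuous_at_eps_delta by (meson half_gt_zero)
	from eventually_inverse_Suc_less[OF d(1)]
	show "\<forall>\<^sub>F n in sequentially. dist (conv (moll n) g x) (g x) < e"
	proof eventually_elim
		case (elim n)
		have "\<bar>conv (moll n) g x - g x\<bar> <= e / 2"
		proof (rule conv_moll_near[OF assms(1,2)])
			fix y assume "dist x y < 1 / (real n + 1)"
			with elim have "dist y x < d" by (simp add: dist_commute)
			from d(2)[OF this] show "\<bar>g y - g x\<bar> <= e / 2" by (simp add: dist_real_def)
		qed
		thus ?case using e by (simp add: dist_real_def)
	qed
qed

lemma moll_outside: "x \<notin> cball 0 1 ==> moll n x = 0"
proof (rule moll_eq_0)
	assume "x \<notin> cball 0 1"
	moreover have "1 / (real n + 1) <= 1" by simp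
	ultimately show "norm x \<ge> 1 / (real n + 1)" unfolding mem_cball dist_0_norm by linarith
qed

lemma Ck_conv_moll:
	"integrable lborel g ==> Ck k (conv (moll n) g)"
	by (rule Ck_conv[OF Ck_moll compact_cball moll_outside])

text \<open>Mollification enlarges supports by an arbitrarily small amount, so that it eventually produces test functions.\<close>
lemma conv_moll_support:
	fixes K S :: "'a::euclidean_space set"
	assumes "compact K" "open S" "K \<subseteq> S"
	obtains K' N where "compact K'" "K' \<subseteq> S" "K \<subseteq> K'"
		"!!g n x. (!!x. x \<notin> K ==> g x = 0) ==> n \<ge> N ==> x \<notin> K' ==> conv (moll n) g x = 0"
proof -
	obtain e where e: "e > 0" "(\<Union>x\<in>K. ball x e) \<subseteq> S"
		using compact_subset_open_imp_ball_epsilon_subset[OF assms] by blast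
	define K' where "K' = {x + y | x y. x \<in> K & y \<in> cball 0 (e/2)}"
	have cK: "compact K'" unfolding K'_def by (rule compact_sums[OF assms(1) compact_cball])
	have KS: "K' \<subseteq> S"
	proof
		fix z assume "z \<in> K'"
		then obtain x y where "z = x + y" "x \<in> K" "norm y <= e/2" by (auto simp: K'_def)
		hence "z \<in> ball x e" using e(1) by (simp add: dist_norm)
		thus "z \<in> S" using e(2) \<open>x \<in> K\<close> by blast
	qed
	have KK: "K \<subseteq> K'"
	proof
		fix x assume "x \<in> K"
		hence "x = x + 0 & x \<in> K & 0 \<in> cball (0::'a) (e/2)" using e by auto
		thus "x \<in> K'" unfolding K'_def by blast
	qed
	obtain N where N: "!!n. n \<ge> N ==> 1 / (real n + 1) < e / 2"
		using eventually_inverse_Suc_less[of "e/2"] e(1) by (auto simp: eventually_sequentially)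
	have "conv (moll n) g x = 0" if g: "!!x. x \<notin> K ==> g x = 0" and n: "n \<ge> N" and x: "x \<notin> K'" for g :: "'a => real" and n x
	proof (rule conv_moll_eq_0)
		fix y assume d: "dist x y < 1 / (real n + 1)"
		have "y \<notin> K"
		proof
			assume "y \<in> K"
			moreover have "x = y + (x - y)" "x - y \<in> cball 0 (e/2)" using d N[OF n] by (auto simp: dist_norm norm_minus_commute)
			ultimately show False using x unfolding K'_def by blast
		qed
		thus "g y = 0" by (rule g)
	qed
	with that[OF cK KS KK] show ?thesis by blast
qed

lemma test_functionsI: "(!!k. Ck k \<phi>) ==> compact K ==> K \<subseteq> S ==> (!!x. x \<notin> K ==> \<phi> x = 0) ==> \<phi> \<in> test_functions S"
	unfolding test_functions_def by blast

text \<open>The restrictions to the intervals $[c+1/(n+1),d-1/(n+1)]$ are mollified.\<close>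
lemma test_dense_interval:
	fixes g :: "real => real"
	assumes g: "continuous_on {c<..<d} g" and B: "!!x. x \<in> {c<..<d} ==> \<bar>g x\<bar> <= B" and B0: "B \<ge> 0"
	obtains \<phi> where "!!n::nat. \<phi> n \<in> test_functions {c<..<d}" "!!n x. \<bar>\<phi> n x\<bar> <= B"
		"!!x. x \<in> {c<..<d} ==> (%n. \<phi> n x) -->> g x"
proof -
	define K where "K n = {c + 1 / (real n + 1) .. d - 1 / (real n + 1)}" for n :: nat
	define G where "G n x = indicator (K n) x * g x" for n x
	define \<phi> where "\<phi> n = conv (moll (Suc n)) (G n)" for n
	have Ksub: "K n \<subseteq> {c<..<d}" for n
	proof
		fix x assume "x \<in> K n"
		moreover have "1 / (real n + 1) > 0" by simp
		ultimately show "x \<in> {c<..<d}" unfolding K_def atLeastAtMost_iff greaterThanLessThan_iff by linarith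
	qed
	have Gm: "G n \<in> borel_measurable borel" for n
	proof -
		have "(%x. indicator (K n) x *R g x) \<in> borel_measurable borel"
			by (rule borel_measurable_continuous_on_indicator) (use g continuous_on_subset[OF g Ksub] in "auto simp: K_def")
		thus ?thesis by (simp add: G_def[abs_def])
	qed
	have GB: "\<bar>G n x\<bar> <= B" for n x
		using B[of x] B0 Ksub[of n] by (cases "x \<in> K n") (auto simp: G_def)
	have Gi: "integrable lborel (G n)" for n
		by (rule bounded_compact_support_integrable[OF Gm _ _ GB, of "K n"]) (auto simp: K_def G_def)
	have "\<phi> n \<in> test_functions {c<..<d}" for n
	proof (rule test_functionsI)
		define s where "s = 1 / (real n + 1) - 1 / (real (Suc n) + 1)"
		have s: "s > 0" unfolding s_def by (simp add: frac_less2)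
		show "compact {c + s .. d - s}" by simp
		show "{c + s .. d - s} \<subseteq> {c<..<d}" using s by auto
		show "Ck k (\<phi> n)" for k unfolding \<phi>_def by (rule Ck_conv_moll[OF Gi])
		show "\<phi> n x = 0" if "x \<notin> {c + s .. d - s}" for x unfolding \<phi>_def
		proof (rule conv_moll_eq_0)
			fix y assume "dist x y < 1 / (real (Suc n) + 1)"
			hence "y \<notin> K n" using that unfolding K_def s_def dist_real_def atLeastAtMost_iff by linarith
			thus "G n y = 0" by (simp add: G_def)
		qed
	qed
	moreover have "\<bar>\<phi> n x\<bar> <= B" for n x unfolding \<phi>_def by (rule conv_moll_bound[OF Gm GB])
	moreover have "(%n. \<phi> n x) -->> g x" if x: "x \<in> {c<..<d}" for x
		unfolding tendsto_iff
	proof (intro allI impI)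
		fix e :: real assume e: "e > 0"
		have "isCont g x" using g x by (simp add: continuous_on_eq_continuous_at)
		then obtain r where r: "r > 0" "!!y. dist y x < r ==> dist (g y) (g x) < e / 2"
			using e unfolding continuous_at_eps_delta by (meson half_gt_zero)
		define q where "q = min r (min ((x - c) / 2) ((d - x) / 2))"
		have q: "q > 0" "q <= r" using r(1) x by (auto simp: q_def)
		have "q <= min ((x - c) / 2) ((d - x) / 2)" unfolding q_def by (rule min.cobounded2)
		hence q': "q <= (x - c) / 2" "q <= (d - x) / 2" by auto
		from eventually_inverse_Suc_less[OF q(1)]
		show "\<forall>\<^sub>F n in sequentially. dist (\<phi> n x) (g x) < e"
		proof eventually_elim
			case (elim n)
			have "\<bar>\<phi> n x - g x\<bar> <= e / 2" unfolding \<phi>_def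
			proof (rule conv_moll_near[OF Gm GB])
				fix y assume y: "dist x y < 1 / (real (Suc n) + 1)"
				have "1 / (real (Suc n) + 1) <= 1 / (real n + 1)" by (simp add: field_simps)
				with y elim have d: "dist x y < q" by linarith
				obtain t where t: "t = 1 / (real n + 1)" by blast
				have "x - y < q" "y - x < q" "t < q" using d elim by (auto simp: t dist_real_def)
				moreover have "2 * q <= x - c" "2 * q <= d - x" using q' by auto
				ultimately have "c + t <= y" "y <= d - t" by auto
				hence "y \<in> K n" by (simp add: K_def t)
				hence "G n y = g y" by (simp add: G_def)
				with r(2)[of y] d q(2) show "\<bar>G n y - g x\<bar> <= e / 2" by (simp add: dist_real_def dist_commute abs_minus_commute)
			qed
			thus ?case using e by (simp add: dist_real_def)
		qed
	qed
	ultimately show ?thesis using that by blast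
qed

subsection \<open>Weak derivatives: uniqueness and integration by parts\<close>

lemma set_integral_cong_simple: "(!!x. x \<in> S ==> f x = g x) ==> set_lebesgue_integral M S f = set_lebesgue_integral M S g"
	unfolding sint_def by (intro Bochner_Integration.integral_cong) (auto simp: indicator_def)

lemma set_integral_mult_support:
	fixes u \<phi> :: "'a => real"
	assumes "K \<subseteq> S" "!!x. x \<notin> K ==> \<phi> x = 0"
	shows "set_lebesgue_integral M S (%x. u x * \<phi> x) = set_lebesgue_integral M K (%x. u x * \<phi> x)"
	unfolding sint_def
proof (rule Bochner_Integration.integral_cong)
	fix x show "indicator S x *R (u x * \<phi> x) = indicator K x *R (u x * \<phi> x)"
		using assms by (cases "x \<in> K") (auto simp: indicator_def)
qed simp

lemma set_integral_tendsto_bounded: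
	fixes u :: "'a => real"
	assumes u: "set_integrable M K u" and b: "!!n x. x \<in> K ==> \<bar>\<phi> n x\<bar> <= B" and K: "K \<in> sets M"
		and m: "!!n. \<phi> n \<in> borel_measurable M" "\<phi>' \<in> borel_measurable M"
		and lim: "AE x in M. x \<in> K --> (%n. \<phi> n x) -->> \<phi>' x"
	shows "(%n. set_lebesgue_integral M K (%x. u x * \<phi> n x)) -->> set_lebesgue_integral M K (%x. u x * \<phi>' x)"
proof -
	have um: "(%x. indicator K x * u x) \<in> borel_measurable M"
		using u unfolding set_integrable_def by auto
	have "(%n. \<integral>x. (indicator K x * u x) * \<phi> n x \<partial>M) -->> (\<integral>x. (indicator K x * u x) * \<phi>' x \<partial>M)"
	proof (rule integral_dominated_convergence[where w="%x. \<bar>B\<bar> * \<bar>indicator K x * u x\<bar>"])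
		show "integrable M (%x. \<bar>B\<bar> * \<bar>indicator K x * u x\<bar>)" using u unfolding set_integrable_def by auto
		show "AE x in M. (%n. indicator K x * u x * \<phi> n x) -->> indicator K x * u x * \<phi>' x"
			using lim by eventually_elim (auto intro!: tendsto_intros simp: indicator_def)
		show "AE x in M. norm (indicator K x * u x * \<phi> n x) <= \<bar>B\<bar> * \<bar>indicator K x * u x\<bar>" for n
		proof (rule AE_I2)
			fix x show "norm (indicator K x * u x * \<phi> n x) <= \<bar>B\<bar> * \<bar>indicator K x * u x\<bar>"
				using b[of x n] by (cases "x \<in> K") (auto simp: abs_mult mult.commute[of _ "\<bar>u x\<bar>"] intro!: mult_left_mono)
		qed
	qed (use m um in measurable)
	thus ?thesis unfolding sint_def by (simp add: mult.assoc)
qed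

lemma has_weak_pd_L1loc: "has_weak_pd S i u g ==> u \<in> L1loc S" "has_weak_pd S i u g ==> g \<in> L1loc S"
	by (auto simp: has_weak_pd_def)

lemma weak_ibp:
	fixes u du g g' :: "'a::euclidean_space => real"
	assumes S: "open S" and u: "has_weak_pd S i u du" and i: "i \<in> Basis"
		and K: "compact K" "K \<subseteq> S" and m[measurable]: "g \<in> borel_measurable borel" "g' \<in> borel_measurable borel"
		and z: "!!x. x \<notin> K ==> g x = 0" "!!x. x \<notin> K ==> g' x = 0"
		and B: "!!x. \<bar>g x\<bar> <= B" "!!x. \<bar>g' x\<bar> <= B"
		and c: "AE x in lborel. isCont g x" "AE x in lborel. isCont g' x"
		and d: "!!n x. conv (pd i (moll n)) g x = conv (moll n) g' x"
	shows "(LBINT x:S. u x * g' x) = - (LBINT x:S. du x * g x)"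
proof -
	obtain K' N where K': "compact K'" "K' \<subseteq> S" "K \<subseteq> K'" and
		out: "!!g n x. (!!x. x \<notin> K ==> g x = 0) ==> n \<ge> N ==> x \<notin> K' ==> conv (moll n) g x = 0"
		using conv_moll_support[OF K(1) S K(2)] by metis
	have K'm: "K' \<in> sets lborel" using K'(1) by (simp add: borel_compact)
	have gi: "integrable lborel g" "integrable lborel g'"
		using bounded_compact_support_integrable[OF m(1) K(1) z(1) B(1)]
			bounded_compact_support_integrable[OF m(2) K(1) z(2) B(2)] by auto
	define \<phi> where "\<phi> n = conv (moll (n + N)) g" for n
	define \<phi>' where "\<phi>' n = conv (moll (n + N)) g'" for n
	have Ckphi: "Ck k (\<phi> n)" "Ck k (\<phi>' n)" for k n unfolding \<phi>_def \<phi>'_def by (rule Ck_conv_moll[OF gi(1)], rule Ck_conv_moll[OF gi(2)])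
	have t: "\<phi> n \<in> test_functions S" for n
		by (rule test_functionsI[OF Ckphi(1) K'(1,2)]) (use out z in \<open>auto simp: \<phi>_def\<close>)
	have pdphi: "pd i (\<phi> n) x = \<phi>' n x" for n x
		unfolding \<phi>_def \<phi>'_def d[symmetric] by (rule pd_conv[OF Ck_moll compact_cball moll_outside gi(1) i])
	have eq: "(LBINT x:S. u x * \<phi>' n x) = - (LBINT x:S. du x * \<phi> n x)" for n
		using u t[of n] pdphi unfolding has_weak_pd_def by auto
	have ui: "lint K' u" "lint K' du"
		using u K' by (auto simp: has_weak_pd_def L1loc_def)
	have z': "\<phi> n x = 0" "\<phi>' n x = 0" if "x \<notin> K'" for n x
		using out z that by (auto simp: \<phi>_def \<phi>'_def)
	have mm: "\<phi> n \<in> borel_measurable lborel" "\<phi>' n \<in> borel_measurable lborel" for n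
		using Ck_borel_measurable[OF Ckphi(1)] Ck_borel_measurable[OF Ckphi(2)] by auto
	have 1: "(%n. LBINT x:K'. u x * \<phi>' n x) -->> (LBINT x:K'. u x * g' x)"
	proof (rule set_integral_tendsto_bounded[OF ui(1) _ K'm mm(2)])
		show "\<bar>\<phi>' n x\<bar> <= B" for n x unfolding \<phi>'_def by (rule conv_moll_bound[OF m(2) B(2)])
		show "AE x in lborel. x \<in> K' --> (%n. \<phi>' n x) -->> g' x"
			using c(2) by eventually_elim (auto simp: \<phi>'_def intro!: LIMSEQ_ignore_initial_segment conv_moll_tendsto[OF m(2) B(2)])
	qed (use m in auto)
	have 2: "(%n. LBINT x:K'. du x * \<phi> n x) -->> (LBINT x:K'. du x * g x)"
	proof (rule set_integral_tendsto_bounded[OF ui(2) _ K'm mm(1)])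
		show "\<bar>\<phi> n x\<bar> <= B" for n x unfolding \<phi>_def by (rule conv_moll_bound[OF m(1) B(1)])
		show "AE x in lborel. x \<in> K' --> (%n. \<phi> n x) -->> g x"
			using c(1) by eventually_elim (auto simp: \<phi>_def intro!: LIMSEQ_ignore_initial_segment conv_moll_tendsto[OF m(1) B(1)])
	qed (use m in auto)
	have "(LBINT x:K'. u x * \<phi>' n x) = - (LBINT x:K'. du x * \<phi> n x)" for n
		using eq[of n] set_integral_mult_support[where \<phi>="\<phi> n", OF K'(2) z'(1)] set_integral_mult_support[where \<phi>="\<phi>' n", OF K'(2) z'(2)]
		by simp
	hence "(LBINT x:K'. u x * g' x) = - (LBINT x:K'. du x * g x)"
		using LIMSEQ_unique[OF 1] tendsto_minus[OF 2] by auto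
	thus ?thesis
		using set_integral_mult_support[where \<phi>=g, OF K'(2)] set_integral_mult_support[where \<phi>=g', OF K'(2)] z K'(3)
		by (metis subsetD)
qed

lemma continuous_against_weak_zero:
	fixes h g :: "'a::euclidean_space => real"
	assumes S: "open S" and h: "h \<in> L1loc S"
		and z: "!!\<phi>. \<phi> \<in> test_functions S ==> (LBINT x:S. h x * \<phi> x) = 0"
		and K: "compact K" "K \<subseteq> S" and g: "continuous_on UNIV g" "!!x. x \<notin> K ==> g x = 0"
	shows "(LBINT x:S. h x * g x) = 0"
proof -
	obtain K' N where K': "compact K'" "K' \<subseteq> S" "K \<subseteq> K'" and
		out: "!!g n x. (!!x. x \<notin> K ==> g x = 0) ==> n \<ge> N ==> x \<notin> K' ==> conv (moll n) g x = 0"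
		using conv_moll_support[OF K(1) S K(2)] by metis
	have K'm: "K' \<in> sets lborel" using K'(1) by (simp add: borel_compact)
	obtain B where B: "!!x. \<bar>g x\<bar> <= B" using continuous_compact_support_bounded[OF g(1) K(1) g(2)] by metis
	have m: "g \<in> borel_measurable borel" using g(1) by (rule borel_measurable_continuous_onI)
	have gi: "integrable lborel g" by (rule bounded_compact_support_integrable[OF m K(1) g(2) B])
	define \<phi> where "\<phi> n = conv (moll (n + N)) g" for n
	have Ckphi: "Ck k (\<phi> n)" for k n unfolding \<phi>_def by (rule Ck_conv_moll[OF gi])
	have t: "\<phi> n \<in> test_functions S" for n
		by (rule test_functionsI[OF Ckphi(1) K'(1,2)]) (use out g in \<open>auto simp: \<phi>_def\<close>)
	have z': "\<phi> n x = 0" if "x \<notin> K'" for n x using out g(2) that by (auto simp: \<phi>_def)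
	have "(%n. LBINT x:K'. h x * \<phi> n x) -->> (LBINT x:K'. h x * g x)"
	proof (rule set_integral_tendsto_bounded[OF _ _ K'm])
		show "lint K' h" using h K' by (auto simp: L1loc_def)
		show "\<bar>\<phi> n x\<bar> <= B" for n x unfolding \<phi>_def by (rule conv_moll_bound[OF m B])
		show "AE x in lborel. x \<in> K' --> (%n. \<phi> n x) -->> g x"
			using g(1) by (auto simp: \<phi>_def continuous_on_eq_continuous_at intro!: LIMSEQ_ignore_initial_segment conv_moll_tendsto[OF m B])
		show "\<phi> n \<in> borel_measurable lborel" for n using Ck_borel_measurable[OF Ckphi] by simp
	qed (use m in auto)
	moreover have "(LBINT x:K'. h x * \<phi> n x) = 0" for n
		using z[OF t[of n]] set_integral_mult_support[where \<phi>="\<phi> n", OF K'(2) z'] by simp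
	ultimately have "(LBINT x:K'. h x * g x) = 0" using LIMSEQ_unique[OF _ tendsto_const] by auto
	thus ?thesis
		using set_integral_mult_support[where \<phi>=g, OF K'(2)] g K'(3) by (metis subsetD)
qed

lemma compact_integral_weak_zero:
	fixes h :: "'a::euclidean_space => real"
	assumes S: "open S" and h: "h \<in> L1loc S"
		and z: "!!\<phi>. \<phi> \<in> test_functions S ==> (LBINT x:S. h x * \<phi> x) = 0"
		and K: "compact K" "K \<subseteq> S" "K ~= {}"
	shows "(LBINT x:K. h x) = 0"
proof -
	obtain e where e: "e > 0" "(\<Union>x\<in>K. ball x e) \<subseteq> S"
		using compact_subset_open_imp_ball_epsilon_subset[OF K(1) S K(2)] by blast
	define K' where "K' = {x + y | x y. x \<in> K & y \<in> cball 0 (e/2)}"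
	have cK: "compact K'" unfolding K'_def by (rule compact_sums[OF K(1) compact_cball])
	have KS: "K' \<subseteq> S"
	proof
		fix z assume "z \<in> K'"
		then obtain x y where "z = x + y" "x \<in> K" "norm y <= e/2" by (auto simp: K'_def)
		hence "z \<in> ball x e" using e(1) by (simp add: dist_norm)
		thus "z \<in> S" using e(2) \<open>x \<in> K\<close> by blast
	qed
	have inK': "x \<in> K'" if "infdist x K <= e/2" for x
	proof -
		obtain y where y: "y \<in> K" "infdist x K = dist x y"
			using infdist_attains_inf[OF compact_imp_closed[OF K(1)] K(3)] by blast
		hence "x = y + (x - y)" "x - y \<in> cball 0 (e/2)" using that by (auto simp: dist_norm norm_minus_commute)
		with y(1) show ?thesis unfolding K'_def by blast
	qed
	define g where "g n x = max 0 (1 - (real n + 2 / e) * infdist x K)" for n x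
	have gc: "continuous_on UNIV (g n)" for n unfolding g_def by (intro continuous_intros)
	have g0: "g n x = 0" if "x \<notin> K'" for n x
	proof -
		have "infdist x K > e/2" using inK' that by force
		hence "(2 / e) * infdist x K \<ge> 1" using e(1) by (simp add: field_simps)
		moreover have "real n * infdist x K \<ge> 0" by (simp add: infdist_nonneg)
		ultimately show ?thesis unfolding g_def by (simp add: distrib_right)
	qed
	have gb: "\<bar>g n x\<bar> <= 1" for n x
		unfolding g_def using e(1) by (auto simp: infdist_nonneg intro!: mult_nonneg_nonneg add_nonneg_nonneg)
	have lim: "(%n. g n x) -->> indicator K x" for x
	proof (cases "x \<in> K")
		case True thus ?thesis by (simp add: g_def)
	next
		case False
		hence p: "infdist x K > 0"
			using infdist_pos_not_in_closed[OF compact_imp_closed[OF K(1)] K(3)] by simp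
		obtain N where N: "1 < real N * infdist x K" using reals_Archimedean3[OF p] by blast
		have "g n x = 0" if "n \<ge> N" for n
		proof -
			have "real N * infdist x K <= real n * infdist x K" using that p by (intro mult_right_mono) auto
			moreover have "(2 / e) * infdist x K \<ge> 0" using e(1) p by simp
			ultimately show ?thesis using N unfolding g_def by (simp add: distrib_right)
		qed
		hence "\<forall>\<^sub>F n in sequentially. 0 = g n x" by (auto simp: eventually_sequentially)
		from Lim_transform_eventually[OF tendsto_const this] False show ?thesis by simp
	qed
	have "(%n. LBINT x:K'. h x * g n x) -->> (LBINT x:K'. h x * indicator K x)"
	proof (rule set_integral_tendsto_bounded[where B=1])
		show "lint K' h" using h cK KS by (auto simp: L1loc_def)
		show "g n \<in> borel_measurable lborel" for n using gc by (simp add: borel_measurable_continuous_onI)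
		show "indicator K \<in> borel_measurable lborel" using K(1) by (intro borel_measurable_indicator) (simp add: borel_compact)
	qed (use gb lim cK in "auto simp: borel_compact")
	moreover have "(LBINT x:K'. h x * g n x) = 0" for n
		using continuous_against_weak_zero[OF S h z cK KS gc[of n] g0]
		by (simp add: set_integral_mult_support[where \<phi>="g n", OF KS g0])
	ultimately have "(LBINT x:K'. h x * indicator K x) = 0" using LIMSEQ_unique[OF _ tendsto_const] by auto
	moreover have "(LBINT x:K'. h x * indicator K x) = (LBINT x:K. h x * indicator K x)"
	proof (rule set_integral_mult_support)
		show "K \<subseteq> K'" using inK' e(1) by (auto simp: infdist_zero)
	qed auto
	moreover have "... = (LBINT x:K. h x)" by (rule set_integral_cong_simple) auto
	ultimately show ?thesis by simp
qed

text \<open>Fundamental lemma of the calculus of variations.\<close>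
lemma weak_zero_nonpos:
	fixes h :: "'a::euclidean_space => real"
	assumes S: "open S" and h: "h \<in> L1loc S"
		and z: "!!\<phi>. \<phi> \<in> test_functions S ==> (LBINT x:S. h x * \<phi> x) = 0"
	shows "AE x in lborel. x \<in> S --> h x <= 0"
proof -
	have hm: "(%x. indicator S x * h x) \<in> borel_measurable borel"
		using h by (auto simp: L1loc_def smeas_def)
	define A where "A n = {x \<in> cball 0 (real n). indicator S x * h x > 0}" for n
	have Am: "A n \<in> sets borel" for n unfolding A_def using hm by measurable
	have A0: "A n \<in> null_sets lborel" for n
	proof (rule ccontr)
		assume na: "A n \<notin> null_sets lborel"
		have fin: "emeasure lborel (A n) < \<infinity>"
			by (rule order.strict_trans1[OF emeasure_mono emeasure_compact_finite[of "cball 0 (real n)"]]) (auto simp: A_def)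
		have epos: "emeasure lborel (A n) > 0"
			using na Am[of n] by (auto simp: null_sets_def zero_less_iff_neq_zero)
		define m where "m = measure lborel (A n)"
		have em: "emeasure lborel (A n) = ennreal m" unfolding m_def using fin by (simp add: emeasure_eq_ennreal_measure)
		hence m: "m > 0" using epos by simp
		have "A n \<in> sets lebesgue" using Am[of n] by simp
		from sets_lebesgue_inner_closed[OF this m]
		obtain T where T': "closed T" "T \<subseteq> A n" "emeasure lebesgue (A n - T) < ennreal m" .
		have T: "compact T" "T \<subseteq> A n"
		proof -
			have "A n \<subseteq> cball 0 (real n)" by (auto simp: A_def)
			hence "bounded T" using T'(2) bounded_cball bounded_subset by blast
			with T' show "compact T" "T \<subseteq> A n" by (auto simp: compact_eq_bounded_closed)
		qed
		have Tpos: "emeasure lborel T ~= 0"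
		proof
			assume "emeasure lborel T = 0"
			hence "emeasure lborel (A n) = emeasure lborel (A n - T)"
				using T(1) Am[of n] by (intro emeasure_Diff_null_set[symmetric]) (auto simp: null_sets_def borel_compact)
			moreover have "A n - T \<in> sets lborel" using Am[of n] T(1) by (simp add: borel_compact sets.Diff)
			hence "emeasure lebesgue (A n - T) = emeasure lborel (A n - T)" by (simp add: emeasure_completion)
			ultimately show False using T'(3) em by simp
		qed
		have AS: "x \<in> S & h x > 0" if "x \<in> A n" for x using that by (cases "x \<in> S") (auto simp: A_def)
		have TS: "T \<subseteq> S" using T(2) AS by auto
		have Tne: "T ~= {}" using Tpos by auto
		have "(LBINT x:T. h x) = 0" by (rule compact_integral_weak_zero[OF S h z T(1) TS Tne])
		hence "(LBINT x. indicator T x * h x) = 0" by (simp add: sint_def)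
		moreover have "integrable lborel (%x. indicator T x * h x)" using h T(1) TS by (auto simp: L1loc_def set_integrable_def)
		moreover have nn: "indicator T x * h x \<ge> 0" for x
			using T(2) AS by (cases "x \<in> T") (auto intro: less_imp_le)
		ultimately have "AE x in lborel. indicator T x * h x = 0"
			using integral_nonneg_eq_0_iff_AE[of lborel "%x. indicator T x * h x"] by auto
		hence "AE x in lborel. x \<notin> T"
		proof eventually_elim
			case (elim x)
			thus ?case using T(2) AS by (cases "x \<in> T") force+
		qed
		hence "emeasure lborel T = 0"
			using T(1) by (subst (asm) AE_iff_measurable[of T]) (auto simp: borel_compact)
		with Tpos show False by simp
	qed
	have "AE x in lborel. \<forall>n. x \<notin> A n" using A0 by (simp add: AE_all_countable AE_not_in)
	thus ?thesis
	proof eventually_elim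
		case (elim x)
		obtain n where "norm x <= real n" using real_arch_simple by blast
		with elim have "\<not> (indicator S x * h x > 0)" by (auto simp: A_def)
		thus ?case by (auto simp: indicator_def)
	qed
qed

lemma L1loc_uminus: "h \<in> L1loc S ==> (%x. - h x) \<in> L1loc S"
	by (auto simp: L1loc_def smeas_def set_integrable_def)

lemma L1loc_diff: "g \<in> L1loc S ==> h \<in> L1loc S ==> (%x. g x - h x) \<in> L1loc S"
	by (auto simp: L1loc_def smeas_def right_diff_distrib)

lemma weak_zero:
	fixes h :: "'a::euclidean_space => real"
	assumes S: "open S" and h: "h \<in> L1loc S"
		and z: "!!\<phi>. \<phi> \<in> test_functions S ==> (LBINT x:S. h x * \<phi> x) = 0"
	shows "AE x in lborel. x \<in> S --> h x = 0"
proof -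
	have "AE x in lborel. x \<in> S --> - h x <= 0"
		by (rule weak_zero_nonpos[OF S L1loc_uminus[OF h]]) (use z in "simp add: sint_def")
	moreover have "AE x in lborel. x \<in> S --> h x <= 0" by (rule weak_zero_nonpos[OF S h z])
	ultimately show ?thesis by eventually_elim auto
qed

lemma test_function_bounded:
	assumes "\<phi> \<in> test_functions S"
	obtains K B where "compact K" "K \<subseteq> S" "!!x. x \<notin> K ==> \<phi> x = 0" "!!x. \<bar>\<phi> x\<bar> <= B" "B \<ge> 0"
proof -
	obtain K where K: "compact K" "K \<subseteq> S" "!!x. x \<notin> K ==> \<phi> x = 0"
		using assms by (auto simp: test_functions_def)
	have "continuous_on UNIV \<phi>" using assms by (auto simp: test_functions_def dest: spec[of _ 0])
	from continuous_compact_support_bounded[OF this K(1,3)] that K show ?thesis by metis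
qed

lemma test_function_measurable: "\<phi> \<in> test_functions S ==> \<phi> \<in> borel_measurable borel"
	using Ck_borel_measurable by (auto simp: test_functions_def)

lemma L1loc_mult_test_integrable:
	assumes "h \<in> L1loc S" "\<phi> \<in> test_functions S"
	shows "lint S (%x. h x * \<phi> x)"
proof -
	obtain K B where K: "compact K" "K \<subseteq> S" "!!x. x \<notin> K ==> \<phi> x = 0" "!!x. \<bar>\<phi> x\<bar> <= B" "B \<ge> 0"
		using test_function_bounded[OF assms(2)] by metis
	have "integrable lborel (%x. indicator K x * h x)" using assms(1) K by (auto simp: L1loc_def set_integrable_def)
	hence "integrable lborel (%x. (indicator K x * h x) * \<phi> x)"
		by (rule integrable_mult_bounded) (use K test_function_measurable[OF assms(2)] in auto)
	moreover have "(indicator K x * h x) * \<phi> x = indicator S x *R (h x * \<phi> x)" for x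
		using K by (cases "x \<in> K") (auto simp: indicator_def)
	ultimately show ?thesis unfolding set_integrable_def by simp
qed

lemma weak_pd_unique:
	assumes S: "open S" and 1: "has_weak_pd S i u g" and 2: "has_weak_pd S i u h"
	shows "AE x in lborel. x \<in> S --> g x = h x"
proof -
	have gh: "g \<in> L1loc S" "h \<in> L1loc S" using 1 2 by (auto simp: has_weak_pd_def)
	have "AE x in lborel. x \<in> S --> g x - h x = 0"
	proof (rule weak_zero[OF S L1loc_diff[OF gh]])
		fix \<phi> assume t: "\<phi> \<in> test_functions S"
		have "(LBINT x:S. g x * \<phi> x) = (LBINT x:S. h x * \<phi> x)"
			using 1 2 t by (auto simp: has_weak_pd_def)
		thus "(LBINT x:S. (g x - h x) * \<phi> x) = 0"
			using L1loc_mult_test_integrable[OF gh(1) t] L1loc_mult_test_integrable[OF gh(2) t]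
			by (simp add: left_diff_distrib)
	qed
	thus ?thesis by eventually_elim auto
qed

section \<open>Functions that are piecewise differentiable along lines\<close>

text \<open>\<open>slicewise S i g g'\<close>: along every line in direction \<open>i\<close> the function \<open>g\<close> is continuous at the points
	of \<open>S\<close>, and has there the derivative \<open>g'\<close> up to finitely many points of the line.\<close>
definition slicewise :: "(plane) set => plane => (plane => real) => (plane => real) => bool" where
	"slicewise S i g g' \<longleftrightarrow> (\<forall>x t. x + t *R i \<in> S --> isCont (%s. g (x + s *R i)) t) &
		 (\<forall>x. \<exists>T. finite T & (\<forall>t. t \<notin> T --> x + t *R i \<in> S -->
				((%s. g (x + s *R i)) has_real_derivative g' (x + t *R i)) (at t)))"

lemma integral_deriv_compact_support:
	fixes f f' :: "real => real"
	assumes T: "finite T" and c: "!!t. isCont f t"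
		and d: "!!t. t \<notin> T ==> DERIV f t :> f' t"
		and z: "!!t. \<bar>t\<bar> > R ==> f t = 0" "!!t. \<bar>t\<bar> > R ==> f' t = 0"
		and i: "integrable lborel f'"
	shows "(LBINT t. f' t) = 0"
proof -
	define r where "r = \<bar>R\<bar> + 1"
	have r: "r > 0" "r > R" by (auto simp: r_def)
	have "(f' has_integral (f r - f (-r))) {-r..r}"
		by (rule fundamental_theorem_of_calculus_interior_strong[OF T])
			 (use r d c in "auto simp: has_real_derivative_iff_has_vector_derivative[symmetric] continuous_at_imp_continuous_on")
	moreover have "f r - f (-r) = 0" using z(1)[of r] z(1)[of "-r"] r by auto
	ultimately have "(f' has_integral 0) {-r..r}" by simp
	hence "(f' has_integral 0) UNIV"
	proof (rule has_integral_on_superset)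
		show "f' x = 0" if "x \<notin> {-r..r}" for x using that r by (intro z(2)) auto
	qed simp
	with has_integral_integral_lborel[OF i] show ?thesis by (rule has_integral_unique)
qed

lemma slice_integral_zero:
	fixes h h' :: "plane => real"
	assumes i: "i = (1, 0) \<or> i = (0, 1)" and s: "slicewise UNIV i h h'"
		and z: "!!x. norm x > R ==> h x = 0" "!!x. norm x > R ==> h' x = 0"
		and h': "integrable lborel h'" "!!x. \<bar>h' x\<bar> <= B"
	shows "(LBINT x. h' x) = 0"
proof -
	have m[measurable]: "h' \<in> borel_measurable borel" using h' by auto
	have int: "integrable (lborel \<Otimes>\<^sub>M lborel) (case_prod (%x y. h' (x, y)))" using h'(1) by (simp add: lborel_prod)
	have line: "(LBINT t. h' (x + t *R i)) = 0" if n: "!!t. norm (x + t *R i) \<ge> \<bar>t\<bar>" for x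
	proof -
		obtain T where T: "finite T" "!!t. t \<notin> T ==> ((%s. h (x + s *R i)) has_real_derivative h' (x + t *R i)) (at t)"
			using s unfolding slicewise_def by (metis UNIV_I)
		have z': "h (x + t *R i) = 0" "h' (x + t *R i) = 0" if "\<bar>t\<bar> > R" for t
			using z n[of t] that by (metis less_le_trans)+
		show ?thesis
		proof (rule integral_deriv_compact_support[OF T(1) _ T(2) z'])
			show "isCont (%s. h (x + s *R i)) t" for t using s unfolding slicewise_def by blast
			show "integrable lborel (%t. h' (x + t *R i))"
			proof (rule bounded_compact_support_integrable[of _ "cball 0 R"])
				show "h' (x + t *R i) = 0" if "t \<notin> cball 0 R" for t using z'(2)[of t] that by auto
				show "\<bar>h' (x + t *R i)\<bar> <= B" for t by (rule h'(2))
				show "(%t. h' (x + t *R i)) \<in> borel_measurable borel" by measurable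
			qed simp
		qed
	qed
	from i show ?thesis
	proof
		assume i1: "i = (1, 0)"
		have "\<bar>t\<bar> <= norm (t, y)" for t y :: real using norm_fst_le[of t y] by simp
		hence "(LBINT x. h' (x, y)) = 0" for y
			using line[of "(0, y)"] i1 by simp
		thus ?thesis using lborel_pair.integral_snd[OF int] by (simp add: lborel_prod case_prod_beta')
	next
		assume i1: "i = (0, 1)"
		have "\<bar>t\<bar> <= norm (x, t)" for t x :: real using norm_snd_le[of t x] by simp
		hence "(LBINT y. h' (x, y)) = 0" for x
			using line[of "(x, 0)"] i1 by simp
		thus ?thesis using lborel_pair.integral_fst[OF int] by (simp add: lborel_prod case_prod_beta')
	qed
qed

lemma slicewise_mult:
	assumes "slicewise S i f f'" "slicewise S i g g'"
	shows "slicewise S i (%x. f x * g x) (%x. f' x * g x + f x * g' x)"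
	unfolding slicewise_def
proof (intro conjI allI)
	fix x
	obtain T U where "finite T" "finite U"
		and T: "!!t. t \<notin> T ==> x + t *R i \<in> S ==> ((%s. f (x + s *R i)) has_real_derivative f' (x + t *R i)) (at t)"
		and U: "!!t. t \<notin> U ==> x + t *R i \<in> S ==> ((%s. g (x + s *R i)) has_real_derivative g' (x + t *R i)) (at t)"
		using assms unfolding slicewise_def by metis
	thus "\<exists>T. finite T & (\<forall>t. t \<notin> T --> x + t *R i \<in> S -->
		 ((%s. f (x + s *R i) * g (x + s *R i)) has_real_derivative
			 f' (x + t *R i) * g (x + t *R i) + f (x + t *R i) * g' (x + t *R i)) (at t))"
		by (intro exI[of _ "T \<union> U"]) (auto intro!: derivative_eq_intros)
qed (use assms in "auto simp: slicewise_def intro!: continuous_intros")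

lemma slicewise_differentiable:
	assumes "!!x. x \<in> S ==> (f has_derivative D x) (at x)"
	shows "slicewise S i f (%x. D x i)"
proof -
	have d: "((%s. f (x + s *R i)) has_real_derivative D (x + t *R i) i) (at t)" if "x + t *R i \<in> S" for x t
	proof -
		have D: "(f has_derivative D (x + t *R i)) (at (x + t *R i))" by (rule assms[OF that])
		have "((%s. x + s *R i) has_derivative (%s. s *R i)) (at t)"
			by (auto intro!: derivative_eq_intros)
		from has_derivative_compose[OF this D]
		have "((%s. f (x + s *R i)) has_derivative (%s. D (x + t *R i) (s *R i))) (at t)" .
		moreover have "D (x + t *R i) (s *R i) = D (x + t *R i) i * s" for s
			using linear_scale[OF has_derivative_linear[OF D]] by simp
		ultimately show ?thesis by (simp add: has_field_derivative_def)
	qed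
	thus ?thesis
		unfolding slicewise_def by (auto intro: exI[of _ "{}"] DERIV_isCont)
qed

lemma slicewise_Ck: "Ck (Suc 0) f ==> slicewise S i f (pd i f)"
	using slicewise_differentiable[of S f "%x. frechet_derivative f (at x)" i, OF Ck_has_derivative[of 0 f]]
	unfolding pd_def[abs_def] by blast

lemma slicewise_extend:
	assumes s: "slicewise S i h h'" and K: "closed K" "K \<subseteq> S"
		and z: "!!x. x \<notin> K ==> h x = 0" "!!x. x \<notin> K ==> h' x = 0"
	shows "slicewise UNIV i h h'"
proof -
	have d: "((%s. h (x + s *R i)) has_real_derivative 0) (at t)" if "x + t *R i \<notin> K" for x t
	proof -
		have "open ((%s. x + s *R i) -` (-K))"
			using K(1) by (intro open_vimage continuous_intros) auto
		hence "\<forall>\<^sub>F s in nhds t. s \<in> (%s. x + s *R i) -` (-K)"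
			by (rule eventually_nhds_in_open) (use that in simp)
		hence "\<forall>\<^sub>F s in nhds t. h (x + s *R i) = 0" by eventually_elim (use z in auto)
		from DERIV_cong_ev[OF refl this refl] show ?thesis by simp
	qed
	show ?thesis unfolding slicewise_def
	proof (intro conjI allI impI)
		fix x t show "isCont (%s. h (x + s *R i)) t"
		proof (cases "x + t *R i \<in> K")
			case True thus ?thesis using s K(2) unfolding slicewise_def by blast
		qed (rule DERIV_isCont[OF d])
	next
		fix x
		obtain T where "finite T"
			and T: "!!t. t \<notin> T ==> x + t *R i \<in> S ==> ((%s. h (x + s *R i)) has_real_derivative h' (x + t *R i)) (at t)"
			using s unfolding slicewise_def by metis
		moreover have "((%s. h (x + s *R i)) has_real_derivative h' (x + t *R i)) (at t)" if "t \<notin> T" for t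
			using T[OF that] d[of x t] z(2)[of "x + t *R i"] K(2) by (cases "x + t *R i \<in> K") auto
		ultimately show "\<exists>T. finite T & (\<forall>t. t \<notin> T --> x + t *R i \<in> UNIV -->
				((%s. h (x + s *R i)) has_real_derivative h' (x + t *R i)) (at t))" by auto
	qed
qed

lemma conv_slicewise:
	assumes i: "i = (1, 0) \<or> i = (0, 1)" and s: "slicewise UNIV i g g'"
		and m[measurable]: "g \<in> borel_measurable borel" "g' \<in> borel_measurable borel"
		and K: "compact K" "!!x. x \<notin> K ==> g x = 0" "!!x. x \<notin> K ==> g' x = 0"
		and B: "!!x. \<bar>g x\<bar> <= B" "!!x. \<bar>g' x\<bar> <= B"
	shows "conv (pd i (moll n)) g x = conv (moll n) g' x"
proof -
	have iB: "i \<in> Basis" using i by (auto simp: Basis_prod_def)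
	have cpd: "continuous_on UNIV (pd i (moll n))" using Ck_moll[of "Suc 0" n] iB by (metis Ck.simps)
	have C1: "Ck (Suc 0) (moll n :: plane => real)" by (rule Ck_moll)
	have cm: "continuous_on UNIV (moll n :: plane => real)" using Ck_moll[of 0 n] by simp
	have pz: "pd i (moll n) x = 0" if "x \<notin> cball 0 1" for x
		by (rule pd_eq_0_outside[OF closed_cball moll_outside that])
	obtain C where C: "!!x::plane. \<bar>moll n x\<bar> <= C"
		using continuous_compact_support_bounded[OF cm compact_cball moll_outside] by blast
	obtain D where D: "!!x. \<bar>pd i (moll n) x\<bar> <= D"
		using continuous_compact_support_bounded[OF cpd compact_cball pz] by blast
	have pm[measurable]: "pd i (moll n) \<in> borel_measurable borel" using cpd by (rule borel_measurable_continuous_onI)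
	have gi: "integrable lborel g" "integrable lborel g'"
		using bounded_compact_support_integrable[OF m(1) K(1,2) B(1)] bounded_compact_support_integrable[OF m(2) K(1,3) B(2)] by auto
	have s1: "slicewise UNIV i (%y. moll n (x - y)) (%y. - pd i (moll n) (x - y))"
	proof -
		have "((%y. moll n (x - y)) has_derivative (%d. frechet_derivative (moll n) (at (x - y)) (- d))) (at y)" for y
			by (rule has_derivative_compose[OF _ Ck_has_derivative[OF Ck_moll]]) (auto intro!: derivative_eq_intros)
		from slicewise_differentiable[OF this, of UNIV]
		have "slicewise UNIV i (%y. moll n (x - y)) (%y. frechet_derivative (moll n) (at (x - y)) (- i))" by simp
		moreover have "frechet_derivative (moll n) (at (x - y)) (- i) = - pd i (moll n) (x - y)" for y
			unfolding pd_def using C1 by (intro linear_neg linear_frechet_derivative) (simp only: Ck.simps)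
		ultimately show ?thesis by simp
	qed
	have i1: "integrable lborel (%y. g y * pd i (moll n) (x - y))"
		by (rule integrable_mult_bounded[OF gi(1) _ D]) simp
	have i2: "integrable lborel (%y. g' y * moll n (x - y))"
		by (rule integrable_mult_bounded[OF gi(2) _ C]) simp
	obtain R where R: "!!y. y \<in> K ==> norm y <= R" using compact_imp_bounded[OF K(1)] by (auto simp: bounded_iff)
	have "(LBINT y. - pd i (moll n) (x - y) * g y + moll n (x - y) * g' y) = 0"
	proof (rule slice_integral_zero[OF i slicewise_mult[OF s1 s], of R])
		show "moll n (x - y) * g y = 0" if "norm y > R" for y using K R that by (metis mult_zero_right not_le)
		show "- pd i (moll n) (x - y) * g y + moll n (x - y) * g' y = 0" if "norm y > R" for y
			using K(2)[of y] K(3)[of y] R[of y] that by (cases "y \<in> K") auto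
		show "\<bar>- pd i (moll n) (x - y) * g y + moll n (x - y) * g' y\<bar> <= D * B + C * B" for y
		proof -
			have "0 <= C" "0 <= D"
				using C[of 0] D[of 0] abs_ge_zero[of "moll n (0::plane)"] abs_ge_zero[of "pd i (moll n) 0"] by linarith+
			hence "\<bar>pd i (moll n) (x - y)\<bar> * \<bar>g y\<bar> <= D * B" "\<bar>moll n (x - y)\<bar> * \<bar>g' y\<bar> <= C * B"
				using mult_mono[OF D B(1)] mult_mono[OF C B(2)] by auto
			thus ?thesis by (intro order_trans[OF abs_triangle_ineq add_mono]) (simp_all add: abs_mult)
		qed
		show "integrable lborel (%y. - pd i (moll n) (x - y) * g y + moll n (x - y) * g' y)"
			using i1 i2 by (simp add: mult.commute)
	qed
	moreover have "(LBINT y. - pd i (moll n) (x - y) * g y + moll n (x - y) * g' y)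
		 = - (LBINT y. g y * pd i (moll n) (x - y)) + (LBINT y. g' y * moll n (x - y))"
		using i1 i2 by (simp add: mult.commute[of _ "g _"] mult.commute[of _ "g' _"])
	ultimately show ?thesis unfolding conv_def by (simp add: mult.commute)
qed

text \<open>The definition of the weak derivative is applied to mollifications of \<open>g\<close>.\<close>
lemma weak_ibp_slices:
	assumes S: "open S" and u: "has_weak_pd S i u du" and i: "i = (1, 0) \<or> i = (0, 1)"
		and K: "compact K" "K \<subseteq> S" and m: "g \<in> borel_measurable borel" "g' \<in> borel_measurable borel"
		and z: "!!x. x \<notin> K ==> g x = 0" "!!x. x \<notin> K ==> g' x = 0"
		and B: "!!x. \<bar>g x\<bar> <= B" "!!x. \<bar>g' x\<bar> <= B"
		and c: "AE x in lborel. isCont g x" "AE x in lborel. isCont g' x"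
		and s: "slicewise UNIV i g g'"
	shows "(LBINT x:S. u x * g' x) = - (LBINT x:S. du x * g x)"
proof (rule weak_ibp[OF S u _ K m z B c])
	show "i \<in> Basis" using i by (auto simp: Basis_prod_def)
	show "conv (pd i (moll n)) g x = conv (moll n) g' x" for n x
		by (rule conv_slicewise[OF i s m K(1) z B])
qed

text \<open>The product with a test function has compact support, and its derivative integrates to zero over every line.\<close>
lemma has_weak_pd_slicesI:
	assumes S: "open S" "g \<in> L1loc S" "g' \<in> L1loc S" and i: "i = (1, 0) \<or> i = (0, 1)"
		and s: "slicewise S i g g'"
		and B: "!!x. x \<in> S ==> \<bar>g x\<bar> <= B" "!!x. x \<in> S ==> \<bar>g' x\<bar> <= B"
	shows "has_weak_pd S i g g'"
	unfolding has_weak_pd_def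
proof (intro conjI ballI S)
	fix \<phi> assume t: "\<phi> \<in> test_functions S"
	have iB: "i \<in> Basis" using i by (auto simp: Basis_prod_def)
	have Ck: "Ck k \<phi>" for k using t by (auto simp: test_functions_def)
	obtain K C where K: "compact K" "K \<subseteq> S" "!!x. x \<notin> K ==> \<phi> x = 0" "!!x. \<bar>\<phi> x\<bar> <= C"
		using test_function_bounded[OF t] by metis
	have pz: "pd i \<phi> x = 0" if "x \<notin> K" for x by (rule pd_eq_0_outside[OF compact_imp_closed[OF K(1)] K(3) that])
	have t': "pd i \<phi> \<in> test_functions S"
		by (rule test_functionsI[OF _ K(1,2) pz]) (use Ck[of "Suc _"] iB in simp)
	obtain D where D: "!!x. \<bar>pd i \<phi> x\<bar> <= D" using test_function_bounded[OF t'] by metis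
	define h where "h x = g x * \<phi> x" for x
	define h' where "h' x = g' x * \<phi> x + g x * pd i \<phi> x" for x
	have i1: "lint S (%x. g' x * \<phi> x)" by (rule L1loc_mult_test_integrable[OF S(3) t])
	have i2: "lint S (%x. g x * pd i \<phi> x)" by (rule L1loc_mult_test_integrable[OF S(2) t'])
	have hz: "h x = 0" "h' x = 0" if "x \<notin> K" for x using K(3)[OF that] pz[OF that] by (auto simp: h_def h'_def)
	have ind: "indicator S x *R h' x = h' x" for x using hz(2)[of x] K(2) by (cases "x \<in> S") auto
	have ih: "lint S h'" unfolding h'_def by (rule set_integral_add(1)[OF i1 i2])
	obtain R where R: "!!y. y \<in> K ==> norm y <= R" using compact_imp_bounded[OF K(1)] by (auto simp: bounded_iff)
	have "(LBINT x. h' x) = 0"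
	proof (rule slice_integral_zero[OF i])
		show "slicewise UNIV i h h'"
		proof (rule slicewise_extend[OF _ compact_imp_closed[OF K(1)] K(2) hz])
			show "slicewise S i h h'" unfolding h_def h'_def by (rule slicewise_mult[OF s slicewise_Ck[OF Ck]])
		qed
		show "h x = 0" "h' x = 0" if "norm x > R" for x using hz R that by (metis not_le)+
		show "integrable lborel h'" using ih by (simp only: set_integrable_def ind)
		show "\<bar>h' x\<bar> <= \<bar>B\<bar> * \<bar>C\<bar> + \<bar>B\<bar> * \<bar>D\<bar>" for x
		proof (cases "x \<in> K")
			case True
			hence "\<bar>g x\<bar> <= \<bar>B\<bar>" "\<bar>g' x\<bar> <= \<bar>B\<bar>" using B[of x] K(2) by (auto intro: order_trans)
			moreover have "\<bar>\<phi> x\<bar> <= \<bar>C\<bar>" "\<bar>pd i \<phi> x\<bar> <= \<bar>D\<bar>" using K(4)[of x] D[of x] by linarith+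
			ultimately have "\<bar>g' x\<bar> * \<bar>\<phi> x\<bar> <= \<bar>B\<bar> * \<bar>C\<bar>" "\<bar>g x\<bar> * \<bar>pd i \<phi> x\<bar> <= \<bar>B\<bar> * \<bar>D\<bar>"
				by (intro mult_mono; simp)+
			thus ?thesis unfolding h'_def by (intro order_trans[OF abs_triangle_ineq add_mono]) (simp_all add: abs_mult)
		qed (simp add: hz)
	qed
	hence "(LBINT x:S. g' x * \<phi> x + g x * pd i \<phi> x) = 0"
		by (simp only: sint_def ind[unfolded h'_def] h'_def)
	thus "(LBINT x:S. g x * pd i \<phi> x) = - (LBINT x:S. g' x * \<phi> x)"
		using set_integral_add(2)[OF i1 i2] by simp
qed

section \<open>Transport of fluxes along fans\<close>

text \<open>The trapezoidal function that vanishes outside $(c,d)$, equals one on $[c',d']$, and is affine in between.\<close>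
definition trap :: "real => real => real => real => real => real" where
	"trap c c' d' d t = max 0 (min 1 (min ((t - c) / (c' - c)) ((d - t) / (d - d'))))"

definition trap_deriv :: "real => real => real => real => real => real" where
	"trap_deriv c c' d' d t = (if c < t & t < c' then 1 / (c' - c) else if d' < t & t < d then - 1 / (d - d') else 0)"

locale trapezoid =
	fixes c c' d' d :: real
	assumes ord: "c < c'" "c' <= d'" "d' < d"
begin

lemma trap_left: "t <= c ==> trap c c' d' d t = 0"
proof -
	assume "t <= c"
	hence "(t - c) / (c' - c) <= 0" using ord by (intro divide_nonpos_pos) auto
	thus ?thesis unfolding trap_def by linarith
qed

lemma trap_right: "d <= t ==> trap c c' d' d t = 0"
proof -
	assume "d <= t"
	hence "(d - t) / (d - d') <= 0" using ord by (intro divide_nonpos_pos) auto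
	thus ?thesis unfolding trap_def by linarith
qed

lemma trap_up: "c <= t ==> t <= c' ==> trap c c' d' d t = (t - c) / (c' - c)"
proof -
	assume t: "c <= t" "t <= c'"
	have "0 <= (t - c) / (c' - c)" "(t - c) / (c' - c) <= 1" "1 <= (d - t) / (d - d')" using t ord by auto
	thus ?thesis unfolding trap_def by linarith
qed

lemma trap_mid: "c' <= t ==> t <= d' ==> trap c c' d' d t = 1"
proof -
	assume t: "c' <= t" "t <= d'"
	have "1 <= (t - c) / (c' - c)" "1 <= (d - t) / (d - d')" using t ord by auto
	thus ?thesis unfolding trap_def by linarith
qed

lemma trap_down: "d' <= t ==> t <= d ==> trap c c' d' d t = (d - t) / (d - d')"
proof -
	assume t: "d' <= t" "t <= d"
	have "0 <= (d - t) / (d - d')" "(d - t) / (d - d') <= 1" "1 <= (t - c) / (c' - c)" using t ord by auto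
	thus ?thesis unfolding trap_def by linarith
qed

lemma trap_bounds: "0 <= trap c c' d' d t" "trap c c' d' d t <= 1"
	unfolding trap_def by auto

lemma trap_isCont: "isCont (trap c c' d' d) t"
	unfolding trap_def[abs_def] by (intro continuous_intros) (use ord in auto)

lemma trap_measurable[measurable]: "trap c c' d' d \<in> borel_measurable borel"
	unfolding trap_def[abs_def] by measurable

lemma trap_deriv_measurable[measurable]: "trap_deriv c c' d' d \<in> borel_measurable borel"
	unfolding trap_deriv_def[abs_def] by measurable

lemma trap_deriv_bound: "\<bar>trap_deriv c c' d' d t\<bar> <= 1 / (c' - c) + 1 / (d - d')"
	using ord by (auto simp: trap_deriv_def)

lemma trap_cases:
	assumes "t \<notin> {c, c', d', d}"
	obtains "t < c" | "c < t" "t < c'" | "c' < t" "t < d'" | "d' < t" "t < d" | "d < t"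
	using assms by force

lemma trap_has_deriv:
	assumes t: "t \<notin> {c, c', d', d}"
	shows "DERIV (trap c c' d' d) t :> trap_deriv c c' d' d t"
proof -
	have ev: "DERIV (trap c c' d' d) t :> D"
		if "DERIV g t :> D" "l < t" "t < r" "!!s. l < s ==> s < r ==> trap c c' d' d s = g s" for g D l r
	proof -
		have "\<forall>\<^sub>F s in nhds t. s \<in> {l<..<r}" using that(2,3) by (intro eventually_nhds_in_open) auto
		hence "\<forall>\<^sub>F s in nhds t. trap c c' d' d s = g s" by eventually_elim (use that(4) in auto)
		from DERIV_cong_ev[OF refl this refl] that(1) show ?thesis by simp
	qed
	from t show ?thesis
	proof (cases rule: trap_cases)
		case 1
		show ?thesis by (rule ev[of "%_. 0" _ "t - 1" c]) (use 1 ord in "auto simp: trap_left trap_deriv_def")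
	next
		case 2
		show ?thesis
			by (rule ev[of "%s. (s - c) / (c' - c)" _ c c'])
				 (use 2 ord in "auto simp: trap_up trap_deriv_def intro!: derivative_eq_intros")
	next
		case 3
		show ?thesis by (rule ev[of "%_. 1" _ c' d']) (use 3 ord in "auto simp: trap_mid trap_deriv_def")
	next
		case 4
		have "((%s. (d - s) / (d - d')) has_real_derivative (0 - 1) / (d - d')) (at t)"
			by (intro DERIV_cdivide DERIV_diff DERIV_const DERIV_ident)
		thus ?thesis
			by (intro ev[of "%s. (d - s) / (d - d')" _ d' d])
				 (use 4 ord in "auto simp: trap_down trap_deriv_def")
	next
		case 5
		show ?thesis by (rule ev[of "%_. 0" _ d "t + 1"]) (use 5 ord in "auto simp: trap_right trap_deriv_def")
	qed
qed

lemma trap_deriv_isCont: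
	assumes t: "t \<notin> {c, c', d', d}"
	shows "isCont (trap_deriv c c' d' d) t"
proof -
	have ev: "isCont (trap_deriv c c' d' d) t"
		if "l < t" "t < r" "!!s. l < s ==> s < r ==> trap_deriv c c' d' d s = D" for D l r
	proof -
		have "\<forall>\<^sub>F s in nhds t. s \<in> {l<..<r}" using that(1,2) by (intro eventually_nhds_in_open) auto
		hence "\<forall>\<^sub>F s in nhds t. trap_deriv c c' d' d s = D" by eventually_elim (use that(3) in auto)
		from isCont_cong[OF this] show ?thesis by simp
	qed
	from t show ?thesis
	proof (cases rule: trap_cases)
		case 1
		show ?thesis by (rule ev[of "t - 1" c 0]) (use 1 ord in "auto simp: trap_deriv_def")
	next
		case 2
		show ?thesis by (rule ev[of c c' "1 / (c' - c)"]) (use 2 ord in "auto simp: trap_deriv_def")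
	next
		case 3
		show ?thesis by (rule ev[of c' d' 0]) (use 3 ord in "auto simp: trap_deriv_def")
	next
		case 4
		show ?thesis by (rule ev[of d' d "- 1 / (d - d')"]) (use 4 ord in "auto simp: trap_deriv_def")
	next
		case 5
		show ?thesis by (rule ev[of d "t + 1" 0]) (use 5 ord in "auto simp: trap_deriv_def")
	qed
qed

end

lemma measurable_fst_borel [measurable (raw)]:
	fixes f :: "'a => plane"
	shows "f \<in> borel_measurable M ==> (%x. fst (f x)) \<in> borel_measurable M"
	by (rule borel_measurable_continuous_on[OF continuous_on_fst[OF continuous_on_id]])

lemma measurable_snd_borel [measurable (raw)]:
	fixes f :: "'a => plane"
	shows "f \<in> borel_measurable M ==> (%x. snd (f x)) \<in> borel_measurable M"
	by (rule borel_measurable_continuous_on[OF continuous_on_snd[OF continuous_on_id]])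

definition bounded_fun :: "('a => real) => bool" where
	"bounded_fun f \<longleftrightarrow> (\<exists>B. \<forall>x. \<bar>f x\<bar> <= B)"

lemma bounded_funI: "(!!x. \<bar>f x\<bar> <= B) ==> bounded_fun f"
	by (auto simp: bounded_fun_def)

lemma bounded_fun_mult: "bounded_fun f ==> bounded_fun g ==> bounded_fun (%x. f x * g x)"
proof -
	assume "bounded_fun f" "bounded_fun g"
	then obtain B C where "!!x. \<bar>f x\<bar> <= B" "!!x. \<bar>g x\<bar> <= C" by (auto simp: bounded_fun_def)
	hence "\<bar>f x * g x\<bar> <= B * C" for x
		unfolding abs_mult by (intro mult_mono) (auto intro: order_trans[OF abs_ge_zero])
	thus ?thesis by (rule bounded_funI)
qed

lemma bounded_fun_add: "bounded_fun f ==> bounded_fun g ==> bounded_fun (%x. f x + g x)"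
proof -
	assume "bounded_fun f" "bounded_fun g"
	then obtain B C where "!!x. \<bar>f x\<bar> <= B" "!!x. \<bar>g x\<bar> <= C" by (auto simp: bounded_fun_def)
	hence "\<bar>f x + g x\<bar> <= B + C" for x by (intro order_trans[OF abs_triangle_ineq add_mono])
	thus ?thesis by (rule bounded_funI)
qed

lemma bounded_fun_comp: "bounded_fun f ==> bounded_fun (%x. f (q x))"
	by (auto simp: bounded_fun_def)

lemma AE_snd_finite: "finite T ==> AE x in (lborel :: (plane) measure). snd x \<notin> T"
proof -
	assume T: "finite T"
	have "AE x in (lborel :: (plane) measure). snd x ~= s" for s
	proof -
		have e: "{x::plane. snd x = s} = {x. x \<bullet> (0, 1) = s}" by auto
		have "negligible {x::plane. snd x = s}" unfolding e
			by (rule negligible_standard_hyperplane) (auto simp: Basis_prod_def)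
		hence "{x::plane. snd x = s} \<in> null_sets lebesgue" by (simp add: negligible_iff_null_sets)
		moreover have "closed {x::plane. snd x = s}" by (intro closed_Collect_eq continuous_intros)
		hence "{x::plane. snd x = s} \<in> sets borel" by (rule borel_closed)
		ultimately have "{x::plane. snd x = s} \<in> null_sets lborel"
			by (auto simp: null_sets_def)
		from AE_not_in[OF this] show ?thesis by simp
	qed
	hence "AE x in (lborel :: (plane) measure). \<forall>s\<in>T. snd x ~= s"
		using T by (simp add: AE_finite_all)
	thus ?thesis by eventually_elim auto
qed

lemma Ck_has_real_derivative: "Ck (Suc 0) f ==> DERIV f x :> pd 1 f x"
proof -
	assume f: "Ck (Suc 0) f"
	have "frechet_derivative f (at x) = (*) (pd 1 f x)"
	proof
		fix d
		have "frechet_derivative f (at x) d = (\<Sum>i\<in>Basis. (d \<bullet> i) * pd i f x)"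
			using f by (intro frechet_derivative_pd) simp
		thus "frechet_derivative f (at x) d = pd 1 f x * d" by simp
	qed
	with Ck_has_derivative[OF f, of x] show ?thesis by (simp add: has_field_derivative_def)
qed

text \<open>The field with components $G\eta\xi W'/W$ and $G\eta/W$, where $\eta$ is evaluated at $\xi=(x_1-p)/W(x_2)$,
	follows the fan $x_1 = p + \xi W(x_2)$ and has divergence $G'\eta/W$.\<close>
lemma fan_identity_compact:
	fixes W G \<eta> W' G' :: "real => real"
	assumes S: "open S" and u: "has_weak_pd S (1, 0) u u1" "has_weak_pd S (0, 1) u u2"
		and T: "finite T"
		and W: "!!t. isCont W t" "w0 > 0" "!!t. w0 <= W t"
			"!!t. t \<notin> T ==> DERIV W t :> W' t" "!!t. t \<notin> T ==> isCont W' t"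
			"bounded_fun W'" "W' \<in> borel_measurable borel"
		and G: "!!t. isCont G t" "!!t. t \<notin> T ==> DERIV G t :> G' t" "!!t. t \<notin> T ==> isCont G' t"
			"bounded_fun G" "bounded_fun G'" "G' \<in> borel_measurable borel"
			"!!t. t \<notin> {c..d} ==> G t = 0" "!!t. t \<notin> {c..d} ==> G' t = 0"
		and \<eta>: "\<eta> \<in> test_functions {0<..<1}"
		and sub: "!!\<xi> t. 0 < \<xi> ==> \<xi> < 1 ==> t \<in> {c..d} ==> (p + \<xi> * W t, t) \<in> S"
	defines "\<xi> \<equiv> %x. (fst x - p) / W (snd x)"
	shows "(LBINT x:S. u x * (G' (snd x) * \<eta> (\<xi> x) / W (snd x))) =
		 - (LBINT x:S. u1 x * (G (snd x) * (\<eta> (\<xi> x) * \<xi> x) * W' (snd x) / W (snd x))) - (LBINT x:S. u2 x * (G (snd x) * \<eta> (\<xi> x) / W (snd x)))"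
proof -
	obtain Kh B where Kh: "compact Kh" "Kh \<subseteq> {0<..<1}" "!!x. x \<notin> Kh ==> \<eta> x = 0" and B: "!!x. \<bar>\<eta> x\<bar> <= B"
		using test_function_bounded[OF \<eta>] by metis
	define \<eta>' where "\<eta>' = pd 1 \<eta>"
	have Cketa: "Ck k \<eta>" for k using \<eta> by (auto simp: test_functions_def)
	have etaz: "\<eta>' x = 0" if "x \<notin> Kh" for x unfolding \<eta>'_def
		by (rule pd_eq_0_outside[OF compact_imp_closed[OF Kh(1)] Kh(3) that])
	have Cketa': "Ck k \<eta>'" for k using Cketa[of "Suc k"] by (simp add: \<eta>'_def)
	have teta': "\<eta>' \<in> test_functions {0<..<1}" by (rule test_functionsI[OF Cketa' Kh(1,2) etaz])
	obtain B' where B': "!!x. \<bar>\<eta>' x\<bar> <= B'" using test_function_bounded[OF teta'] by metis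
	have deta: "DERIV \<eta> t :> \<eta>' t" for t
		unfolding \<eta>'_def by (rule Ck_has_real_derivative[OF Cketa])
	have ceta: "isCont \<eta> t" "isCont \<eta>' t" for t
		using Cketa[of 0] Cketa'[of 0] by (simp_all add: continuous_on_eq_continuous_at)
	have meta[measurable]: "\<eta> \<in> borel_measurable borel" "\<eta>' \<in> borel_measurable borel"
		using Ck_borel_measurable[OF Cketa] Ck_borel_measurable[OF Cketa'] by auto
	have mW[measurable]: "W \<in> borel_measurable borel" "G \<in> borel_measurable borel" "W' \<in> borel_measurable borel" "G' \<in> borel_measurable borel"
		using W(1,7) G(1,6) by (auto intro!: borel_measurable_continuous_onI continuous_at_imp_continuous_on)
	have Wnz: "W t ~= 0" for t using W(2) W(3)[of t] by auto
	define K where "K = (%z. (p + fst z * W (snd z), snd z)) ` (Kh \<times> {c..d})"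
	have Wsnd: "isCont (%z::plane. W (snd z)) z" for z
		using isCont_o2[OF isCont_snd[OF continuous_ident] W(1)] .
	have "isCont (%z. (p + fst z * W (snd z), snd z)) z" for z
		by (rule isCont_Pair[OF isCont_add[OF continuous_const isCont_mult[OF isCont_fst[OF continuous_ident] Wsnd]] isCont_snd[OF continuous_ident]])
	hence "continuous_on (Kh \<times> {c..d}) (%z. (p + fst z * W (snd z), snd z))"
		by (intro continuous_at_imp_continuous_on) blast
	from compact_continuous_image[OF this compact_Times[OF Kh(1) compact_Icc]]
	have K: "compact K" unfolding K_def .
	have KS: "K \<subseteq> S" using sub Kh(2) unfolding K_def by force
	have inK: "x \<in> K" if "\<xi> x \<in> Kh" "snd x \<in> {c..d}" for x
	proof -
		have "x = (%z. (p + fst z * W (snd z), snd z)) (\<xi> x, snd x)"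
			using Wnz by (simp add: \<xi>_def prod_eq_iff)
		moreover have "(\<xi> x, snd x) \<in> Kh \<times> {c..d}" using that by blast
		ultimately show ?thesis unfolding K_def by (rule image_eqI)
	qed
	define g2 where "g2 x = G (snd x) * \<eta> (\<xi> x) * inverse (W (snd x))" for x
	define g2' where "g2' x = G' (snd x) * \<eta> (\<xi> x) * inverse (W (snd x))
		 + (-1) * (G (snd x) * W' (snd x) * (inverse (W (snd x)) * inverse (W (snd x))) * (\<eta> (\<xi> x) + \<eta>' (\<xi> x) * \<xi> x))" for x
	define g1 where "g1 x = G (snd x) * (\<eta> (\<xi> x) * \<xi> x) * W' (snd x) * inverse (W (snd x))" for x
	define g1' where "g1' x = G (snd x) * W' (snd x) * (inverse (W (snd x)) * inverse (W (snd x))) * (\<eta> (\<xi> x) + \<eta>' (\<xi> x) * \<xi> x)" for x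
	have z: "G (snd x) * \<eta> (\<xi> x) = 0" "G' (snd x) * \<eta> (\<xi> x) = 0" "G (snd x) * \<eta>' (\<xi> x) = 0" if "x \<notin> K" for x
	proof -
		from that inK[of x] consider "\<xi> x \<notin> Kh" | "snd x \<notin> {c..d}" by blast
		hence "G (snd x) * \<eta> (\<xi> x) = 0 & G' (snd x) * \<eta> (\<xi> x) = 0 & G (snd x) * \<eta>' (\<xi> x) = 0"
			by cases (use Kh(3) etaz G(7,8) in simp_all)
		thus "G (snd x) * \<eta> (\<xi> x) = 0" "G' (snd x) * \<eta> (\<xi> x) = 0" "G (snd x) * \<eta>' (\<xi> x) = 0" by auto
	qed
	have z2: "g2 x = 0" "g2' x = 0" "g1 x = 0" "g1' x = 0" if "x \<notin> K" for x
		using z[OF that] by (auto simp: g2_def g2'_def g1_def g1'_def)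
	have bxi: "bounded_fun (%x. \<eta> (\<xi> x))" "bounded_fun (%x. \<eta>' (\<xi> x))"
		using B B' by (auto intro: bounded_funI)
	have bW: "bounded_fun (%x::plane. inverse (W (snd x)))"
	proof (rule bounded_funI)
		fix x :: "plane"
		have "0 < W (snd x)" using W(2) W(3)[of "snd x"] by linarith
		thus "\<bar>inverse (W (snd x))\<bar> <= inverse w0"
			using le_imp_inverse_le[OF W(3)[of "snd x"] W(2)] by simp
	qed
	have bx: "bounded_fun (%x. \<eta> (\<xi> x) * \<xi> x)" "bounded_fun (%x. \<eta>' (\<xi> x) * \<xi> x)"
	proof -
		have "\<bar>\<eta> y * y\<bar> <= B" for y
		proof (cases "y \<in> Kh")
			case True
			hence "\<bar>\<eta> y\<bar> * \<bar>y\<bar> <= B * 1" using Kh(2) B[of y] by (intro mult_mono) (auto intro: order_trans[OF abs_ge_zero])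
			thus ?thesis by (simp add: abs_mult)
		qed (use Kh(3) B[of y] in auto)
		thus "bounded_fun (%x. \<eta> (\<xi> x) * \<xi> x)" by (rule bounded_funI)
		have "\<bar>\<eta>' y * y\<bar> <= B'" for y
		proof (cases "y \<in> Kh")
			case True
			hence "\<bar>\<eta>' y\<bar> * \<bar>y\<bar> <= B' * 1" using Kh(2) B'[of y] by (intro mult_mono) (auto intro: order_trans[OF abs_ge_zero])
			thus ?thesis by (simp add: abs_mult)
		qed (use etaz B'[of y] in auto)
		thus "bounded_fun (%x. \<eta>' (\<xi> x) * \<xi> x)" by (rule bounded_funI)
	qed
	have bG: "bounded_fun (%x::plane. G (snd x))" "bounded_fun (%x::plane. G' (snd x))" "bounded_fun (%x::plane. W' (snd x))"
		using W(6) G(4,5) by (auto intro: bounded_fun_comp)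
	note bnds = bxi bW bx bG
	have b: "bounded_fun g2" "bounded_fun g2'" "bounded_fun g1" "bounded_fun g1'"
		unfolding g2_def[abs_def] g2'_def[abs_def] g1_def[abs_def] g1'_def[abs_def]
		by (intro bounded_fun_mult[of "%_. -1"] bounded_fun_mult bounded_fun_add bnds; auto intro: bounded_funI[of _ 1])+
	have mxi[measurable]: "\<xi> \<in> borel_measurable borel" unfolding \<xi>_def[abs_def] by measurable
	have m: "g2 \<in> borel_measurable borel" "g2' \<in> borel_measurable borel" "g1 \<in> borel_measurable borel" "g1' \<in> borel_measurable borel"
		unfolding g2_def[abs_def] g2'_def[abs_def] g1_def[abs_def] g1'_def[abs_def] by measurable
	have cont: "isCont g2 x & isCont g2' x & isCont g1 x & isCont g1' x" if "snd x \<notin> T" for x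
	proof -
		have cs: "isCont (%x. F (snd x)) x" if "isCont F (snd x)" for F :: "real => real"
			using isCont_o2[OF isCont_snd[OF continuous_ident] that] .
		have cxi: "isCont \<xi> x" unfolding \<xi>_def[abs_def] by (intro continuous_intros cs W(1)) (use Wnz in auto)
		have ce: "isCont (%x. \<eta> (\<xi> x)) x" "isCont (%x. \<eta>' (\<xi> x)) x"
			using isCont_o2[OF cxi ceta(1)] isCont_o2[OF cxi ceta(2)] by auto
		show ?thesis unfolding g2_def[abs_def] g2'_def[abs_def] g1_def[abs_def] g1'_def[abs_def]
			by (intro conjI continuous_intros cs ce cxi W(1) G(1) W(5)[OF that] G(3)[OF that]) (use Wnz in auto)
	qed
	have ae: "AE x in lborel. isCont g2 x" "AE x in lborel. isCont g2' x" "AE x in lborel. isCont g1 x" "AE x in lborel. isCont g1' x"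
		using AE_snd_finite[OF T] cont by (auto elim!: eventually_mono)
	have s1: "slicewise UNIV (1, 0) g1 g1'"
		unfolding slicewise_def
	proof (intro conjI allI impI)
		fix x :: "plane" and t :: real
		define y where "y = snd x"
		have xi: "\<xi> (x + s *R (1, 0)) = (fst x + s - p) / W y" "snd (x + s *R (1,0)) = y" for s by (auto simp: \<xi>_def y_def)
		have d1: "((%s. (fst x + s - p) / W y) has_real_derivative 1 / W y) (at t)" for t
			by (rule DERIV_cdivide) (auto intro!: derivative_eq_intros)
		have d2: "((%s. \<eta> ((fst x + s - p) / W y)) has_real_derivative \<eta>' ((fst x + t - p) / W y) * (1 / W y)) (at t)" for t
			by (rule DERIV_chain2[OF deta d1])
		have d: "((%s. g1 (x + s *R (1, 0))) has_real_derivative g1' (x + t *R (1,0))) (at t)" for t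
			unfolding g1_def g1'_def xi
			by (rule derivative_eq_intros d1 d2 refl)+ (simp add: divide_inverse algebra_simps)
		show "isCont (%s. g1 (x + s *R (1, 0))) t" using d by (rule DERIV_isCont)
		show "\<exists>T. finite T & (\<forall>t. t \<notin> T --> x + t *R (1, 0) \<in> UNIV --> ((%s. g1 (x + s *R (1, 0))) has_real_derivative g1' (x + t *R (1,0))) (at t))"
			using d by (intro exI[of _ "{}"]) auto
	qed
	have s2: "slicewise UNIV (0, 1) g2 g2'"
		unfolding slicewise_def
	proof (intro conjI allI impI)
		fix x :: "plane" and t :: real
		define y where "y = snd x"
		have xi: "\<xi> (x + s *R (0, 1)) = (fst x - p) / W (y + s)" "snd (x + s *R (0,1)) = y + s" for s by (auto simp: \<xi>_def y_def)
		have sh: "isCont (%s. F (y + s)) t" if "isCont F (y + t)" for F :: "real => real" and t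
			using that by (intro isCont_o2[where f="%s. y + s" and g=F] continuous_intros)
		have c1: "isCont (%s. (fst x - p) / W (y + s)) t"
			by (intro continuous_intros sh W(1)) (use Wnz in auto)
		have c2: "isCont (%s. \<eta> ((fst x - p) / W (y + s))) t" by (rule isCont_o2[OF c1 ceta(1)])
		show "isCont (%s. g2 (x + s *R (0, 1))) t"
			unfolding g2_def xi by (intro continuous_intros c2 sh W(1) G(1)) (use Wnz in auto)
		have d: "((%s. g2 (x + s *R (0, 1))) has_real_derivative g2' (x + t *R (0, 1))) (at t)" if "y + t \<notin> T" for t
		proof -
			have dy: "DERIV ((%s. y + s)) t :> 1" by (auto intro!: derivative_eq_intros)
			have dW: "((%s. W (y + s)) has_real_derivative W' (y + t)) (at t)"
				using DERIV_chain2[where f=W and g="%s. y + s" and x=t and s=UNIV, OF W(4)[OF that] dy] by simp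
			have dG: "((%s. G (y + s)) has_real_derivative G' (y + t)) (at t)"
				using DERIV_chain2[where f=G and g="%s. y + s" and x=t and s=UNIV, OF G(2)[OF that] dy] by simp
			have d1: "((%s. inverse (W (y + s))) has_real_derivative - (inverse (W (y + t)) * W' (y + t) * inverse (W (y + t)))) (at t)"
				by (rule DERIV_inverse'[OF dW Wnz])
			have d2: "((%s. (fst x - p) / W (y + s)) has_real_derivative (fst x - p) * - (inverse (W (y + t)) * W' (y + t) * inverse (W (y + t)))) (at t)"
				using DERIV_cmult[OF d1, of "fst x - p"] by (simp add: divide_inverse)
			have d3: "((%s. \<eta> ((fst x - p) / W (y + s))) has_real_derivative
					\<eta>' ((fst x - p) / W (y + t)) * ((fst x - p) * - (inverse (W (y + t)) * W' (y + t) * inverse (W (y + t))))) (at t)"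
				by (rule DERIV_chain2[OF deta d2])
			show ?thesis unfolding g2_def g2'_def xi
				by (rule derivative_eq_intros dG d1 d3 refl)+ (simp add: divide_inverse algebra_simps)
		qed
		have "finite ((%s. s - y) ` T)" using T by simp
		moreover have "y + t \<notin> T" if "t \<notin> (%s. s - y) ` T" for t using that by force
		ultimately show "\<exists>T. finite T & (\<forall>t. t \<notin> T --> x + t *R (0, 1) \<in> UNIV --> ((%s. g2 (x + s *R (0, 1))) has_real_derivative g2' (x + t *R (0,1))) (at t))"
			using d by (intro exI[of _ "(%s. s - y) ` T"]) auto
	qed
	obtain B1 where B1: "!!x. \<bar>g1 x\<bar> <= B1" "!!x. \<bar>g1' x\<bar> <= B1"
		using b(3,4) unfolding bounded_fun_def by (metis max.coboundedI1 max.coboundedI2)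
	obtain B2 where B2: "!!x. \<bar>g2 x\<bar> <= B2" "!!x. \<bar>g2' x\<bar> <= B2"
		using b(1,2) unfolding bounded_fun_def by (metis max.coboundedI1 max.coboundedI2)
	have I1: "(LBINT x:S. u x * g1' x) = - (LBINT x:S. u1 x * g1 x)"
		by (rule weak_ibp_slices[OF S u(1) _ K KS m(3,4) z2(3,4) B1 ae(3,4) s1]) auto
	have I2: "(LBINT x:S. u x * g2' x) = - (LBINT x:S. u2 x * g2 x)"
		by (rule weak_ibp_slices[OF S u(2) _ K KS m(1,2) z2(1,2) B2 ae(1,2) s2]) auto
	have Km: "K \<in> sets lborel" using K by (simp add: borel_compact)
	have uK: "integrable lborel (%x. indicator K x * u x)" using u(1) K KS by (auto simp: has_weak_pd_def L1loc_def set_integrable_def)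
	have int: "lint S (%x. u x * h x)"
		if h: "h \<in> borel_measurable borel" "bounded_fun h" "!!x. x \<notin> K ==> h x = 0" for h
	proof -
		obtain C where "!!x. \<bar>h x\<bar> <= C" using h(2) unfolding bounded_fun_def by blast
		hence "integrable lborel (%x. (indicator K x * u x) * h x)"
			using that(1) by (intro integrable_mult_bounded[OF uK]) auto
		moreover have "(indicator K x * u x) * h x = indicator S x *R (u x * h x)" for x
			using that(3)[of x] KS by (cases "x \<in> K") auto
		ultimately show ?thesis by (simp add: set_integrable_def)
	qed
	have "(LBINT x:S. u x * (g1' x + g2' x)) = (LBINT x:S. u x * g1' x) + (LBINT x:S. u x * g2' x)"
		unfolding distrib_left using int m b z2 by (intro set_integral_add(2)) auto
	moreover have "g1' x + g2' x = G' (snd x) * \<eta> (\<xi> x) / W (snd x)" for x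
		by (simp add: g1'_def g2'_def divide_inverse)
	moreover have "g2 x = G (snd x) * \<eta> (\<xi> x) / W (snd x)" for x by (simp add: g2_def divide_inverse)
	moreover have "g1 x = G (snd x) * (\<eta> (\<xi> x) * \<xi> x) * W' (snd x) / W (snd x)" for x by (simp add: g1_def divide_inverse)
	ultimately show ?thesis using I1 I2 by simp
qed

text \<open>The conservation law along a fan, for a profile that need not vanish at the sides of the fan: it is the limit of compactly supported profiles, as the field is tangent to the sides.\<close>
lemma fan_identity:
	fixes W \<Psi> W' :: "real => real" and p :: real
	assumes tz: "trapezoid c c' d' d" and S: "open S" and u: "has_weak_pd S (1, 0) u u1" "has_weak_pd S (0, 1) u u2"
		and T: "finite T"
		and W: "!!t. isCont W t" "w0 > 0" "!!t. w0 <= W t"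
			"!!t. t \<notin> T ==> DERIV W t :> W' t" "!!t. t \<notin> T ==> isCont W' t"
			"bounded_fun W'" "W' \<in> borel_measurable borel"
		and \<Psi>: "continuous_on {0<..<1} \<Psi>" "!!s. s \<in> {0<..<1} ==> \<bar>\<Psi> s\<bar> <= M"
	defines "\<xi> \<equiv> %x. (fst x - p) / W (snd x)"
	defines "D \<equiv> {x. c < snd x & snd x < d & 0 < \<xi> x & \<xi> x < 1}"
	assumes DS: "D \<subseteq> S"
		and int: "lint D u" "lint D u1" "lint D u2"
	shows "(LBINT x:D. u x * (trap_deriv c c' d' d (snd x) * \<Psi> (\<xi> x) / W (snd x))) =
		 - (LBINT x:D. u1 x * (trap c c' d' d (snd x) * (\<Psi> (\<xi> x) * \<xi> x) * W' (snd x) / W (snd x)))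
		 - (LBINT x:D. u2 x * (trap c c' d' d (snd x) * \<Psi> (\<xi> x) / W (snd x)))"
proof -
	interpret trapezoid c c' d' d by (rule tz)
	have M0: "M \<ge> 0" using \<Psi>(2)[of "1/2"] by (auto intro: order_trans[OF abs_ge_zero])
	obtain \<eta> where \<eta>: "!!n::nat. \<eta> n \<in> test_functions {0<..<1}" "!!n x. \<bar>\<eta> n x\<bar> <= M"
		"!!x. x \<in> {0<..<1} ==> (%n. \<eta> n x) -->> \<Psi> x"
		using test_dense_interval[OF \<Psi> M0] by metis
	have m\<eta>[measurable]: "\<eta> n \<in> borel_measurable borel" for n using test_function_measurable[OF \<eta>(1)] .
	have mW[measurable]: "W \<in> borel_measurable borel" "W' \<in> borel_measurable borel"
		using W(1,7) by (auto intro!: borel_measurable_continuous_onI continuous_at_imp_continuous_on)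
	have m\<xi>[measurable]: "\<xi> \<in> borel_measurable borel" unfolding \<xi>_def[abs_def] by measurable
	define \<Psi>0 where "\<Psi>0 s = indicator {0<..<1} s *R \<Psi> s" for s
	have m\<Psi>[measurable]: "\<Psi>0 \<in> borel_measurable borel" unfolding \<Psi>0_def[abs_def]
		by (rule borel_measurable_continuous_on_indicator[OF _ \<Psi>(1)]) simp
	have Dm[measurable]: "D \<in> sets lborel" unfolding D_def by measurable
	have Wpos: "W t > 0" for t using W(2) W(3)[of t] by linarith
	have Wnz: "W t ~= 0" for t using Wpos[of t] by simp
	have Winv: "inverse (W t) <= inverse w0" "0 <= inverse (W t)" for t
		using le_imp_inverse_le[OF W(3)[of t] W(2)] Wpos[of t] by auto
	define l where "l = min (c' - c) (d - d')"
	have l: "l > 0" "l <= c' - c" "l <= d - d'" using ord by (auto simp: l_def)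
	define \<kappa> where "\<kappa> n = l / (real n + 2)" for n :: nat
	have \<kappa>: "\<kappa> n > 0" "\<kappa> n <= l / 2" for n unfolding \<kappa>_def using l(1) by (simp, intro divide_left_mono) auto
	have \<kappa>0: "\<kappa> -->> 0"
	proof -
		have "(%n. l * inverse (real (Suc (Suc n)))) -->> l * 0"
			by (intro tendsto_mult tendsto_const LIMSEQ_Suc[OF LIMSEQ_inverse_real_of_nat])
		thus ?thesis by (simp add: \<kappa>_def[abs_def] divide_inverse add.commute)
	qed
	define g where "g n = trap (c + \<kappa> n) c' d' (d - \<kappa> n)" for n
	define g' where "g' n = trap_deriv (c + \<kappa> n) c' d' (d - \<kappa> n)" for n
	have tzn: "trapezoid (c + \<kappa> n) c' d' (d - \<kappa> n)" for n
		using \<kappa>[of n] l ord by unfold_locales linarith+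
	define B where "B = 2 / (c' - c) + 2 / (d - d')"
	have g'B: "\<bar>g' n t\<bar> <= B" for n t
	proof -
		have "1 / (c' - (c + \<kappa> n)) <= 1 / ((c' - c) / 2)" "1 / ((d - \<kappa> n) - d') <= 1 / ((d - d') / 2)"
			using \<kappa>[of n] l ord by (auto intro!: frac_le simp del: divide_divide_eq_right)
		thus ?thesis
			using trapezoid.trap_deriv_bound[OF tzn[of n], of t] unfolding g'_def B_def by simp
	qed
	have glim: "(%n. g n t) -->> trap c c' d' d t" for t
	proof -
		have "(%n. max 0 (min 1 (min ((t - (c + \<kappa> n)) / (c' - (c + \<kappa> n))) ((d - \<kappa> n - t) / (d - \<kappa> n - d')))))
			-->> max 0 (min 1 (min ((t - (c + 0)) / (c' - (c + 0))) ((d - 0 - t) / (d - 0 - d'))))"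
			by (intro tendsto_intros \<kappa>0) (use ord in auto)
		thus ?thesis by (simp add: g_def trap_def)
	qed
	have g'lim: "(%n. g' n t) -->> trap_deriv c c' d' d t" if t: "c < t" "t < d" for t
	proof -
		have k: "(%n. c + \<kappa> n) -->> c" "(%n. d - \<kappa> n) -->> d"
			using tendsto_add[OF tendsto_const \<kappa>0, of c] tendsto_diff[OF tendsto_const \<kappa>0, of d] by auto
		have 1: "(%n. if t < c' then 1 / (c' - (c + \<kappa> n)) else if d' < t then - 1 / (d - \<kappa> n - d') else 0)
			-->> (if t < c' then 1 / (c' - (c + 0)) else if d' < t then - 1 / (d - 0 - d') else 0)"
			using ord by (auto intro!: tendsto_intros k)
		have "\<forall>\<^sub>F n in sequentially. \<kappa> n < t - c" "\<forall>\<^sub>F n in sequentially. \<kappa> n < d - t"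
			using t by (auto intro!: order_tendstoD(2)[OF \<kappa>0])
		hence "\<forall>\<^sub>F n in sequentially. (if t < c' then 1 / (c' - (c + \<kappa> n)) else if d' < t then - 1 / (d - \<kappa> n - d') else 0) = g' n t"
			by eventually_elim (auto simp: g'_def trap_deriv_def)
		from Lim_transform_eventually[OF 1 this]
		have "(%n. g' n t) -->> (if t < c' then 1 / (c' - (c + 0)) else if d' < t then - 1 / (d - 0 - d') else 0)" .
		moreover have "trap_deriv c c' d' d t = (if t < c' then 1 / (c' - (c + 0)) else if d' < t then - 1 / (d - 0 - d') else 0)"
			using t by (auto simp: trap_deriv_def)
		ultimately show ?thesis by (simp only:)
	qed
	have subD: "(p + s * W t, t) \<in> D" if "0 < s" "s < 1" "t \<in> {c + \<kappa> n .. d - \<kappa> n}" for s t n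
		using that \<kappa>(1)[of n] Wpos[of t] unfolding D_def \<xi>_def by auto
	have out: "g n (snd x) * \<eta> n (\<xi> x) = 0" "g' n (snd x) * \<eta> n (\<xi> x) = 0" if "x \<notin> D" for x n
	proof -
		have h: "\<eta> n s = 0" if "s \<notin> {0<..<1}" for s using \<eta>(1)[of n] that by (auto simp: test_functions_def)
		have "g n (snd x) = 0" "g' n (snd x) = 0" if "snd x \<notin> {c + \<kappa> n <..< d - \<kappa> n}"
			using that trapezoid.trap_left[OF tzn[of n], of "snd x"] trapezoid.trap_right[OF tzn[of n], of "snd x"] trapezoid.ord[OF tzn[of n]]
			by (auto simp: g_def g'_def trap_deriv_def not_less)
		moreover have "snd x \<in> {c + \<kappa> n <..< d - \<kappa> n} ==> \<xi> x \<notin> {0<..<1}"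
			using that \<kappa>(1)[of n] unfolding D_def by auto
		ultimately show "g n (snd x) * \<eta> n (\<xi> x) = 0" "g' n (snd x) * \<eta> n (\<xi> x) = 0" using h by fastforce+
	qed
	have eqn: "(LBINT x:S. u x * (g' n (snd x) * \<eta> n (\<xi> x) / W (snd x))) =
		 - (LBINT x:S. u1 x * (g n (snd x) * (\<eta> n (\<xi> x) * \<xi> x) * W' (snd x) / W (snd x))) - (LBINT x:S. u2 x * (g n (snd x) * \<eta> n (\<xi> x) / W (snd x)))" for n
		unfolding \<xi>_def
	proof (rule fan_identity_compact[OF S u, of "T \<union> {c + \<kappa> n, c', d', d - \<kappa> n}" W w0 W' _ _ "c + \<kappa> n" "d - \<kappa> n"])
		show "\<eta> n \<in> test_functions {0<..<1}" by (rule \<eta>(1))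
		show "(p + s * W t, t) \<in> S" if "0 < s" "s < 1" "t \<in> {c + \<kappa> n..d - \<kappa> n}" for s t using subD[OF that] DS by blast
		show "isCont (g n) t" for t unfolding g_def by (rule trapezoid.trap_isCont[OF tzn])
		show "DERIV (g n) t :> g' n t" if "t \<notin> T \<union> {c + \<kappa> n, c', d', d - \<kappa> n}" for t
			unfolding g_def g'_def by (rule trapezoid.trap_has_deriv[OF tzn]) (use that in auto)
		show "isCont (g' n) t" if "t \<notin> T \<union> {c + \<kappa> n, c', d', d - \<kappa> n}" for t
			unfolding g_def g'_def by (rule trapezoid.trap_deriv_isCont[OF tzn]) (use that in auto)
		show "bounded_fun (g n)" by (rule bounded_funI[of _ 1]) (use trapezoid.trap_bounds[OF tzn] in "auto simp: g_def abs_le_iff intro: order_trans[of _ 0]")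
		show "bounded_fun (g' n)" by (rule bounded_funI[OF g'B])
		show "g' n \<in> borel_measurable borel" unfolding g'_def by (rule trapezoid.trap_deriv_measurable[OF tzn])
		show "g n t = 0" "g' n t = 0" if "t \<notin> {c + \<kappa> n..d - \<kappa> n}" for t
			using that trapezoid.trap_left[OF tzn[of n], of t] trapezoid.trap_right[OF tzn[of n], of t] trapezoid.ord[OF tzn[of n]]
			by (auto simp: g_def g'_def trap_deriv_def)
	qed (use T W in auto)
	have mg[measurable]: "g n \<in> borel_measurable borel" "g' n \<in> borel_measurable borel" for n
		unfolding g_def g'_def by (rule trapezoid.trap_measurable[OF tzn] trapezoid.trap_deriv_measurable[OF tzn])+
	have gb: "\<bar>g n t\<bar> <= 1" for n t using trapezoid.trap_bounds[OF tzn[of n], of t] by (simp add: g_def)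
	have B0: "B \<ge> 0" using ord by (simp add: B_def)
	obtain w2 where w2: "!!t. \<bar>W' t\<bar> <= w2" using W(6) by (auto simp: bounded_fun_def)
	have w20: "w2 \<ge> 0" using w2[of 0] by (auto intro: order_trans[OF abs_ge_zero])
	have Wi: "\<bar>inverse (W t)\<bar> <= inverse w0" for t using Winv by simp
	have L0: "(%n. LBINT x:D. u x * (g' n (snd x) * \<eta> n (\<xi> x) / W (snd x))) -->>
		 (LBINT x:D. u x * (trap_deriv c c' d' d (snd x) * \<Psi>0 (\<xi> x) / W (snd x)))"
	proof (rule set_integral_tendsto_bounded[OF int(1) _ Dm, where B="B * M * inverse w0"])
		show "\<bar>g' n (snd x) * \<eta> n (\<xi> x) / W (snd x)\<bar> <= B * M * inverse w0" for n x
			unfolding divide_inverse abs_mult using g'B \<eta>(2) Wi B0 M0 W(2) by (intro mult_mono) auto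
		show "AE x in lborel. x \<in> D --> (%n. g' n (snd x) * \<eta> n (\<xi> x) / W (snd x)) -->> trap_deriv c c' d' d (snd x) * \<Psi>0 (\<xi> x) / W (snd x)"
			using Wpos Wnz by (intro AE_I2 impI tendsto_intros g'lim) (auto simp: D_def \<Psi>0_def \<eta>(3))
	qed measurable
	have L2: "(%n. LBINT x:D. u2 x * (g n (snd x) * \<eta> n (\<xi> x) / W (snd x))) -->>
		 (LBINT x:D. u2 x * (trap c c' d' d (snd x) * \<Psi>0 (\<xi> x) / W (snd x)))"
	proof (rule set_integral_tendsto_bounded[OF int(3) _ Dm, where B="1 * M * inverse w0"])
		show "\<bar>g n (snd x) * \<eta> n (\<xi> x) / W (snd x)\<bar> <= 1 * M * inverse w0" for n x
			unfolding divide_inverse abs_mult using gb \<eta>(2) Wi M0 W(2) by (intro mult_mono) auto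
		show "AE x in lborel. x \<in> D --> (%n. g n (snd x) * \<eta> n (\<xi> x) / W (snd x)) -->> trap c c' d' d (snd x) * \<Psi>0 (\<xi> x) / W (snd x)"
			using Wpos Wnz by (intro AE_I2 impI tendsto_intros glim) (auto simp: D_def \<Psi>0_def \<eta>(3))
	qed measurable
	have L1: "(%n. LBINT x:D. u1 x * (g n (snd x) * (\<eta> n (\<xi> x) * \<xi> x) * W' (snd x) / W (snd x))) -->>
		 (LBINT x:D. u1 x * (trap c c' d' d (snd x) * (\<Psi>0 (\<xi> x) * \<xi> x) * W' (snd x) / W (snd x)))"
	proof (rule set_integral_tendsto_bounded[OF int(2) _ Dm, where B="1 * (M * 1) * w2 * inverse w0"])
		show "\<bar>g n (snd x) * (\<eta> n (\<xi> x) * \<xi> x) * W' (snd x) / W (snd x)\<bar> <= 1 * (M * 1) * w2 * inverse w0" if "x \<in> D" for n x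
		proof -
			have "\<bar>\<xi> x\<bar> <= 1" using that by (auto simp: D_def)
			thus ?thesis
				unfolding divide_inverse abs_mult using gb \<eta>(2) Wi w2 w20 M0 W(2) by (intro mult_mono) auto
		qed
		show "AE x in lborel. x \<in> D --> (%n. g n (snd x) * (\<eta> n (\<xi> x) * \<xi> x) * W' (snd x) / W (snd x)) -->> trap c c' d' d (snd x) * (\<Psi>0 (\<xi> x) * \<xi> x) * W' (snd x) / W (snd x)"
			using Wpos Wnz by (intro AE_I2 impI tendsto_intros glim) (auto simp: D_def \<Psi>0_def \<eta>(3))
	qed measurable
	have toD: "(LBINT x:S. f x * h x) = (LBINT x:D. f x * h x)" if "!!x. x \<notin> D ==> h x = 0" for f h :: "plane => real"
		by (rule set_integral_mult_support[OF DS that])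
	have eqD: "(LBINT x:D. u x * (g' n (snd x) * \<eta> n (\<xi> x) / W (snd x))) =
		 - (LBINT x:D. u1 x * (g n (snd x) * (\<eta> n (\<xi> x) * \<xi> x) * W' (snd x) / W (snd x))) - (LBINT x:D. u2 x * (g n (snd x) * \<eta> n (\<xi> x) / W (snd x)))" for n
		using eqn[of n]
		by (subst (asm) toD, use out in simp, subst (asm) toD, use out in fastforce, subst (asm) toD, use out in simp, simp)
	have "(LBINT x:D. u x * (trap_deriv c c' d' d (snd x) * \<Psi>0 (\<xi> x) / W (snd x))) =
		 - (LBINT x:D. u1 x * (trap c c' d' d (snd x) * (\<Psi>0 (\<xi> x) * \<xi> x) * W' (snd x) / W (snd x)))
		 - (LBINT x:D. u2 x * (trap c c' d' d (snd x) * \<Psi>0 (\<xi> x) / W (snd x)))"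
		by (rule LIMSEQ_unique[OF L0]) (unfold eqD, intro tendsto_intros L1 L2)
	moreover have "\<Psi>0 (\<xi> x) = \<Psi> (\<xi> x)" if "x \<in> D" for x using that by (auto simp: \<Psi>0_def D_def)
	ultimately show ?thesis by (simp cong: set_integral_cong_simple)
qed

section \<open>Square integrable functions and Sobolev spaces\<close>

lemma integrable_bound_pointwise:
	fixes f g :: "'a => real"
	assumes "integrable M f" "g \<in> borel_measurable M" "!!x. norm (g x) <= norm (f x)"
	shows "integrable M g"
	by (rule Bochner_Integration.integrable_bound[OF assms(1,2) AE_I2]) (rule assms(3))

lemma Cauchy_Schwarz_integral:
	fixes f g :: "'a => real"
	assumes f: "integrable M (%x. (f x)^2)" and g: "integrable M (%x. (g x)^2)" and fg: "integrable M (%x. f x * g x)"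
	shows "(\<integral>x. f x * g x \<partial>M)^2 <= (\<integral>x. (f x)^2 \<partial>M) * (\<integral>x. (g x)^2 \<partial>M)"
proof -
	define A where "A = (\<integral>x. (f x)^2 \<partial>M)"
	define B where "B = (\<integral>x. f x * g x \<partial>M)"
	define C where "C = (\<integral>x. (g x)^2 \<partial>M)"
	have q: "0 <= s^2 * A + 2 * (s * r * B) + r^2 * C" for s r
	proof -
		have "0 <= (\<integral>x. (s * f x + r * g x)^2 \<partial>M)" by simp
		also have "(%x. (s * f x + r * g x)^2) = (%x. s^2 * (f x)^2 + 2 * (s * r * (f x * g x)) + r^2 * (g x)^2)"
			by (simp add: power2_eq_square algebra_simps)
		also have "(\<integral>x. s^2 * (f x)^2 + 2 * (s * r * (f x * g x)) + r^2 * (g x)^2 \<partial>M) = s^2 * A + 2 * (s * r * B) + r^2 * C"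
			using f g fg by (simp add: A_def B_def C_def)
		finally show ?thesis .
	qed
	have A0: "0 <= A" "0 <= C" by (auto simp: A_def C_def)
	have "B^2 <= A * C"
	proof (cases "A = 0")
		case True
		have "B = 0"
		proof (rule ccontr)
			assume B: "B ~= 0"
			from q[of "- (C + 1) / (2 * B)" 1] True B have "0 <= - (C + 1) + C" by (simp add: field_simps)
			thus False by simp
		qed
		thus ?thesis using True by simp
	next
		case False
		hence A: "A > 0" using A0 by simp
		have "0 <= A * (A * C - B^2)" using q[of "- B" A] by (simp add: power2_eq_square algebra_simps)
		thus ?thesis using A by (simp add: zero_le_mult_iff)
	qed
	thus ?thesis by (simp add: A_def B_def C_def)
qed

lemma integrable_mult_L2:
	fixes f g :: "'a => real"
	assumes "integrable M (%x. (f x)^2)" "integrable M (%x. (g x)^2)" "f \<in> borel_measurable M" "g \<in> borel_measurable M"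
	shows "integrable M (%x. f x * g x)"
proof (rule Bochner_Integration.integrable_bound[of _ "%x. (f x)^2 + (g x)^2"])
	show "AE x in M. norm (f x * g x) <= norm ((f x)^2 + (g x)^2)"
	proof (rule AE_I2)
		fix x
		have "0 <= (\<bar>f x\<bar> - \<bar>g x\<bar>)^2" by simp
		hence "2 * (\<bar>f x\<bar> * \<bar>g x\<bar>) <= (f x)^2 + (g x)^2" by (simp add: power2_eq_square algebra_simps)
		moreover have "0 <= \<bar>f x\<bar> * \<bar>g x\<bar>" by simp
		ultimately have "\<bar>f x\<bar> * \<bar>g x\<bar> <= (f x)^2 + (g x)^2" by linarith
		thus "norm (f x * g x) <= norm ((f x)^2 + (g x)^2)" by (simp add: abs_mult)
	qed
qed (use assms in auto)

subsection \<open>Membership in Lebesgue spaces\<close>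

lemma Lp2_square: "u \<in> Lp 2 S \<longleftrightarrow> lmeas S u & lint S (%x. (u x)^2)"
	by (simp add: Lp_def)

lemma Lp1_iff: "u \<in> Lp 1 S \<longleftrightarrow> lint S u"
	unfolding Lp_def smeas_def set_integrable_def
proof (safe)
	assume "(%x. indicator S x *R u x) \<in> borel_measurable lborel" "integrable lborel (%x. indicator S x *R \<bar>u x\<bar> ^ 1)"
	thus "integrable lborel (%x. indicator S x *R u x)"
		using Bochner_Integration.integrable_bound[of lborel "%x. indicator S x *R \<bar>u x\<bar> ^ 1" "%x. indicator S x *R u x"]
		by (auto simp: indicator_def)
next
	assume i: "integrable lborel (%x. indicator S x *R u x)"
	thus "(%x. indicator S x *R u x) \<in> borel_measurable lborel" by simp
	have "(%x. indicator S x *R \<bar>u x\<bar> ^ 1) = (%x. \<bar>indicator S x *R u x\<bar>)" by (auto simp: abs_mult)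
	thus "integrable lborel (%x. indicator S x *R \<bar>u x\<bar> ^ 1)" using i by simp
qed

lemma Lp2_indicator:
	assumes "u \<in> Lp 2 S"
	shows "(%x. indicator S x * u x) \<in> borel_measurable lborel" "integrable lborel (%x. (indicator S x * u x)^2)"
proof -
	show "(%x. indicator S x * u x) \<in> borel_measurable lborel" using assms by (simp add: Lp_def smeas_def)
	have "(%x. (indicator S x * u x)^2) = (%x. indicator S x *R (u x)^2)" by (auto simp: indicator_def)
	thus "integrable lborel (%x. (indicator S x * u x)^2)" using assms by (simp add: Lp2_square set_integrable_def)
qed

lemma Lp2_mult_integrable:
	assumes "u \<in> Lp 2 S" "g \<in> Lp 2 S"
	shows "lint S (%x. u x * g x)"
proof -
	have "integrable lborel (%x. (indicator S x * u x) * (indicator S x * g x))"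
		by (rule integrable_mult_L2) (use Lp2_indicator assms in auto)
	moreover have "(%x. (indicator S x * u x) * (indicator S x * g x)) = (%x. indicator S x *R (u x * g x))"
		by (auto simp: indicator_def)
	ultimately show ?thesis by (simp add: set_integrable_def)
qed

lemma Lp2_Cauchy_Schwarz:
	assumes "u \<in> Lp 2 S" "g \<in> Lp 2 S"
	shows "(LBINT x:S. u x * g x)^2 <= (LBINT x:S. (u x)^2) * (LBINT x:S. (g x)^2)"
proof -
	have i: "integrable lborel (%x. (indicator S x * u x) * (indicator S x * g x))"
		by (rule integrable_mult_L2) (use Lp2_indicator assms in auto)
	have "(%x. (indicator S x * u x) * (indicator S x * g x)) = (%x. indicator S x *R (u x * g x))"
		"(%x. (indicator S x * u x)^2) = (%x. indicator S x *R (u x)^2)" "(%x. (indicator S x * g x)^2) = (%x. indicator S x *R (g x)^2)"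
		by (auto simp: indicator_def)
	with Cauchy_Schwarz_integral[OF Lp2_indicator(2)[OF assms(1)] Lp2_indicator(2)[OF assms(2)] i]
	show ?thesis by (simp add: sint_def)
qed

lemma bounded_Lp2:
	assumes S: "S \<in> sets lborel" "emeasure lborel S < \<infinity>" and m: "lmeas S g"
		and B: "!!x. x \<in> S ==> \<bar>g x\<bar> <= B"
	shows "g \<in> Lp 2 S"
proof -
	have "integrable lborel (%x. B^2 * indicator S x)" using S by (intro integrable_mult_right integrable_real_indicator) auto
	moreover have "(%x. indicator S x *R (g x)^2) \<in> borel_measurable lborel"
	proof -
		have "(%x. indicator S x *R (g x)^2) = (%x. (indicator S x *R g x)^2)" by (auto simp: indicator_def)
		thus ?thesis using m by (simp add: smeas_def)
	qed
	moreover have "norm (indicator S x *R (g x)^2) <= norm (B^2 * indicator S x)" for x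
		using power_mono[OF B abs_ge_zero, of x 2] by (cases "x \<in> S") auto
	ultimately have "integrable lborel (%x. indicator S x *R (g x)^2)"
		by (rule integrable_bound_pointwise)
	thus ?thesis using m by (simp add: Lp2_square set_integrable_def)
qed

lemma Lp2_integrable:
	assumes "S \<in> sets lborel" "emeasure lborel S < \<infinity>" "u \<in> Lp 2 S"
	shows "lint S u"
proof -
	have "(%_. 1) \<in> Lp 2 S" by (rule bounded_Lp2[OF assms(1,2), where B=1]) (use assms(1) in "auto simp: smeas_def")
	from Lp2_mult_integrable[OF assms(3) this] show ?thesis by simp
qed

lemma set_borel_measurable_subset_borel:
	fixes u :: "'a::euclidean_space => real"
	assumes "lmeas S u" "T \<in> sets lborel" "T \<subseteq> S"
	shows "lmeas T u"
proof -
	have "(%x. indicator T x * (indicator S x *R u x)) \<in> borel_measurable lborel"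
		using assms by (auto simp: smeas_def)
	moreover have "(%x. indicator T x * (indicator S x *R u x)) = (%x. indicator T x *R u x)"
	proof
		fix x show "indicator T x * (indicator S x *R u x) = indicator T x *R u x"
			using assms(3) by (cases "x \<in> T") auto
	qed
	ultimately show ?thesis by (simp add: smeas_def)
qed

lemma Lp2_subset:
	assumes "u \<in> Lp 2 S" "T \<in> sets lborel" "T \<subseteq> S"
	shows "u \<in> Lp 2 T"
	using assms set_borel_measurable_subset_borel set_integrable_subset unfolding Lp2_square by metis

lemma L1loc_subset:
	assumes "u \<in> L1loc S" "T \<in> sets lborel" "T \<subseteq> S"
	shows "u \<in> L1loc T"
	using assms set_borel_measurable_subset_borel unfolding L1loc_def by blast

lemma integrable_L1loc:
	assumes "lint S u"
	shows "u \<in> L1loc S"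
proof -
	have "lint K u" if "compact K" "K \<subseteq> S" for K
		by (rule set_integrable_subset[OF assms]) (use that in "auto simp: borel_compact")
	thus ?thesis using assms by (auto simp: L1loc_def smeas_def set_integrable_def)
qed

lemma Lp2_add:
	assumes "u \<in> Lp 2 S" "g \<in> Lp 2 S"
	shows "(%x. r * u x + s * g x) \<in> Lp 2 S"
proof -
	have m: "lmeas S (%x. r * u x + s * g x)"
		using Lp2_indicator(1)[OF assms(1)] Lp2_indicator(1)[OF assms(2)]
		unfolding smeas_def real_scaleR_def distrib_left
		by (intro borel_measurable_add) (auto simp: mult.left_commute[of _ r] mult.left_commute[of _ s])
	have "lint S (%x. r^2 * (u x)^2 + (2 * r * s * (u x * g x) + s^2 * (g x)^2))"
		using assms Lp2_mult_integrable[OF assms] unfolding Lp2_square by (intro set_integral_add(1) set_integrable_mult_right) auto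
	moreover have "(%x. r^2 * (u x)^2 + (2 * r * s * (u x * g x) + s^2 * (g x)^2)) = (%x. (r * u x + s * g x)^2)"
		by (simp add: power2_eq_square algebra_simps)
	ultimately show ?thesis using m by (simp add: Lp2_square)
qed

lemma Lp2_mult_bounded:
	assumes u: "u \<in> Lp 2 S" and m: "lmeas S g" and B: "!!x. x \<in> S ==> \<bar>g x\<bar> <= B"
	shows "(%x. u x * g x) \<in> Lp 2 S"
proof -
	have e: "indicator S x *R (u x * g x) = (indicator S x * u x) * (indicator S x *R g x)" for x by (auto simp: indicator_def)
	have m': "lmeas S (%x. u x * g x)"
		using borel_measurable_times[OF Lp2_indicator(1)[OF u] m[unfolded smeas_def]]
		unfolding smeas_def e .
	have "integrable lborel (%x. B^2 * (indicator S x * u x)^2)" using Lp2_indicator(2)[OF u] by auto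
	moreover have "(%x. indicator S x *R (u x * g x)^2) \<in> borel_measurable lborel"
	proof -
		have "(%x. indicator S x *R (u x * g x)^2) = (%x. (indicator S x *R (u x * g x))^2)" by (auto simp: indicator_def)
		thus ?thesis using m' by (simp add: smeas_def)
	qed
	moreover have "norm (indicator S x *R (u x * g x)^2) <= norm (B^2 * (indicator S x * u x)^2)" for x
	proof (cases "x \<in> S")
		case True
		have "(g x)^2 <= B^2" using power_mono[OF B[OF True] abs_ge_zero, of 2] by simp
		hence "(u x)^2 * (g x)^2 <= (u x)^2 * B^2" by (rule mult_left_mono) simp
		thus ?thesis using True by (simp add: power_mult_distrib abs_mult mult.commute)
	qed auto
	ultimately have "integrable lborel (%x. indicator S x *R (u x * g x)^2)"
		by (rule integrable_bound_pointwise)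
	thus ?thesis using m' by (simp add: Lp2_square set_integrable_def)
qed

lemma set_integral_cong_AE_simple:
	fixes f g :: "'a::euclidean_space => real"
	assumes "AE x in lborel. x \<in> S --> f x = g x" "lmeas S f" "lmeas S g"
	shows "(LBINT x:S. f x) = (LBINT x:S. g x)"
	unfolding sint_def
proof (rule integral_cong_AE)
	show "AE x in lborel. indicator S x *R f x = indicator S x *R g x"
		using assms(1) by eventually_elim (auto simp: indicator_def)
qed (use assms in "auto simp: smeas_def")

lemma Lp_cong_AE:
	fixes f g :: "'a::euclidean_space => real"
	assumes ae: "AE x in lborel. x \<in> S --> f x = g x" and g: "lmeas S g" and f: "f \<in> Lp p S"
	shows "g \<in> Lp p S"
proof (cases "p = 0")
	case True thus ?thesis using f g by (simp add: Lp_def)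
next
	case False
	have e: "(%x. indicator S x *R \<bar>g x\<bar> ^ p) = (%x. \<bar>indicator S x *R g x\<bar> ^ p)" using False by (auto simp: indicator_def)
	have "integrable lborel (%x. indicator S x *R \<bar>g x\<bar> ^ p)"
	proof (rule integrable_cong_AE_imp)
		show "integrable lborel (%x. indicator S x *R \<bar>f x\<bar> ^ p)" using f by (simp add: Lp_def set_integrable_def)
		show "(%x. indicator S x *R \<bar>g x\<bar> ^ p) \<in> borel_measurable lborel" unfolding e using g by (auto simp: smeas_def)
		show "AE x in lborel. indicator S x *R \<bar>f x\<bar> ^ p = indicator S x *R \<bar>g x\<bar> ^ p"
			using ae by eventually_elim (auto simp: indicator_def)
	qed
	thus ?thesis using g by (simp add: Lp_def set_integrable_def)
qed

subsection \<open>Weak derivatives\<close>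

lemma wpd_works: "has_weak_pd S i u g ==> has_weak_pd S i u (wpd S i u)"
	unfolding wpd_def by (rule someI[of "has_weak_pd S i u"])

lemma wpd_AE_eq:
	assumes "open S" "has_weak_pd S i u g"
	shows "AE x in lborel. x \<in> S --> wpd S i u x = g x"
	by (rule weak_pd_unique[OF assms(1) wpd_works[OF assms(2)] assms(2)])

lemma sobolev1D:
	assumes "u \<in> sobolev 1 p S" "open S" "i \<in> Basis"
	shows "u \<in> Lp p S" "has_weak_pd S i u (wpd S i u)" "wpd S i u \<in> Lp p S"
proof -
	have s: "u \<in> Lp p S" "\<forall>i\<in>Basis. \<exists>g\<in>Lp p S. has_weak_pd S i u g"
		using assms(1) unfolding One_nat_def sobolev.simps by blast+
	show "u \<in> Lp p S" by (rule s(1))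
	obtain g where g: "g \<in> Lp p S" "has_weak_pd S i u g" using s(2) assms(3) by blast
	show w: "has_weak_pd S i u (wpd S i u)" by (rule wpd_works[OF g(2)])
	show "wpd S i u \<in> Lp p S"
	proof (rule Lp_cong_AE[OF _ _ g(1)])
		show "AE x in lborel. x \<in> S --> g x = wpd S i u x" by (rule weak_pd_unique[OF assms(2) g(2) w])
		show "lmeas S (wpd S i u)" using has_weak_pd_L1loc(2)[OF w] by (simp add: L1loc_def)
	qed
qed

lemma sobolev1I:
	assumes "u \<in> Lp p S" "!!i. i \<in> Basis ==> g i \<in> Lp p S" "!!i. i \<in> Basis ==> has_weak_pd S i u (g i)"
	shows "u \<in> sobolev 1 p S"
	using assms unfolding One_nat_def sobolev.simps by blast

lemma test_functions_mono: "T \<subseteq> S ==> test_functions T \<subseteq> test_functions S"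
	unfolding test_functions_def by blast

lemma has_weak_pd_subset:
	assumes "has_weak_pd S i u g" "T \<subseteq> S" "T \<in> sets lborel"
	shows "has_weak_pd T i u g"
	unfolding has_weak_pd_def
proof (intro conjI ballI)
	show "u \<in> L1loc T" "g \<in> L1loc T"
		using L1loc_subset[OF has_weak_pd_L1loc(1)[OF assms(1)] assms(3,2)] L1loc_subset[OF has_weak_pd_L1loc(2)[OF assms(1)] assms(3,2)] .
	fix \<phi> assume t: "\<phi> \<in> test_functions T"
	then obtain K where K: "compact K" "K \<subseteq> T" "!!x. x \<notin> K ==> \<phi> x = 0" by (auto simp: test_functions_def)
	have pz: "pd i \<phi> x = 0" if "x \<notin> K" for x by (rule pd_eq_0_outside[OF compact_imp_closed[OF K(1)] K(3) that])
	have KS: "K \<subseteq> S" using K(2) assms(2) by blast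
	have "(LBINT x:S. u x * pd i \<phi> x) = - (LBINT x:S. g x * \<phi> x)"
		using assms(1) t test_functions_mono[OF assms(2)] by (auto simp: has_weak_pd_def)
	thus "(LBINT x:T. u x * pd i \<phi> x) = - (LBINT x:T. g x * \<phi> x)"
		using set_integral_mult_support[where \<phi>="pd i \<phi>", OF KS pz] set_integral_mult_support[where \<phi>="pd i \<phi>", OF K(2) pz]
			set_integral_mult_support[where \<phi>=\<phi>, OF KS K(3)] set_integral_mult_support[where \<phi>=\<phi>, OF K(2,3)] by metis
qed

lemma L1loc_lincomb: "g \<in> L1loc S ==> h \<in> L1loc S ==> (%x. r * g x + s * h x) \<in> L1loc S"
proof -
	assume gh: "g \<in> L1loc S" "h \<in> L1loc S"
	have "lint K (%x. r * g x + s * h x)" if "compact K" "K \<subseteq> S" for K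
		using gh that by (intro set_integral_add(1) set_integrable_mult_right) (auto simp: L1loc_def)
	moreover have "lmeas S (%x. r * g x + s * h x)"
		using gh unfolding L1loc_def smeas_def real_scaleR_def distrib_left
		by (auto simp: mult.left_commute[of _ r] mult.left_commute[of _ s] intro!: borel_measurable_add)
	ultimately show ?thesis by (auto simp: L1loc_def)
qed

lemma pd_test_function: "\<phi> \<in> test_functions S ==> i \<in> Basis ==> pd i \<phi> \<in> test_functions S"
proof -
	assume t: "\<phi> \<in> test_functions S" and i: "i \<in> Basis"
	then obtain K where K: "compact K" "K \<subseteq> S" "!!x. x \<notin> K ==> \<phi> x = 0" by (auto simp: test_functions_def)
	have "Ck k (pd i \<phi>)" for k
	proof -
		have "Ck (Suc k) \<phi>" using t unfolding test_functions_def by blast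
		thus ?thesis using i by simp
	qed
	thus ?thesis
		by (rule test_functionsI[OF _ K(1,2)]) (rule pd_eq_0_outside[OF compact_imp_closed[OF K(1)] K(3)])
qed

lemma has_weak_pd_lincomb:
	assumes u: "has_weak_pd S i u g" and v: "has_weak_pd S i v h" and i: "i \<in> Basis"
	shows "has_weak_pd S i (%x. r * u x + s * v x) (%x. r * g x + s * h x)"
	unfolding has_weak_pd_def
proof (intro conjI ballI L1loc_lincomb)
	fix \<phi> assume t: "\<phi> \<in> test_functions S"
	have lin: "(LBINT x:S. (r * f x + s * k x) * \<theta> x) = r * (LBINT x:S. f x * \<theta> x) + s * (LBINT x:S. k x * \<theta> x)"
		if "f \<in> L1loc S" "k \<in> L1loc S" "\<theta> \<in> test_functions S" for f k \<theta>
	proof -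
		have "(LBINT x:S. (r * f x + s * k x) * \<theta> x) = (LBINT x:S. r * (f x * \<theta> x) + s * (k x * \<theta> x))"
			by (simp add: distrib_right mult.assoc)
		also have "... = (LBINT x:S. r * (f x * \<theta> x)) + (LBINT x:S. s * (k x * \<theta> x))"
			by (intro set_integral_add(2) set_integrable_mult_right L1loc_mult_test_integrable that)
		finally show ?thesis by simp
	qed
	show "(LBINT x:S. (r * u x + s * v x) * pd i \<phi> x) = - (LBINT x:S. (r * g x + s * h x) * \<phi> x)"
		using u v t pd_test_function[OF t i] has_weak_pd_L1loc[OF u] has_weak_pd_L1loc[OF v]
		by (subst (1 2) lin) (auto simp: has_weak_pd_def)
qed (use has_weak_pd_L1loc[OF u] has_weak_pd_L1loc[OF v] in auto)

lemma Basis_real2: "(Basis :: (plane) set) = {(1, 0), (0, 1)}"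
	by (auto simp: Basis_prod_def)

lemma wgrad_real2: "wgrad S u x = (wpd S (1, 0) u x, wpd S (0, 1) u x)"
	by (simp add: wgrad_def Basis_real2)

section \<open>Approximation by dilated mollifications\<close>

lemma L2_continuous_dense:
	fixes G :: "'a::euclidean_space => real"
	assumes S: "S \<in> sets lborel" "emeasure lborel S < \<infinity>" and G: "G \<in> Lp 2 S" and e: "e > 0"
	obtains h M where "continuous_on UNIV h" "!!x. \<bar>h x\<bar> <= M" "(LBINT x:S. (G x - h x)^2) < e"
proof -
	define g where "g x = indicator S x * G x" for x
	have gm[measurable]: "g \<in> borel_measurable borel" and gi: "integrable lborel (%x. (g x)^2)"
		using Lp2_indicator[OF G] by (auto simp: g_def[abs_def])
	have Sm[measurable]: "S \<in> sets borel" using S by simp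
	define T where "T k x = max (- real k) (min (real k) (g x))" for k x
	have "(%k. LBINT x. (g x - T k x)^2) -->> (\<integral>x. 0 \<partial>(lborel::'a measure))"
	proof (rule integral_dominated_convergence[where w="%x. (g x)^2"])
		show "AE x in lborel. (%k. (g x - T k x)^2) -->> 0"
		proof (rule AE_I2)
			fix x
			obtain N where N: "\<bar>g x\<bar> <= real N" using real_arch_simple by blast
			have "\<forall>\<^sub>F k in sequentially. 0 = (g x - T k x)^2"
				unfolding eventually_sequentially by (intro exI[of _ N]) (use N in "auto simp: T_def")
			from Lim_transform_eventually[OF tendsto_const this] show "(%k. (g x - T k x)^2) -->> 0" .
		qed
		show "AE x in lborel. norm ((g x - T k x)^2) <= (g x)^2" for k
		proof (rule AE_I2)
			fix x
			have "\<bar>g x - T k x\<bar> <= \<bar>g x\<bar>" unfolding T_def by linarith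
			thus "norm ((g x - T k x)^2) <= (g x)^2" by (simp add: abs_le_square_iff)
		qed
		show "(%x. (g x - T k x)^2) \<in> borel_measurable lborel" for k unfolding T_def by measurable
	qed (use gi in auto)
	hence "\<forall>\<^sub>F k in sequentially. (LBINT x. (g x - T k x)^2) < e / 4"
		using e by (intro order_tendstoD(2)) auto
	then obtain k where k: "(LBINT x. (g x - T k x)^2) < e / 4" by (auto simp: eventually_sequentially)
	have Tm: "T k \<in> borel_measurable borel" unfolding T_def by measurable
	have "T k measurable_on UNIV"
		by (rule lebesgue_measurable_imp_measurable_on) (use Tm in "auto intro: measurable_completion")
	then obtain N c where N: "negligible N" and c: "!!n. continuous_on UNIV (c n)"
		and lim: "!!x. x \<notin> N ==> (%n. c n x) -->> T k x"
		unfolding measurable_on_def by auto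
	define h where "h n x = max (- real k) (min (real k) (c n x))" for n x
	have hc: "continuous_on UNIV (h n)" for n unfolding h_def by (intro continuous_intros c)
	have hm[measurable]: "h n \<in> borel_measurable borel" for n using hc by (rule borel_measurable_continuous_onI)
	have hb: "\<bar>h n x\<bar> <= real k" for n x unfolding h_def by linarith
	have Tb: "\<bar>T k x\<bar> <= real k" for x unfolding T_def by linarith
	have Nae: "AE x in lborel. x \<notin> N"
	proof -
		have "N \<in> null_sets (completion lborel)" using N by (simp add: negligible_iff_null_sets)
		from AE_not_in[OF this] show ?thesis by (simp add: AE_completion_iff)
	qed
	have "(%n. LBINT x. indicator S x * (T k x - h n x)^2) -->> (\<integral>x. 0 \<partial>(lborel::'a measure))"
	proof (rule integral_dominated_convergence[where w="%x. (2 * real k)^2 * indicator S x"])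
		show "AE x in lborel. (%n. indicator S x * (T k x - h n x)^2) -->> 0"
			using Nae
		proof eventually_elim
			case (elim x)
			have "(%n. h n x) -->> max (- real k) (min (real k) (T k x))"
				unfolding h_def by (intro tendsto_intros lim[OF elim])
			moreover have "max (- real k) (min (real k) (T k x)) = T k x" using Tb[of x] by linarith
			ultimately have "(%n. h n x) -->> T k x" by simp
			hence "(%n. indicator S x * (T k x - h n x)^2) -->> indicator S x * (T k x - T k x)^2"
				by (intro tendsto_intros)
			thus ?case by simp
		qed
		show "integrable lborel (%x. (2 * real k)^2 * indicator S x)"
			using S by (intro integrable_mult_right integrable_real_indicator) auto
		show "AE x in lborel. norm (indicator S x * (T k x - h n x)^2) <= (2 * real k)^2 * indicator S x" for n
		proof (rule AE_I2)
			fix x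
			have "\<bar>T k x - h n x\<bar> <= 2 * real k" using Tb[of x] hb[of n x] by linarith
			hence "(T k x - h n x)^2 <= (2 * real k)^2" using power_mono[of "\<bar>T k x - h n x\<bar>" "2 * real k" 2] by simp
			thus "norm (indicator S x * (T k x - h n x)^2) <= (2 * real k)^2 * indicator S x"
				by (cases "x \<in> S") auto
		qed
		show "(%x. indicator S x * (T k x - h n x)^2) \<in> borel_measurable lborel" for n using Tm by measurable
	qed (use S in auto)
	hence "\<forall>\<^sub>F n in sequentially. (LBINT x. indicator S x * (T k x - h n x)^2) < e / 4"
		using e by (intro order_tendstoD(2)) auto
	then obtain n where n: "(LBINT x. indicator S x * (T k x - h n x)^2) < e / 4" by (auto simp: eventually_sequentially)
	have i1: "integrable lborel (%x. (g x - T k x)^2)"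
	proof (rule integrable_bound_pointwise[OF gi])
		fix x
		have "\<bar>g x - T k x\<bar> <= \<bar>g x\<bar>" unfolding T_def by linarith
		thus "norm ((g x - T k x)^2) <= norm ((g x)^2)" by (simp add: abs_le_square_iff)
	qed (unfold T_def, measurable)
	have i2: "integrable lborel (%x. indicator S x * (T k x - h n x)^2)"
	proof (rule integrable_bound_pointwise[of _ "%x. (2 * real k)^2 * indicator S x"])
		fix x
		have "\<bar>T k x - h n x\<bar> <= 2 * real k" using Tb[of x] hb[of n x] by linarith
		hence "(T k x - h n x)^2 <= (2 * real k)^2" using power_mono[of "\<bar>T k x - h n x\<bar>" "2 * real k" 2] by simp
		thus "norm (indicator S x * (T k x - h n x)^2) <= norm ((2 * real k)^2 * indicator S x :: real)"
			by (cases "x \<in> S") auto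
	qed (use S Tm in "auto intro!: integrable_mult_right integrable_real_indicator")
	have "(LBINT x:S. (G x - h n x)^2) <= (LBINT x. 2 * (g x - T k x)^2 + 2 * (indicator S x * (T k x - h n x)^2))"
		unfolding sint_def
	proof (rule integral_mono_AE')
		show "integrable lborel (%x. 2 * (g x - T k x)^2 + 2 * (indicator S x * (T k x - h n x)^2))" using i1 i2 by auto
		show "AE x in lborel. indicator S x *R (G x - h n x)^2 <= 2 * (g x - T k x)^2 + 2 * (indicator S x * (T k x - h n x)^2)"
		proof (rule AE_I2)
			fix x
			have "0 <= ((g x - T k x) - (T k x - h n x))^2" by simp
			hence "(g x - h n x)^2 <= 2 * (g x - T k x)^2 + 2 * (T k x - h n x)^2"
				by (simp add: power2_eq_square algebra_simps)
			thus "indicator S x *R (G x - h n x)^2 <= 2 * (g x - T k x)^2 + 2 * (indicator S x * (T k x - h n x)^2)"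
				by (cases "x \<in> S") (auto simp: g_def)
		qed
		show "AE x in lborel. 0 <= 2 * (g x - T k x)^2 + 2 * (indicator S x * (T k x - h n x)^2)" by auto
	qed
	also have "... = 2 * (LBINT x. (g x - T k x)^2) + 2 * (LBINT x. indicator S x * (T k x - h n x)^2)"
		using i1 i2 by simp
	also have "... < e" using k n by simp
	finally show ?thesis using that hc hb by blast
qed

lemma moll_bounded: "\<exists>C. \<forall>x::'a::euclidean_space. \<bar>moll n x\<bar> <= C"
proof -
	have "continuous_on UNIV (moll n :: 'a => real)" using Ck_moll[of 0 n] by simp
	from continuous_compact_support_bounded[OF this compact_cball moll_outside] show ?thesis by blast
qed

lemma conv_moll_Jensen:
	fixes G :: "'a::euclidean_space => real"
	assumes G: "integrable lborel G" "integrable lborel (%x. (G x)^2)"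
	shows "(conv (moll n) G x)^2 <= conv (moll n) (%y. (G y)^2) x"
proof -
	obtain C where C: "!!x::'a. \<bar>moll n x\<bar> <= C" using moll_bounded by blast
	have i1: "integrable lborel (%y. moll n (x - y) * G y)"
		using integrable_mult_bounded[OF G(1), of "%y. moll n (x - y)" C] C by (simp add: mult.commute)
	have i2: "integrable lborel (%y. moll n (x - y) * (G y)^2)"
		using integrable_mult_bounded[OF G(2), of "%y. moll n (x - y)" C] C by (simp add: mult.commute)
	define m where "m = conv (moll n) G x"
	have "0 <= (LBINT y. moll n (x - y) * (G y - m)^2)" by (simp add: moll_nonneg)
	also have "(%y. moll n (x - y) * (G y - m)^2) = (%y. moll n (x - y) * (G y)^2 - 2 * m * (moll n (x - y) * G y) + m^2 * moll n (x - y))"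
		by (simp add: power2_eq_square algebra_simps)
	also have "(LBINT y. moll n (x - y) * (G y)^2 - 2 * m * (moll n (x - y) * G y) + m^2 * moll n (x - y))
		 = conv (moll n) (%y. (G y)^2) x - 2 * m * m + m^2"
		using i1 i2 moll_minus_integrable[of n x] by (simp add: conv_def m_def moll_minus_integral)
	finally show ?thesis by (simp add: m_def power2_eq_square)
qed

lemma dilated_moll_L2_bound:
	fixes G :: "'a::euclidean_space => real"
	assumes G: "integrable lborel G" "integrable lborel (%x. (G x)^2)" and l: "1/2 <= l"
	shows "integrable lborel (%x. (conv (moll n) G (t + l *R x))^2)"
		and "(LBINT x. (conv (moll n) G (t + l *R x))^2) <= 2 ^ DIM('a) * (LBINT x. (G x)^2)"
proof -
	have [measurable]: "G \<in> borel_measurable borel" using G by auto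
	obtain C where C: "!!x::'a. \<bar>moll n x\<bar> <= C" using moll_bounded by blast
	have i2: "integrable lborel (%y. moll n (x - y) * (G y)^2)" for x
		using integrable_mult_bounded[OF G(2), of "%y. moll n (x - y)" C] C by (simp add: mult.commute)
	have cm[measurable]: "conv (moll n) G \<in> borel_measurable borel"
		by (rule Ck_borel_measurable[OF Ck_conv_moll[OF G(1)]])
	define I where "I = (LBINT x. (G x)^2)"
	have Ieq: "(\<integral>\<^sup>+x. ennreal ((G x)^2) \<partial>lborel) = ennreal I" unfolding I_def by (rule nn_integral_eq_integral[OF G(2)]) simp
	have inner: "(\<integral>\<^sup>+x. ennreal (moll n (t + l *R x - y)) \<partial>lborel) <= ennreal (2 ^ DIM('a))" for y
	proof -
		have "(\<integral>\<^sup>+x. ennreal (moll n (x - y)) \<partial>lborel) = ennreal (\<bar>l\<bar> ^ DIM('a)) * (\<integral>\<^sup>+x. ennreal (moll n (t + l *R x - y)) \<partial>lborel)"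
			using l by (subst lborel_affine[of l t]) (simp_all add: nn_integral_density nn_integral_distr nn_integral_cmult)
		moreover have "(\<integral>\<^sup>+x. ennreal (moll n (x - y)) \<partial>lborel) = 1"
		proof -
			have "(\<integral>\<^sup>+x. ennreal (moll n (x - y)) \<partial>lborel) = (\<integral>\<^sup>+(x::'a). ennreal (moll n x) \<partial>lborel)"
				using nn_integral_distr[of "(+) (- y)" lborel borel "%x::'a. ennreal (moll n x)", symmetric]
				by (simp add: lborel_distr_plus)
			also have "... = ennreal (\<integral>x. moll n x \<partial>(lborel :: 'a measure))" by (rule nn_integral_eq_integral[OF moll_integrable]) (simp add: moll_nonneg)
			finally show ?thesis by (simp add: moll_integral)
		qed
		ultimately have one: "1 = ennreal (\<bar>l\<bar> ^ DIM('a)) * (\<integral>\<^sup>+x. ennreal (moll n (t + l *R x - y)) \<partial>lborel)" by simp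
		have "1 <= (2 * l) ^ DIM('a)" using l by (intro one_le_power) auto
		hence "ennreal 1 <= ennreal (2 ^ DIM('a)) * ennreal (\<bar>l\<bar> ^ DIM('a))"
			using l by (subst ennreal_mult[symmetric]) (auto simp: power_mult_distrib)
		hence "1 * (\<integral>\<^sup>+x. ennreal (moll n (t + l *R x - y)) \<partial>lborel) <=
			 ennreal (2 ^ DIM('a)) * ennreal (\<bar>l\<bar> ^ DIM('a)) * (\<integral>\<^sup>+x. ennreal (moll n (t + l *R x - y)) \<partial>lborel)"
			by (intro mult_right_mono) auto
		also have "... = ennreal (2 ^ DIM('a))" using one by (simp add: mult.assoc)
		finally show ?thesis by simp
	qed
	have "(\<integral>\<^sup>+x. ennreal ((conv (moll n) G (t + l *R x))^2) \<partial>lborel)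
		 <= (\<integral>\<^sup>+x. (\<integral>\<^sup>+y. ennreal (moll n (t + l *R x - y) * (G y)^2) \<partial>lborel) \<partial>lborel)"
	proof (rule nn_integral_mono)
		fix x
		have "ennreal ((conv (moll n) G (t + l *R x))^2) <= ennreal (conv (moll n) (%y. (G y)^2) (t + l *R x))"
			by (rule ennreal_leI[OF conv_moll_Jensen[OF G]])
		also have "... = (\<integral>\<^sup>+y. ennreal (moll n (t + l *R x - y) * (G y)^2) \<partial>lborel)"
			unfolding conv_def by (rule nn_integral_eq_integral[symmetric, OF i2]) (simp add: moll_nonneg)
		finally show "ennreal ((conv (moll n) G (t + l *R x))^2) <= (\<integral>\<^sup>+y. ennreal (moll n (t + l *R x - y) * (G y)^2) \<partial>lborel)" .
	qed
	also have "... = (\<integral>\<^sup>+y. (\<integral>\<^sup>+x. ennreal (moll n (t + l *R x - y) * (G y)^2) \<partial>lborel) \<partial>lborel)"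
		by (rule lborel_pair.Fubini') (simp add: lborel_prod[symmetric] borel_prod[symmetric])
	also have "... = (\<integral>\<^sup>+y. ennreal ((G y)^2) * (\<integral>\<^sup>+x. ennreal (moll n (t + l *R x - y)) \<partial>lborel) \<partial>lborel)"
		by (subst nn_integral_cmult[symmetric]) (auto simp: ennreal_mult moll_nonneg mult.commute)
	also have "... <= (\<integral>\<^sup>+y. ennreal ((G y)^2) * ennreal (2 ^ DIM('a)) \<partial>lborel)"
		by (intro nn_integral_mono mult_left_mono inner) auto
	also have "... = ennreal (2 ^ DIM('a) * I)"
		by (subst nn_integral_multc) (auto simp: Ieq ennreal_mult I_def mult.commute)
	finally have le: "(\<integral>\<^sup>+x. ennreal ((conv (moll n) G (t + l *R x))^2) \<partial>lborel) <= ennreal (2 ^ DIM('a) * I)" .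
	hence "(\<integral>\<^sup>+x. ennreal (norm ((conv (moll n) G (t + l *R x))^2)) \<partial>lborel) < \<infinity>"
		by (simp add: order.strict_trans1)
	thus int: "integrable lborel (%x. (conv (moll n) G (t + l *R x))^2)" by (intro integrableI_bounded) auto
	show "(LBINT x. (conv (moll n) G (t + l *R x))^2) <= 2 ^ DIM('a) * (LBINT x. (G x)^2)"
		using le nn_integral_eq_integral[OF int] by (simp add: I_def)
qed

text \<open>Mollification after a dilation towards a centre; each value only depends on values inside \<open>S\<close>.\<close>
locale dilated_mollification =
	fixes S :: "'a::euclidean_space set" and z :: 'a and l :: "nat => real" and m :: "nat => nat"
	assumes S: "open S" "bounded S"
		and l: "!!n. 1/2 <= l n" "l -->> 1" and m: "filterlim m at_top sequentially"
		and inside: "!!n x. x \<in> closure S ==> cball (z + l n *R (x - z)) (1 / (real (m n) + 1)) \<subseteq> S"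
begin

definition A :: "nat => 'a => 'a" where "A n x = z + l n *R (x - z)"

definition P :: "nat => ('a => real) => 'a => real" where
	"P n g x = conv (moll (m n)) (%y. indicator S y * g y) (A n x)"

lemma A_affine: "A n x = (z - l n *R z) + l n *R x"
	by (simp add: A_def scaleR_diff_right)

lemma Sm: "S \<in> sets lborel" "emeasure lborel S < \<infinity>"
	using S emeasure_bounded_finite[OF S(2)] by auto

lemma ind_integrable: "g \<in> Lp 2 S ==> integrable lborel (%x. indicator S x * g x)"
	using Lp2_integrable[OF Sm] by (simp add: set_integrable_def)

lemma P_bound:
	assumes g: "g \<in> Lp 2 S"
	shows "lint S (%x. (P n g x)^2)" "(LBINT x:S. (P n g x)^2) <= 2 ^ DIM('a) * (LBINT x:S. (g x)^2)"
proof -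
	note b = dilated_moll_L2_bound[OF ind_integrable[OF g] Lp2_indicator(2)[OF g] l(1)[of n], of "m n" "z - l n *R z"]
	have i: "integrable lborel (%x. (P n g x)^2)" unfolding P_def A_affine by (rule b(1))
	hence "lint UNIV (%x. (P n g x)^2)" by (simp add: set_integrable_def)
	thus i': "lint S (%x. (P n g x)^2)" by (rule set_integrable_subset) (use Sm in auto)
	have "(LBINT x:S. (P n g x)^2) <= (LBINT x. (P n g x)^2)" unfolding sint_def
		by (rule integral_mono_AE') (use i in "auto simp: indicator_def")
	also have "... <= 2 ^ DIM('a) * (LBINT x. (indicator S x * g x)^2)" unfolding P_def A_affine by (rule b(2))
	also have "(%x. (indicator S x * g x)^2) = (%x. indicator S x *R (g x)^2)" by (auto simp: indicator_def)
	finally show "(LBINT x:S. (P n g x)^2) <= 2 ^ DIM('a) * (LBINT x:S. (g x)^2)"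
		by (simp add: sint_def)
qed

lemma P_measurable: "g \<in> Lp 2 S ==> P n g \<in> borel_measurable borel"
proof -
	assume g: "g \<in> Lp 2 S"
	have [measurable]: "conv (moll (m n)) (%y. indicator S y * g y) \<in> borel_measurable borel"
		by (rule Ck_borel_measurable[OF Ck_conv_moll[OF ind_integrable[OF g]]])
	show ?thesis unfolding P_def A_affine by measurable
qed

lemma P_Lp2: "g \<in> Lp 2 S ==> P n g \<in> Lp 2 S"
proof -
	assume g: "g \<in> Lp 2 S"
	have [measurable]: "P n g \<in> borel_measurable borel" "S \<in> sets borel" using P_measurable[OF g] S by auto
	have "lmeas S (P n g)" unfolding smeas_def by measurable
	thus ?thesis using P_bound(1)[OF g] by (simp add: Lp2_square)
qed

lemma inverse_m: "(%n. 1 / (real (m n) + 1)) -->> 0"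
proof -
	have "(%n. inverse (real (Suc n))) -->> 0" by (rule LIMSEQ_inverse_real_of_nat)
	from filterlim_compose[OF this m] show ?thesis by (simp add: inverse_eq_divide add.commute)
qed

lemma P_tendsto_continuous:
	assumes h: "continuous_on UNIV h" "!!x. \<bar>h x\<bar> <= M" and x: "x \<in> S"
	shows "(%n. P n h x) -->> h x"
	unfolding tendsto_iff
proof (intro allI impI)
	fix e :: real assume e: "e > 0"
	have "isCont h x" using h(1) by (simp add: continuous_on_eq_continuous_at)
	then obtain d where d: "d > 0" "!!y. dist y x < d ==> dist (h y) (h x) < e / 2"
		using e unfolding continuous_at_eps_delta by (meson half_gt_zero)
	have "(%n. A n x) -->> z + 1 *R (x - z)" unfolding A_def by (intro tendsto_intros l)
	hence "(%n. dist (A n x) x) -->> 0" using tendsto_dist[OF _ tendsto_const, of "%n. A n x" x sequentially x] by simp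
	hence e1: "\<forall>\<^sub>F n in sequentially. dist (A n x) x < d / 2" using d by (intro order_tendstoD(2)) auto
	have e2: "\<forall>\<^sub>F n in sequentially. 1 / (real (m n) + 1) < d / 2" using d by (intro order_tendstoD(2)[OF inverse_m]) auto
	have hm: "h \<in> borel_measurable borel" using h(1) by (rule borel_measurable_continuous_onI)
	show "\<forall>\<^sub>F n in sequentially. dist (P n h x) (h x) < e"
		using e1 e2
	proof eventually_elim
		case (elim n)
		have "\<bar>P n h x - h x\<bar> <= e / 2" unfolding P_def
		proof (rule conv_moll_near)
			show "(%y. indicator S y * h y) \<in> borel_measurable borel" using hm Sm by (intro borel_measurable_times) auto
			show "\<bar>indicator S y * h y\<bar> <= M" for y
				using h(2)[of y] abs_ge_zero[of "h y"] by (cases "y \<in> S") (auto simp del: abs_ge_zero)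
			fix y assume y: "dist (A n x) y < 1 / (real (m n) + 1)"
			hence "y \<in> S" using inside[of x n] x closure_subset[of S] unfolding A_def[symmetric] by (meson mem_cball less_imp_le subsetD)
			moreover have "dist y x < d" using y elim dist_triangle[of y x "A n x"] by (simp add: dist_commute)
			ultimately show "\<bar>indicator S y * h y - h x\<bar> <= e / 2" using d(2)[of y] by (simp add: dist_real_def)
		qed
		thus ?case using e by (simp add: dist_real_def)
	qed
qed

lemma P_bounded:
	assumes "h \<in> borel_measurable borel" "!!x. \<bar>h x\<bar> <= M"
	shows "\<bar>P n h x\<bar> <= M"
	unfolding P_def
proof (rule conv_moll_bound)
	show "(%y. indicator S y * h y) \<in> borel_measurable borel" using assms Sm by (intro borel_measurable_times) auto
	show "\<bar>indicator S y * h y\<bar> <= M" for y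
		using assms(2)[of y] abs_ge_zero[of "h y"] by (cases "y \<in> S") (auto simp del: abs_ge_zero)
qed

lemma P_tendsto_continuous_L2:
	assumes h: "continuous_on UNIV h" "!!x. \<bar>h x\<bar> <= M"
	shows "(%n. LBINT x:S. (P n h x - h x)^2) -->> 0"
proof -
	have hm: "h \<in> borel_measurable borel" using h(1) by (rule borel_measurable_continuous_onI)
	have hL: "h \<in> Lp 2 S" by (rule bounded_Lp2[OF Sm _ h(2)]) (use hm S(1) in "auto simp: smeas_def")
	have [measurable]: "P n h \<in> borel_measurable borel" for n by (rule P_measurable[OF hL])
	have [measurable]: "h \<in> borel_measurable borel" by (rule hm)
	have [measurable]: "S \<in> sets borel" using S by simp
	have "(%n. LBINT x. indicator S x *R (P n h x - h x)^2) -->> (\<integral>x. 0 \<partial>(lborel::'a measure))"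
	proof (rule integral_dominated_convergence[where w="%x. (2 * M)^2 * indicator S x"])
		show "integrable lborel (%x. (2 * M)^2 * indicator S x)"
			using Sm by (intro integrable_mult_right integrable_real_indicator) auto
		show "AE x in lborel. (%n. indicator S x *R (P n h x - h x)^2) -->> 0"
		proof (rule AE_I2)
			fix x
			show "(%n. indicator S x *R (P n h x - h x)^2) -->> 0"
			proof (cases "x \<in> S")
				case True
				have "(%n. (P n h x - h x)^2) -->> (h x - h x)^2" by (intro tendsto_intros P_tendsto_continuous[OF h True])
				thus ?thesis using True by simp
			qed simp
		qed
		show "AE x in lborel. norm (indicator S x *R (P n h x - h x)^2) <= (2 * M)^2 * indicator S x" for n
		proof (rule AE_I2)
			fix x
			have "\<bar>P n h x - h x\<bar> <= 2 * M" using P_bounded[OF hm h(2), of n x] h(2)[of x] by linarith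
			hence "(P n h x - h x)^2 <= (2 * M)^2" using power_mono[of "\<bar>P n h x - h x\<bar>" "2 * M" 2] by simp
			thus "norm (indicator S x *R (P n h x - h x)^2) <= (2 * M)^2 * indicator S x" by (cases "x \<in> S") auto
		qed
	qed auto
	thus ?thesis by (simp add: sint_def)
qed

lemma P_diff:
	assumes "g \<in> Lp 2 S" "h \<in> Lp 2 S"
	shows "P n (%x. g x - h x) x = P n g x - P n h x"
proof -
	obtain C where C: "!!x::'a. \<bar>moll (m n) x\<bar> <= C" using moll_bounded by blast
	have i: "integrable lborel (%y. moll (m n) (A n x - y) * (indicator S y * f y))" if "f \<in> Lp 2 S" for f
		using integrable_mult_bounded[OF ind_integrable[OF that], of "%y. moll (m n) (A n x - y)" C] C by (simp add: mult.commute)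
	show ?thesis unfolding P_def conv_def
		using Bochner_Integration.integral_diff[OF i[OF assms(1)] i[OF assms(2)]] by (simp add: right_diff_distrib)
qed

lemma P_tendsto_L2:
	assumes g: "g \<in> Lp 2 S"
	shows "(%n. LBINT x:S. (P n g x - g x)^2) -->> 0"
	unfolding tendsto_iff
proof (intro allI impI)
	fix e :: real assume e: "e > 0"
	define K where "K = (3 * 2 ^ DIM('a) + 3 :: real)"
	have K: "K > 0" by (simp add: K_def add_pos_pos)
	obtain h M where h: "continuous_on UNIV h" "!!x. \<bar>h x\<bar> <= M" "(LBINT x:S. (g x - h x)^2) < e / (2 * K)"
		using L2_continuous_dense[OF Sm g, of "e / (2 * K)"] e K by auto
	have hm: "h \<in> borel_measurable borel" using h(1) by (rule borel_measurable_continuous_onI)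
	have hL: "h \<in> Lp 2 S" by (rule bounded_Lp2[OF Sm _ h(2)]) (use hm S(1) in "auto simp: smeas_def")
	have dL: "(%x. g x - h x) \<in> Lp 2 S" using Lp2_add[OF g hL, where r=1 and s="-1"] by simp
	have pL: "(%x. P n h x - h x) \<in> Lp 2 S" for n using Lp2_add[OF P_Lp2[OF hL] hL, where r=1 and s="-1"] by simp
	have "\<forall>\<^sub>F n in sequentially. (LBINT x:S. (P n h x - h x)^2) < e / 6"
		using e by (intro order_tendstoD(2)[OF P_tendsto_continuous_L2[OF h(1,2)]]) auto
	thus "\<forall>\<^sub>F n in sequentially. dist (LBINT x:S. (P n g x - g x)^2) 0 < e"
	proof eventually_elim
		case (elim n)
		have i1: "lint S (%x. (P n (%x. g x - h x) x)^2)" by (rule P_bound(1)[OF dL])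
		have i2: "lint S (%x. (P n h x - h x)^2)" "lint S (%x. (g x - h x)^2)"
			using pL dL by (auto simp: Lp2_square)
		have i3: "lint S (%x. (P n g x - g x)^2)"
			using Lp2_add[OF P_Lp2[OF g] g, where r=1 and s="-1"] by (simp add: Lp2_square)
		have "(LBINT x:S. (P n g x - g x)^2) <= (LBINT x:S. 3 * (P n (%x. g x - h x) x)^2 + (3 * (P n h x - h x)^2 + 3 * (g x - h x)^2))"
		proof (rule set_integral_mono[OF i3])
			show "lint S (%x. 3 * (P n (%x. g x - h x) x)^2 + (3 * (P n h x - h x)^2 + 3 * (g x - h x)^2))"
				by (intro set_integral_add(1) set_integrable_mult_right i1 i2)
			fix x
			define p q r where "p = P n (%x. g x - h x) x" and "q = P n h x - h x" and "r = h x - g x"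
			have "P n g x - g x = p + q + r" by (simp add: p_def q_def r_def P_diff[OF g hL])
			moreover have "(p + q + r)^2 <= 3 * p^2 + (3 * q^2 + 3 * r^2)"
			proof -
				have "0 <= (p - q)^2 + (q - r)^2 + (p - r)^2" by simp
				thus ?thesis by (simp add: power2_eq_square algebra_simps)
			qed
			moreover have "r^2 = (g x - h x)^2" by (simp add: r_def power2_commute)
			ultimately show "(P n g x - g x)^2 <= 3 * (P n (%x. g x - h x) x)^2 + (3 * (P n h x - h x)^2 + 3 * (g x - h x)^2)"
				by (simp add: p_def q_def)
		qed
		also have "... = 3 * (LBINT x:S. (P n (%x. g x - h x) x)^2) + (3 * (LBINT x:S. (P n h x - h x)^2) + 3 * (LBINT x:S. (g x - h x)^2))"
			by (subst set_integral_add(2); (intro set_integral_add(1) set_integrable_mult_right i1 i2)?)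
				 (subst set_integral_add(2); (intro set_integrable_mult_right i1 i2)?; simp)
		also have "... <= K * (LBINT x:S. (g x - h x)^2) + 3 * (LBINT x:S. (P n h x - h x)^2)"
			using P_bound(2)[OF dL, of n] by (simp add: K_def algebra_simps)
		also have "... < K * (e / (2 * K)) + 3 * (e / 6)"
			using h(3) elim K by (intro add_less_le_mono mult_strict_left_mono) auto
		also have "... = e" using K by simp
		finally have "(LBINT x:S. (P n g x - g x)^2) < e" .
		moreover have "0 <= (LBINT x:S. (P n g x - g x)^2)"
			unfolding sint_def by (intro integral_nonneg_AE) auto
		ultimately show ?case by simp
	qed
qed

lemma P_has_derivative:
	assumes "g \<in> Lp 2 S"
	shows "Ck (Suc 0) (P n g)"
		and "i \<in> Basis ==> pd i (P n g) x = l n * conv (pd i (moll (m n))) (%y. indicator S y * g y) (A n x)"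
proof -
	let ?G = "%y. indicator S y * g y"
	have G: "integrable lborel ?G" by (rule ind_integrable[OF assms])
	have C: "Ck (Suc 0) (conv (moll (m n)) ?G)" by (rule Ck_conv_moll[OF G])
	have D: "(P n g has_derivative (%d. frechet_derivative (conv (moll (m n)) ?G) (at (A n x)) (l n *R d))) (at x)" for x
		unfolding P_def A_affine
		by (rule has_derivative_compose[OF _ Ck_has_derivative[OF C]]) (auto intro!: derivative_eq_intros)
	have pd: "pd i (P n g) x = l n * pd i (conv (moll (m n)) ?G) (A n x)" for i x
	proof -
		have "linear (frechet_derivative (conv (moll (m n)) ?G) (at (A n x)))"
			using C by (intro linear_frechet_derivative) (simp only: Ck.simps)
		from linear_scale[OF this] show ?thesis unfolding pd_eq[OF D] by (simp add: pd_def)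
	qed
	show "i \<in> Basis ==> pd i (P n g) x = l n * conv (pd i (moll (m n))) ?G (A n x)"
		unfolding pd by (rule arg_cong[OF pd_conv[OF Ck_moll compact_cball moll_outside G]])
	have cont: "continuous_on UNIV (pd i (conv (moll (m n)) ?G))" if "i \<in> Basis" for i
		using C that by simp
	have cA: "continuous_on UNIV (A n)" unfolding A_affine by (intro continuous_intros)
	have "continuous_on UNIV (pd i (P n g))" if "i \<in> Basis" for i
		unfolding pd[abs_def] by (intro continuous_intros continuous_on_compose2[OF cont[OF that] cA]) auto
	thus "Ck (Suc 0) (P n g)" using D by (auto simp: differentiable_def)
qed

lemma pd_P:
	assumes g: "g \<in> Lp 2 S" and w: "has_weak_pd S i g h" and i: "i \<in> Basis" and x: "x \<in> closure S"
	shows "pd i (P n g) x = l n * P n h x"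
proof -
	define \<phi> where "\<phi> y = moll (m n) (A n x - y)" for y
	have D: "(\<phi> has_derivative (%d. frechet_derivative (moll (m n)) (at (A n x - y)) (- d))) (at y)" for y
		unfolding \<phi>_def by (rule has_derivative_compose[OF _ Ck_has_derivative[OF Ck_moll]]) (auto intro!: derivative_eq_intros)
	have C1: "Ck (Suc 0) (moll (m n) :: 'a => real)" by (rule Ck_moll)
	have p: "pd i \<phi> y = - pd i (moll (m n)) (A n x - y)" for y
	proof -
		have "linear (frechet_derivative (moll (m n) :: 'a => real) (at (A n x - y)))"
			using C1 by (intro linear_frechet_derivative) (simp only: Ck.simps)
		from linear_neg[OF this] show ?thesis unfolding pd_eq[OF D] by (simp add: pd_def)
	qed
	have Ckr: "Ck k (%y. \<theta> (v - y))" if "Ck k \<theta>" for k and \<theta> :: "'a => real" and v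
		using that
	proof (induction k arbitrary: \<theta>)
		case 0
		have "continuous_on UNIV (%y. v - y)" by (intro continuous_intros)
		from continuous_on_compose2[OF _ this, of UNIV \<theta>] 0 show ?case by simp
	next
		case (Suc k)
		have D: "((%y. \<theta> (v - y)) has_derivative (%d. frechet_derivative \<theta> (at (v - y)) (- d))) (at y)" for y
			by (rule has_derivative_compose[OF _ Ck_has_derivative[OF Suc.prems]]) (auto intro!: derivative_eq_intros)
		have "pd j (%y. \<theta> (v - y)) = (%y. (-1) * pd j \<theta> (v - y))" for j
		proof
			fix y
			have "linear (frechet_derivative \<theta> (at (v - y)))" using Suc.prems by (intro linear_frechet_derivative) (simp only: Ck.simps)
			from linear_neg[OF this] show "pd j (%y. \<theta> (v - y)) y = (-1) * pd j \<theta> (v - y)" unfolding pd_eq[OF D] by (simp add: pd_def)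
		qed
		moreover have "Ck k (%y. (-1) * pd j \<theta> (v - y))" if "j \<in> Basis" for j
			using Suc.prems that by (intro Ck_mult Ck_const Suc.IH[of "pd j \<theta>"]) simp
		ultimately show ?case using D by (auto simp: differentiable_def)
	qed
	have t: "\<phi> \<in> test_functions S"
	proof (rule test_functionsI)
		show "Ck k \<phi>" for k unfolding \<phi>_def[abs_def] by (rule Ckr[OF Ck_moll])
		show "cball (A n x) (1 / (real (m n) + 1)) \<subseteq> S" using inside[OF x] by (simp add: A_def)
		show "\<phi> y = 0" if "y \<notin> cball (A n x) (1 / (real (m n) + 1))" for y
			unfolding \<phi>_def by (rule moll_eq_0) (use that in "auto simp: dist_norm")
	qed auto
	have "(LBINT y:S. g y * pd i \<phi> y) = - (LBINT y:S. h y * \<phi> y)"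
		using w t by (auto simp: has_weak_pd_def)
	hence "conv (pd i (moll (m n))) (%y. indicator S y * g y) (A n x) = conv (moll (m n)) (%y. indicator S y * h y) (A n x)"
		unfolding p by (simp add: conv_def sint_def \<phi>_def mult.assoc mult.left_commute mult.commute)
	thus ?thesis using P_has_derivative(2)[OF g i] by (simp add: P_def)
qed

end

section \<open>The trace on the upper boundary\<close>

subsection \<open>Integration over rectangles\<close>

lemma rect_integral:
	fixes f :: "plane => real"
	assumes X: "X \<in> sets borel" "Y \<in> sets borel" and f: "lint (X \<times> Y) f"
	shows "(LBINT x:X\<times>Y. f x) = (LBINT s:X. (LBINT t:Y. f (s, t)))"
		and "lint X (%s. LBINT t:Y. f (s, t))"
		and "AE s in lborel. s \<in> X --> lint Y (%t. f (s, t))"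
proof -
	define F where "F s t = indicator X s * (indicator Y t * f (s, t))" for s t
	have F: "indicator (X \<times> Y) x *R f x = F (fst x) (snd x)" for x by (cases x) (auto simp: F_def indicator_def)
	have i0: "integrable lborel (%x. F (fst x) (snd x))" using f unfolding set_integrable_def F .
	hence i: "integrable (lborel \<Otimes>\<^sub>M lborel) (case_prod F)"
		by (simp add: lborel_prod case_prod_beta')
	have Fs: "F s t = indicator X s * (indicator Y t *R f (s, t))" for s t by (simp add: F_def)
	have e: "(LBINT t. F s t) = indicator X s *R (LBINT t:Y. f (s, t))" for s
		by (simp add: F_def sint_def)
	have "(LBINT x:X\<times>Y. f x) = (LBINT x. F (fst x) (snd x))" by (simp only: sint_def F)
	also have "... = (LBINT s. (LBINT t. F s t))"
		using lborel_pair.integral_fst[OF i] by (simp add: lborel_prod case_prod_beta')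
	also have "... = (LBINT s:X. (LBINT t:Y. f (s, t)))" by (simp only: e sint_def[of _ X])
	finally show "(LBINT x:X\<times>Y. f x) = (LBINT s:X. (LBINT t:Y. f (s, t)))" .
	show "lint X (%s. LBINT t:Y. f (s, t))"
		using lborel_pair.integrable_fst[OF i] by (simp only: set_integrable_def e)
	show "AE s in lborel. s \<in> X --> lint Y (%t. f (s, t))"
		using lborel_pair.AE_integrable_fst[OF i] by eventually_elim (auto simp: F_def set_integrable_def)
qed

lemma rect_L2_average:
	fixes h :: "plane => real"
	assumes X: "X \<in> sets borel" "Y \<in> sets borel" and Y: "emeasure lborel Y < \<infinity>" and h: "h \<in> Lp 2 (X \<times> Y)"
		and X': "emeasure lborel (X \<times> Y) < \<infinity>"
	shows "(%s. LBINT t:Y. h (s, t)) \<in> Lp 2 X"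
		and "(LBINT s:X. (LBINT t:Y. h (s, t))^2) <= measure lborel Y * (LBINT x:X\<times>Y. (h x)^2)"
proof -
	have XY: "X \<times> Y \<in> sets lborel" using X by (simp add: borel_Times)
	have hi: "lint (X \<times> Y) h" by (rule Lp2_integrable[OF XY X' h])
	have h2: "lint (X \<times> Y) (%x. (h x)^2)" using h by (simp add: Lp2_square)
	note r1 = rect_integral[OF X hi] and r2 = rect_integral[OF X h2]
	have m: "lmeas X (%s. LBINT t:Y. h (s, t))" using r1(2) by (auto simp: set_integrable_def smeas_def)
	have oneY: "(%_. 1) \<in> Lp 2 Y" by (rule bounded_Lp2[where B=1]) (use X Y in "auto simp: smeas_def")
	have mY: "(LBINT t:Y. 1^2) = measure lborel Y" using X Y by (simp add: sint_def)
	have ae: "AE s in lborel. s \<in> X --> (LBINT t:Y. h (s, t))^2 <= measure lborel Y * (LBINT t:Y. (h (s, t))^2)"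
		using r1(3) r2(3)
	proof eventually_elim
		case (elim s)
		show ?case
		proof
			assume s: "s \<in> X"
			have "(%t. h (s, t)) \<in> Lp 2 Y"
				using elim s by (auto simp: Lp2_square set_integrable_def smeas_def)
			from Lp2_Cauchy_Schwarz[OF this oneY] show "(LBINT t:Y. h (s, t))^2 <= measure lborel Y * (LBINT t:Y. (h (s, t))^2)"
				unfolding mY by (simp add: mult.commute)
		qed
	qed
	have bnd: "integrable lborel (%s. indicator X s *R (measure lborel Y * (LBINT t:Y. (h (s, t))^2)))"
		using set_integrable_mult_right[OF r2(2), of "measure lborel Y"] by (simp add: set_integrable_def)
	have int: "integrable lborel (%s. indicator X s *R (LBINT t:Y. h (s, t))^2)"
	proof (rule Bochner_Integration.integrable_bound[OF bnd])
		have "(%s. indicator X s *R (LBINT t:Y. h (s, t))^2) = (%s. (indicator X s *R (LBINT t:Y. h (s, t)))^2)"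
			by (auto simp: indicator_def)
		thus "(%s. indicator X s *R (LBINT t:Y. h (s, t))^2) \<in> borel_measurable lborel"
			using m by (simp add: smeas_def)
		show "AE s in lborel. norm (indicator X s *R (LBINT t:Y. h (s, t))^2) <= norm (indicator X s *R (measure lborel Y * (LBINT t:Y. (h (s, t))^2)))"
			using ae by eventually_elim (auto simp: indicator_def)
	qed
	thus "(%s. LBINT t:Y. h (s, t)) \<in> Lp 2 X" using m by (simp add: Lp2_square set_integrable_def)
	have "(LBINT s:X. (LBINT t:Y. h (s, t))^2) <= (LBINT s:X. measure lborel Y * (LBINT t:Y. (h (s, t))^2))"
		unfolding sint_def[of _ X]
		by (rule integral_mono_AE[OF int bnd]) (use ae in "eventually_elim, auto simp: indicator_def")
	also have "... = measure lborel Y * (LBINT x:X\<times>Y. (h x)^2)" using r2(1) by simp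
	finally show "(LBINT s:X. (LBINT t:Y. h (s, t))^2) <= measure lborel Y * (LBINT x:X\<times>Y. (h x)^2)" .
qed

subsection \<open>Geometry of the lower rectangle\<close>

lemma open_Omega0: "open (Omega0 a b)"
	by (simp add: Omega0_def interval_I_def open_Times)

lemma bounded_Omega0: "bounded (Omega0 a b)"
	by (simp add: Omega0_def interval_I_def bounded_Times)

lemma Omega0_sets: "Omega0 a b \<in> sets lborel" "emeasure lborel (Omega0 a b) < \<infinity>"
	using open_Omega0[of a b] emeasure_bounded_finite[OF bounded_Omega0, of a b] by auto

lemma interval_I_sets: "interval_I a \<in> sets borel" "emeasure lborel (interval_I a) < \<infinity>" "open (interval_I a)"
	using emeasure_bounded_finite[of "{0<..<a}"] by (auto simp: interval_I_def)

lemma closure_Omega0: "a > 0 ==> b > 0 ==> closure (Omega0 a b) = {0..a} \<times> {-b..0}"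
	by (simp add: Omega0_def interval_I_def closure_Times)

lemma Ck1_weak_pd:
	fixes S :: "(plane) set"
	assumes f: "Ck (Suc 0) f" and S: "open S" "bounded S" and i: "i \<in> Basis"
	shows "has_weak_pd S i f (pd i f)" "f \<in> Lp 2 S" "pd i f \<in> Lp 2 S"
proof -
	have Sm: "S \<in> sets lborel" "emeasure lborel S < \<infinity>" using S emeasure_bounded_finite[OF S(2)] by auto
	have c: "continuous_on UNIV f" "continuous_on UNIV (pd i f)" using Ck_SucD[OF f] f i by (auto simp only: Ck.simps)
	have bd: "\<exists>B. \<forall>x\<in>S. \<bar>h x\<bar> <= B" if "continuous_on UNIV h" for h :: "plane => real"
	proof -
		have "compact (h ` closure S)"
			using S(2) continuous_on_subset[OF that] by (intro compact_continuous_image) auto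
		hence "bounded (h ` closure S)" by (rule compact_imp_bounded)
		then obtain B where "\<forall>y\<in>h ` closure S. norm y <= B" unfolding bounded_iff by blast
		hence "\<forall>x\<in>S. \<bar>h x\<bar> <= B" using closure_subset[of S] unfolding real_norm_def by blast
		thus ?thesis by blast
	qed
	have L: "h \<in> Lp 2 S" if "continuous_on UNIV h" for h :: "plane => real"
	proof -
		obtain B where "!!x. x \<in> S ==> \<bar>h x\<bar> <= B" using bd[OF \<open>continuous_on UNIV h\<close>] by blast
		moreover have "lmeas S h"
			unfolding smeas_def using borel_measurable_continuous_onI[OF that] Sm by auto
		ultimately show ?thesis using bounded_Lp2[OF Sm] by blast
	qed
	show l: "f \<in> Lp 2 S" "pd i f \<in> Lp 2 S" using L c by auto
	obtain B where B: "!!x. x \<in> S ==> \<bar>f x\<bar> <= B" using bd[OF c(1)] by blast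
	obtain B' where B': "!!x. x \<in> S ==> \<bar>pd i f x\<bar> <= B'" using bd[OF c(2)] by blast
	show "has_weak_pd S i f (pd i f)"
	proof (rule has_weak_pd_slicesI[OF S(1) _ _ _ slicewise_Ck[OF f]])
		show "f \<in> L1loc S" "pd i f \<in> L1loc S" using integrable_L1loc Lp2_integrable[OF Sm] l by blast+
		show "i = (1, 0) \<or> i = (0, 1)" using i by (simp add: Basis_real2)
		show "\<bar>f x\<bar> <= max B B'" "\<bar>pd i f x\<bar> <= max B B'" if "x \<in> S" for x using B[OF that] B'[OF that] by auto
	qed
qed

lemma H1_norm_square:
	fixes S :: "(plane) set"
	assumes S: "open S" and v: "v \<in> Lp 2 S" "has_weak_pd S (1, 0) v g1" "has_weak_pd S (0, 1) v g2" "g1 \<in> Lp 2 S" "g2 \<in> Lp 2 S"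
	shows "(H1_norm S v)^2 = (LBINT x:S. (v x)^2) + ((LBINT x:S. (g1 x)^2) + (LBINT x:S. (g2 x)^2))"
proof -
	have v1: "v \<in> sobolev 1 2 S"
		by (rule sobolev1I[where g="%i. if i = (1, 0) then g1 else g2"]) (use v in "auto simp: Basis_real2")
	have B: "(1, 0) \<in> (Basis :: (plane) set)" "(0, 1) \<in> (Basis :: (plane) set)" by (auto simp: Basis_real2)
	note w1 = sobolev1D[OF v1 S B(1)] and w2 = sobolev1D[OF v1 S B(2)]
	have ae: "AE x in lborel. x \<in> S --> wpd S (1, 0) v x = g1 x" "AE x in lborel. x \<in> S --> wpd S (0, 1) v x = g2 x"
		by (rule wpd_AE_eq[OF S v(2)], rule wpd_AE_eq[OF S v(3)])
	have gi: "lint S (%x. (g1 x)^2)" "lint S (%x. (g2 x)^2)" using v by (auto simp: Lp2_square)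
	have wi: "lint S (%x. (wpd S (1,0) v x)^2)" "lint S (%x. (wpd S (0,1) v x)^2)" using w1 w2 by (auto simp: Lp2_square)
	have "(LBINT x:S. wgrad S v x \<bullet> wgrad S v x) = (LBINT x:S. (wpd S (1,0) v x)^2 + (wpd S (0,1) v x)^2)"
		by (simp add: wgrad_real2 power2_eq_square)
	also have "... = (LBINT x:S. (g1 x)^2 + (g2 x)^2)"
	proof (rule set_integral_cong_AE_simple)
		show "AE x in lborel. x \<in> S --> (wpd S (1,0) v x)^2 + (wpd S (0,1) v x)^2 = (g1 x)^2 + (g2 x)^2"
			using ae by eventually_elim auto
		show "lmeas S (%x. (wpd S (1,0) v x)^2 + (wpd S (0,1) v x)^2)" "lmeas S (%x. (g1 x)^2 + (g2 x)^2)"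
			using set_integral_add(1)[OF wi] set_integral_add(1)[OF gi] by (auto simp: set_integrable_def smeas_def)
	qed
	also have "... = (LBINT x:S. (g1 x)^2) + (LBINT x:S. (g2 x)^2)" by (rule set_integral_add(2)[OF gi])
	finally have e: "H1_inner S v v = (LBINT x:S. (v x)^2) + ((LBINT x:S. (g1 x)^2) + (LBINT x:S. (g2 x)^2))"
		by (simp add: H1_inner_def power2_eq_square)
	moreover have "0 <= (LBINT x:S. (f x)^2)" for f :: "plane => real"
		unfolding sint_def by (intro integral_nonneg_AE) auto
	ultimately show ?thesis by (simp add: H1_norm_def)
qed

text \<open>The integral over vertical lines of $\partial_2((x_2+b)u)/b$; it represents the trace.\<close>
definition trace_average :: "real => real => (plane => real) => (plane => real) => real => real" where
	"trace_average a b u u2 s = 1 / b * (LBINT y:{-b<..<0}. u (s, y) + (y + b) * u2 (s, y))"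

lemma set_integral_nonneg_simple: "(!!x. x \<in> S ==> 0 <= f x) ==> 0 <= (LBINT x:S. f x :: real)"
	unfolding sint_def by (intro integral_nonneg_AE) (auto simp: indicator_def)

lemma dilation_parameters:
	fixes a b :: real
	assumes a: "a > 0" and b: "b > 0"
	obtains l :: "nat => real" and m :: "nat => nat" where "dilated_mollification (Omega0 a b) (a/2, - b/2) l m" "!!n. l n <= 1"
proof -
	define l where "l n = 1 - 1 / (real n + 2)" for n :: nat
	define r where "r n = min a b / (4 * (real n + 2))" for n :: nat
	have r: "r n > 0" for n using a b by (auto simp: r_def)
	have "\<exists>m\<ge>n. 1 / (real m + 1) < r n" for n
	proof -
		have "\<forall>\<^sub>F m in sequentially. 1 / (real m + 1) < r n & m \<ge> n"
			using eventually_inverse_Suc_less[OF r[of n]] eventually_ge_at_top[of n] by eventually_elim simp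
		thus ?thesis by (auto simp: eventually_sequentially)
	qed
	then obtain m where m: "!!n. n <= m n" "!!n. 1 / (real (m n) + 1) < r n" by metis
	have "dilated_mollification (Omega0 a b) (a/2, - b/2) l m"
	proof
		show "open (Omega0 a b)" "bounded (Omega0 a b)" by (rule open_Omega0 bounded_Omega0)+
		show "1 / 2 <= l n" for n by (simp add: l_def field_simps)
		have "(%n. inverse (real (Suc (Suc n)))) -->> 0"
			by (rule LIMSEQ_Suc[OF LIMSEQ_inverse_real_of_nat])
		hence "(%n. 1 - inverse (real (Suc (Suc n)))) -->> 1 - 0" by (intro tendsto_intros)
		thus "l -->> 1" by (simp add: l_def[abs_def] inverse_eq_divide add.commute)
		show "filterlim m at_top sequentially"
			by (rule filterlim_at_top_mono[OF filterlim_ident]) (use m(1) in auto)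
		fix n x assume x: "x \<in> closure (Omega0 a b)"
		show "cball ((a/2, - b/2) + l n *R (x - (a/2, - b/2))) (1 / (real (m n) + 1)) \<subseteq> Omega0 a b"
		proof
			fix y assume y: "y \<in> cball ((a/2, - b/2) + l n *R (x - (a/2, - b/2))) (1 / (real (m n) + 1))"
			have l0: "0 <= l n" by (simp add: l_def field_simps)
			define c where "c = (a/2, - b/2) + l n *R (x - (a/2, - b/2))"
			have d: "dist c y < r n" using y m(2)[of n] by (simp add: c_def)
			have f1: "\<bar>fst c - fst y\<bar> < r n" using d dist_fst_le[of c y] by (simp add: dist_real_def)
			have f2: "\<bar>snd c - snd y\<bar> < r n" using d dist_snd_le[of c y] by (simp add: dist_real_def)
			have x1: "\<bar>fst x - a/2\<bar> <= a/2" "\<bar>snd x + b/2\<bar> <= b/2" using x unfolding closure_Omega0[OF a b] mem_Times_iff atLeastAtMost_iff by (intro abs_leI; linarith)+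
			have c1: "\<bar>fst c - a/2\<bar> <= l n * (a/2)" "\<bar>snd c + b/2\<bar> <= l n * (b/2)"
				using mult_left_mono[OF x1(1) l0] mult_left_mono[OF x1(2) l0] l0 by (auto simp: c_def abs_mult)
			have h1: "r n <= a / (4 * (real n + 2))" "r n <= b / (4 * (real n + 2))"
				unfolding r_def by (intro divide_right_mono; simp)+
			have h2: "a / (4 * (real n + 2)) < a/2 - l n * (a/2)" "b / (4 * (real n + 2)) < b/2 - l n * (b/2)"
			proof -
				have "c / (4 * (real n + 2)) < c/2 - l n * (c/2)" if "c > 0" for c :: real
				proof -
					have e: "c/2 - l n * (c/2) = 2 * (c / (4 * (real n + 2)))" by (simp add: l_def field_simps)
					have "c / (4 * (real n + 2)) > 0" using that by simp
					thus ?thesis unfolding e by linarith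
				qed
				with a b show "a / (4 * (real n + 2)) < a/2 - l n * (a/2)" "b / (4 * (real n + 2)) < b/2 - l n * (b/2)" by blast+
			qed
			have key: "\<bar>y' - A\<bar> < A" if "\<bar>c' - y'\<bar> < r'" "\<bar>c' - A\<bar> <= E" "r' <= q" "q < A - E" for y' c' A E r' q :: real
				using that by linarith
			have key': "\<bar>y' + A\<bar> < A" if "\<bar>c' - y'\<bar> < r'" "\<bar>c' + A\<bar> <= E" "r' <= q" "q < A - E" for y' c' A E r' q :: real
				using that by linarith
			have "\<bar>fst y - a/2\<bar> < a/2" "\<bar>snd y + b/2\<bar> < b/2"
				using key[OF f1 c1(1) h1(1) h2(1)] key'[OF f2 c1(2) h1(2) h2(2)] by auto
			hence "0 < fst y" "fst y < a" "- b < snd y" "snd y < 0" unfolding abs_less_iff by linarith+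
			thus "y \<in> Omega0 a b" by (cases y) (auto simp: Omega0_def interval_I_def)
		qed
	qed
	moreover have "l n <= 1" for n by (simp add: l_def)
	ultimately show ?thesis using that by blast
qed

lemma Ck1_trace_formula:
	fixes U :: "plane => real"
	assumes U: "Ck (Suc 0) U" and b: "b > 0"
	shows "U (s, 0) = 1 / b * (LBINT y:{-b<..<0}. U (s, y) + (y + b) * pd (0, 1) U (s, y))"
proof -
	have c: "continuous_on UNIV U" "continuous_on UNIV (pd (0, 1) U)"
		using Ck_SucD[OF U] U by (auto simp: Basis_real2)
	have d: "((%y. U (s, y)) has_real_derivative pd (0, 1) U (s, y)) (at y)" for y
	proof -
		have "((%t. (s, t)) has_derivative (%t. (0, t))) (at y)" by (auto intro!: derivative_eq_intros)
		from has_derivative_compose[OF this Ck_has_derivative[OF U]]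
		have D: "((%t. U (s, t)) has_derivative (%t. frechet_derivative U (at (s, y)) (0, t))) (at y)" .
		have L: "linear (frechet_derivative U (at (s, y)))" using U by (intro linear_frechet_derivative) (simp only: Ck.simps)
		have "frechet_derivative U (at (s, y)) (0, t) = pd (0, 1) U (s, y) * t" for t
		proof -
			have "(0, t) = t *R (0::real, 1::real)" by simp
			thus ?thesis unfolding pd_def by (simp only: linear_scale[OF L, of t "(0, 1)"] real_scaleR_def mult.commute)
		qed
		with D show ?thesis by (simp add: has_field_derivative_def)
	qed
	have cs: "continuous_on A (%y. U (s, y))" "continuous_on A (%y. pd (0, 1) U (s, y))" for A
	proof -
		have "continuous_on A (%y. (s, y))" by (intro continuous_intros)
		from continuous_on_compose2[OF c(1) this] continuous_on_compose2[OF c(2) this]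
		show "continuous_on A (%y. U (s, y))" "continuous_on A (%y. pd (0, 1) U (s, y))" by auto
	qed
	have "(LBINT y:{-b..0}. U (s, y) + (y + b) * pd (0, 1) U (s, y)) = (0 + b) * U (s, 0) - (-b + b) * U (s, -b)"
		unfolding sint_def real_scaleR_def mult.commute[of "indicator _ _"]
	proof (rule integral_FTC_Icc_real)
		show "DERIV (%y. (y + b) * U (s, y)) x :> U (s, x) + (x + b) * pd (0, 1) U (s, x)" for x
			by (auto intro!: derivative_eq_intros d)
		show "isCont (%x. U (s, x) + (x + b) * pd (0, 1) U (s, x)) x" for x
			using cs[of UNIV] by (intro continuous_intros) (simp_all add: continuous_on_eq_continuous_at)
	qed (use b in auto)
	moreover have "(LBINT y:{-b..0}. U (s, y) + (y + b) * pd (0, 1) U (s, y)) = (LBINT y:{-b<..<0}. U (s, y) + (y + b) * pd (0, 1) U (s, y))"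
		unfolding sint_def
		by (rule integral_discrete_difference[of "{-b, 0}"]) (auto simp: indicator_def)
	ultimately show ?thesis using b by simp
qed

text \<open>By the Cauchy-Schwarz inequality on vertical lines, the average depends continuously on \<open>u\<close> in $H^1$; on smooth functions it is the boundary value.\<close>
lemma has_trace0_exists:
	assumes a: "a > 0" and b: "b > 0" and u: "u \<in> H1 (Omega0 a b)"
	shows "has_trace0 a b u (trace_average a b u (wpd (Omega0 a b) (0, 1) u))"
proof -
	define S where "S = Omega0 a b"
	have oS: "open S" "bounded S" unfolding S_def by (rule open_Omega0 bounded_Omega0)+
	have Sm: "S \<in> sets lborel" "emeasure lborel S < \<infinity>" unfolding S_def by (rule Omega0_sets)+
	have SI: "S = interval_I a \<times> {-b<..<0}" by (simp add: S_def Omega0_def)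
	have B: "(1, 0) \<in> (Basis :: (plane) set)" "(0, 1) \<in> (Basis :: (plane) set)" by (auto simp: Basis_real2)
	define g1 g2 where "g1 = wpd S (1, 0) u" and "g2 = wpd S (0, 1) u"
	have u': "u \<in> sobolev 1 2 S" using u by (simp add: S_def)
	note w1 = sobolev1D[OF u' oS(1) B(1), folded g1_def] and w2 = sobolev1D[OF u' oS(1) B(2), folded g2_def]
	obtain l m where dm: "dilated_mollification S (a/2, - b/2) l m" and l1: "!!n. l n <= 1"
		using dilation_parameters[OF a b] unfolding S_def by blast
	interpret dilated_mollification S "(a/2, - b/2)" l m by (rule dm)
	define U where "U n = P n u" for n
	have UC: "Ck (Suc 0) (U n)" for n unfolding U_def by (rule P_has_derivative(1)[OF w1(1)])
	note U1 = Ck1_weak_pd[OF UC oS B(1)] and U2 = Ck1_weak_pd[OF UC oS B(2)]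
	have pdU: "pd (1, 0) (U n) x = l n * P n g1 x" "pd (0, 1) (U n) x = l n * P n g2 x" if "x \<in> S" for n x
		unfolding U_def using pd_P[OF w1(1) w1(2) B(1) subsetD[OF closure_subset that]] pd_P[OF w2(1) w2(2) B(2) subsetD[OF closure_subset that]] .
	have conv0: "(%n. LBINT x:S. (U n x - u x)^2) -->> 0" unfolding U_def by (rule P_tendsto_L2[OF w1(1)])
	have convg: "(%n. LBINT x:S. (l n * P n g x - g x)^2) -->> 0" if g: "g \<in> Lp 2 S" for g
	proof (rule tendsto_sandwich[OF _ _ tendsto_const])
		have "(%n. 2 * (LBINT x:S. (P n g x - g x)^2) + 2 * (1 - l n)^2 * (4 * (LBINT x:S. (g x)^2))) -->> 2 * 0 + 2 * (1 - 1)^2 * (4 * (LBINT x:S. (g x)^2))"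
			by (intro tendsto_intros P_tendsto_L2[OF g] l)
		thus "(%n. 2 * (LBINT x:S. (P n g x - g x)^2) + 2 * (1 - l n)^2 * (4 * (LBINT x:S. (g x)^2))) -->> 0" by simp
		show "\<forall>\<^sub>F n in sequentially. (LBINT x:S. (l n * P n g x - g x)^2) <= 2 * (LBINT x:S. (P n g x - g x)^2) + 2 * (1 - l n)^2 * (4 * (LBINT x:S. (g x)^2))"
		proof (rule always_eventually, rule allI)
			fix n
			have i: "lint S (%x. (l n * P n g x - g x)^2)" "lint S (%x. (P n g x - g x)^2)" "lint S (%x. (P n g x)^2)"
				using Lp2_add[OF P_Lp2[OF g] g, where r="l n" and s="-1"] Lp2_add[OF P_Lp2[OF g] g, where r=1 and s="-1"] P_Lp2[OF g] by (auto simp: Lp2_square)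
			have "(LBINT x:S. (l n * P n g x - g x)^2) <= (LBINT x:S. 2 * (P n g x - g x)^2 + (2 * (1 - l n)^2) * (P n g x)^2)"
			proof (rule set_integral_mono[OF i(1)])
				show "lint S (%x. 2 * (P n g x - g x)^2 + (2 * (1 - l n)^2) * (P n g x)^2)"
					by (intro set_integral_add(1) set_integrable_mult_right i)
				fix x
				define p q where "p = P n g x - g x" and "q = (1 - l n) * P n g x"
				have e1: "l n * P n g x - g x = p - q" by (simp add: p_def q_def algebra_simps)
				have e2: "(2 * (1 - l n)^2) * (P n g x)^2 = 2 * q^2" by (simp add: q_def power_mult_distrib)
				have "(p - q)^2 <= 2 * p^2 + 2 * q^2"
				proof -
					have "0 <= (p + q)^2" by simp
					thus ?thesis by (simp add: power2_eq_square algebra_simps)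
				qed
				thus "(l n * P n g x - g x)^2 <= 2 * (P n g x - g x)^2 + (2 * (1 - l n)^2) * (P n g x)^2"
					unfolding e1 e2 p_def[symmetric] .
			qed
			also have "... = 2 * (LBINT x:S. (P n g x - g x)^2) + (2 * (1 - l n)^2) * (LBINT x:S. (P n g x)^2)"
				using set_integral_add(2)[OF set_integrable_mult_right[OF i(2)] set_integrable_mult_right[OF i(3)], of 2 "2 * (1 - l n)^2"]
				by (simp only: set_integral_mult_right)
			also have "... <= 2 * (LBINT x:S. (P n g x - g x)^2) + 2 * (1 - l n)^2 * (4 * (LBINT x:S. (g x)^2))"
				using P_bound(2)[OF g, of n] by (intro add_left_mono mult_left_mono) auto
			finally show "(LBINT x:S. (l n * P n g x - g x)^2) <= 2 * (LBINT x:S. (P n g x - g x)^2) + 2 * (1 - l n)^2 * (4 * (LBINT x:S. (g x)^2))" .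
		qed
	qed (auto intro!: always_eventually set_integral_nonneg_simple)
	have cong: "(LBINT x:S. (pd (1, 0) (U n) x - g1 x)^2) = (LBINT x:S. (l n * P n g1 x - g1 x)^2)"
		"(LBINT x:S. (pd (0, 1) (U n) x - g2 x)^2) = (LBINT x:S. (l n * P n g2 x - g2 x)^2)" for n
		by (rule set_integral_cong_simple; simp add: pdU)+
	have L2d: "(%x. U n x - u x) \<in> Lp 2 S" "(%x. pd (1, 0) (U n) x - g1 x) \<in> Lp 2 S" "(%x. pd (0, 1) (U n) x - g2 x) \<in> Lp 2 S" for n
		using Lp2_add[OF U1(2) w1(1), where r=1 and s="-1"] Lp2_add[OF U1(3) w1(3), where r=1 and s="-1"] Lp2_add[OF U2(3) w2(3), where r=1 and s="-1"] by auto
	have nsq: "(H1_norm S (%x. U n x - u x))^2 = (LBINT x:S. (U n x - u x)^2) + ((LBINT x:S. (l n * P n g1 x - g1 x)^2) + (LBINT x:S. (l n * P n g2 x - g2 x)^2))" for n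
		unfolding cong[symmetric]
	proof (rule H1_norm_square[OF oS(1) L2d(1) _ _ L2d(2,3)])
		show "has_weak_pd S (1, 0) (%x. U n x - u x) (%x. pd (1, 0) (U n) x - g1 x)"
			using has_weak_pd_lincomb[OF U1(1) w1(2) B(1), where r=1 and s="-1"] by simp
		show "has_weak_pd S (0, 1) (%x. U n x - u x) (%x. pd (0, 1) (U n) x - g2 x)"
			using has_weak_pd_lincomb[OF U2(1) w2(2) B(2), where r=1 and s="-1"] by simp
	qed
	have "(%n. (H1_norm S (%x. U n x - u x))^2) -->> 0 + (0 + 0)"
		unfolding nsq by (intro tendsto_add conv0 convg w1 w2)
	hence "(%n. sqrt ((H1_norm S (%x. U n x - u x))^2)) -->> sqrt 0" by (intro tendsto_intros) simp
	hence N: "(%n. H1_norm S (%x. U n x - u x)) -->> 0"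
		by (simp add: tendsto_rabs_zero_iff)
	define t where "t = trace_average a b u g2"
	define k where "k n x = (U n x - u x) + (snd x + b) * (pd (0, 1) (U n) x - g2 x)" for n x
	have sb: "\<bar>snd x + b\<bar> <= b" if "x \<in> S" for x using that by (auto simp: SI)
	have msnd: "lmeas S (%x. snd x + b)" unfolding smeas_def using Sm by measurable
	have mulL: "(%x. (snd x + b) * f x) \<in> Lp 2 S" if "f \<in> Lp 2 S" for f
		using Lp2_mult_bounded[OF that msnd sb] by (simp add: mult.commute)
	have kL: "k n \<in> Lp 2 S" for n unfolding k_def[abs_def]
		using Lp2_add[OF L2d(1) mulL[OF L2d(3)], where r=1 and s=1] by simp
	have X: "interval_I a \<in> sets borel" "{-b<..<0} \<in> sets borel" using interval_I_sets by auto
	have Y: "emeasure lborel {-b<..<0} < \<infinity>" "measure lborel {-b<..<0} = b" using b by auto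
	have hL: "(%x. u x + (snd x + b) * g2 x) \<in> Lp 2 S" using Lp2_add[OF w1(1) mulL[OF w2(3)], where r=1 and s=1] by simp
	have hi: "lint (interval_I a \<times> {-b<..<0}) (%x. u x + (snd x + b) * g2 x)"
		using Lp2_integrable[OF Sm hL] by (simp add: SI)
	have "(%s. LBINT y:{-b<..<0}. u (s, y) + (y + b) * g2 (s, y)) \<in> Lp 2 (interval_I a)"
		using rect_L2_average(1)[OF X Y(1) hL[unfolded SI]] Sm(2) by (simp add: SI)
	hence tL: "t \<in> Lp 2 (interval_I a)"
		unfolding t_def trace_average_def[abs_def] using Lp2_add[where r="1/b" and s=0] by fastforce
	have Uk: "AE s in lborel. s \<in> interval_I a --> U n (s, 0) - t s = 1 / b * (LBINT y:{-b<..<0}. k n (s, y))" for n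
	proof -
		have hiU: "lint (interval_I a \<times> {-b<..<0}) (%x. U n x + (snd x + b) * pd (0, 1) (U n) x)"
			using Lp2_integrable[OF Sm Lp2_add[OF U1(2)[of n] mulL[OF U2(3)[of n]], where r=1 and s=1]] by (simp add: SI)
		show ?thesis using rect_integral(3)[OF X hi] rect_integral(3)[OF X hiU]
		proof eventually_elim
			case (elim s)
			show ?case
			proof
				assume "s \<in> interval_I a"
				hence i: "lint {-b<..<0} (%y. u (s, y) + (y + b) * g2 (s, y))" "lint {-b<..<0} (%y. U n (s, y) + (y + b) * pd (0, 1) (U n) (s, y))"
					using elim by auto
				have "U n (s, 0) - t s = 1 / b * ((LBINT y:{-b<..<0}. U n (s, y) + (y + b) * pd (0, 1) (U n) (s, y)) - (LBINT y:{-b<..<0}. u (s, y) + (y + b) * g2 (s, y)))"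
					unfolding t_def trace_average_def using Ck1_trace_formula[OF UC[of n] b, of s] by (simp add: right_diff_distrib)
				also have "... = 1 / b * (LBINT y:{-b<..<0}. (U n (s, y) + (y + b) * pd (0, 1) (U n) (s, y)) - (u (s, y) + (y + b) * g2 (s, y)))"
					using set_integral_diff(2)[OF i(2,1)] by simp
				also have "... = 1 / b * (LBINT y:{-b<..<0}. k n (s, y))" by (simp add: k_def algebra_simps)
				finally show "U n (s, 0) - t s = 1 / b * (LBINT y:{-b<..<0}. k n (s, y))" .
			qed
		qed
	qed
	have "(%n. LBINT s:interval_I a. (U n (s, 0) - t s)^2) -->> 0"
	proof (rule tendsto_sandwich[OF _ _ tendsto_const])
		have "(%n. 1 / b * (2 * (LBINT x:S. (U n x - u x)^2) + (2 * b^2) * (LBINT x:S. (l n * P n g2 x - g2 x)^2))) -->> 1 / b * (2 * 0 + (2 * b^2) * 0)"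
			by (intro tendsto_intros conv0 convg w2)
		thus "(%n. 1 / b * (2 * (LBINT x:S. (U n x - u x)^2) + (2 * b^2) * (LBINT x:S. (l n * P n g2 x - g2 x)^2))) -->> 0" by simp
		show "\<forall>\<^sub>F n in sequentially. (LBINT s:interval_I a. (U n (s, 0) - t s)^2) <= 1 / b * (2 * (LBINT x:S. (U n x - u x)^2) + (2 * b^2) * (LBINT x:S. (l n * P n g2 x - g2 x)^2))"
		proof (rule always_eventually, rule allI)
			fix n
			note ra = rect_L2_average[OF X Y(1) kL[of n, unfolded SI] Sm(2)[unfolded SI]]
			have mk: "lmeas (interval_I a) (%s. (1 / b * (LBINT y:{-b<..<0}. k n (s, y)))^2)"
				using Lp2_add[OF ra(1) ra(1), where r="1/b" and s=0]
				by (auto simp: Lp2_square set_integrable_def smeas_def)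
			have mU: "lmeas (interval_I a) (%s. (U n (s, 0) - t s)^2)"
			proof -
				have cU: "continuous_on UNIV (U n)" using Ck_SucD[OF UC[of n]] by simp
				have "continuous_on UNIV (%s::real. (s, 0::real))" by (intro continuous_intros)
				from continuous_on_compose2[OF cU this] have "continuous_on UNIV (%s. U n (s, 0))" by simp
				hence [measurable]: "(%s. U n (s, 0)) \<in> borel_measurable borel" by (rule borel_measurable_continuous_onI)
				have [measurable]: "(%s. indicator (interval_I a) s * t s) \<in> borel_measurable borel" "interval_I a \<in> sets borel"
					using tL X by (auto simp: Lp_def smeas_def)
				have "(%s. indicator (interval_I a) s *R (U n (s, 0) - t s)^2) = (%s. indicator (interval_I a) s * (U n (s, 0) - indicator (interval_I a) s * t s)^2)"
					by (auto simp: indicator_def)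
				thus ?thesis unfolding smeas_def by simp
			qed
			have "(LBINT s:interval_I a. (U n (s, 0) - t s)^2) = (LBINT s:interval_I a. (1 / b * (LBINT y:{-b<..<0}. k n (s, y)))^2)"
				by (rule set_integral_cong_AE_simple[OF _ mU mk]) (use Uk[of n] in "eventually_elim, auto")
			also have "... = 1 / b^2 * (LBINT s:interval_I a. (LBINT y:{-b<..<0}. k n (s, y))^2)"
				by (simp add: power_mult_distrib power_divide)
			also have "... <= 1 / b^2 * (b * (LBINT x:S. (k n x)^2))"
				using ra(2) by (intro mult_left_mono) (auto simp: SI Y(2))
			also have "... = 1 / b * (LBINT x:S. (k n x)^2)" using b by (simp add: power2_eq_square)
			also have "... <= 1 / b * (LBINT x:S. 2 * (U n x - u x)^2 + (2 * b^2) * (pd (0, 1) (U n) x - g2 x)^2)"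
			proof (intro mult_left_mono set_integral_mono)
				show "lint S (%x. (k n x)^2)" using kL by (simp add: Lp2_square)
				show "lint S (%x. 2 * (U n x - u x)^2 + (2 * b^2) * (pd (0, 1) (U n) x - g2 x)^2)"
					using L2d[of n] by (intro set_integral_add(1) set_integrable_mult_right) (auto simp: Lp2_square)
				fix x assume x: "x \<in> S"
				define p q where "p = U n x - u x" and "q = pd (0, 1) (U n) x - g2 x"
				have "(snd x + b)^2 <= b^2" using power_mono[OF sb[OF x] abs_ge_zero, of 2] by simp
				hence "2 * ((snd x + b)^2 * q^2) <= 2 * (b^2 * q^2)" by (simp add: mult_right_mono)
				moreover have "(p + (snd x + b) * q)^2 <= 2 * p^2 + 2 * ((snd x + b)^2 * q^2)"
				proof -
					define r where "r = (snd x + b) * q"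
					have "0 <= (p - r)^2" by simp
					hence "(p + r)^2 <= 2 * p^2 + 2 * r^2" by (simp add: power2_eq_square algebra_simps)
					thus ?thesis by (simp add: r_def power_mult_distrib)
				qed
				ultimately show "(k n x)^2 <= 2 * (U n x - u x)^2 + (2 * b^2) * (pd (0, 1) (U n) x - g2 x)^2"
					by (simp add: k_def p_def q_def mult.assoc)
			qed (use b in auto)
			also have "(LBINT x:S. 2 * (U n x - u x)^2 + (2 * b^2) * (pd (0, 1) (U n) x - g2 x)^2) = 2 * (LBINT x:S. (U n x - u x)^2) + (2 * b^2) * (LBINT x:S. (pd (0, 1) (U n) x - g2 x)^2)"
				using L2d[of n] by (subst set_integral_add(2)) (auto simp: Lp2_square)
			finally show "(LBINT s:interval_I a. (U n (s, 0) - t s)^2) <= 1 / b * (2 * (LBINT x:S. (U n x - u x)^2) + (2 * b^2) * (LBINT x:S. (l n * P n g2 x - g2 x)^2))"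
				by (simp only: cong)
		qed
	qed (auto intro!: always_eventually set_integral_nonneg_simple)
	moreover have "U n \<in> H1 S" for n
		by (rule sobolev1I[where g="%i. pd i (U n)"]) (use Ck1_weak_pd[OF UC oS] B in auto)
	moreover have "continuous_on (closure S) (U n)" for n
		using Ck_SucD[OF UC[of n]] continuous_on_subset by auto
	ultimately show ?thesis
		using tL N unfolding has_trace0_def t_def g2_def S_def by blast
qed

subsection \<open>The trace as a volume integral\<close>

lemma L2_tendsto_pairing:
	fixes f :: "nat => 'a::euclidean_space => real"
	assumes f: "!!n. f n \<in> Lp 2 S" "g \<in> Lp 2 S" "k \<in> Lp 2 S" and lim: "(%n. LBINT x:S. (f n x - g x)^2) -->> 0"
	shows "(%n. LBINT x:S. f n x * k x) -->> (LBINT x:S. g x * k x)"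
proof -
	have d: "(%x. f n x - g x) \<in> Lp 2 S" for n using Lp2_add[OF f(1,2), where r=1 and s="-1"] by simp
	have "(%n. sqrt ((LBINT x:S. (f n x - g x)^2) * (LBINT x:S. (k x)^2))) -->> sqrt (0 * (LBINT x:S. (k x)^2))"
		by (intro tendsto_intros lim)
	hence 0: "(%n. sqrt ((LBINT x:S. (f n x - g x)^2) * (LBINT x:S. (k x)^2))) -->> 0" by simp
	have "norm (LBINT x:S. (f n x - g x) * k x) <= sqrt ((LBINT x:S. (f n x - g x)^2) * (LBINT x:S. (k x)^2))" for n
		unfolding real_norm_def by (rule real_le_rsqrt) (use Lp2_Cauchy_Schwarz[OF d f(3)] in simp)
	hence "(%n. LBINT x:S. (f n x - g x) * k x) -->> 0"
		by (intro Lim_null_comparison[OF always_eventually 0]) auto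
	moreover have "(LBINT x:S. (f n x - g x) * k x) = (LBINT x:S. f n x * k x) - (LBINT x:S. g x * k x)" for n
		using Lp2_mult_integrable[OF f(1,3), of n] Lp2_mult_integrable[OF f(2,3)] by (simp add: left_diff_distrib)
	ultimately show ?thesis by (simp add: LIM_zero_iff)
qed

lemma set_integral_abs_le:
	fixes f g :: "'a::euclidean_space => real"
	assumes "lint S f" "lint S g" "!!x. x \<in> S ==> \<bar>f x\<bar> <= g x"
	shows "\<bar>LBINT x:S. f x\<bar> <= (LBINT x:S. g x)"
proof -
	have "\<bar>LBINT x:S. f x\<bar> <= (LBINT x. \<bar>indicator S x *R f x\<bar>)"
		unfolding sint_def by (rule integral_abs_bound)
	also have "... <= (LBINT x:S. g x)" unfolding sint_def
		by (rule integral_mono_AE) (use assms in "auto simp: set_integrable_def indicator_def intro!: AE_I2")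
	finally show ?thesis .
qed

lemma set_integrable_mult_bounded:
	fixes u g :: "'a::euclidean_space => real"
	assumes u: "lint S u" and m: "lmeas S g" and B: "!!x. x \<in> S ==> \<bar>g x\<bar> <= B"
	shows "lint S (%x. u x * g x)"
proof -
	have "integrable lborel (%x. (indicator S x *R u x) * (indicator S x *R g x))"
	proof (rule integrable_mult_bounded[of _ _ _ "\<bar>B\<bar>"])
		show "\<bar>indicator S x *R g x\<bar> <= \<bar>B\<bar>" for x using B[of x] by (cases "x \<in> S") auto
	qed (use u m in "auto simp: set_integrable_def smeas_def")
	moreover have "(%x. (indicator S x *R u x) * (indicator S x *R g x)) = (%x. indicator S x *R (u x * g x))"
		by (auto simp: indicator_def)
	ultimately show ?thesis by (simp add: set_integrable_def)
qed

text \<open>A function of the first coordinate only, continuous on the interval, is measurable on subsets of the strip.\<close>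
lemma strip_measurable:
	fixes \<psi> :: "real => real"
	assumes \<psi>: "continuous_on (interval_I a) \<psi>" and S: "S \<in> sets borel" "!!x. x \<in> S ==> fst x \<in> interval_I a"
	shows "lmeas S (%x::plane. \<psi> (fst x))"
proof -
	have [measurable]: "(%s. indicator (interval_I a) s *R \<psi> s) \<in> borel_measurable borel"
		by (rule borel_measurable_continuous_on_indicator[OF _ \<psi>]) (use interval_I_sets in auto)
	have "(%x::plane. indicator (interval_I a) (fst x) *R \<psi> (fst x)) \<in> borel_measurable borel"
		by (rule measurable_compose[OF _ \<open>_ \<in> borel_measurable borel\<close>]) measurable
	hence "(%x. indicator S x *R (indicator (interval_I a) (fst x) *R \<psi> (fst x))) \<in> borel_measurable borel"
		by (rule borel_measurable_scaleR[OF borel_measurable_indicator[OF S(1)]])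
	moreover have "(%x. indicator S x *R (indicator (interval_I a) (fst x) *R \<psi> (fst x))) = (%x. indicator S x *R \<psi> (fst x))"
	proof
		fix x show "indicator S x *R (indicator (interval_I a) (fst x) *R \<psi> (fst x)) = indicator S x *R \<psi> (fst x)"
			using S(2)[of x] by (cases "x \<in> S") auto
	qed
	ultimately show ?thesis by (simp add: smeas_def)
qed

lemma boundary_layer_average:
	fixes U :: "plane => real" and \<psi> :: "real => real"
	assumes a: "a > 0" and b: "b > 0" and U: "continuous_on (closure (Omega0 a b)) U"
		and \<psi>: "continuous_on (interval_I a) \<psi>" "!!s. s \<in> interval_I a ==> \<bar>\<psi> s\<bar> <= M"
		and t: "!!n. 0 < t n" "!!n. t n <= b" "t -->> 0"
	shows "(%n. 1 / t n * (LBINT x:interval_I a \<times> {- t n<..<0}. U x * \<psi> (fst x))) -->> (LBINT s:interval_I a. U (s, 0) * \<psi> s)"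
	unfolding tendsto_iff
proof (intro allI impI)
	fix e :: real assume e: "e > 0"
	define c where "c = e / (2 * a * (\<bar>M\<bar> + 1))"
	have c: "c > 0" using e a by (simp add: c_def)
	have cl: "closure (Omega0 a b) = {0..a} \<times> {-b..0}" by (rule closure_Omega0[OF a b])
	have "uniformly_continuous_on ({0..a} \<times> {-b..0}) U"
		using U unfolding cl by (intro compact_uniformly_continuous) (auto intro: compact_Times)
	then obtain d where d: "d > 0" "!!x y. x \<in> {0..a} \<times> {-b..0} ==> y \<in> {0..a} \<times> {-b..0} ==> dist y x < d ==> dist (U y) (U x) < c"
		unfolding uniformly_continuous_on_def using c by metis
	have X: "interval_I a \<in> sets borel" using interval_I_sets by auto
	have XL: "measure lborel (interval_I a) = a" using a by (simp add: interval_I_def)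
	show "\<forall>\<^sub>F n in sequentially. dist (1 / t n * (LBINT x:interval_I a \<times> {- t n<..<0}. U x * \<psi> (fst x))) (LBINT s:interval_I a. U (s, 0) * \<psi> s) < e"
		using order_tendstoD(2)[OF t(3) d(1)]
	proof eventually_elim
		case (elim n)
		define R where "R = interval_I a \<times> {- t n<..<0}"
		have Rs: "R \<in> sets lborel" using X by (simp add: R_def borel_Times)
		have Rb: "bounded R" by (simp add: R_def interval_I_def bounded_Times)
		have Rf: "emeasure lborel R < \<infinity>" using emeasure_bounded_finite[OF Rb] by simp
		have Rsub: "R \<subseteq> {0..a} \<times> {-b..0}" using t(2)[of n] by (auto simp: R_def interval_I_def)
		have oR: "open R" by (auto simp: R_def interval_I_def intro: open_Times)
		have "bounded (U ` ({0..a} \<times> {-b..0}))"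
			using U unfolding cl by (intro compact_imp_bounded compact_continuous_image) (auto intro: compact_Times)
		then obtain B where B: "!!x. x \<in> {0..a} \<times> {-b..0} ==> \<bar>U x\<bar> <= B" unfolding bounded_iff by (metis imageI real_norm_def)
		have mU: "lmeas R U" unfolding smeas_def
			using borel_measurable_continuous_on_indicator[of R U] continuous_on_subset[OF U[unfolded cl] Rsub] oR by auto
		have c0: "continuous_on {0..a} (%s. U (s, 0))"
		proof -
			have "continuous_on {0..a} (%s::real. (s, 0::real))" by (intro continuous_intros)
			from continuous_on_compose2[OF U[unfolded cl] this] show ?thesis using b by fastforce
		qed
		have c0': "continuous_on (interval_I a) (%s. U (s, 0))" by (rule continuous_on_subset[OF c0]) (auto simp: interval_I_def)
		have mU0: "lmeas R (%x. U (fst x, 0))"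
			using strip_measurable[OF c0', of R] Rs by (auto simp: R_def)
		have mp: "lmeas R (%x. \<psi> (fst x))"
			using strip_measurable[OF \<psi>(1), of R] Rs by (auto simp: R_def)
		have bp: "\<bar>\<psi> (fst x)\<bar> <= M" if "x \<in> R" for x using that \<psi>(2) by (auto simp: R_def)
		have bU: "\<bar>U x\<bar> <= B" "\<bar>U (fst x, 0)\<bar> <= B" if "x \<in> R" for x
			using that B[of x] B[of "(fst x, 0)"] Rsub b by (auto simp: R_def interval_I_def)
		have iU: "lint R (%x. U x * \<psi> (fst x))" "lint R (%x. U (fst x, 0) * \<psi> (fst x))"
			using set_integrable_mult_bounded[OF Lp2_integrable[OF Rs Rf bounded_Lp2[OF Rs Rf mU bU(1)]] mp bp]
				set_integrable_mult_bounded[OF Lp2_integrable[OF Rs Rf bounded_Lp2[OF Rs Rf mU0 bU(2)]] mp bp] by auto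
		have L0: "(LBINT x:R. U (fst x, 0) * \<psi> (fst x)) = t n * (LBINT s:interval_I a. U (s, 0) * \<psi> s)"
		proof -
			have "(LBINT x:R. U (fst x, 0) * \<psi> (fst x)) = (LBINT s:interval_I a. (LBINT y:{- t n<..<0}. U (s, 0) * \<psi> s))"
				using rect_integral(1)[OF X _ iU(2)[unfolded R_def]] by (simp add: R_def)
			also have "... = (LBINT s:interval_I a. t n * (U (s, 0) * \<psi> s))"
			proof -
				have "(LBINT y:{- t n<..<0}. r) = t n * r" for r :: real
					using t(1)[of n] by (simp add: sint_def)
				thus ?thesis by (simp only:)
			qed
			finally show ?thesis by (simp only: set_integral_mult_right)
		qed
		have "\<bar>(LBINT x:R. U x * \<psi> (fst x) - U (fst x, 0) * \<psi> (fst x))\<bar> <= (LBINT x:R. c * \<bar>M\<bar>)"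
		proof (rule set_integral_abs_le)
			show "lint R (%x. U x * \<psi> (fst x) - U (fst x, 0) * \<psi> (fst x))" using iU by auto
			show "lint R (%x. c * \<bar>M\<bar>)" using Rs Rf by (auto simp: set_integrable_def)
			fix x assume x: "x \<in> R"
			have "dist x (fst x, 0) = \<bar>snd x\<bar>" by (cases x) (simp add: dist_Pair_Pair dist_real_def)
			hence "dist x (fst x, 0) < d" using x elim by (auto simp: R_def)
			moreover have "(fst x, 0) \<in> {0..a} \<times> {-b..0}" using x Rsub b by (auto simp: R_def interval_I_def)
			ultimately have "\<bar>U x - U (fst x, 0)\<bar> < c" using d(2)[of "(fst x, 0)" x] x Rsub by (auto simp: dist_real_def)
			hence "\<bar>U x - U (fst x, 0)\<bar> * \<bar>\<psi> (fst x)\<bar> <= c * \<bar>M\<bar>"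
				using bp[OF x] c by (intro mult_mono) auto
			thus "\<bar>U x * \<psi> (fst x) - U (fst x, 0) * \<psi> (fst x)\<bar> <= c * \<bar>M\<bar>"
				by (simp add: left_diff_distrib[symmetric] abs_mult)
		qed
		also have "(LBINT x:R. c * \<bar>M\<bar>) = t n * (a * (c * \<bar>M\<bar>))"
		proof -
			have "(LBINT x:R. c * \<bar>M\<bar>) = (LBINT s:interval_I a. (LBINT y:{- t n<..<0}. c * \<bar>M\<bar>))"
				unfolding R_def by (rule rect_integral(1)[OF X]) (use Rs Rf in "auto simp: R_def set_integrable_def")
			also have "... = (LBINT s:interval_I a. t n * (c * \<bar>M\<bar>))"
				using t(1)[of n] by (simp add: sint_def[of _ "{- t n<..<0}"])
			also have "... = t n * (a * (c * \<bar>M\<bar>))"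
				using X interval_I_sets(2)[of a] XL by (simp add: sint_def)
			finally show ?thesis .
		qed
		finally have le: "\<bar>(LBINT x:R. U x * \<psi> (fst x)) - t n * (LBINT s:interval_I a. U (s, 0) * \<psi> s)\<bar> <= t n * (a * (c * \<bar>M\<bar>))"
			using set_integral_diff(2)[OF iU] L0 by simp
		have "1 / t n * (LBINT x:R. U x * \<psi> (fst x)) - (LBINT s:interval_I a. U (s, 0) * \<psi> s)
			 = 1 / t n * ((LBINT x:R. U x * \<psi> (fst x)) - t n * (LBINT s:interval_I a. U (s, 0) * \<psi> s))"
			using t(1)[of n] by (simp add: field_simps)
		also have "\<bar>...\<bar> <= 1 / t n * (t n * (a * (c * \<bar>M\<bar>)))"
			using le t(1)[of n] unfolding abs_mult by (intro mult_mono) auto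
		also have "... = a * (c * \<bar>M\<bar>)" using t(1)[of n] by simp
		also have "... < e"
		proof -
			have "a * (c * \<bar>M\<bar>) <= a * (c * (\<bar>M\<bar> + 1))" using a c by simp
			also have "... = e / 2"
			proof -
				have "a * (e / (2 * a * N) * N) = e / 2" if "N > 0" for N using a that by (simp add: field_simps)
				from this[of "\<bar>M\<bar> + 1"] show ?thesis unfolding c_def by simp
			qed
			finally show ?thesis using e by simp
		qed
		finally show ?case by (simp add: dist_real_def R_def)
	qed
qed

text \<open>The fan identity with constant width and a cutoff that descends from one to zero on $(-t_n,0)$, as $t_n\to0$.\<close>
lemma trace_identity_continuous:
	fixes U :: "plane => real" and \<psi> :: "real => real"
	assumes a: "a > 0" and b: "b > 0" and U: "U \<in> H1 (Omega0 a b)" "continuous_on (closure (Omega0 a b)) U"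
		and \<psi>: "continuous_on (interval_I a) \<psi>" "!!s. s \<in> interval_I a ==> \<bar>\<psi> s\<bar> <= M"
	shows "(LBINT s:interval_I a. U (s, 0) * \<psi> s) =
		1 / b * ((LBINT x:Omega0 a b. U x * \<psi> (fst x)) + (LBINT x:Omega0 a b. wpd (Omega0 a b) (0, 1) U x * ((snd x + b) * \<psi> (fst x))))"
proof -
	define S where "S = Omega0 a b"
	have oS: "open S" unfolding S_def by (rule open_Omega0)
	have Sm: "S \<in> sets lborel" "emeasure lborel S < \<infinity>" unfolding S_def by (rule Omega0_sets)+
	have SI: "S = interval_I a \<times> {-b<..<0}" by (simp add: S_def Omega0_def)
	have B: "(1, 0) \<in> (Basis :: (plane) set)" "(0, 1) \<in> (Basis :: (plane) set)" by (auto simp: Basis_real2)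
	have U1: "U \<in> sobolev 1 2 S" using U by (simp add: S_def)
	note w1 = sobolev1D[OF U1 oS B(1)] and w2 = sobolev1D[OF U1 oS B(2)]
	define u2 where "u2 = wpd S (0, 1) U"
	define t where "t n = b / (real n + 2)" for n :: nat
	have t: "0 < t n" "t n <= b / 2" "t n <= b" for n
	proof -
		show "0 < t n" using b by (simp add: t_def)
		show "t n <= b / 2" unfolding t_def using b by (intro divide_left_mono) auto
		thus "t n <= b" using b by simp
	qed
	have t0: "t -->> 0"
	proof -
		have "(%n. b * inverse (real (Suc (Suc n)))) -->> b * 0"
			by (intro tendsto_mult tendsto_const LIMSEQ_Suc[OF LIMSEQ_inverse_real_of_nat])
		thus ?thesis by (simp add: t_def[abs_def] divide_inverse add.commute)
	qed
	have mp: "lmeas S (%x. \<psi> (fst x))"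
		using strip_measurable[OF \<psi>(1), of S] Sm by (auto simp: SI)
	have bp: "\<bar>\<psi> (fst x)\<bar> <= M" if "x \<in> S" for x using that \<psi>(2) by (auto simp: SI)
	have Ui: "lint S U" "lint S u2" unfolding u2_def using Lp2_integrable[OF Sm w1(1)] Lp2_integrable[OF Sm w2(3)] .
	have U\<psi>: "lint S (%x. U x * \<psi> (fst x))" "lint S (%x. u2 x * \<psi> (fst x))"
		using set_integrable_mult_bounded[OF Ui(1) mp bp] set_integrable_mult_bounded[OF Ui(2) mp bp] by auto
	have c\<psi>: "continuous_on {0<..<1} (%s. \<psi> (a * s))"
	proof -
		have "continuous_on {0<..<1} (%s. a * s)" by (intro continuous_intros)
		moreover have "(%s. a * s) ` {0<..<1} \<subseteq> interval_I a" using a by (auto simp: interval_I_def)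
		ultimately show ?thesis by (rule continuous_on_compose2[OF \<psi>(1)])
	qed
	have b\<psi>: "\<bar>\<psi> (a * s)\<bar> <= M" if "s \<in> {0<..<1}" for s using \<psi>(2)[of "a * s"] that a by (auto simp: interval_I_def)
	have D: "{x::plane. - b < snd x & snd x < 0 & 0 < (fst x - 0) / a & (fst x - 0) / a < 1} = S"
		using a by (auto simp: SI interval_I_def field_simps)
	have tz: "trapezoid (- b) (- t n) (- t n) 0" for n using t[of n] b by unfold_locales linarith+
	have fan: "(LBINT x:S. U x * (trap_deriv (- b) (- t n) (- t n) 0 (snd x) * \<psi> (fst x))) = - (LBINT x:S. u2 x * (trap (- b) (- t n) (- t n) 0 (snd x) * \<psi> (fst x)))" for n
	proof -
		have "(LBINT x:S. U x * (trap_deriv (- b) (- t n) (- t n) 0 (snd x) * \<psi> (a * ((fst x - 0) / a)) / a)) =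
			 - (LBINT x:S. wpd S (1, 0) U x * (trap (- b) (- t n) (- t n) 0 (snd x) * (\<psi> (a * ((fst x - 0) / a)) * ((fst x - 0) / a)) * 0 / a))
			 - (LBINT x:S. u2 x * (trap (- b) (- t n) (- t n) 0 (snd x) * \<psi> (a * ((fst x - 0) / a)) / a))"
			unfolding u2_def
			by (rule fan_identity[OF tz oS w1(2) w2(2) finite.emptyI, where W="%_. a" and W'="%_. 0" and ?w0.0=a and p=0 and \<Psi>="%s. \<psi> (a * s)", unfolded D])
				 (use a c\<psi> b\<psi> Ui Lp2_integrable[OF Sm w1(3)] in "auto intro: bounded_funI[of _ 0] simp: u2_def")
		hence "(LBINT x:S. U x * (trap_deriv (- b) (- t n) (- t n) 0 (snd x) * \<psi> (fst x))) / a = - ((LBINT x:S. u2 x * (trap (- b) (- t n) (- t n) 0 (snd x) * \<psi> (fst x))) / a)"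
			using a by simp
		thus ?thesis using a by (simp only: minus_divide_left divide_cancel_right) simp
	qed
	let ?i = "%n x::plane. indicator {x. snd x < - t n} x / (b - t n)"
	have i2: "lint S (%x. U x * \<psi> (fst x) * (?i n x))" for n
	proof (rule set_integrable_mult_bounded[OF U\<psi>(1), of _ "1 / (b - t n)"])
		have "{x::plane. snd x < - t n} \<in> sets borel" by measurable
		thus "lmeas S (%x. ?i n x)"
			unfolding smeas_def using Sm by measurable
		show "\<bar>?i n x\<bar> <= 1 / (b - t n)" for x :: "plane"
			using t[of n] b by (auto simp: indicator_def)
	qed
	have sub: "interval_I a \<times> {- t n<..<0} \<subseteq> S" for n using t(3)[of n] by (auto simp: SI)
	have ms: "interval_I a \<times> {- t n<..<0} \<in> sets borel" for n using interval_I_sets(1)[of a] by (simp add: borel_Times)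
	have split: "(LBINT x:S. U x * (trap_deriv (- b) (- t n) (- t n) 0 (snd x) * \<psi> (fst x))) =
		 (LBINT x:S. U x * \<psi> (fst x) * (?i n x)) - 1 / t n * (LBINT x:interval_I a \<times> {- t n<..<0}. U x * \<psi> (fst x))" for n
	proof -
		have e: "(LBINT x:interval_I a \<times> {- t n<..<0}. U x * \<psi> (fst x)) = (LBINT x:S. U x * \<psi> (fst x) * indicator (interval_I a \<times> {- t n<..<0}) x)"
		proof -
			have "(LBINT x:S. U x * \<psi> (fst x) * indicator (interval_I a \<times> {- t n<..<0}) x) = (LBINT x:interval_I a \<times> {- t n<..<0}. U x * \<psi> (fst x) * indicator (interval_I a \<times> {- t n<..<0}) x)"
				by (rule set_integral_mult_support[OF sub]) auto
			also have "... = (LBINT x:interval_I a \<times> {- t n<..<0}. U x * \<psi> (fst x))" by (rule set_integral_cong_simple) auto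
			finally show ?thesis by simp
		qed
		have i3: "lint S (%x. U x * \<psi> (fst x) * indicator (interval_I a \<times> {- t n<..<0}) x)"
			by (rule set_integrable_mult_bounded[OF U\<psi>(1), of _ 1]) (use ms Sm in "auto simp: smeas_def indicator_def")
		have "(LBINT x:S. U x * (trap_deriv (- b) (- t n) (- t n) 0 (snd x) * \<psi> (fst x))) =
			 (LBINT x:S. U x * \<psi> (fst x) * (?i n x) - 1 / t n * (U x * \<psi> (fst x) * indicator (interval_I a \<times> {- t n<..<0}) x))"
		proof (rule set_integral_cong_simple)
			fix x assume x: "x \<in> S"
			have "trap_deriv (- b) (- t n) (- t n) 0 (snd x) = ?i n x - 1 / t n * indicator (interval_I a \<times> {- t n<..<0}) x"
				using x t[of n] b by (cases x) (auto simp: trap_deriv_def indicator_def SI)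
			thus "U x * (trap_deriv (- b) (- t n) (- t n) 0 (snd x) * \<psi> (fst x)) =
				U x * \<psi> (fst x) * (?i n x) - 1 / t n * (U x * \<psi> (fst x) * indicator (interval_I a \<times> {- t n<..<0}) x)"
				by (simp only: left_diff_distrib right_diff_distrib mult_ac)
		qed
		also have "... = (LBINT x:S. U x * \<psi> (fst x) * (?i n x)) - (LBINT x:S. 1 / t n * (U x * \<psi> (fst x) * indicator (interval_I a \<times> {- t n<..<0}) x))"
			by (rule set_integral_diff(2)[OF i2 set_integrable_mult_right[OF i3]])
		finally show ?thesis by (simp add: e)
	qed
	have ev: "\<forall>\<^sub>F n in sequentially. snd x < - t n" if "x \<in> S" for x
		using order_tendstoD(2)[OF t0, of "- snd x"] that by (auto simp: SI elim!: eventually_mono)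
	have bt: "1 / (b - t n) <= 2 / b" for n
		using frac_le[of 1 1 "b/2" "b - t n"] t(2)[of n] b by simp
	have L1: "(%n. LBINT x:S. U x * \<psi> (fst x) * (?i n x)) -->> (LBINT x:S. U x * \<psi> (fst x) * (1 / b))"
	proof (rule set_integral_tendsto_bounded[OF U\<psi>(1) _ Sm(1), where B="2/b"])
		show "\<bar>?i n x\<bar> <= 2 / b" for n x
			using t[of n] b bt[of n] by (auto simp: indicator_def)
		have "{x::plane. snd x < - t n} \<in> sets borel" for n by measurable
		thus "(%x::plane. ?i n x) \<in> borel_measurable lborel" for n
			by (intro borel_measurable_divide borel_measurable_indicator borel_measurable_const) simp
		show "AE x in lborel. x \<in> S --> (%n. ?i n x) -->> 1 / b"
		proof (intro AE_I2 impI)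
			fix x assume "x \<in> S"
			from ev[OF this] have "\<forall>\<^sub>F n in sequentially. 1 / (b - t n) = ?i n x"
				by eventually_elim auto
			hence ev': "\<forall>\<^sub>F n in sequentially. 1 / (b - t n) = ?i n x" .
			have "(%n. 1 / (b - t n)) -->> 1 / (b - 0)" by (intro tendsto_intros t0) (use b in auto)
			from Lim_transform_eventually[OF this ev'] show "(%n. ?i n x) -->> 1 / b"
				by simp
		qed
	qed auto
	have L2: "(%n. LBINT x:S. u2 x * \<psi> (fst x) * trap (- b) (- t n) (- t n) 0 (snd x)) -->> (LBINT x:S. u2 x * \<psi> (fst x) * ((snd x + b) / b))"
	proof (rule set_integral_tendsto_bounded[OF U\<psi>(2) _ Sm(1), where B=1])
		show "\<bar>trap (- b) (- t n) (- t n) 0 (snd x)\<bar> <= 1" for n x using trapezoid.trap_bounds[OF tz[of n], of "snd x"] by simp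
		show "(%x::plane. trap (- b) (- t n) (- t n) 0 (snd x)) \<in> borel_measurable lborel" for n
			using trapezoid.trap_measurable[OF tz[of n]] by measurable
		show "AE x in lborel. x \<in> S --> (%n. trap (- b) (- t n) (- t n) 0 (snd x)) -->> (snd x + b) / b"
		proof (intro AE_I2 impI)
			fix x assume x: "x \<in> S"
			from ev[OF x] have ev': "\<forall>\<^sub>F n in sequentially. (snd x + b) / (b - t n) = trap (- b) (- t n) (- t n) 0 (snd x)"
			proof eventually_elim
				case (elim n)
				thus ?case using trapezoid.trap_up[OF tz[of n], of "snd x"] x by (auto simp: SI)
			qed
			have "(%n. (snd x + b) / (b - t n)) -->> (snd x + b) / (b - 0)" by (intro tendsto_intros t0) (use b in auto)
			from Lim_transform_eventually[OF this ev'] show "(%n. trap (- b) (- t n) (- t n) 0 (snd x)) -->> (snd x + b) / b"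
				by simp
		qed
	qed measurable
	have e1: "(LBINT x:S. U x * \<psi> (fst x) * (1 / b)) - (LBINT s:interval_I a. U (s, 0) * \<psi> s) = - (LBINT x:S. u2 x * \<psi> (fst x) * ((snd x + b) / b))"
	proof (rule LIMSEQ_unique)
		show "(%n. (LBINT x:S. U x * \<psi> (fst x) * (?i n x)) - 1 / t n * (LBINT x:interval_I a \<times> {- t n<..<0}. U x * \<psi> (fst x)))
			-->> (LBINT x:S. U x * \<psi> (fst x) * (1 / b)) - (LBINT s:interval_I a. U (s, 0) * \<psi> s)"
			by (intro tendsto_diff L1 boundary_layer_average[OF a b U(2) \<psi> t(1,3) t0])
		show "(%n. (LBINT x:S. U x * \<psi> (fst x) * (?i n x)) - 1 / t n * (LBINT x:interval_I a \<times> {- t n<..<0}. U x * \<psi> (fst x)))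
			-->> - (LBINT x:S. u2 x * \<psi> (fst x) * ((snd x + b) / b))"
			unfolding split[symmetric] fan using tendsto_minus[OF L2] by (simp only: mult_ac)
	qed
	have e2: "(LBINT x:S. U x * \<psi> (fst x) * (1 / b)) = 1 / b * (LBINT x:S. U x * \<psi> (fst x))" by simp
	have e3: "(LBINT x:S. u2 x * \<psi> (fst x) * ((snd x + b) / b)) = 1 / b * (LBINT x:S. u2 x * ((snd x + b) * \<psi> (fst x)))"
		unfolding set_integral_mult_right[symmetric] by (rule set_integral_cong_simple) simp
	show ?thesis using e1 unfolding e2 e3 distrib_left S_def[symmetric] u2_def[symmetric] by linarith
qed

lemma trace0_identity:
	fixes u :: "plane => real" and \<psi> :: "real => real"
	assumes a: "a > 0" and b: "b > 0" and u: "u \<in> H1 (Omega0 a b)"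
		and \<psi>: "continuous_on (interval_I a) \<psi>" "!!s. s \<in> interval_I a ==> \<bar>\<psi> s\<bar> <= M"
	shows "trace0 a b u \<in> Lp 2 (interval_I a)"
		and "(LBINT s:interval_I a. trace0 a b u s * \<psi> s) =
		1 / b * ((LBINT x:Omega0 a b. u x * \<psi> (fst x)) + (LBINT x:Omega0 a b. wpd (Omega0 a b) (0, 1) u x * ((snd x + b) * \<psi> (fst x))))"
proof -
	define S where "S = Omega0 a b"
	define t where "t = trace0 a b u"
	have oS: "open S" unfolding S_def by (rule open_Omega0)
	have Sm: "S \<in> sets lborel" "emeasure lborel S < \<infinity>" unfolding S_def by (rule Omega0_sets)+
	have SI: "S = interval_I a \<times> {-b<..<0}" by (simp add: S_def Omega0_def)
	have B: "(1, 0) \<in> (Basis :: (plane) set)" "(0, 1) \<in> (Basis :: (plane) set)" by (auto simp: Basis_real2)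
	have "has_trace0 a b u t" unfolding t_def trace0_def by (rule someI[where P="has_trace0 a b u", OF has_trace0_exists[OF a b u]])
	then obtain U where t: "t \<in> Lp 2 (interval_I a)" and U: "!!n. U n \<in> H1 S" "!!n. continuous_on (closure S) (U n)"
		and N: "(%n. H1_norm S (%x. U n x - u x)) -->> 0" and tr: "(%n. LBINT s:interval_I a. (U n (s, 0) - t s)^2) -->> 0"
		unfolding has_trace0_def S_def by blast
	show "trace0 a b u \<in> Lp 2 (interval_I a)" using t by (simp add: t_def)
	have u': "u \<in> sobolev 1 2 S" using u by (simp add: S_def)
	have U': "U n \<in> sobolev 1 2 S" for n by (rule U(1))
	note w1 = sobolev1D[OF u' oS B(1)] and w2 = sobolev1D[OF u' oS B(2)]
	note W1 = sobolev1D[OF U' oS B(1)] and W2 = sobolev1D[OF U' oS B(2)]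
	have L2d: "(%x. U n x - u x) \<in> Lp 2 S" "(%x. wpd S (1, 0) (U n) x - wpd S (1, 0) u x) \<in> Lp 2 S" "(%x. wpd S (0, 1) (U n) x - wpd S (0, 1) u x) \<in> Lp 2 S" for n
		using Lp2_add[OF W1(1) w1(1), where r=1 and s="-1"] Lp2_add[OF W1(3) w1(3), where r=1 and s="-1"] Lp2_add[OF W2(3) w2(3), where r=1 and s="-1"] by auto
	have nsq: "(H1_norm S (%x. U n x - u x))^2 = (LBINT x:S. (U n x - u x)^2) + ((LBINT x:S. (wpd S (1, 0) (U n) x - wpd S (1, 0) u x)^2) + (LBINT x:S. (wpd S (0, 1) (U n) x - wpd S (0, 1) u x)^2))" for n
	proof (rule H1_norm_square[OF oS L2d(1) _ _ L2d(2,3)])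
		show "has_weak_pd S (1, 0) (%x. U n x - u x) (%x. wpd S (1, 0) (U n) x - wpd S (1, 0) u x)"
			using has_weak_pd_lincomb[OF W1(2) w1(2) B(1), where r=1 and s="-1"] by simp
		show "has_weak_pd S (0, 1) (%x. U n x - u x) (%x. wpd S (0, 1) (U n) x - wpd S (0, 1) u x)"
			using has_weak_pd_lincomb[OF W2(2) w2(2) B(2), where r=1 and s="-1"] by simp
	qed
	have N2: "(%n. (H1_norm S (%x. U n x - u x))^2) -->> 0" using tendsto_power[OF N, of 2] by simp
	have c0: "(%n. LBINT x:S. (U n x - u x)^2) -->> 0" and c2: "(%n. LBINT x:S. (wpd S (0, 1) (U n) x - wpd S (0, 1) u x)^2) -->> 0"
	proof -
		have nn: "0 <= (LBINT x:S. (f x)^2)" for f :: "plane => real" by (rule set_integral_nonneg_simple) simp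
		show "(%n. LBINT x:S. (U n x - u x)^2) -->> 0"
			by (rule tendsto_sandwich[OF _ _ tendsto_const N2]) (use nn in "auto simp: nsq intro!: always_eventually add_nonneg_nonneg")
		show "(%n. LBINT x:S. (wpd S (0, 1) (U n) x - wpd S (0, 1) u x)^2) -->> 0"
			by (rule tendsto_sandwich[OF _ _ tendsto_const N2]) (use nn in "auto simp: nsq intro!: always_eventually add_nonneg_nonneg")
	qed
	have Im: "interval_I a \<in> sets lborel" "emeasure lborel (interval_I a) < \<infinity>" using interval_I_sets by auto
	have m\<psi>: "lmeas (interval_I a) \<psi>" unfolding smeas_def
		using borel_measurable_continuous_on_indicator[OF _ \<psi>(1)] interval_I_sets by auto
	have \<psi>L: "\<psi> \<in> Lp 2 (interval_I a)" by (rule bounded_Lp2[OF Im m\<psi> \<psi>(2)])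
	have mp: "lmeas S (%x. \<psi> (fst x))" using strip_measurable[OF \<psi>(1), of S] Sm by (auto simp: SI)
	have bp: "\<bar>\<psi> (fst x)\<bar> <= M" if "x \<in> S" for x using that \<psi>(2) by (auto simp: SI)
	have \<psi>S: "(%x. \<psi> (fst x)) \<in> Lp 2 S" by (rule bounded_Lp2[OF Sm mp bp])
	have \<psi>b: "(%x. (snd x + b) * \<psi> (fst x)) \<in> Lp 2 S"
	proof -
		have "(%x. \<psi> (fst x) * (snd x + b)) \<in> Lp 2 S"
			by (rule Lp2_mult_bounded[OF \<psi>S, where B=b]) (use Sm in "auto simp: SI smeas_def")
		thus ?thesis by (simp add: mult.commute)
	qed
	have UL: "(%s. U n (s, 0)) \<in> Lp 2 (interval_I a)" for n
	proof -
		have cl: "closure S = {0..a} \<times> {-b..0}" unfolding S_def by (rule closure_Omega0[OF a b])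
		have "continuous_on {0..a} (%s::real. (s, 0::real))" by (intro continuous_intros)
		moreover have "(%s::real. (s, 0::real)) ` {0..a} \<subseteq> {0..a} \<times> {-b..0}" using b by auto
		ultimately have c: "continuous_on {0..a} (%s. U n (s, 0))" by (rule continuous_on_compose2[OF U(2)[of n, unfolded cl]])
		have "bounded ((%s. U n (s, 0)) ` {0..a})" by (intro compact_imp_bounded compact_continuous_image c) auto
		then obtain K where K: "!!s. s \<in> {0..a} ==> \<bar>U n (s, 0)\<bar> <= K" unfolding bounded_iff by (metis imageI real_norm_def)
		have c': "continuous_on (interval_I a) (%s. U n (s, 0))" by (rule continuous_on_subset[OF c]) (auto simp: interval_I_def)
		have "lmeas (interval_I a) (%s. U n (s, 0))" unfolding smeas_def
			using borel_measurable_continuous_on_indicator[OF _ c'] interval_I_sets by auto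
		thus ?thesis by (rule bounded_Lp2[OF Im, where B=K]) (use K in "auto simp: interval_I_def")
	qed
	have "(LBINT s:interval_I a. t s * \<psi> s) = 1 / b * ((LBINT x:S. u x * \<psi> (fst x)) + (LBINT x:S. wpd S (0, 1) u x * ((snd x + b) * \<psi> (fst x))))"
	proof (rule LIMSEQ_unique)
		show "(%n. LBINT s:interval_I a. U n (s, 0) * \<psi> s) -->> (LBINT s:interval_I a. t s * \<psi> s)"
			by (rule L2_tendsto_pairing[OF UL t \<psi>L tr])
		have e: "(LBINT s:interval_I a. U n (s, 0) * \<psi> s) = 1 / b * ((LBINT x:S. U n x * \<psi> (fst x)) + (LBINT x:S. wpd S (0, 1) (U n) x * ((snd x + b) * \<psi> (fst x))))" for n
			unfolding S_def by (rule trace_identity_continuous[OF a b U(1)[unfolded S_def] U(2)[unfolded S_def] \<psi>])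
		show "(%n. LBINT s:interval_I a. U n (s, 0) * \<psi> s) -->> 1 / b * ((LBINT x:S. u x * \<psi> (fst x)) + (LBINT x:S. wpd S (0, 1) u x * ((snd x + b) * \<psi> (fst x))))"
			unfolding e by (intro tendsto_intros L2_tendsto_pairing[OF W1(1) w1(1) \<psi>S c0] L2_tendsto_pairing[OF W2(3) w2(3) \<psi>b c2])
	qed
	thus "(LBINT s:interval_I a. trace0 a b u s * \<psi> s) =
		1 / b * ((LBINT x:Omega0 a b. u x * \<psi> (fst x)) + (LBINT x:Omega0 a b. wpd (Omega0 a b) (0, 1) u x * ((snd x + b) * \<psi> (fst x))))"
		by (simp add: t_def S_def)
qed

section \<open>The perforated domain\<close>

lemma line_derivative:
	fixes f :: "plane => real"
	assumes D: "(f has_derivative D) (at (x + t *R i))"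
	shows "((%s. f (x + s *R i)) has_real_derivative D i) (at t)"
proof -
	have "((%s. x + s *R i) has_derivative (%s. s *R i)) (at t)" by (auto intro!: derivative_eq_intros)
	from has_derivative_compose[OF this D]
	have "((%s. f (x + s *R i)) has_derivative (%s. D (s *R i))) (at t)" .
	moreover have "D (s *R i) = D i * s" for s
		using linear_scale[OF has_derivative_linear[OF D], of s i] by simp
	ultimately show ?thesis by (simp add: has_field_derivative_def)
qed

lemma slicewise_fst:
	assumes "!!s. DERIV \<psi> s :> \<gamma> s"
	shows "slicewise S (1, 0) (%x. \<psi> (fst x)) (%x. \<gamma> (fst x))" "slicewise S (0, 1) (%x. \<psi> (fst x)) (%x. 0)"
proof -
	have d: "((%s. \<psi> (r + s)) has_real_derivative \<gamma> (r + t)) (at t)" for r t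
	proof -
		have "DERIV ((%s. r + s)) t :> 1" by (auto intro!: derivative_eq_intros)
		from DERIV_chain2[where f=\<psi> and g="%s. r + s" and x=t and s=UNIV, OF assms this] show ?thesis by simp
	qed
	hence c: "isCont (%s. \<psi> (r + s)) t" for r t by (rule DERIV_isCont)
	show "slicewise S (1, 0) (%x. \<psi> (fst x)) (%x. \<gamma> (fst x))"
		unfolding slicewise_def using d c by (auto intro!: exI[of _ "{}"])
	show "slicewise S (0, 1) (%x. \<psi> (fst x)) (%x. 0)"
		unfolding slicewise_def by (auto intro!: exI[of _ "{}"])
qed

lemma slicewise_snd:
	assumes c: "!!s. isCont \<psi> s" and T: "finite T" and d: "!!s. s \<notin> T ==> DERIV \<psi> s :> \<gamma> s"
	shows "slicewise S (0, 1) (%x. \<psi> (snd x)) (%x. \<gamma> (snd x))" "slicewise S (1, 0) (%x. \<psi> (snd x)) (%x. 0)"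
proof -
	have d': "((%s. \<psi> (r + s)) has_real_derivative \<gamma> (r + t)) (at t)" if "r + t \<notin> T" for r t
	proof -
		have "DERIV ((%s. r + s)) t :> 1" by (auto intro!: derivative_eq_intros)
		from DERIV_chain2[where f=\<psi> and g="%s. r + s" and x=t and s=UNIV, OF d[OF that] this] show ?thesis by simp
	qed
	have c': "isCont (%s. \<psi> (r + s)) t" for r t
		using c by (intro isCont_o2[where f="%s. r + s" and g=\<psi>] continuous_intros)
	show "slicewise S (0, 1) (%x. \<psi> (snd x)) (%x. \<gamma> (snd x))"
		unfolding slicewise_def
	proof (intro conjI allI impI)
		fix x :: "plane"
		show "isCont (%s. \<psi> (snd (x + s *R (0, 1)))) t" for t using c' by simp
		show "\<exists>T. finite T & (\<forall>t. t \<notin> T --> x + t *R (0, 1) \<in> S --> ((%s. \<psi> (snd (x + s *R (0, 1)))) has_real_derivative \<gamma> (snd (x + t *R (0, 1)))) (at t))"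
		proof (intro exI[of _ "(%s. s - snd x) ` T"] conjI allI impI)
			show "finite ((%s. s - snd x) ` T)" using T by simp
			fix t assume "t \<notin> (%s. s - snd x) ` T"
			hence "snd x + t \<notin> T" by force
			from d'[OF this] show "((%s. \<psi> (snd (x + s *R (0, 1)))) has_real_derivative \<gamma> (snd (x + t *R (0, 1)))) (at t)" by simp
		qed
	qed
	show "slicewise S (1, 0) (%x. \<psi> (snd x)) (%x. 0)"
		unfolding slicewise_def by (auto intro!: exI[of _ "{}"])
qed

text \<open>Functions that are piecewise differentiable along lines are admissible in the weak formulation.\<close>
lemma weak_solution_test:
	fixes S :: "(plane) set"
	assumes S: "open S" "bounded S" and ws: "weak_solution S \<omega> f u"
		and s: "slicewise S (1, 0) \<Phi> G1" "slicewise S (0, 1) \<Phi> G2"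
		and m: "lmeas S \<Phi>" "lmeas S G1" "lmeas S G2"
		and B: "!!x. x \<in> S ==> \<bar>\<Phi> x\<bar> <= B" "!!x. x \<in> S ==> \<bar>G1 x\<bar> <= B" "!!x. x \<in> S ==> \<bar>G2 x\<bar> <= B"
	shows "(LBINT x:S. wpd S (1, 0) u x * G1 x) + (LBINT x:S. wpd S (0, 1) u x * G2 x) - \<omega>^2 * (LBINT x:S. u x * \<Phi> x) = (LBINT x:S. f x * \<Phi> x)"
proof -
	have Sm: "S \<in> sets lborel" "emeasure lborel S < \<infinity>" using S emeasure_bounded_finite[OF S(2)] by auto
	note L = bounded_Lp2[OF Sm m(1) B(1)] bounded_Lp2[OF Sm m(2) B(2)] bounded_Lp2[OF Sm m(3) B(3)]
	have L': "\<Phi> \<in> Lp 2 S" "G1 \<in> Lp 2 S" "G2 \<in> Lp 2 S" using L by auto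
	note loc = L'[THEN Lp2_integrable[OF Sm], THEN integrable_L1loc]
	have w1: "has_weak_pd S (1, 0) \<Phi> G1" by (rule has_weak_pd_slicesI[OF S(1) loc(1,2) _ s(1) B(1,2)]) auto
	have w2: "has_weak_pd S (0, 1) \<Phi> G2" by (rule has_weak_pd_slicesI[OF S(1) loc(1,3) _ s(2) B(1,3)]) auto
	have H: "\<Phi> \<in> sobolev 1 2 S"
		by (rule sobolev1I[where g="%i. if i = (1, 0) then G1 else G2"]) (use L' w1 w2 in "auto simp: Basis_real2")
	have Bs: "(1, 0) \<in> (Basis :: (plane) set)" "(0, 1) \<in> (Basis :: (plane) set)" by (auto simp: Basis_real2)
	have u: "u \<in> sobolev 1 2 S" and eq: "(LBINT x:S. wgrad S u x \<bullet> wgrad S \<Phi> x) - \<omega>^2 * (LBINT x:S. u x * \<Phi> x) = (LBINT x:S. f x * \<Phi> x)"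
		using ws H unfolding weak_solution_def by blast+
	note u1 = sobolev1D[OF u S(1) Bs(1)] and u2 = sobolev1D[OF u S(1) Bs(2)]
	note p1 = sobolev1D[OF H S(1) Bs(1)] and p2 = sobolev1D[OF H S(1) Bs(2)]
	have i: "lint S (%x. wpd S (1, 0) u x * G1 x)" "lint S (%x. wpd S (0, 1) u x * G2 x)"
		using Lp2_mult_integrable[OF u1(3) L'(2)] Lp2_mult_integrable[OF u2(3) L'(3)] by auto
	have i': "lint S (%x. wpd S (1, 0) u x * wpd S (1, 0) \<Phi> x)" "lint S (%x. wpd S (0, 1) u x * wpd S (0, 1) \<Phi> x)"
		using Lp2_mult_integrable[OF u1(3) p1(3)] Lp2_mult_integrable[OF u2(3) p2(3)] by auto
	have "(LBINT x:S. wgrad S u x \<bullet> wgrad S \<Phi> x) = (LBINT x:S. wpd S (1, 0) u x * wpd S (1, 0) \<Phi> x + wpd S (0, 1) u x * wpd S (0, 1) \<Phi> x)"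
		by (simp add: wgrad_real2)
	also have "... = (LBINT x:S. wpd S (1, 0) u x * G1 x + wpd S (0, 1) u x * G2 x)"
	proof (rule set_integral_cong_AE_simple)
		show "AE x in lborel. x \<in> S --> wpd S (1, 0) u x * wpd S (1, 0) \<Phi> x + wpd S (0, 1) u x * wpd S (0, 1) \<Phi> x = wpd S (1, 0) u x * G1 x + wpd S (0, 1) u x * G2 x"
			using wpd_AE_eq[OF S(1) w1] wpd_AE_eq[OF S(1) w2] by eventually_elim auto
	qed (use set_integral_add(1)[OF i] set_integral_add(1)[OF i'] in "auto simp: set_integrable_def smeas_def")
	also have "... = (LBINT x:S. wpd S (1, 0) u x * G1 x) + (LBINT x:S. wpd S (0, 1) u x * G2 x)" by (rule set_integral_add(2)[OF i])
	finally show ?thesis using eq by simp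
qed

text \<open>The geometry for a fixed parameter \<open>ep\<close> $=\varepsilon=a/N$. The smallness conditions say that a channel is at most half as wide as a cell, and that half the height of the layer is at most $b/2$.\<close>
locale resonator =
	fixes a b L V \<alpha> ep :: real and N :: nat
	assumes pos: "a > 0" "b > 0" "L > 0" "V > 0" "\<alpha> > 0" "ep > 0"
		and N: "a = real N * ep" and small: "\<alpha> * ep^2 <= 1/2" "V * ep / 2 <= b / 2"
begin

definition \<delta> where "\<delta> = \<alpha> * ep ^ 3"
definition h where "h = V * ep / 2"
definition Om where "Om = Omega_eps a b L V \<alpha> ep"
definition O0 where "O0 = Omega0 a b"
definition Se where "Se = S_eps a L V ep"
definition Ce where "Ce = C_eps a L \<alpha> ep"

lemma \<delta>: "\<delta> > 0" "\<delta> <= ep / 2" "\<delta> < ep"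
proof -
	show "\<delta> > 0" using pos by (simp add: \<delta>_def)
	have "\<delta> = (\<alpha> * ep^2) * ep" by (simp add: \<delta>_def power3_eq_cube power2_eq_square)
	also have "... <= 1/2 * ep" using small(1) pos by (intro mult_right_mono) auto
	finally show "\<delta> <= ep / 2" by simp
	thus "\<delta> < ep" using pos by linarith
qed

lemma h: "h > 0" "h <= b / 2" "(L + V) * ep = L * ep + 2 * h" "h < b"
	using pos small by (auto simp: h_def algebra_simps)

lemma cell_sub:
	assumes "k < N" "real k * ep < s" "s < real k * ep + ep"
	shows "s \<in> interval_I a"
proof -
	have "real k + 1 <= real N" using assms(1) by linarith
	hence "(real k + 1) * ep <= a" unfolding N using pos by (intro mult_right_mono) auto
	moreover have "0 <= real k * ep" using pos by simp
	ultimately have "0 < s" "s < a" using assms(2,3) unfolding distrib_right by linarith+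
	thus ?thesis by (simp add: interval_I_def)
qed

lemma Ce_eq: "Ce = (\<Union>k<N. {real k * ep<..<real k * ep + \<delta>} \<times> {0..L * ep})"
proof -
	have "a / ep = real N" using pos N by simp
	hence "{k::nat. real k <= a / ep - 1} = {..<N}" by auto
	thus ?thesis by (simp add: Ce_def C_eps_def \<delta>_def)
qed

lemma Om_eq: "Om = O0 \<union> Se \<union> Ce" by (simp add: Om_def Omega_eps_def O0_def Se_def Ce_def)

lemma O0_iff: "x \<in> O0 \<longleftrightarrow> fst x \<in> interval_I a & - b < snd x & snd x < 0"
	by (cases x) (auto simp: O0_def Omega0_def)

lemma Se_iff: "x \<in> Se \<longleftrightarrow> fst x \<in> interval_I a & L * ep < snd x & snd x < (L + V) * ep"
	by (cases x) (auto simp: Se_def S_eps_def)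

lemma Ce_iff: "x \<in> Ce \<longleftrightarrow> (\<exists>k<N. real k * ep < fst x & fst x < real k * ep + \<delta>) & 0 <= snd x & snd x <= L * ep"
	by (cases x) (auto simp: Ce_eq)

lemma Ce_strip: "x \<in> Ce ==> fst x \<in> interval_I a"
	unfolding Ce_iff using cell_sub \<delta>(3) by force

lemma Om_strip: "x \<in> Om ==> fst x \<in> interval_I a & - b < snd x & snd x < (L + V) * ep"
proof -
	assume x: "x \<in> Om"
	have "0 < L * ep" "0 < V * ep" using pos by auto
	hence "0 < (L + V) * ep" "L * ep < (L + V) * ep" by (auto simp: distrib_right)
	note 0 = \<open>0 < L * ep\<close> this
	consider "x \<in> O0" | "x \<in> Se" | "x \<in> Ce" using x unfolding Om_eq by blast
	thus ?thesis
	proof cases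
		case 1 thus ?thesis unfolding O0_iff using 0 pos by linarith
	next
		case 2 thus ?thesis unfolding Se_iff using 0 pos by linarith
	next
		case 3
		with Ce_strip[OF 3] show ?thesis unfolding Ce_iff using 0 pos by linarith
	qed
qed

lemma Om_alt: "Om = O0 \<union> Se \<union> (\<Union>k<N. {real k * ep<..<real k * ep + \<delta>} \<times> {-b<..<(L + V) * ep})"
proof (intro equalityI subsetI)
	fix x assume x: "x \<in> Om"
	show "x \<in> O0 \<union> Se \<union> (\<Union>k<N. {real k * ep<..<real k * ep + \<delta>} \<times> {-b<..<(L + V) * ep})"
	proof (cases "x \<in> Ce")
		case True
		then obtain k where "k < N" "real k * ep < fst x" "fst x < real k * ep + \<delta>" by (auto simp: Ce_iff)
		moreover have "- b < snd x" "snd x < (L + V) * ep" using Om_strip[OF x] by auto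
		ultimately show ?thesis by (cases x) auto
	qed (use x in "auto simp: Om_eq")
next
	fix x assume x: "x \<in> O0 \<union> Se \<union> (\<Union>k<N. {real k * ep<..<real k * ep + \<delta>} \<times> {-b<..<(L + V) * ep})"
	show "x \<in> Om"
	proof (cases "x \<in> O0 \<union> Se")
		case False
		then obtain k where k: "k < N" "real k * ep < fst x" "fst x < real k * ep + \<delta>" "- b < snd x" "snd x < (L + V) * ep"
			using x by (cases x) auto
		hence "fst x \<in> interval_I a" using cell_sub[of k "fst x"] \<delta>(3) by simp
		hence "0 <= snd x" "snd x <= L * ep" using False k by (auto simp: O0_iff Se_iff)
		hence "x \<in> Ce" using k by (auto simp: Ce_iff)
		thus ?thesis by (simp add: Om_eq)
	qed (auto simp: Om_eq)
qed

lemma Om_open: "open Om"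
	unfolding Om_alt O0_def Se_def Omega0_def S_eps_def interval_I_def
	by (intro open_Un open_UN open_Times ballI) auto

lemma Om_bounded: "bounded Om"
proof (rule bounded_subset)
	show "bounded ({0..a} \<times> {-b..(L + V) * ep})" by (intro bounded_Times) auto
	show "Om \<subseteq> {0..a} \<times> {-b..(L + V) * ep}"
	proof
		fix x assume "x \<in> Om"
		from Om_strip[OF this] show "x \<in> {0..a} \<times> {-b..(L + V) * ep}" by (cases x) (auto simp: interval_I_def)
	qed
qed

lemma O0_sets: "O0 \<in> sets lborel" "O0 \<in> sets borel" "open O0" "O0 \<subseteq> Om" "emeasure lborel O0 < \<infinity>"
	using Omega0_sets[of a b] open_Omega0[of a b] by (auto simp: O0_def Om_eq)

lemma Se_sets: "Se \<in> sets lborel" "Se \<in> sets borel" "open Se" "Se \<subseteq> Om"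
proof -
	show o: "open Se" by (auto simp: Se_def S_eps_def interval_I_def intro: open_Times)
	thus "Se \<in> sets lborel" "Se \<in> sets borel" by auto
qed (auto simp: Om_eq)

lemma Ce_sets: "Ce \<in> sets lborel" "Ce \<in> sets borel" "Ce \<subseteq> Om"
proof -
	show "Ce \<in> sets borel" unfolding Ce_eq by (intro sets.finite_UN) (auto simp: borel_Times)
	thus "Ce \<in> sets lborel" by simp
qed (auto simp: Om_eq)

lemma Om_sets: "Om \<in> sets lborel" "Om \<in> sets borel" "emeasure lborel Om < \<infinity>"
	using Om_open emeasure_bounded_finite[OF Om_bounded] by auto

lemma disjoint_parts: "O0 \<inter> Se = {}" "(O0 \<union> Se) \<inter> Ce = {}"
proof -
	have "0 < L * ep" using pos by simp
	thus "O0 \<inter> Se = {}" "(O0 \<union> Se) \<inter> Ce = {}" by (auto simp: O0_iff Se_iff Ce_iff)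
qed

lemma integral_Om:
	assumes "lint Om f"
	shows "(LBINT x:Om. f x) = (LBINT x:O0. f x) + (LBINT x:Se. f x) + (LBINT x:Ce. (f x :: real))"
proof -
	have i: "lint T f" if "T \<in> sets lborel" "T \<subseteq> Om" for T by (rule set_integrable_subset[OF assms that])
	have "(LBINT x:Om. f x) = (LBINT x:O0 \<union> Se. f x) + (LBINT x:Ce. f x)"
		unfolding Om_eq by (rule set_integral_Un[OF disjoint_parts(2)]) (intro i; use O0_sets Se_sets Ce_sets in auto)+
	also have "(LBINT x:O0 \<union> Se. f x) = (LBINT x:O0. f x) + (LBINT x:Se. f x)"
		by (rule set_integral_Un[OF disjoint_parts(1)]) (intro i; use O0_sets Se_sets in auto)+
	finally show ?thesis .
qed

lemma measure_Se: "measure lborel Se = a * (V * ep)"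
proof -
	have 0: "0 <= V * ep" "L * ep <= (L + V) * ep" using pos by (auto simp: distrib_right)
	have "emeasure lborel Se = emeasure (lborel \<Otimes>\<^sub>M lborel) ({0<..<a} \<times> {L * ep<..<(L + V) * ep})"
		by (simp add: Se_def S_eps_def interval_I_def lborel_prod)
	also have "... = emeasure lborel {0<..<a} * emeasure lborel {L * ep<..<(L + V) * ep}"
		by (rule lborel.emeasure_pair_measure_Times) auto
	also have "... = ennreal (a * (V * ep))" using pos 0 by (simp add: ennreal_mult[symmetric] distrib_right)
	finally show ?thesis using pos 0 by (simp add: measure_def)
qed

lemma measure_Ce: "measure lborel Ce <= a * \<alpha> * L * ep ^ 3"
proof -
	have "emeasure lborel Ce <= (\<Sum>k<N. emeasure lborel ({real k * ep<..<real k * ep + \<delta>} \<times> {0..L * ep}))"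
		unfolding Ce_eq by (rule emeasure_subadditive_finite) (auto simp: borel_Times)
	also have "... = (\<Sum>k<N. ennreal (\<delta> * (L * ep)))"
	proof (rule sum.cong[OF refl])
		fix k
		have "emeasure lborel ({real k * ep<..<real k * ep + \<delta>} \<times> {0..L * ep}) = emeasure (lborel \<Otimes>\<^sub>M lborel) ({real k * ep<..<real k * ep + \<delta>} \<times> {0..L * ep})"
			by (simp add: lborel_prod)
		also have "... = emeasure lborel {real k * ep<..<real k * ep + \<delta>} * emeasure lborel {0..L * ep}"
			by (rule lborel.emeasure_pair_measure_Times) auto
		also have "... = ennreal (\<delta> * (L * ep))" using \<delta>(1) pos by (simp add: ennreal_mult[symmetric])
		finally show "emeasure lborel ({real k * ep<..<real k * ep + \<delta>} \<times> {0..L * ep}) = ennreal (\<delta> * (L * ep))" .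
	qed
	also have "... = ennreal (real N * (\<delta> * (L * ep)))" using \<delta>(1) pos by (simp add: ennreal_mult ennreal_of_nat_eq_real_of_nat)
	also have "real N * (\<delta> * (L * ep)) = a * \<alpha> * L * ep ^ 3" unfolding N \<delta>_def by (simp add: algebra_simps power3_eq_cube)
	finally have "emeasure lborel Ce <= ennreal (a * \<alpha> * L * ep ^ 3)" .
	thus ?thesis using pos unfolding measure_def by (intro enn2real_leI) auto
qed

lemma L1_small:
	assumes g: "g \<in> Lp 2 Om" and E: "E \<in> sets lborel" "E \<subseteq> Om" and K: "(LBINT x:Om. (g x)^2) <= K"
	shows "(LBINT x:E. \<bar>g x\<bar>) <= sqrt (measure lborel E * K)"
proof (rule real_le_rsqrt)
	have Ef: "emeasure lborel E < \<infinity>" using emeasure_mono[OF E(2), of lborel] Om_sets by (auto intro: le_less_trans)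
	have gE: "g \<in> Lp 2 E" by (rule Lp2_subset[OF g E])
	have "lmeas E (%x. \<bar>g x\<bar>)"
	proof -
		have "(%x. indicator E x *R \<bar>g x\<bar>) = (%x. \<bar>indicator E x * g x\<bar>)" by (auto simp: abs_mult)
		thus ?thesis using Lp2_indicator(1)[OF gE] by (simp add: smeas_def)
	qed
	hence ag: "(%x. \<bar>g x\<bar>) \<in> Lp 2 E" using gE by (simp add: Lp2_square)
	have one: "(%_. 1) \<in> Lp 2 E" by (rule bounded_Lp2[OF E(1) Ef, where B=1]) (use E in "auto simp: smeas_def")
	have "(LBINT x:E. \<bar>g x\<bar>)^2 <= (LBINT x:E. (g x)^2) * (LBINT x:E. 1)"
		using Lp2_Cauchy_Schwarz[OF ag one] by simp
	also have "(LBINT x:E. 1) = measure lborel E" using E Ef by (simp add: sint_def)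
	also have "(LBINT x:E. (g x)^2) * measure lborel E <= K * measure lborel E"
	proof (rule mult_right_mono)
		have "(LBINT x:E. (g x)^2) <= (LBINT x:Om. (g x)^2)" unfolding sint_def
			by (rule integral_mono_AE') (use g E in "auto simp: Lp2_square set_integrable_def indicator_def")
		thus "(LBINT x:E. (g x)^2) <= K" using K by simp
	qed simp
	finally show "(LBINT x:E. \<bar>g x\<bar>)^2 <= measure lborel E * K" by (simp add: mult.commute)
qed

end

section \<open>Testing the equation on the perforated domain\<close>

lemma L2_set_integral_subset_le:
	fixes f :: "'a::euclidean_space => real"
	assumes "lint S f" "T \<in> sets lborel" "T \<subseteq> S" "!!x. x \<in> S ==> 0 <= f x"
	shows "(LBINT x:T. f x) <= (LBINT x:S. f x)"
	unfolding sint_def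
	by (rule integral_mono_AE') (use assms in "auto simp: set_integrable_def indicator_def")

lemma set_borel_measurable_cong:
	"(!!x. x \<in> S ==> f x = g x) ==> set_borel_measurable M S f ==> set_borel_measurable M S (g :: 'a => real)"
proof -
	assume "!!x. x \<in> S ==> f x = g x" and m: "set_borel_measurable M S f"
	hence "(%x. indicator S x *R f x) = (%x. indicator S x *R g x)" by (auto simp: indicator_def)
	with m show ?thesis by (simp add: smeas_def)
qed

lemma set_borel_measurable_disjoint_Un:
	fixes f :: "'a => real"
	assumes "set_borel_measurable M A f" "set_borel_measurable M B f" "A \<inter> B = {}"
	shows "set_borel_measurable M (A \<union> B) f"
proof -
	have "(%x. indicator (A \<union> B) x *R f x) = (%x. indicator A x *R f x + indicator B x *R f x)"
	proof
		fix x show "indicator (A \<union> B) x *R f x = indicator A x *R f x + indicator B x *R f x"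
			using assms(3) by (cases "x \<in> A"; cases "x \<in> B") auto
	qed
	thus ?thesis using assms by (simp add: smeas_def)
qed

text \<open>A solution on the perforated domain; \<open>u1\<close> and \<open>u2\<close> are its partial derivatives.\<close>
locale resonator_solution = resonator +
	fixes \<omega> K :: real and f u :: "plane => real"
	assumes f: "f \<in> Lp 2 UNIV" "AE x in lborel. x \<notin> Omega0 a b --> f x = 0"
		and ws: "weak_solution (Omega_eps a b L V \<alpha> ep) \<omega> f u"
		and K: "H1_norm (Omega_eps a b L V \<alpha> ep) u <= K"
begin

definition u1 where "u1 = wpd Om (1, 0) u"
definition u2 where "u2 = wpd Om (0, 1) u"

lemma u_H1: "u \<in> sobolev 1 2 Om" using ws by (simp add: weak_solution_def Om_def)

lemma Basis2: "(1, 0) \<in> (Basis :: (plane) set)" "(0, 1) \<in> (Basis :: (plane) set)" by (auto simp: Basis_real2)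

lemmas u_props = sobolev1D[OF u_H1 Om_open Basis2(1), folded u1_def] sobolev1D(2,3)[OF u_H1 Om_open Basis2(2), folded u2_def]

lemma u_L2: "u \<in> Lp 2 Om" "u1 \<in> Lp 2 Om" "u2 \<in> Lp 2 Om" using u_props by auto

lemma u_weak: "has_weak_pd Om (1, 0) u u1" "has_weak_pd Om (0, 1) u u2" using u_props by auto

lemma u_int: "lint Om u" "lint Om u1" "lint Om u2"
	using u_L2 Lp2_integrable[OF Om_sets(1,3)] by auto

lemma u_bounds: "(LBINT x:Om. (u x)^2) <= K^2" "(LBINT x:Om. (u1 x)^2) <= K^2" "(LBINT x:Om. (u2 x)^2) <= K^2"
proof -
	have n: "(H1_norm Om u)^2 = (LBINT x:Om. (u x)^2) + ((LBINT x:Om. (u1 x)^2) + (LBINT x:Om. (u2 x)^2))"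
		by (rule H1_norm_square[OF Om_open u_L2(1) u_weak u_L2(2,3)])
	have nn: "0 <= (LBINT x:Om. (g x)^2)" for g :: "plane => real" by (rule set_integral_nonneg_simple) simp
	have "0 <= H1_inner Om u u" unfolding H1_inner_def
		by (intro add_nonneg_nonneg set_integral_nonneg_simple) auto
	hence "0 <= H1_norm Om u" by (simp add: H1_norm_def)
	hence "(H1_norm Om u)^2 <= K^2" using K by (intro power_mono) (simp_all add: Om_def)
	with n nn[of u] nn[of u1] nn[of u2]
	show "(LBINT x:Om. (u x)^2) <= K^2" "(LBINT x:Om. (u1 x)^2) <= K^2" "(LBINT x:Om. (u2 x)^2) <= K^2" by linarith+
qed

lemma abs_integrable: "g \<in> {u, u1, u2} ==> lint Om (%x. \<bar>g x\<bar>)"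
	using u_int set_integrable_abs by auto

lemma strip_meas:
	fixes E :: "(plane) set" and \<psi> :: "real => real"
	assumes "continuous_on UNIV \<psi>" "E \<in> sets borel"
	shows "lmeas E (%x::plane. \<psi> (fst x))"
proof -
	have [measurable]: "\<psi> \<in> borel_measurable borel" using assms by (auto intro: borel_measurable_continuous_onI)
	have m: "(%x::plane. \<psi> (fst x)) \<in> borel_measurable borel" by measurable
	have i: "(indicator E :: plane => real) \<in> borel_measurable borel" by (rule borel_measurable_indicator[OF assms(2)])
	have "(%x. indicator E x * \<psi> (fst x)) \<in> borel_measurable borel" by (rule borel_measurable_times[OF i m])
	thus ?thesis by (simp add: smeas_def)
qed

text \<open>A bound for the terms of the tested equation that live in the channels.\<close>
lemma channel_bound:
	assumes g: "g \<in> {u, u1, u2}" and m: "lmeas Ce \<Phi>" and B: "!!x. x \<in> Ce ==> \<bar>\<Phi> x\<bar> <= M" and M: "M \<ge> 0"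
	shows "\<bar>LBINT x:Ce. g x * \<Phi> x\<bar> <= M * (LBINT x:Ce. \<bar>g x\<bar>)"
proof -
	have gi: "lint Ce g" using g set_integrable_subset[OF u_int(1) Ce_sets(1,3)] set_integrable_subset[OF u_int(2) Ce_sets(1,3)] set_integrable_subset[OF u_int(3) Ce_sets(1,3)] by auto
	have "\<bar>LBINT x:Ce. g x * \<Phi> x\<bar> <= (LBINT x:Ce. M * \<bar>g x\<bar>)"
	proof (rule set_integral_abs_le)
		show "lint Ce (%x. g x * \<Phi> x)" by (rule set_integrable_mult_bounded[OF gi m B])
		show "lint Ce (%x. M * \<bar>g x\<bar>)" by (intro set_integrable_mult_right set_integrable_abs gi)
		show "\<bar>g x * \<Phi> x\<bar> <= M * \<bar>g x\<bar>" if "x \<in> Ce" for x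
			using B[OF that] by (simp add: abs_mult mult.commute[of M] mult_left_mono)
	qed
	thus ?thesis by simp
qed

lemma f_vanishes:
	assumes m: "lmeas E \<Phi>" and E: "E \<in> sets borel" "E \<inter> O0 = {}"
	shows "(LBINT x:E. f x * \<Phi> x) = 0"
proof -
	have [measurable]: "f \<in> borel_measurable borel" using f(1) by (simp add: Lp_def smeas_def)
	have "(LBINT x:E. f x * \<Phi> x) = (LBINT x:E. 0)"
	proof (rule set_integral_cong_AE_simple)
		show "AE x in lborel. x \<in> E --> f x * \<Phi> x = 0" using f(2) by eventually_elim (use E(2) in "auto simp: O0_def")
		have "(%x. f x * (indicator E x *R \<Phi> x)) \<in> borel_measurable lborel"
			using m by (intro borel_measurable_times) (auto simp: smeas_def)
		thus "lmeas E (%x. f x * \<Phi> x)"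
			by (simp add: smeas_def mult.left_commute)
	qed (auto simp: smeas_def)
	thus ?thesis by simp
qed

lemma f_L2: "f \<in> Lp 2 Om" by (rule Lp2_subset[OF f(1)]) (use Om_sets in auto)

lemma test_parts:
	assumes g: "g \<in> Lp 2 Om" and m: "lmeas Om \<Phi>" and B: "!!x. x \<in> Om ==> \<bar>\<Phi> x\<bar> <= B"
	shows "(LBINT x:Om. g x * \<Phi> x) = (LBINT x:O0. g x * \<Phi> x) + (LBINT x:Se. g x * \<Phi> x) + (LBINT x:Ce. g x * \<Phi> x)"
	by (rule integral_Om[OF set_integrable_mult_bounded[OF Lp2_integrable[OF Om_sets(1,3) g] m B]])

text \<open>The tested equation in the upper layer, the size of the solution in the channels, and a bound for the latter.\<close>
abbreviation "upper \<psi> \<gamma> \<equiv> (LBINT x:Se. u1 x * \<gamma> (fst x)) - \<omega>^2 * (LBINT x:Se. u x * \<psi> (fst x))"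
abbreviation "leak \<equiv> (LBINT x:Ce. \<bar>u1 x\<bar>) + \<omega>^2 * (LBINT x:Ce. \<bar>u x\<bar>)"
abbreviation "rate \<equiv> (1 + \<omega>^2) * sqrt (a * \<alpha> * L * K^2 * ep)"

text \<open>The test function is $\psi(x_1)$ times a cutoff that rises linearly from zero to one across the channels.\<close>
lemma pde_channel:
	fixes \<psi> \<gamma> :: "real => real"
	assumes \<psi>: "!!s. DERIV \<psi> s :> \<gamma> s" and c\<gamma>: "continuous_on UNIV \<gamma>"
		and B: "!!s. \<bar>\<psi> s\<bar> <= M" "!!s. \<bar>\<gamma> s\<bar> <= M"
	shows "\<bar>(upper \<psi> \<gamma>) + 1 / (L * ep) * (LBINT x:Ce. u2 x * \<psi> (fst x))\<bar>
		 <= M * leak"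
proof -
	define l where "l = L * ep"
	define r where "r = (L + V) * ep"
	have l: "l > 0" "r > l" using pos by (auto simp: l_def r_def distrib_right)
	interpret trapezoid 0 l r "r + 1" using l by unfold_locales auto
	let ?c = "trap 0 l r (r + 1)" and ?c' = "trap_deriv 0 l r (r + 1)"
	have M0: "M \<ge> 0" using B(1)[of 0] by linarith
	have c\<psi>: "continuous_on UNIV \<psi>" using DERIV_isCont[OF \<psi>] by (auto simp: continuous_on_eq_continuous_at)
	have [measurable]: "\<psi> \<in> borel_measurable borel" "\<gamma> \<in> borel_measurable borel"
		using c\<psi> c\<gamma> by (auto intro: borel_measurable_continuous_onI)
	have [measurable]: "Om \<in> sets borel" "Ce \<in> sets borel" by (rule Om_sets Ce_sets)+
	define \<Phi> where "\<Phi> x = \<psi> (fst x) * ?c (snd x)" for x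
	define G1 where "G1 x = \<gamma> (fst x) * ?c (snd x)" for x
	define G2 where "G2 x = \<psi> (fst x) * ?c' (snd x)" for x
	have s1: "slicewise Om (1, 0) \<Phi> G1"
		using slicewise_mult[OF slicewise_fst(1)[OF \<psi>] slicewise_snd(2)[OF trap_isCont _ trap_has_deriv, of "{0, l, r, r + 1}"], of Om]
		by (simp add: \<Phi>_def[abs_def] G1_def[abs_def])
	have s2: "slicewise Om (0, 1) \<Phi> G2"
		using slicewise_mult[OF slicewise_fst(2)[OF \<psi>] slicewise_snd(1)[OF trap_isCont _ trap_has_deriv, of "{0, l, r, r + 1}"], of Om]
		by (simp add: \<Phi>_def[abs_def] G2_def[abs_def])
	have m: "lmeas E \<Phi>" "lmeas E G1" "lmeas E G2" if [measurable]: "E \<in> sets borel" for E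
		unfolding smeas_def \<Phi>_def G1_def G2_def by measurable
	define B' where "B' = 1 / l + 1 + 1"
	have B'1: "B' \<ge> 1" using l by (simp add: B'_def)
	have bd: "\<bar>\<Phi> x\<bar> <= M * B'" "\<bar>G1 x\<bar> <= M * B'" "\<bar>G2 x\<bar> <= M * B'" for x
	proof -
		have c1: "\<bar>?c (snd x)\<bar> <= B'" using trap_bounds[of "snd x"] B'1 by auto
		have c2: "\<bar>?c' (snd x)\<bar> <= B'" using trap_deriv_bound[of "snd x"] by (simp add: B'_def)
		show "\<bar>\<Phi> x\<bar> <= M * B'" "\<bar>G1 x\<bar> <= M * B'" "\<bar>G2 x\<bar> <= M * B'"
			unfolding \<Phi>_def G1_def G2_def abs_mult by (intro mult_mono B c1 c2 M0; simp)+
	qed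
	have test: "(LBINT x:Om. u1 x * G1 x) + (LBINT x:Om. u2 x * G2 x) - \<omega>^2 * (LBINT x:Om. u x * \<Phi> x) = (LBINT x:Om. f x * \<Phi> x)"
		unfolding u1_def u2_def
		by (rule weak_solution_test[OF Om_open Om_bounded _ s1 s2 m(1,2,3)[OF Om_sets(2)] bd]) (use ws in "simp add: Om_def")
	have O0v: "?c (snd x) = 0" "?c' (snd x) = 0" if "x \<in> O0" for x
		using that l trap_left[of "snd x"] by (auto simp: O0_iff trap_deriv_def)
	have Sev: "?c (snd x) = 1" "?c' (snd x) = 0" if "x \<in> Se" for x
		using that l trap_mid[of "snd x"] by (auto simp: Se_iff trap_deriv_def l_def r_def)
	have zero: "(LBINT x:O0. g x * h x) = 0" if "!!x. x \<in> O0 ==> h x = 0" for g h :: "plane => real"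
	proof -
		have "(LBINT x:O0. g x * h x) = (LBINT x:O0. 0)" by (rule set_integral_cong_simple) (use that in simp)
		thus ?thesis by simp
	qed
	have z1: "(LBINT x:O0. u1 x * G1 x) = 0" "(LBINT x:O0. u2 x * G2 x) = 0" "(LBINT x:O0. u x * \<Phi> x) = 0" "(LBINT x:O0. f x * \<Phi> x) = 0"
		by (rule zero; simp add: G1_def G2_def \<Phi>_def O0v)+
	have s: "(LBINT x:Se. u1 x * G1 x) = (LBINT x:Se. u1 x * \<gamma> (fst x))" "(LBINT x:Se. u x * \<Phi> x) = (LBINT x:Se. u x * \<psi> (fst x))"
		by (rule set_integral_cong_simple; simp add: G1_def \<Phi>_def Sev)+
	have sz: "(LBINT x:Se. u2 x * G2 x) = 0"
	proof -
		have "(LBINT x:Se. u2 x * G2 x) = (LBINT x:Se. 0)" by (rule set_integral_cong_simple) (simp add: G2_def Sev)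
		thus ?thesis by simp
	qed
	have fz: "(LBINT x:Se. f x * \<Phi> x) = 0" "(LBINT x:Ce. f x * \<Phi> x) = 0"
		using f_vanishes[OF m(1)[OF Se_sets(2)] Se_sets(2)] f_vanishes[OF m(1)[OF Ce_sets(2)] Ce_sets(2)] disjoint_parts by auto
	have u2C: "lmeas Ce (%x. u2 x * k x)" if "lmeas Ce k" "!!x. x \<in> Ce ==> \<bar>k x\<bar> <= Q" for k :: "plane => real" and Q
		using set_integrable_mult_bounded[OF set_integrable_subset[OF u_int(3) Ce_sets(1,3)] that]
		by (auto simp: set_integrable_def smeas_def)
	have C2: "(LBINT x:Ce. u2 x * G2 x) = 1 / (L * ep) * (LBINT x:Ce. u2 x * \<psi> (fst x))"
	proof -
		have "(LBINT x:Ce. u2 x * G2 x) = (LBINT x:Ce. u2 x * (1 / l * \<psi> (fst x)))"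
		proof (rule set_integral_cong_AE_simple)
			show "AE x in lborel. x \<in> Ce --> u2 x * G2 x = u2 x * (1 / l * \<psi> (fst x))"
				using AE_snd_finite[of "{0, l}", OF finite.insertI[OF finite.insertI[OF finite.emptyI]]]
			proof eventually_elim
				case (elim x)
				show ?case
				proof
					assume "x \<in> Ce"
					hence "0 < snd x" "snd x < l" using elim by (auto simp: Ce_iff l_def)
					thus "u2 x * G2 x = u2 x * (1 / l * \<psi> (fst x))" by (simp add: G2_def trap_deriv_def)
				qed
			qed
			show "lmeas Ce (%x. u2 x * G2 x)" by (rule u2C[OF m(3)[OF Ce_sets(2)] bd(3)])
			show "lmeas Ce (%x. u2 x * (1 / l * \<psi> (fst x)))"
			proof (rule u2C)
				show "lmeas Ce (%x. 1 / l * \<psi> (fst x))" unfolding smeas_def by measurable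
				show "\<bar>1 / l * \<psi> (fst x)\<bar> <= 1 / l * M" for x using B(1)[of "fst x"] l unfolding abs_mult by (intro mult_mono) auto
			qed
		qed
		also have "... = 1 / l * (LBINT x:Ce. u2 x * \<psi> (fst x))"
			unfolding set_integral_mult_right[symmetric] by (rule set_integral_cong_simple) simp
		finally show ?thesis by (simp add: l_def)
	qed
	have c1: "\<bar>G1 x\<bar> <= M" "\<bar>\<Phi> x\<bar> <= M" for x
		using mult_mono[OF B(2) _ M0, of "?c (snd x)" 1 "fst x"] mult_mono[OF B(1) _ M0, of "?c (snd x)" 1 "fst x"] trap_bounds[of "snd x"]
		by (auto simp: G1_def \<Phi>_def abs_mult)
	have R: "\<bar>(LBINT x:Ce. u1 x * G1 x)\<bar> <= M * (LBINT x:Ce. \<bar>u1 x\<bar>)" "\<bar>(LBINT x:Ce. u x * \<Phi> x)\<bar> <= M * (LBINT x:Ce. \<bar>u x\<bar>)"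
		using channel_bound[OF _ m(2)[OF Ce_sets(2)] c1(1) M0, of u1] channel_bound[OF _ m(1)[OF Ce_sets(2)] c1(2) M0, of u] by auto
	have "(upper \<psi> \<gamma>) + 1 / (L * ep) * (LBINT x:Ce. u2 x * \<psi> (fst x))
		= - (LBINT x:Ce. u1 x * G1 x) + \<omega>^2 * (LBINT x:Ce. u x * \<Phi> x)"
		using test unfolding test_parts[OF u_L2(2) m(2)[OF Om_sets(2)] bd(2)] test_parts[OF u_L2(3) m(3)[OF Om_sets(2)] bd(3)]
			test_parts[OF u_L2(1) m(1)[OF Om_sets(2)] bd(1)] test_parts[OF f_L2 m(1)[OF Om_sets(2)] bd(1)] z1 s sz fz C2
		by (simp add: distrib_left)
	note e = this
	have "\<bar>- (LBINT x:Ce. u1 x * G1 x) + \<omega>^2 * (LBINT x:Ce. u x * \<Phi> x)\<bar> <= \<bar>LBINT x:Ce. u1 x * G1 x\<bar> + \<omega>^2 * \<bar>LBINT x:Ce. u x * \<Phi> x\<bar>"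
		by (rule order_trans[OF abs_triangle_ineq]) (simp add: abs_mult)
	also have "... <= M * (LBINT x:Ce. \<bar>u1 x\<bar>) + \<omega>^2 * (M * (LBINT x:Ce. \<bar>u x\<bar>))"
		by (intro add_mono mult_left_mono R) auto
	also have "... = M * leak" by (simp add: distrib_left mult.left_commute)
	finally show ?thesis unfolding e .
qed

text \<open>The test function is \<open>\<phi>\<close> below and $\psi(x_1)$ in the channels and in the layer.\<close>
lemma pde_lower:
	fixes \<psi> \<gamma> :: "real => real"
	assumes \<psi>: "!!s. DERIV \<psi> s :> \<gamma> s" and c\<gamma>: "continuous_on UNIV \<gamma>"
		and B: "!!s. \<bar>\<psi> s\<bar> <= M" "!!s. \<bar>\<gamma> s\<bar> <= M"
		and \<phi>: "continuous_on (closure O0) \<phi>" "continuous_on (closure O0) D" "!!x. x \<in> O0 ==> GDERIV \<phi> x :> D x"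
		and tr: "!!s. s \<in> interval_I a ==> \<phi> (s, 0) = \<psi> s"
	shows "\<bar>((LBINT x:O0. u1 x * fst (D x)) + (LBINT x:O0. u2 x * snd (D x)) - \<omega>^2 * (LBINT x:O0. u x * \<phi> x) - (LBINT x:O0. f x * \<phi> x))
			 + (upper \<psi> \<gamma>)\<bar>
		 <= M * leak"
proof -
	have M0: "M \<ge> 0" using B(1)[of 0] by linarith
	have Le: "L * ep > 0" using pos by simp
	have cl: "closure O0 = {0..a} \<times> {-b..0}" unfolding O0_def by (rule closure_Omega0[OF pos(1,2)])
	have c\<psi>: "continuous_on UNIV \<psi>" using DERIV_isCont[OF \<psi>] by (auto simp: continuous_on_eq_continuous_at)
	define \<Phi> where "\<Phi> x = (if snd x < 0 then \<phi> x else \<psi> (fst x))" for x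
	define G1 where "G1 x = (if snd x < 0 then fst (D x) else \<gamma> (fst x))" for x
	define G2 where "G2 x = (if snd x < 0 then snd (D x) else 0)" for x
	have \<Phi>_min: "\<Phi> x = \<phi> (fst x, min (snd x) 0)" if "fst x \<in> interval_I a" for x
		using tr[OF that] by (cases "snd x < 0") (auto simp: \<Phi>_def)
	have hd: "(\<phi> has_derivative (%h. h \<bullet> D x)) (at x)" if "x \<in> O0" for x using \<phi>(3)[OF that] by (simp add: gderiv_def)
	have d: "((%s. \<phi> (x + s *R i)) has_real_derivative (i \<bullet> D (x + t *R i))) (at t)" if "x + t *R i \<in> O0" for x t i
		by (rule line_derivative[OF hd[OF that]])
	have s1: "slicewise Om (1, 0) \<Phi> G1"
	proof -
		have dd: "((%s. \<Phi> (x + s *R (1, 0))) has_real_derivative G1 (x + t *R (1, 0))) (at t)" if x: "x + t *R (1, 0) \<in> Om" for x t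
		proof (cases "snd x < 0")
			case True
			hence "x + t *R (1, 0) \<in> O0" using Om_strip[OF x] by (auto simp: O0_iff)
			from d[OF this] show ?thesis using True by (simp add: \<Phi>_def G1_def inner_Pair_0 inner_prod_def)
		next
			case False
			have "DERIV ((%s. fst x + s)) t :> 1" by (auto intro!: derivative_eq_intros)
			from DERIV_chain2[where f=\<psi> and g="%s. fst x + s" and x=t and s=UNIV, OF \<psi> this]
			show ?thesis using False by (simp add: \<Phi>_def G1_def)
		qed
		hence "isCont (%s. \<Phi> (x + s *R (1, 0))) t" if "x + t *R (1, 0) \<in> Om" for x t using that by (blast intro: DERIV_isCont)
		with dd show ?thesis unfolding slicewise_def by (blast intro: finite.emptyI)
	qed
	have s2: "slicewise Om (0, 1) \<Phi> G2"
		unfolding slicewise_def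
	proof (intro conjI allI impI)
		fix x t assume x: "x + t *R (0, 1) \<in> Om"
		have xI: "fst x \<in> interval_I a" and xb: "- b < snd x + t" using Om_strip[OF x] by auto
		have e: "(%s. \<Phi> (x + s *R (0, 1))) = (%s. \<phi> (fst x, min (snd x + s) 0))" using \<Phi>_min xI by auto
		have "continuous_on {- b - snd x<..} (%s. (fst x, min (snd x + s) 0))" by (intro continuous_intros)
		moreover have "(%s. (fst x, min (snd x + s) 0)) ` {- b - snd x<..} \<subseteq> closure O0"
			using xI pos unfolding cl by (auto simp: interval_I_def)
		ultimately have "continuous_on {- b - snd x<..} (%s. \<phi> (fst x, min (snd x + s) 0))" by (rule continuous_on_compose2[OF \<phi>(1)])
		thus "isCont (%s. \<Phi> (x + s *R (0, 1))) t" unfolding e using xb by (simp add: continuous_on_eq_continuous_at)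
	next
		fix x :: "plane"
		show "\<exists>T. finite T & (\<forall>t. t \<notin> T --> x + t *R (0, 1) \<in> Om --> ((%s. \<Phi> (x + s *R (0, 1))) has_real_derivative G2 (x + t *R (0, 1))) (at t))"
		proof (intro exI[of _ "{- snd x}"] conjI allI impI)
			fix t assume t: "t \<notin> {- snd x}" and x: "x + t *R (0, 1) \<in> Om"
			show "((%s. \<Phi> (x + s *R (0, 1))) has_real_derivative G2 (x + t *R (0, 1))) (at t)"
			proof (cases "snd x + t < 0")
				case True
				hence "x + t *R (0, 1) \<in> O0" using Om_strip[OF x] by (auto simp: O0_iff)
				from d[OF this] have 1: "((%s. \<phi> (x + s *R (0, 1))) has_real_derivative G2 (x + t *R (0, 1))) (at t)"
					using True by (simp add: G2_def inner_prod_def)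
				have "\<forall>\<^sub>F s in nhds t. s \<in> {..< - snd x}" using True by (intro eventually_nhds_in_open) auto
				hence "\<forall>\<^sub>F s in nhds t. \<Phi> (x + s *R (0, 1)) = \<phi> (x + s *R (0, 1))" by eventually_elim (auto simp: \<Phi>_def)
				from DERIV_cong_ev[OF refl this refl] 1 show ?thesis by simp
			next
				case False
				hence t': "snd x + t > 0" using t by auto
				have "\<forall>\<^sub>F s in nhds t. s \<in> {- snd x <..}" using t' by (intro eventually_nhds_in_open) auto
				hence "\<forall>\<^sub>F s in nhds t. \<Phi> (x + s *R (0, 1)) = \<psi> (fst x)" by eventually_elim (auto simp: \<Phi>_def)
				from DERIV_cong_ev[OF refl this refl] show ?thesis using t' by (simp add: G2_def)
			qed
		qed simp
	qed
	have sub: "O0 \<subseteq> closure O0" by (rule closure_subset)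
	have cm: "lmeas O0 k" if "continuous_on (closure O0) k" for k :: "plane => real"
		unfolding smeas_def
		using borel_measurable_continuous_on_indicator[OF O0_sets(2) continuous_on_subset[OF that sub]] by simp
	have m: "lmeas Om (%x. if snd x < 0 then k x else q (fst x))" if "continuous_on (closure O0) k" "continuous_on UNIV q" for k :: "plane => real" and q :: "real => real"
	proof -
		have "lmeas O0 (%x. if snd x < 0 then k x else q (fst x))"
			by (rule set_borel_measurable_cong[OF _ cm[OF that(1)]]) (auto simp: O0_iff)
		moreover have "lmeas Se (%x. if snd x < 0 then k x else q (fst x))" "lmeas Ce (%x. if snd x < 0 then k x else q (fst x))"
			using set_borel_measurable_cong[OF _ strip_meas[OF that(2) Se_sets(2)], of "%x. if snd x < 0 then k x else q (fst x)"]
				set_borel_measurable_cong[OF _ strip_meas[OF that(2) Ce_sets(2)], of "%x. if snd x < 0 then k x else q (fst x)"] Le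
			by (auto simp: Se_iff Ce_iff)
		ultimately show ?thesis unfolding Om_eq using disjoint_parts by (intro set_borel_measurable_disjoint_Un) auto
	qed
	have cD: "continuous_on (closure O0) (%x. fst (D x))" "continuous_on (closure O0) (%x. snd (D x))"
		using \<phi>(2) by (auto intro: continuous_intros)
	have m': "lmeas Om \<Phi>" "lmeas Om G1" "lmeas Om G2"
		using m[OF \<phi>(1) c\<psi>] m[OF cD(1) c\<gamma>] m[OF cD(2) continuous_on_const[of _ 0]] by (auto simp: \<Phi>_def[abs_def] G1_def[abs_def] G2_def[abs_def])
	have bd0: "\<exists>Q. \<forall>x\<in>O0. \<bar>k x\<bar> <= Q" if "continuous_on (closure O0) k" for k :: "plane => real"
	proof -
		have "bounded (k ` closure O0)" using that unfolding cl by (intro compact_imp_bounded compact_continuous_image) (auto intro: compact_Times)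
		then obtain Q where "\<forall>y\<in>k ` closure O0. norm y <= Q" unfolding bounded_iff by blast
		thus ?thesis using sub unfolding real_norm_def by blast
	qed
	obtain Q0 Q1 Q2 where Q: "!!x. x \<in> O0 ==> \<bar>\<phi> x\<bar> <= Q0" "!!x. x \<in> O0 ==> \<bar>fst (D x)\<bar> <= Q1" "!!x. x \<in> O0 ==> \<bar>snd (D x)\<bar> <= Q2"
		using bd0[OF \<phi>(1)] bd0[OF cD(1)] bd0[OF cD(2)] by blast
	define Q where "Q = \<bar>Q0\<bar> + \<bar>Q1\<bar> + \<bar>Q2\<bar> + M"
	have bd: "\<bar>\<Phi> x\<bar> <= Q" "\<bar>G1 x\<bar> <= Q" "\<bar>G2 x\<bar> <= Q" if "x \<in> Om" for x
	proof -
		have "snd x < 0 ==> x \<in> O0" using Om_strip[OF that] by (auto simp: O0_iff)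
		thus "\<bar>\<Phi> x\<bar> <= Q" "\<bar>G1 x\<bar> <= Q" "\<bar>G2 x\<bar> <= Q"
			using Q[of x] B[of "fst x"] M0 by (auto simp: \<Phi>_def G1_def G2_def Q_def)
	qed
	have test: "(LBINT x:Om. u1 x * G1 x) + (LBINT x:Om. u2 x * G2 x) - \<omega>^2 * (LBINT x:Om. u x * \<Phi> x) = (LBINT x:Om. f x * \<Phi> x)"
		unfolding u1_def u2_def
		by (rule weak_solution_test[OF Om_open Om_bounded _ s1 s2 m' bd]) (use ws in "simp_all add: Om_def")
	have o: "(LBINT x:O0. u1 x * G1 x) = (LBINT x:O0. u1 x * fst (D x))" "(LBINT x:O0. u2 x * G2 x) = (LBINT x:O0. u2 x * snd (D x))"
		"(LBINT x:O0. u x * \<Phi> x) = (LBINT x:O0. u x * \<phi> x)" "(LBINT x:O0. f x * \<Phi> x) = (LBINT x:O0. f x * \<phi> x)"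
		by (rule set_integral_cong_simple; simp add: O0_iff G1_def G2_def \<Phi>_def)+
	have Sy: "\<not> snd x < 0" if "x \<in> Se \<union> Ce" for x using that Le by (auto simp: Se_iff Ce_iff)
	have s: "(LBINT x:Se. u1 x * G1 x) = (LBINT x:Se. u1 x * \<gamma> (fst x))" "(LBINT x:Se. u x * \<Phi> x) = (LBINT x:Se. u x * \<psi> (fst x))"
		by (rule set_integral_cong_simple; use Sy in \<open>simp add: G1_def \<Phi>_def\<close>)+
	have z: "(LBINT x:Se. u2 x * G2 x) = 0" "(LBINT x:Ce. u2 x * G2 x) = 0"
	proof -
		have "(LBINT x:E. u2 x * G2 x) = (LBINT x:E. 0)" if "E \<subseteq> Se \<union> Ce" for E
			by (rule set_integral_cong_simple) (use Sy that in "auto simp: G2_def")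
		from this[of Se] this[of Ce] show "(LBINT x:Se. u2 x * G2 x) = 0" "(LBINT x:Ce. u2 x * G2 x) = 0" by auto
	qed
	have mC: "lmeas E \<Phi>" "lmeas E G1" if "E \<in> sets lborel" "E \<subseteq> Om" for E
		by (rule set_borel_measurable_subset_borel[OF _ that]; rule m')+
	have fz: "(LBINT x:Se. f x * \<Phi> x) = 0" "(LBINT x:Ce. f x * \<Phi> x) = 0"
		using f_vanishes[OF mC(1)[OF Se_sets(1,4)] Se_sets(2)] f_vanishes[OF mC(1)[OF Ce_sets(1,3)] Ce_sets(2)] disjoint_parts by auto
	have c1: "\<bar>G1 x\<bar> <= M" "\<bar>\<Phi> x\<bar> <= M" if "x \<in> Ce" for x
		using Sy[of x] that B[of "fst x"] by (auto simp: G1_def \<Phi>_def)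
	have R: "\<bar>(LBINT x:Ce. u1 x * G1 x)\<bar> <= M * (LBINT x:Ce. \<bar>u1 x\<bar>)" "\<bar>(LBINT x:Ce. u x * \<Phi> x)\<bar> <= M * (LBINT x:Ce. \<bar>u x\<bar>)"
		using channel_bound[OF _ mC(2)[OF Ce_sets(1,3)] c1(1) M0, of u1] channel_bound[OF _ mC(1)[OF Ce_sets(1,3)] c1(2) M0, of u] by auto
	have tp: "(LBINT x:Om. u1 x * G1 x) = (LBINT x:O0. u1 x * G1 x) + (LBINT x:Se. u1 x * G1 x) + (LBINT x:Ce. u1 x * G1 x)"
		"(LBINT x:Om. u2 x * G2 x) = (LBINT x:O0. u2 x * G2 x) + (LBINT x:Se. u2 x * G2 x) + (LBINT x:Ce. u2 x * G2 x)"
		"(LBINT x:Om. u x * \<Phi> x) = (LBINT x:O0. u x * \<Phi> x) + (LBINT x:Se. u x * \<Phi> x) + (LBINT x:Ce. u x * \<Phi> x)"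
		"(LBINT x:Om. f x * \<Phi> x) = (LBINT x:O0. f x * \<Phi> x) + (LBINT x:Se. f x * \<Phi> x) + (LBINT x:Ce. f x * \<Phi> x)"
		using test_parts[OF u_L2(2) m'(2) bd(2)] test_parts[OF u_L2(3) m'(3) bd(3)]
			test_parts[OF u_L2(1) m'(1) bd(1)] test_parts[OF f_L2 m'(1) bd(1)] by blast+
	have "((LBINT x:O0. u1 x * fst (D x)) + (LBINT x:O0. u2 x * snd (D x)) - \<omega>^2 * (LBINT x:O0. u x * \<phi> x) - (LBINT x:O0. f x * \<phi> x))
			 + (upper \<psi> \<gamma>)
		= - (LBINT x:Ce. u1 x * G1 x) + \<omega>^2 * (LBINT x:Ce. u x * \<Phi> x)"
		using test unfolding tp o s z fz by (simp add: distrib_left)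
	note e = this
	have "\<bar>- (LBINT x:Ce. u1 x * G1 x) + \<omega>^2 * (LBINT x:Ce. u x * \<Phi> x)\<bar> <= \<bar>LBINT x:Ce. u1 x * G1 x\<bar> + \<omega>^2 * \<bar>LBINT x:Ce. u x * \<Phi> x\<bar>"
		by (rule order_trans[OF abs_triangle_ineq]) (simp add: abs_mult)
	also have "... <= M * (LBINT x:Ce. \<bar>u1 x\<bar>) + \<omega>^2 * (M * (LBINT x:Ce. \<bar>u x\<bar>))"
		by (intro add_mono mult_left_mono R) auto
	also have "... = M * leak" by (simp add: distrib_left mult.left_commute)
	finally show ?thesis unfolding e .
qed

subsection \<open>Identities in the upper layer\<close>

text \<open>Integration by parts in $x_1$ produces no boundary terms, since \<open>\<gamma>\<close> does not depend on $x_2$ and vanishes near the lateral sides.\<close>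
lemma Se_ibp:
	fixes \<gamma> :: "real => real"
	assumes \<gamma>: "\<gamma> \<in> test_functions (interval_I a)"
	shows "(LBINT x:Se. u1 x * \<gamma> (fst x)) = - (LBINT x:Se. u x * pd 1 \<gamma> (fst x))"
proof -
	let ?J = "{L * ep<..<(L + V) * ep}"
	obtain \<eta> where \<eta>: "!!n::nat. \<eta> n \<in> test_functions ?J" "!!n x. \<bar>\<eta> n x\<bar> <= 1" "!!x. x \<in> ?J ==> (%n. \<eta> n x) -->> 1"
		by (rule test_dense_interval[of "L * ep" "(L + V) * ep" "%_. 1" 1]) auto
	obtain Kg Bg where Kg: "compact Kg" "Kg \<subseteq> interval_I a" "!!s. s \<notin> Kg ==> \<gamma> s = 0" and Bg: "!!s. \<bar>\<gamma> s\<bar> <= Bg"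
		using test_function_bounded[OF \<gamma>] by metis
	have \<gamma>': "pd 1 \<gamma> \<in> test_functions (interval_I a)" by (rule pd_test_function[OF \<gamma>]) simp
	obtain Bg' where Bg': "!!s. \<bar>pd 1 \<gamma> s\<bar> <= Bg'" using test_function_bounded[OF \<gamma>'] by metis
	have [measurable]: "\<gamma> \<in> borel_measurable borel" "pd 1 \<gamma> \<in> borel_measurable borel" "!!n. \<eta> n \<in> borel_measurable borel"
		using test_function_measurable \<gamma> \<gamma>' \<eta>(1) by blast+
	define \<Phi> where "\<Phi> n x = \<gamma> (fst x) * \<eta> n (snd x)" for n and x :: "plane"
	have Ckg: "Ck k \<gamma>" "Ck k (\<eta> n)" for k n using \<gamma> \<eta>(1)[of n] by (auto simp: test_functions_def)
	have Ckf: "Ck k (%x::plane. \<gamma> (fst x))" "Ck k (%x::plane. \<eta> n (snd x))" for k n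
		using Ck_compose[OF Ckg(1) Ck_bounded_linear[OF bounded_linear_fst]] Ck_compose[OF Ckg(2) Ck_bounded_linear[OF bounded_linear_snd]] by auto
	have t: "\<Phi> n \<in> test_functions Om" for n
	proof -
		obtain Ke where Ke: "compact Ke" "Ke \<subseteq> ?J" "!!s. s \<notin> Ke ==> \<eta> n s = 0"
			using test_function_bounded[OF \<eta>(1)[of n]] by metis
		show ?thesis
		proof (rule test_functionsI)
			show "Ck k (\<Phi> n)" for k unfolding \<Phi>_def by (rule Ck_mult[OF Ckf])
			show "compact (Kg \<times> Ke)" by (rule compact_Times[OF Kg(1) Ke(1)])
			show "Kg \<times> Ke \<subseteq> Om"
			proof
				fix x assume "x \<in> Kg \<times> Ke"
				hence "fst x \<in> interval_I a" "snd x \<in> ?J" using Kg(2) Ke(2) by auto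
				hence "x \<in> Se" by (simp add: Se_iff)
				thus "x \<in> Om" using Se_sets(4) by blast
			qed
			show "\<Phi> n x = 0" if "x \<notin> Kg \<times> Ke" for x using that Kg(3) Ke(3) by (cases x) (auto simp: \<Phi>_def)
		qed
	qed
	have pdF: "pd (1, 0) (\<Phi> n) x = pd 1 \<gamma> (fst x) * \<eta> n (snd x)" for n x
	proof -
		have "((%s. \<gamma> (fst x + s)) has_real_derivative pd 1 \<gamma> (fst x)) (at 0)"
		proof -
			have g: "DERIV ((%s. fst x + s)) 0 :> 1" by (auto intro!: derivative_eq_intros)
			have "(\<gamma> has_real_derivative pd 1 \<gamma> (fst x)) (at (fst x + 0))" using Ck_has_real_derivative[OF Ckg(1), of "fst x"] by simp
			from DERIV_chain2[where f=\<gamma> and g="%s. fst x + s" and x=0 and s=UNIV, OF this g] show ?thesis by simp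
		qed
		hence 1: "((%s. \<Phi> n (x + s *R (1, 0))) has_real_derivative pd 1 \<gamma> (fst x) * \<eta> n (snd x)) (at 0)"
			unfolding \<Phi>_def by (auto intro!: derivative_eq_intros)
		have "Ck (Suc 0) (\<Phi> n)" using t[of n] unfolding test_functions_def by blast
		from line_derivative[of "\<Phi> n" _ x 0 "(1, 0)", OF Ck_has_derivative[OF this]]
		have "((%s. \<Phi> n (x + s *R (1, 0))) has_real_derivative pd (1, 0) (\<Phi> n) x) (at 0)"
			by (simp add: pd_def zero_prod_def[symmetric])
		from DERIV_unique[OF this 1] show ?thesis .
	qed
	have eq: "(LBINT x:Se. u x * (pd 1 \<gamma> (fst x) * \<eta> n (snd x))) = - (LBINT x:Se. u1 x * (\<gamma> (fst x) * \<eta> n (snd x)))" for n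
	proof -
		have z: "\<Phi> n x = 0" "pd (1, 0) (\<Phi> n) x = 0" if "x \<notin> Se" for x
		proof -
			have "\<not> (fst x \<in> interval_I a & snd x \<in> ?J)" using that by (auto simp: Se_iff)
			moreover have "\<gamma> s = 0" "pd 1 \<gamma> s = 0" if "s \<notin> interval_I a" for s
				using \<gamma> \<gamma>' that unfolding test_functions_def by blast+
			moreover have "\<eta> n s = 0" if "s \<notin> ?J" for s using \<eta>(1)[of n] that unfolding test_functions_def by blast
			ultimately show "\<Phi> n x = 0" "pd (1, 0) (\<Phi> n) x = 0" by (auto simp: \<Phi>_def pdF)
		qed
		have "(LBINT x:Om. u x * pd (1, 0) (\<Phi> n) x) = - (LBINT x:Om. u1 x * \<Phi> n x)"
			using u_weak(1) t unfolding has_weak_pd_def by blast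
		moreover have "(LBINT x:Om. u x * pd (1, 0) (\<Phi> n) x) = (LBINT x:Se. u x * pd (1, 0) (\<Phi> n) x)"
			by (rule set_integral_mult_support[OF Se_sets(4) z(2)])
		moreover have "(LBINT x:Om. u1 x * \<Phi> n x) = (LBINT x:Se. u1 x * \<Phi> n x)"
			by (rule set_integral_mult_support[OF Se_sets(4) z(1)])
		ultimately show ?thesis by (simp add: pdF \<Phi>_def)
	qed
	have iS: "lint Se u" "lint Se u1" using u_int set_integrable_subset[OF _ Se_sets(1,4)] by auto
	have "(%n. LBINT x:Se. u x * (pd 1 \<gamma> (fst x) * \<eta> n (snd x))) -->> (LBINT x:Se. u x * (pd 1 \<gamma> (fst x)))"
	proof (rule set_integral_tendsto_bounded[OF iS(1) _ Se_sets(1), where B="Bg' * 1"])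
		show "\<bar>pd 1 \<gamma> (fst x) * \<eta> n (snd x)\<bar> <= Bg' * 1" for n x
			unfolding abs_mult using Bg'[of "fst x"] by (intro mult_mono \<eta>(2) Bg') (auto intro: order_trans[OF abs_ge_zero])
		show "AE x in lborel. x \<in> Se --> (%n. pd 1 \<gamma> (fst x) * \<eta> n (snd x)) -->> pd 1 \<gamma> (fst x)"
		proof (intro AE_I2 impI)
			fix x assume "x \<in> Se"
			hence "(%n. pd 1 \<gamma> (fst x) * \<eta> n (snd x)) -->> pd 1 \<gamma> (fst x) * 1" by (intro tendsto_intros \<eta>(3)) (auto simp: Se_iff)
			thus "(%n. pd 1 \<gamma> (fst x) * \<eta> n (snd x)) -->> pd 1 \<gamma> (fst x)" by simp
		qed
	qed measurable
	moreover have "(%n. LBINT x:Se. u1 x * (\<gamma> (fst x) * \<eta> n (snd x))) -->> (LBINT x:Se. u1 x * (\<gamma> (fst x)))"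
	proof (rule set_integral_tendsto_bounded[OF iS(2) _ Se_sets(1), where B="Bg * 1"])
		show "\<bar>\<gamma> (fst x) * \<eta> n (snd x)\<bar> <= Bg * 1" for n x
			unfolding abs_mult using Bg[of "fst x"] by (intro mult_mono \<eta>(2) Bg) (auto intro: order_trans[OF abs_ge_zero])
		show "AE x in lborel. x \<in> Se --> (%n. \<gamma> (fst x) * \<eta> n (snd x)) -->> \<gamma> (fst x)"
		proof (intro AE_I2 impI)
			fix x assume "x \<in> Se"
			hence "(%n. \<gamma> (fst x) * \<eta> n (snd x)) -->> \<gamma> (fst x) * 1" by (intro tendsto_intros \<eta>(3)) (auto simp: Se_iff)
			thus "(%n. \<gamma> (fst x) * \<eta> n (snd x)) -->> \<gamma> (fst x)" by simp
		qed
	qed measurable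
	ultimately have "(LBINT x:Se. u x * (pd 1 \<gamma> (fst x))) = - (LBINT x:Se. u1 x * (\<gamma> (fst x)))"
		unfolding eq using LIMSEQ_unique tendsto_minus by blast
	thus ?thesis by simp
qed

lemma Se_average:
	assumes \<psi>: "continuous_on (interval_I a) \<psi>" "!!s. s \<in> interval_I a ==> \<bar>\<psi> s\<bar> <= M"
	shows "(LBINT x:Se. u x * \<psi> (fst x)) = ep * V * (LBINT s:interval_I a. resonator_average L V ep u s * \<psi> s)"
proof -
	let ?J = "{L * ep<..<(L + V) * ep}"
	have mp: "lmeas Se (%x. \<psi> (fst x))" by (rule strip_measurable[OF \<psi>(1) Se_sets(2)]) (simp add: Se_iff)
	have i: "lint Se (%x. u x * \<psi> (fst x))"
		by (rule set_integrable_mult_bounded[OF set_integrable_subset[OF u_int(1) Se_sets(1,4)] mp, where B=M]) (use \<psi>(2) in "simp add: Se_iff")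
	have "(LBINT x:Se. u x * \<psi> (fst x)) = (LBINT s:interval_I a. (LBINT t:?J. u (s, t) * \<psi> s))"
		using rect_integral(1)[of "interval_I a" ?J "%x. u x * \<psi> (fst x)"] i interval_I_sets(1)[of a] by (simp add: Se_def S_eps_def)
	also have "... = (LBINT s:interval_I a. ep * V * (resonator_average L V ep u s * \<psi> s))"
	proof (rule set_integral_cong_simple)
		fix s
		have "?J = {ep * L<..<ep * (L + V)}" by (simp add: mult.commute)
		thus "(LBINT t:?J. u (s, t) * \<psi> s) = ep * V * (resonator_average L V ep u s * \<psi> s)"
			using pos by (simp add: resonator_average_def)
	qed
	finally show ?thesis by simp
qed

text \<open>Averages over the upper half of the layer and over the whole layer are close; this is the fan identity with constant width and a tent function as cutoff.\<close>
lemma upper_half_average: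
	assumes \<psi>: "continuous_on (interval_I a) \<psi>" "!!s. s \<in> interval_I a ==> \<bar>\<psi> s\<bar> <= M"
	shows "\<bar>1 / h * (LBINT x:Se. u x * \<psi> (fst x) * indicator {x. L * ep + h < snd x} x) - 1 / (ep * V) * (LBINT x:Se. u x * \<psi> (fst x))\<bar>
		 <= M * (LBINT x:Se. \<bar>u2 x\<bar>)"
proof -
	define l where "l = L * ep"
	have lV: "(L + V) * ep = l + 2 * h" using h(3) by (simp add: l_def)
	have tz: "trapezoid l (l + h) (l + h) (l + 2 * h)" using h(1) by unfold_locales auto
	interpret trapezoid l "l + h" "l + h" "l + 2 * h" by (rule tz)
	let ?t = "trap l (l + h) (l + h) (l + 2 * h)" and ?t' = "trap_deriv l (l + h) (l + h) (l + 2 * h)"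
	have c\<psi>: "continuous_on {0<..<1} (%s. \<psi> (a * s))"
	proof -
		have "continuous_on {0<..<1} (%s. a * s)" by (intro continuous_intros)
		moreover have "(%s. a * s) ` {0<..<1} \<subseteq> interval_I a" using pos by (auto simp: interval_I_def)
		ultimately show ?thesis by (rule continuous_on_compose2[OF \<psi>(1)])
	qed
	have b\<psi>: "\<bar>\<psi> (a * s)\<bar> <= M" if "s \<in> {0<..<1}" for s using \<psi>(2)[of "a * s"] that pos by (auto simp: interval_I_def)
	have D: "{x::plane. l < snd x & snd x < l + 2 * h & 0 < (fst x - 0) / a & (fst x - 0) / a < 1} = Se"
	proof -
		have "0 < (s - 0) / a & (s - 0) / a < 1 \<longleftrightarrow> s \<in> interval_I a" for s
			using pos by (auto simp: interval_I_def divide_less_eq zero_less_divide_iff)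
		thus ?thesis unfolding set_eq_iff mem_Collect_eq Se_iff lV l_def[symmetric] by blast
	qed
	have iS: "lint Se u" "lint Se u1" "lint Se u2" using u_int set_integrable_subset[OF _ Se_sets(1,4)] by auto
	have "(LBINT x:Se. u x * (?t' (snd x) * \<psi> (a * ((fst x - 0) / a)) / a)) =
			 - (LBINT x:Se. u1 x * (?t (snd x) * (\<psi> (a * ((fst x - 0) / a)) * ((fst x - 0) / a)) * 0 / a))
			 - (LBINT x:Se. u2 x * (?t (snd x) * \<psi> (a * ((fst x - 0) / a)) / a))"
		by (rule fan_identity[OF tz Om_open u_weak finite.emptyI, where W="%_. a" and W'="%_. 0" and ?w0.0=a and p=0 and \<Psi>="%s. \<psi> (a * s)", unfolded D])
			 (use pos c\<psi> b\<psi> iS Se_sets in "auto intro: bounded_funI[of _ 0]")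
	hence "(LBINT x:Se. u x * (?t' (snd x) * \<psi> (fst x))) / a = - ((LBINT x:Se. u2 x * (?t (snd x) * \<psi> (fst x))) / a)"
		using pos by simp
	hence E: "(LBINT x:Se. u x * (?t' (snd x) * \<psi> (fst x))) = - (LBINT x:Se. u2 x * (?t (snd x) * \<psi> (fst x)))"
		using pos by (simp only: minus_divide_left divide_cancel_right) simp
	have mp: "lmeas Se (%x. \<psi> (fst x))" by (rule strip_measurable[OF \<psi>(1) Se_sets(2)]) (simp add: Se_iff)
	have bp: "\<bar>\<psi> (fst x)\<bar> <= M" if "x \<in> Se" for x using \<psi>(2) that by (simp add: Se_iff)
	have i: "lint Se (%x. u x * \<psi> (fst x))" by (rule set_integrable_mult_bounded[OF iS(1) mp bp])
	define X where "X = {x::plane. l + h < snd x}"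
	have Xm: "X \<in> sets borel" unfolding X_def by measurable
	have iX: "lint Se (%x. u x * \<psi> (fst x) * indicator X x)"
	proof (rule set_integrable_mult_bounded[OF i, of _ 1])
		show "lmeas Se (indicator X :: plane => real)"
		proof -
			have i: "(indicator Se :: plane => real) \<in> borel_measurable borel" "(indicator X :: plane => real) \<in> borel_measurable borel"
				using borel_measurable_indicator[OF Se_sets(2)] borel_measurable_indicator[OF Xm] by blast+
			have "(%x. (indicator Se x :: real) * indicator X x) \<in> borel_measurable borel" by (rule borel_measurable_times[OF i])
			thus ?thesis by (simp only: smeas_def real_scaleR_def measurable_lborel2)
		qed
	qed (auto simp: indicator_def)
	have mt: "lmeas Se (%x. F (snd x) * \<psi> (fst x))" if "F \<in> borel_measurable borel" for F :: "real => real"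
	proof -
		have "(%x::plane. F (snd x) * (indicator Se x *R \<psi> (fst x))) \<in> borel_measurable lborel"
			using mp that by (intro borel_measurable_times) (auto simp: smeas_def)
		thus ?thesis by (simp add: smeas_def mult.left_commute)
	qed
	have tb: "\<bar>?t (snd x) * \<psi> (fst x)\<bar> <= M" if "x \<in> Se" for x
		using mult_mono[of "?t (snd x)" 1 "\<bar>\<psi> (fst x)\<bar>" M] trap_bounds[of "snd x"] bp[OF that] by (simp add: abs_mult)
	have idb: "lint Se (%x. u x * (?t' (snd x) * \<psi> (fst x)))"
	proof (rule set_integrable_mult_bounded[OF iS(1) mt[OF trap_deriv_measurable]])
		show "\<bar>?t' (snd x) * \<psi> (fst x)\<bar> <= (1 / (l + h - l) + 1 / (l + 2 * h - (l + h))) * M" if "x \<in> Se" for x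
			unfolding abs_mult using trap_deriv_bound[of "snd x"] bp[OF that] h(1) by (intro mult_mono) auto
	qed
	have "(LBINT x:Se. u x * (?t' (snd x) * \<psi> (fst x)))
		= (LBINT x:Se. 1 / h * (u x * \<psi> (fst x)) - 2 / h * (u x * \<psi> (fst x) * indicator X x))"
	proof (rule set_integral_cong_AE_simple)
		show "AE x in lborel. x \<in> Se --> u x * (?t' (snd x) * \<psi> (fst x)) = 1 / h * (u x * \<psi> (fst x)) - 2 / h * (u x * \<psi> (fst x) * indicator X x)"
			using AE_snd_finite[of "{l + h}", simplified]
		proof eventually_elim
			case (elim x)
			show ?case
			proof
				assume "x \<in> Se"
				hence "?t' (snd x) = 1 / h - 2 / h * indicator X x"
					using elim h(1) by (auto simp: trap_deriv_def X_def Se_iff lV l_def[symmetric] indicator_def)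
				thus "u x * (?t' (snd x) * \<psi> (fst x)) = 1 / h * (u x * \<psi> (fst x)) - 2 / h * (u x * \<psi> (fst x) * indicator X x)"
					by (simp only: left_diff_distrib right_diff_distrib mult_ac)
			qed
		qed
		show "lmeas Se (%x. u x * (?t' (snd x) * \<psi> (fst x)))"
			using idb by (auto simp: set_integrable_def smeas_def)
		show "lmeas Se (%x. 1 / h * (u x * \<psi> (fst x)) - 2 / h * (u x * \<psi> (fst x) * indicator X x))"
			using set_integral_diff(1)[OF set_integrable_mult_right[OF i, of "1 / h"] set_integrable_mult_right[OF iX, of "2 / h"]]
			by (auto simp: set_integrable_def smeas_def)
	qed
	also have "... = 1 / h * (LBINT x:Se. u x * \<psi> (fst x)) - 2 / h * (LBINT x:Se. u x * \<psi> (fst x) * indicator X x)"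
		using set_integral_diff(2)[OF set_integrable_mult_right[OF i, of "1 / h"] set_integrable_mult_right[OF iX, of "2 / h"]]
		by (simp only: set_integral_mult_right)
	finally have F: "2 / h * (LBINT x:Se. u x * \<psi> (fst x) * indicator X x) - 1 / h * (LBINT x:Se. u x * \<psi> (fst x)) = (LBINT x:Se. u2 x * (?t (snd x) * \<psi> (fst x)))"
		using E by simp
	have Q: "\<bar>LBINT x:Se. u2 x * (?t (snd x) * \<psi> (fst x))\<bar> <= (LBINT x:Se. M * \<bar>u2 x\<bar>)"
	proof (rule set_integral_abs_le)
		show "lint Se (%x. u2 x * (?t (snd x) * \<psi> (fst x)))"
			by (rule set_integrable_mult_bounded[OF iS(3) mt[OF trap_measurable] tb])
		show "lint Se (%x. M * \<bar>u2 x\<bar>)" by (intro set_integrable_mult_right set_integrable_abs iS)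
		show "\<bar>u2 x * (?t (snd x) * \<psi> (fst x))\<bar> <= M * \<bar>u2 x\<bar>" if "x \<in> Se" for x
			unfolding abs_mult[of "u2 x"] using mult_left_mono[OF tb[OF that], of "\<bar>u2 x\<bar>"] by (simp add: mult.commute)
	qed
	have "1 / h * (LBINT x:Se. u x * \<psi> (fst x) * indicator X x) - 1 / (ep * V) * (LBINT x:Se. u x * \<psi> (fst x))
			= 1 / 2 * (LBINT x:Se. u2 x * (?t (snd x) * \<psi> (fst x)))"
		unfolding F[symmetric] using pos by (simp add: h_def field_simps)
	note e = this
	have "\<bar>1 / 2 * (LBINT x:Se. u2 x * (?t (snd x) * \<psi> (fst x)))\<bar> <= M * (LBINT x:Se. \<bar>u2 x\<bar>)" using Q by simp
	hence "\<bar>1 / h * (LBINT x:Se. u x * \<psi> (fst x) * indicator X x) - 1 / (ep * V) * (LBINT x:Se. u x * \<psi> (fst x))\<bar> <= M * (LBINT x:Se. \<bar>u2 x\<bar>)"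
		unfolding e .
	thus ?thesis unfolding X_def l_def .
qed

end

section \<open>The flux through the channels\<close>

lemma set_integral_sum_zero:
	fixes F :: "nat => 'a::euclidean_space => real"
	assumes "!!k. k < N ==> lint S (F k)"
	shows "lint S (%x. \<Sum>k<N. F k x)" "(LBINT x:S. (\<Sum>k<N. F k x)) = (\<Sum>k<N. LBINT x:S. F k x)"
proof -
	have i: "integrable lborel (%x. indicator S x *R F k x)" if "k \<in> {..<N}" for k
		using assms[of k] that unfolding set_integrable_def by blast
	show "lint S (%x. \<Sum>k<N. F k x)"
		unfolding set_integrable_def scaleR_sum_right by (rule Bochner_Integration.integrable_sum[OF i])
	show "(LBINT x:S. (\<Sum>k<N. F k x)) = (\<Sum>k<N. LBINT x:S. F k x)"
		unfolding sint_def scaleR_sum_right by (rule Bochner_Integration.integral_sum[OF i])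
qed

context resonator_solution
begin

text \<open>The width \<open>W\<close> of the fan: $\delta$ in the channel and $\varepsilon$ at distance at least \<open>h\<close> from it. The
cutoff \<open>G\<close> equals one on the fan. The fan \<open>D k\<close> through channel number \<open>k\<close> is $0<\xi<1$ in the fan coordinate
\<open>xi k\<close>; \<open>Fan\<close> is the range of $x_2$ where the width varies.\<close>
definition W where "W y = ep - (ep - \<delta>) * trap (- h) 0 (L * ep) (L * ep + h) y"
definition W' where "W' y = - (ep - \<delta>) * trap_deriv (- h) 0 (L * ep) (L * ep + h) y"
definition G where "G = trap (- b) (- h) (L * ep + h) ((L + V) * ep)"
definition G' where "G' = trap_deriv (- b) (- h) (L * ep + h) ((L + V) * ep)"
definition xi where "xi k x = (fst x - real k * ep) / W (snd x)"
definition D where "D k = {x. - b < snd x & snd x < (L + V) * ep & 0 < xi k x & xi k x < 1}"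
definition Fan where "Fan = {- h<..<0} \<union> {L * ep<..<L * ep + h}"

lemma Le: "L * ep > 0" using pos by simp

lemma tzW: "trapezoid (- h) 0 (L * ep) (L * ep + h)" using h Le by unfold_locales auto
lemma tzG: "trapezoid (- b) (- h) (L * ep + h) ((L + V) * ep)"
proof -
	have "(L + V) * ep = L * ep + 2 * h" by (rule h(3))
	thus ?thesis using h(1,4) Le by unfold_locales linarith+
qed

lemma W_bounds: "\<delta> <= W y" "W y <= ep" "0 < W y"
proof -
	have 1: "0 <= trap (- h) 0 (L * ep) (L * ep + h) y" "trap (- h) 0 (L * ep) (L * ep + h) y <= 1" by (rule trapezoid.trap_bounds[OF tzW])+
	have d: "0 <= ep - \<delta>" using \<delta> by simp
	have "(ep - \<delta>) * trap (- h) 0 (L * ep) (L * ep + h) y <= (ep - \<delta>) * 1" by (rule mult_left_mono[OF 1(2) d])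
	thus a: "\<delta> <= W y" by (simp add: W_def)
	show "W y <= ep" using mult_nonneg_nonneg[OF d 1(1)] by (simp add: W_def)
	show "0 < W y" using a \<delta>(1) by linarith
qed

lemma W_isCont: "isCont W y"
	unfolding W_def[abs_def] by (intro continuous_intros trapezoid.trap_isCont[OF tzW])

lemma W_deriv: "y \<notin> {- h, 0, L * ep, L * ep + h} ==> DERIV W y :> W' y"
	unfolding W_def[abs_def] W'_def by (auto intro!: derivative_eq_intros trapezoid.trap_has_deriv[OF tzW] simp: algebra_simps)

lemma W'_isCont: "y \<notin> {- h, 0, L * ep, L * ep + h} ==> isCont W' y"
	unfolding W'_def[abs_def] by (intro continuous_intros trapezoid.trap_deriv_isCont[OF tzW])

lemma W'_measurable[measurable]: "W' \<in> borel_measurable borel"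
	unfolding W'_def[abs_def] using trapezoid.trap_deriv_measurable[OF tzW] by measurable

lemma W_measurable[measurable]: "W \<in> borel_measurable borel"
	unfolding W_def[abs_def] using trapezoid.trap_measurable[OF tzW] by measurable

lemma G_measurable[measurable]: "G \<in> borel_measurable borel" "G' \<in> borel_measurable borel"
	unfolding G_def G'_def by (rule trapezoid.trap_measurable[OF tzG], rule trapezoid.trap_deriv_measurable[OF tzG])

lemma W'_bound: "\<bar>W' y\<bar> <= 2 / V"
proof -
	have "\<bar>trap_deriv (- h) 0 (L * ep) (L * ep + h) y\<bar> <= 1 / h"
		using h(1) Le by (auto simp: trap_deriv_def)
	hence "\<bar>ep - \<delta>\<bar> * \<bar>trap_deriv (- h) 0 (L * ep) (L * ep + h) y\<bar> <= ep * (1 / h)"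
		using \<delta> pos by (intro mult_mono) auto
	also have "ep * (1 / h) = 2 / V" using pos by (simp add: h_def)
	finally show ?thesis unfolding W'_def abs_mult abs_minus_cancel .
qed

lemma W_values:
	"y <= - h ==> W y = ep" "L * ep + h <= y ==> W y = ep" "0 <= y ==> y <= L * ep ==> W y = \<delta>"
	using trapezoid.trap_left[OF tzW] trapezoid.trap_right[OF tzW] trapezoid.trap_mid[OF tzW] by (auto simp: W_def)

lemma W'_values:
	"y <= - h ==> W' y = 0" "L * ep + h <= y ==> W' y = 0" "0 < y ==> y < L * ep ==> W' y = 0"
	using h(1) Le by (auto simp: W'_def trap_deriv_def)

lemma G_values: "- h <= y ==> y <= L * ep + h ==> G y = 1" "- h <= y ==> y <= L * ep + h ==> G' y = 0"
	using trapezoid.trap_mid[OF tzG, of y] by (auto simp: G_def G'_def trap_deriv_def)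

lemma G_bound: "\<bar>G y\<bar> <= 1" using trapezoid.trap_bounds[OF tzG, of y] by (simp add: G_def)

lemma D_cell: "x \<in> D k ==> real k * ep < fst x & fst x < real k * ep + W (snd x)"
	using W_bounds(3)[of "snd x"] by (simp add: D_def xi_def zero_less_divide_iff divide_less_eq)

lemma D_iff: "x \<in> D k \<longleftrightarrow> - b < snd x & snd x < (L + V) * ep & real k * ep < fst x & fst x < real k * ep + W (snd x)"
	using W_bounds(3)[of "snd x"] by (auto simp: D_def xi_def zero_less_divide_iff divide_less_eq)

lemma D_sub: "k < N ==> D k \<subseteq> Om"
proof
	fix x assume k: "k < N" and x: "x \<in> D k"
	have I: "fst x \<in> interval_I a" by (rule cell_sub[OF k]) (use D_cell[OF x] W_bounds(2)[of "snd x"] in linarith)+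
	have y: "- b < snd x" "snd x < (L + V) * ep" using x by (auto simp: D_def)
	consider "snd x < 0" | "L * ep < snd x" | "0 <= snd x" "snd x <= L * ep" by linarith
	thus "x \<in> Om"
	proof cases
		case 1 hence "x \<in> O0" using I y by (simp add: O0_iff)
		thus ?thesis by (simp add: Om_eq)
	next
		case 2 hence "x \<in> Se" using I y by (simp add: Se_iff)
		thus ?thesis by (simp add: Om_eq)
	next
		case 3
		hence "x \<in> Ce" using D_cell[OF x] k W_values(3)[of "snd x"] by (auto simp: Ce_iff)
		thus ?thesis by (simp add: Om_eq)
	qed
qed

lemma xi_measurable[measurable]: "xi k \<in> borel_measurable borel"
	unfolding xi_def[abs_def] by measurable

lemma D_sets[measurable]: "D k \<in> sets borel"
	unfolding D_def by measurable

lemma xi_bounds: "x \<in> D k ==> 0 < xi k x & xi k x < 1" by (simp add: D_def)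

lemma cell_unique:
	assumes "x \<in> D k" "real j * ep < fst x" "fst x < real j * ep + ep"
	shows "k = j"
proof -
	have "real k * ep < fst x" "fst x < real k * ep + ep" using D_cell[OF assms(1)] W_bounds(2)[of "snd x"] by linarith+
	hence "real k * ep < (real j + 1) * ep" "real j * ep < (real k + 1) * ep" using assms(2,3) by (simp_all add: distrib_right)
	hence "real k < real j + 1" "real j < real k + 1" using pos by simp_all
	thus ?thesis by linarith
qed

lemma cell_exists:
	assumes "s \<in> interval_I a" "!!k. k < N ==> s ~= real k * ep"
	obtains k where "k < N" "real k * ep < s" "s < real k * ep + ep"
proof -
	define k where "k = nat \<lfloor>s / ep\<rfloor>"
	have s: "0 < s" "s < real N * ep" using assms(1) N by (auto simp: interval_I_def)
	have q: "0 < s / ep" "s / ep < real N" using s pos by (simp_all add: divide_less_eq)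
	have k: "real k <= s / ep" "s / ep < real k + 1" using q(1) unfolding k_def by linarith+
	have kN: "k < N" using k(1) q(2) by linarith
	have "real k * ep <= s" "s < real k * ep + ep" using k pos by (simp_all add: le_divide_eq divide_less_eq distrib_right)
	moreover have "s ~= real k * ep" by (rule assms(2)[OF kN])
	ultimately show ?thesis using that[OF kN] by simp
qed

subsection \<open>Size of the fans\<close>

lemma fan_half_integral:
	assumes "q = - h \<or> q = L * ep"
	shows "lint {q<..<q + h} (%y. 1 / W y)" "(LBINT y:{q<..<q + h}. 1 / W y) <= V * ln (1 / (\<alpha> * ep^2))"
proof -
	define m where "m = (ep - \<delta>) / h"
	have m: "m > 0" using \<delta>(3) h(1) by (simp add: m_def)
	define s :: real where "s = (if q = - h then -1 else 1)"
	define c where "c = (if q = - h then 0 else L * ep)"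
	have s: "s = 1 \<or> s = -1" by (simp add: s_def)
	have ne: "- h ~= L * ep" using h(1) Le by linarith
	define lin where "lin y = \<delta> + m * (s * (y - c))" for y
	have Wl: "W y = lin y" if "q <= y" "y <= q + h" for y
	proof (cases "q = - h")
		case True
		hence "trap (- h) 0 (L * ep) (L * ep + h) y = (y - (- h)) / (0 - (- h))"
			using that by (intro trapezoid.trap_up[OF tzW]) auto
		hence "W y = ep - (ep - \<delta>) * ((y + h) / h)" by (simp add: W_def)
		also have "... = lin y" using h(1) True by (simp add: lin_def m_def s_def c_def field_simps)
		finally show ?thesis .
	next
		case False
		hence q: "q = L * ep" using assms by simp
		hence "trap (- h) 0 (L * ep) (L * ep + h) y = (L * ep + h - y) / (L * ep + h - L * ep)"
			using that by (intro trapezoid.trap_down[OF tzW]) auto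
		hence "W y = ep - (ep - \<delta>) * ((L * ep + h - y) / h)" by (simp add: W_def)
		also have "... = lin y"
		proof -
			have "ep - (ep - \<delta>) * ((l + h - y) / h) = \<delta> + (ep - \<delta>) / h * (1 * (y - l))" for l using h(1) by (simp add: field_simps)
			thus ?thesis using False by (simp add: lin_def m_def s_def c_def)
		qed
		finally show ?thesis .
	qed
	have pl: "0 < lin y" if "q <= y" "y <= q + h" for y using W_bounds(3)[of y] Wl[OF that] by simp
	have ends: "{lin q, lin (q + h)} = {\<delta>, ep}" "s * (ln (lin (q + h)) - ln (lin q)) = ln ep - ln \<delta>"
	proof -
		have W0: "lin q = W q" "lin (q + h) = W (q + h)" using Wl h(1) by auto
		show "{lin q, lin (q + h)} = {\<delta>, ep}" "s * (ln (lin (q + h)) - ln (lin q)) = ln ep - ln \<delta>"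
			using W_values h(1) Le assms ne unfolding W0 s_def by (auto simp: insert_commute)
	qed
	have i0: "lint {q..q + h} (%y. 1 / W y)"
	proof -
		have "continuous_on {q..q + h} (%y. 1 / W y)"
			using W_isCont W_bounds(3) by (intro continuous_at_imp_continuous_on ballI continuous_intros) (auto simp: less_le)
		thus ?thesis by (rule borel_integrable_atLeastAtMost')
	qed
	show "lint {q<..<q + h} (%y. 1 / W y)" by (rule set_integrable_subset[OF i0]) auto
	have "(LBINT y:{q..q + h}. 1 / W y) = (LBINT y:{q..q + h}. 1 / lin y)" by (rule set_integral_cong_simple) (use Wl in auto)
	also have "... = s / m * ln (lin (q + h)) - s / m * ln (lin q)"
		unfolding sint_def real_scaleR_def mult.commute[of "indicator _ _"]
	proof (rule integral_FTC_Icc_real)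
		show "q <= q + h" using h(1) by simp
		fix y assume y: "q <= y" "y <= q + h"
		show "DERIV (%y. s / m * ln (lin y)) y :> 1 / lin y"
		proof -
			have "DERIV lin y :> m * s" unfolding lin_def[abs_def] by (auto intro!: derivative_eq_intros)
			hence "((%y. s / m * ln (lin y)) has_real_derivative s / m * (1 / lin y * (m * s))) (at y)"
				by (intro DERIV_cmult DERIV_chain2[where f=ln] DERIV_ln_divide pl[OF y])
			moreover have e: "s / m * (1 / lin y * (m * s)) = 1 / lin y" using m s by auto
			ultimately show ?thesis unfolding e by blast
		qed
		show "isCont (%y. 1 / lin y) y" unfolding lin_def by (intro continuous_intros) (use pl[OF y] in "auto simp: lin_def")
	qed
	also have "... = 1 / m * (ln ep - ln \<delta>)" unfolding ends(2)[symmetric] by (simp add: algebra_simps)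
	also have "ln ep - ln \<delta> = ln (1 / (\<alpha> * ep^2))"
	proof -
		have "ep / \<delta> = 1 / (\<alpha> * ep^2)" using pos by (simp add: \<delta>_def power3_eq_cube power2_eq_square)
		thus ?thesis using ln_div[of ep \<delta>] pos \<delta>(1) by simp
	qed
	also have "1 / m * ln (1 / (\<alpha> * ep^2)) <= V * ln (1 / (\<alpha> * ep^2))"
	proof (rule mult_right_mono)
		have "h <= V * (ep - \<delta>)" using \<delta>(2) pos by (simp add: h_def right_diff_distrib)
		thus "1 / m <= V" using \<delta>(3) h(1) by (simp add: m_def divide_le_eq)
		have "0 < \<alpha> * ep^2" using pos by simp
		hence "1 <= 1 / (\<alpha> * ep^2)" using small(1) by simp
		thus "0 <= ln (1 / (\<alpha> * ep^2))" by simp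
	qed
	finally have "(LBINT y:{q..q + h}. 1 / W y) <= V * ln (1 / (\<alpha> * ep^2))" .
	moreover have "(LBINT y:{q<..<q + h}. 1 / W y) <= (LBINT y:{q..q + h}. 1 / W y)"
		by (rule L2_set_integral_subset_le[OF i0]) (use W_bounds(3) in "auto simp: less_imp_le")
	ultimately show "(LBINT y:{q<..<q + h}. 1 / W y) <= V * ln (1 / (\<alpha> * ep^2))" by simp
qed

text \<open>The integration in $x_1$ comes first and leaves the integral of $1/W$ over the two ramps.\<close>
lemma fan_integral:
	assumes "k < N"
	defines "F \<equiv> %x. indicator (D k) x * (indicator Fan (snd x) * (1 / (W (snd x))^2))"
	shows "lint Om F" "(LBINT x:Om. F x) <= 2 * V * ln (1 / (\<alpha> * ep^2))"
proof -
	have Fm: "Fan \<in> sets borel" by (simp add: Fan_def)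
	have [measurable]: "F \<in> borel_measurable borel" unfolding F_def using Fm by measurable
	have Fb: "\<bar>F x\<bar> <= 1 / \<delta>^2" for x
	proof -
		have "\<delta>^2 <= (W (snd x))^2" using W_bounds(1) \<delta>(1) by (intro power_mono) auto
		hence "1 / (W (snd x))^2 <= 1 / \<delta>^2" using \<delta>(1) by (intro frac_le) auto
		thus ?thesis by (auto simp: F_def indicator_def)
	qed
	have "F \<in> Lp 2 Om" by (rule bounded_Lp2[OF Om_sets(1,3) _ Fb]) (use Om_sets in "auto simp: smeas_def")
	thus i: "lint Om F" by (rule Lp2_integrable[OF Om_sets(1,3)])
	have F0: "indicator Om x *R F x = F x" for x using D_sub[OF assms(1)] by (cases "x \<in> D k") (auto simp: F_def)
	have iF: "integrable (lborel \<Otimes>\<^sub>M lborel) (case_prod (%x y. F (x, y)))"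
		using i unfolding set_integrable_def F0 by (simp add: lborel_prod)
	have "(LBINT x:Om. F x) = (LBINT x. F x)" unfolding sint_def F0 ..
	also have "... = (LBINT y. (LBINT x. F (x, y)))"
		using lborel_pair.integral_snd[OF iF] by (simp add: lborel_prod case_prod_beta')
	also have "... = (LBINT y. indicator Fan y * (1 / W y))"
	proof (rule Bochner_Integration.integral_cong[OF refl])
		fix y
		show "(LBINT x. F (x, y)) = indicator Fan y * (1 / W y)"
		proof (cases "y \<in> Fan")
			case True
			hence y: "- b < y" "y < (L + V) * ep" using h Le by (auto simp: Fan_def)
			have "(LBINT x. F (x, y)) = (LBINT x. indicator {real k * ep<..<real k * ep + W y} x * (1 / (W y)^2))"
				using True y by (intro Bochner_Integration.integral_cong) (auto simp: F_def D_iff indicator_def)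
			also have "... = W y * (1 / (W y)^2)" using W_bounds(3)[of y] by simp
			also have "... = 1 / W y" using W_bounds(3)[of y] by (simp add: power2_eq_square)
			finally show ?thesis using True by simp
		qed (simp add: F_def)
	qed
	also have "... = (LBINT y:{- h<..<- h + h}. 1 / W y) + (LBINT y:{L * ep<..<L * ep + h}. 1 / W y)"
	proof -
		have "(LBINT y:{- h<..<- h + h} \<union> {L * ep<..<L * ep + h}. 1 / W y) = (LBINT y:{- h<..<- h + h}. 1 / W y) + (LBINT y:{L * ep<..<L * ep + h}. 1 / W y)"
			by (rule set_integral_Un) (use fan_half_integral(1)[of "- h"] fan_half_integral(1)[of "L * ep"] Le in auto)
		thus ?thesis by (simp add: Fan_def sint_def)
	qed
	also have "... <= V * ln (1 / (\<alpha> * ep^2)) + V * ln (1 / (\<alpha> * ep^2))" by (intro add_mono fan_half_integral(2)) auto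
	finally show "(LBINT x:Om. F x) <= 2 * V * ln (1 / (\<alpha> * ep^2))" by simp
qed

subsection \<open>Summation over the cells\<close>

text \<open>The weights of the derivatives and of the solution itself in the identity of the cell number \<open>k\<close>.\<close>
definition A2 where "A2 \<psi> k x = indicator (D k) x * (\<alpha> * ep * (G (snd x) * \<psi> (real k * ep + ep * xi k x) / W (snd x)))"
definition A1 where "A1 \<psi> k x = indicator (D k) x * (\<alpha> * ep * (G (snd x) * (\<psi> (real k * ep + ep * xi k x) * xi k x) * W' (snd x) / W (snd x)))"
definition A0 where "A0 \<psi> k x = indicator (D k) x * (\<alpha> * ep * (G' (snd x) * \<psi> (real k * ep + ep * xi k x) / W (snd x)))"

lemma cell_identity:
	fixes \<psi> :: "real => real"
	assumes k: "k < N" and c\<psi>: "continuous_on UNIV \<psi>" and B: "!!s. \<bar>\<psi> s\<bar> <= M"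
	shows "lint Om (%x. u2 x * A2 \<psi> k x + (u1 x * A1 \<psi> k x + u x * A0 \<psi> k x))"
		and "(LBINT x:Om. u2 x * A2 \<psi> k x + (u1 x * A1 \<psi> k x + u x * A0 \<psi> k x)) = 0"
proof -
	have [measurable]: "\<psi> \<in> borel_measurable borel" using c\<psi> by (rule borel_measurable_continuous_onI)
	have M0: "M \<ge> 0" using B[of 0] by linarith
	have DO: "D k \<subseteq> Om" by (rule D_sub[OF k])
	have iD: "lint (D k) u" "lint (D k) u1" "lint (D k) u2"
	proof -
		have Dl: "D k \<in> sets lborel" by simp
		show "lint (D k) u" "lint (D k) u1" "lint (D k) u2"
			by (rule set_integrable_subset[OF _ Dl DO]; rule u_int)+
	qed
	have c\<Psi>: "continuous_on {0<..<1} (%s. \<psi> (real k * ep + ep * s))"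
	proof -
		have "continuous_on {0<..<1} (%s. real k * ep + ep * s)" by (intro continuous_intros)
		from continuous_on_compose2[OF c\<psi> this] show ?thesis by simp
	qed
	have fan: "(LBINT x:D k. u x * (G' (snd x) * \<psi> (real k * ep + ep * xi k x) / W (snd x))) =
		 - (LBINT x:D k. u1 x * (G (snd x) * (\<psi> (real k * ep + ep * xi k x) * xi k x) * W' (snd x) / W (snd x)))
		 - (LBINT x:D k. u2 x * (G (snd x) * \<psi> (real k * ep + ep * xi k x) / W (snd x)))"
		unfolding G_def G'_def xi_def D_def
	proof (rule fan_identity[OF tzG Om_open u_weak, of "{- h, 0, L * ep, L * ep + h}" W \<delta> W' "%s. \<psi> (real k * ep + ep * s)" M "real k * ep"])
		show "{x. - b < snd x & snd x < (L + V) * ep & 0 < (fst x - real k * ep) / W (snd x) & (fst x - real k * ep) / W (snd x) < 1} \<subseteq> Om"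
			"lint {x. - b < snd x & snd x < (L + V) * ep & 0 < (fst x - real k * ep) / W (snd x) & (fst x - real k * ep) / W (snd x) < 1} u"
			"lint {x. - b < snd x & snd x < (L + V) * ep & 0 < (fst x - real k * ep) / W (snd x) & (fst x - real k * ep) / W (snd x) < 1} u1"
			"lint {x. - b < snd x & snd x < (L + V) * ep & 0 < (fst x - real k * ep) / W (snd x) & (fst x - real k * ep) / W (snd x) < 1} u2"
			using DO iD by (simp_all add: D_def xi_def)
		show "bounded_fun W'" by (rule bounded_funI[OF W'_bound])
	qed (use W_isCont W_deriv W'_isCont \<delta>(1) W_bounds(1) c\<Psi> B W'_measurable in auto)
	have bd: "\<bar>A2 \<psi> k x\<bar> <= \<alpha> * ep * (1 * M * (1 / \<delta>))" "\<bar>A1 \<psi> k x\<bar> <= \<alpha> * ep * (1 * (M * 1) * (2 / V) * (1 / \<delta>))"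
		"\<bar>A0 \<psi> k x\<bar> <= \<alpha> * ep * ((1 / (- h - - b) + 1 / ((L + V) * ep - (L * ep + h))) * M * (1 / \<delta>))" for x
	proof -
		have Wi: "\<bar>1 / W (snd x)\<bar> <= 1 / \<delta>"
			using W_bounds[of "snd x"] \<delta>(1) by (auto intro!: frac_le)
		have gb: "\<bar>G' (snd x)\<bar> <= 1 / (- h - - b) + 1 / ((L + V) * ep - (L * ep + h))" unfolding G'_def by (rule trapezoid.trap_deriv_bound[OF tzG])
		have gp: "0 <= 1 / (- h - - b) + 1 / ((L + V) * ep - (L * ep + h))" using h by simp
		have Vp: "0 <= 2 / V" "0 <= 1 / \<delta>" "0 <= \<alpha> * ep" using pos \<delta>(1) by auto
		have 1: "\<bar>G (snd x) * \<psi> (real k * ep + ep * xi k x) * (1 / W (snd x))\<bar> <= 1 * M * (1 / \<delta>)"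
			unfolding abs_mult[of _ "1 / W (snd x)"] abs_mult[of "G (snd x)"] by (intro mult_mono Wi B G_bound M0 mult_nonneg_nonneg Vp) auto
		have 3: "\<bar>G' (snd x) * \<psi> (real k * ep + ep * xi k x) * (1 / W (snd x))\<bar> <= (1 / (- h - - b) + 1 / ((L + V) * ep - (L * ep + h))) * M * (1 / \<delta>)"
			unfolding abs_mult[of _ "1 / W (snd x)"] abs_mult[of "G' (snd x)"] by (intro mult_mono Wi B gb gp M0 mult_nonneg_nonneg Vp) auto
		have 2: "\<bar>G (snd x) * (\<psi> (real k * ep + ep * xi k x) * xi k x) * W' (snd x) * (1 / W (snd x))\<bar> <= 1 * (M * 1) * (2 / V) * (1 / \<delta>)" if "x \<in> D k"
		proof -
			have x1: "\<bar>xi k x\<bar> <= 1" using xi_bounds[OF that] by simp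
			show ?thesis
				unfolding abs_mult[of _ "1 / W (snd x)"] abs_mult[of _ "W' (snd x)"] abs_mult[of "G (snd x)"] abs_mult[of _ "xi k x"]
				by (intro mult_mono Wi B G_bound M0 mult_nonneg_nonneg Vp W'_bound x1) auto
		qed
		have I: "\<bar>indicator (D k) x * (\<alpha> * ep * z)\<bar> <= \<alpha> * ep * Z" if "x \<in> D k ==> \<bar>z\<bar> <= Z" "0 <= Z" for z Z
		proof (cases "x \<in> D k")
			case True
			have "\<bar>\<alpha> * ep * z\<bar> = \<alpha> * ep * \<bar>z\<bar>" by (simp only: abs_mult[of "\<alpha> * ep" z] abs_of_nonneg[OF Vp(3)])
			also have "... <= \<alpha> * ep * Z" by (rule mult_left_mono[OF that(1)[OF True] Vp(3)])
			finally show ?thesis using True by simp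
		next
			case False
			thus ?thesis using mult_nonneg_nonneg[OF Vp(3) that(2)] by simp
		qed
		show "\<bar>A2 \<psi> k x\<bar> <= \<alpha> * ep * (1 * M * (1 / \<delta>))" unfolding A2_def by (rule I) (use 1 M0 Vp in auto)
		show "\<bar>A1 \<psi> k x\<bar> <= \<alpha> * ep * (1 * (M * 1) * (2 / V) * (1 / \<delta>))" unfolding A1_def by (rule I) (use 2 M0 pos \<delta>(1) in auto)
		show "\<bar>A0 \<psi> k x\<bar> <= \<alpha> * ep * ((1 / (- h - - b) + 1 / ((L + V) * ep - (L * ep + h))) * M * (1 / \<delta>))"
			unfolding A0_def
		proof (rule I)
			show "\<bar>G' (snd x) * \<psi> (real k * ep + ep * xi k x) / W (snd x)\<bar> <= (1 / (- h - - b) + 1 / ((L + V) * ep - (L * ep + h))) * M * (1 / \<delta>)"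
				using 3 by simp
			show "0 <= (1 / (- h - - b) + 1 / ((L + V) * ep - (L * ep + h))) * M * (1 / \<delta>)" by (intro mult_nonneg_nonneg gp M0 Vp)
		qed
	qed
	have m: "lmeas Om (A2 \<psi> k)" "lmeas Om (A1 \<psi> k)" "lmeas Om (A0 \<psi> k)"
	proof -
		have [measurable]: "Om \<in> sets borel" by (rule Om_sets)
		show "lmeas Om (A2 \<psi> k)" "lmeas Om (A1 \<psi> k)" "lmeas Om (A0 \<psi> k)"
			unfolding smeas_def A2_def A1_def A0_def by measurable
	qed
	have i: "lint Om (%x. u2 x * A2 \<psi> k x)" "lint Om (%x. u1 x * A1 \<psi> k x)" "lint Om (%x. u x * A0 \<psi> k x)"
		using set_integrable_mult_bounded[OF u_int(3) m(1) bd(1)] set_integrable_mult_bounded[OF u_int(2) m(2) bd(2)] set_integrable_mult_bounded[OF u_int(1) m(3) bd(3)] by auto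
	show "lint Om (%x. u2 x * A2 \<psi> k x + (u1 x * A1 \<psi> k x + u x * A0 \<psi> k x))"
		by (intro set_integral_add(1) i)
	have toD: "(LBINT x:Om. g x * (indicator (D k) x * (\<alpha> * ep * z x))) = \<alpha> * ep * (LBINT x:D k. g x * z x)" for g z :: "plane => real"
	proof -
		have "(LBINT x:Om. g x * (indicator (D k) x * (\<alpha> * ep * z x))) = (LBINT x:D k. g x * (indicator (D k) x * (\<alpha> * ep * z x)))"
			by (rule set_integral_mult_support[OF DO]) simp
		also have "... = (LBINT x:D k. \<alpha> * ep * (g x * z x))" by (rule set_integral_cong_simple) simp
		finally show ?thesis by simp
	qed
	have "(LBINT x:Om. u2 x * A2 \<psi> k x + (u1 x * A1 \<psi> k x + u x * A0 \<psi> k x)) = (LBINT x:Om. u2 x * A2 \<psi> k x) + ((LBINT x:Om. u1 x * A1 \<psi> k x) + (LBINT x:Om. u x * A0 \<psi> k x))"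
		using set_integral_add(2)[OF i(1) set_integral_add(1)[OF i(2,3)]] set_integral_add(2)[OF i(2,3)] by simp
	also have "... = 0" unfolding A2_def A1_def A0_def toD fan by (simp add: right_diff_distrib)
	finally show "(LBINT x:Om. u2 x * A2 \<psi> k x + (u1 x * A1 \<psi> k x + u x * A0 \<psi> k x)) = 0" .
qed

end

lemma AE_fst_finite: "finite T ==> AE x in (lborel :: (plane) measure). fst x \<notin> T"
proof -
	assume T: "finite T"
	have "AE x in (lborel :: (plane) measure). fst x ~= s" for s
	proof -
		have e: "{x::plane. fst x = s} = {x. x \<bullet> (1, 0) = s}" by auto
		have "negligible {x::plane. fst x = s}" unfolding e
			by (rule negligible_standard_hyperplane) (simp add: Basis_real2)
		moreover have "{x::plane. fst x = s} \<in> sets borel" by measurable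
		ultimately have "{x::plane. fst x = s} \<in> null_sets lborel"
			by (simp add: negligible_iff_null_sets null_sets_completion_iff)
		from AE_not_in[OF this] show ?thesis by simp
	qed
	hence "AE x in (lborel :: (plane) measure). \<forall>s\<in>T. fst x ~= s" by (intro AE_finite_allI[OF T])
	thus ?thesis by eventually_elim auto
qed

context resonator_solution
begin

text \<open>The part of the lower, respectively upper, domain beyond the fans.\<close>
definition Lo where "Lo = O0 \<inter> {x. snd x < - h}"
definition Up where "Up = Se \<inter> {x. L * ep + h < snd x}"

lemma Lo_sets: "Lo \<in> sets borel" "Lo \<subseteq> Om" "Up \<in> sets borel" "Up \<subseteq> Om" "Up \<subseteq> Se"
proof -
	have "{x::plane. snd x < - h} \<in> sets borel" "{x::plane. L * ep + h < snd x} \<in> sets borel" by measurable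
	thus "Lo \<in> sets borel" "Up \<in> sets borel" unfolding Lo_def Up_def using sets.Int[OF O0_sets(2)] sets.Int[OF Se_sets(2)] by blast+
	show "Lo \<subseteq> Om" "Up \<subseteq> Om" "Up \<subseteq> Se" using O0_sets(4) Se_sets(4) by (auto simp: Lo_def Up_def)
qed

text \<open>
	The sum over all cells of the integrands in the cell identities, with \<open>\<psi>\<close> evaluated at $x_1$ in the
  channels and the contribution of the fans dropped.
\<close>
definition T where "T \<psi> x = u2 x * (indicator Ce x * (1 / ep^2 * \<psi> (fst x)))
		+ ((u2 x * (indicator Lo x * (\<alpha> * (G (snd x) * \<psi> (fst x)))) + u x * (indicator Lo x * (\<alpha> * (G' (snd x) * \<psi> (fst x)))))
		+ (u2 x * (indicator Up x * (\<alpha> * (G (snd x) * \<psi> (fst x)))) + u x * (indicator Up x * (\<alpha> * (G' (snd x) * \<psi> (fst x))))))"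

text \<open>The weight of the fans, the weighted gradient, and the total error of the summation.\<close>
abbreviation "fw k x \<equiv> indicator (D k) x * (indicator Fan (snd x) * (1 / (W (snd x))^2)) :: real"
abbreviation "grad2 x \<equiv> (u2 x)^2 + 4 / V^2 * (u1 x)^2"
abbreviation "err M \<tau> \<equiv> M / ep * (LBINT x:Ce. \<bar>u2 x\<bar>) + \<alpha> * M * (ep * \<tau> * (K^2 * (1 + 4 / V^2)) + a * V / \<tau> * ln (1 / (\<alpha> * ep^2)))"

text \<open>A pointwise bound for the error in the summation; \<open>\<tau>\<close> is the parameter in Young's inequality.\<close>
definition Err where "Err M \<tau> x = M / ep * (indicator Ce x * \<bar>u2 x\<bar>)
		+ \<alpha> * ep * M * (\<tau> * grad2 x
			 + 1 / (2 * \<tau>) * (\<Sum>k<N. fw k x))"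

abbreviation R where "R \<psi> k x \<equiv> u2 x * A2 \<psi> k x + (u1 x * A1 \<psi> k x + u x * A0 \<psi> k x)"

lemma fan_term_bound:
	assumes M: "!!s. \<bar>\<psi> s\<bar> <= M" and \<tau>: "\<tau> > 0" and x: "x \<in> D j" "- h < snd x" "snd x < L * ep + h"
	shows "\<bar>R \<psi> j x\<bar> <= \<alpha> * ep * M * (\<tau> * grad2 x + 1 / (2 * \<tau>) * (1 / (W (snd x))^2))"
proof -
	define p where "p = \<psi> (real j * ep + ep * xi j x)"
	define w where "w = 1 / W (snd x)"
	define q where "q = \<bar>u2 x\<bar> + 2 / V * \<bar>u1 x\<bar>"
	have w: "0 < w" using W_bounds(3)[of "snd x"] by (simp add: w_def)
	have M0: "0 <= M" using M[of 0] by linarith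
	have g: "G (snd x) = 1" "G' (snd x) = 0" using G_values[of "snd x"] x by auto
	have e: "R \<psi> j x = \<alpha> * ep * (p * w * (u2 x + u1 x * (xi j x * W' (snd x))))"
		using x(1) by (simp add: A2_def A1_def A0_def g p_def w_def algebra_simps)
	have q1: "\<bar>u2 x + u1 x * (xi j x * W' (snd x))\<bar> <= q"
	proof -
		have "\<bar>xi j x * W' (snd x)\<bar> <= 1 * (2 / V)" unfolding abs_mult
			by (rule mult_mono[OF _ W'_bound]) (use xi_bounds[OF x(1)] in auto)
		hence "\<bar>u1 x * (xi j x * W' (snd x))\<bar> <= \<bar>u1 x\<bar> * (2 / V)" unfolding abs_mult[of "u1 x"] by (intro mult_left_mono) auto
		thus ?thesis unfolding q_def mult.commute[of "2 / V"] by linarith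
	qed
	have "\<bar>p * w * (u2 x + u1 x * (xi j x * W' (snd x)))\<bar> <= M * w * q"
		unfolding abs_mult using M[of "real j * ep + ep * xi j x"] w M0 q1 by (intro mult_mono) (auto simp: p_def)
	also have "... = M * (w * q)" by simp
	also have "... <= M * (\<tau> / 2 * q^2 + 1 / (2 * \<tau>) * w^2)"
	proof (rule mult_left_mono[OF _ M0])
		have "0 <= (\<tau> * q - w)^2 / (2 * \<tau>)" using \<tau> by simp
		also have "... = \<tau> / 2 * q^2 + 1 / (2 * \<tau>) * w^2 - w * q" using \<tau> by (simp add: field_simps power2_eq_square)
		finally show "w * q <= \<tau> / 2 * q^2 + 1 / (2 * \<tau>) * w^2" by simp
	qed
	also have "... <= M * (\<tau> * grad2 x + 1 / (2 * \<tau>) * w^2)"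
	proof (rule mult_left_mono[OF _ M0])
		have "0 <= (\<bar>u2 x\<bar> - 2 / V * \<bar>u1 x\<bar>)^2" by simp
		also have "... = 2 * grad2 x - q^2"
			by (simp add: q_def power2_sum power2_diff power_mult_distrib power_divide)
		finally have "q^2 <= 2 * grad2 x" by simp
		hence "\<tau> / 2 * q^2 <= \<tau> / 2 * (2 * grad2 x)" using \<tau> by (intro mult_left_mono) auto
		moreover have "\<tau> / 2 * (2 * grad2 x) = \<tau> * grad2 x" by (simp only: times_divide_eq_left times_divide_eq_right) simp
		ultimately show "\<tau> / 2 * q^2 + 1 / (2 * \<tau>) * w^2 <= \<tau> * grad2 x + 1 / (2 * \<tau>) * w^2" by linarith
	qed
	finally have "\<bar>p * w * (u2 x + u1 x * (xi j x * W' (snd x)))\<bar> <= M * (\<tau> * grad2 x + 1 / (2 * \<tau>) * w^2)" .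
	hence "\<alpha> * ep * \<bar>p * w * (u2 x + u1 x * (xi j x * W' (snd x)))\<bar> <= \<alpha> * ep * (M * (\<tau> * grad2 x + 1 / (2 * \<tau>) * w^2))"
		using pos by (intro mult_left_mono) auto
	moreover have "0 <= \<alpha> * ep" using pos by simp
	moreover have "w^2 = 1 / (W (snd x))^2" by (simp add: w_def power_divide)
	ultimately show ?thesis unfolding e abs_mult[of "\<alpha> * ep"] by (simp only: abs_of_nonneg mult.assoc)
qed

text \<open>At almost every point at most one cell contributes. Beyond the fans its term is exact, in the channels \<open>\<psi>\<close> oscillates by at most $M\varepsilon$, and inside the fans the whole term is an error.\<close>
lemma cell_sum_pointwise:
	assumes \<psi>: "!!s. DERIV \<psi> s :> \<gamma> s" and M: "!!s. \<bar>\<psi> s\<bar> <= M" "!!s. \<bar>\<gamma> s\<bar> <= M" and \<tau>: "\<tau> > 0"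
		and x: "x \<in> Om" "!!k. k < N ==> fst x ~= real k * ep" "snd x \<notin> {- h, 0, L * ep, L * ep + h}"
	shows "\<bar>T \<psi> x - (\<Sum>k<N. R \<psi> k x)\<bar> <= Err M \<tau> x"
proof -
	have M0: "0 <= M" using M(1)[of 0] by linarith
	obtain j where j: "j < N" "real j * ep < fst x" "fst x < real j * ep + ep" using cell_exists[of "fst x"] Om_strip[OF x(1)] x(2) by blast
	have uniq: "x \<notin> D k" if "k ~= j" for k using cell_unique[OF _ j(2,3), of k] that by blast
	have "(\<Sum>k<N. R \<psi> k x) = (\<Sum>k\<in>{j}. R \<psi> k x)"
		by (rule sum.mono_neutral_right) (use j uniq in "auto simp: A2_def A1_def A0_def")
	hence S: "(\<Sum>k<N. R \<psi> k x) = R \<psi> j x" by simp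
	have nn: "0 <= \<tau> * grad2 x" "0 <= \<alpha> * ep * M" "0 <= M / ep * (indicator Ce x * \<bar>u2 x\<bar>)" "0 <= 1 / (2 * \<tau>)"
		"!!k. 0 <= fw k x"
		using \<tau> pos M0 by auto
	have nnS: "0 <= \<alpha> * ep * M * (\<tau> * grad2 x
			 + 1 / (2 * \<tau>) * (\<Sum>k<N. fw k x))"
		by (intro mult_nonneg_nonneg[OF nn(2)] add_nonneg_nonneg nn(1) mult_nonneg_nonneg[OF nn(4)] sum_nonneg nn(5))
	have Err0: "0 <= Err M \<tau> x" "M / ep * (indicator Ce x * \<bar>u2 x\<bar>) <= Err M \<tau> x" unfolding Err_def using nn(3) nnS by linarith+
	have y: "- b < snd x" "snd x < (L + V) * ep" "fst x \<in> interval_I a" using Om_strip[OF x(1)] by auto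
	have out: "\<bar>T \<psi> x - R \<psi> j x\<bar> <= Err M \<tau> x" if o: "W (snd x) = ep" "W' (snd x) = 0" and i: "x \<notin> Ce" "indicator Lo x + indicator Up x = (1::real)"
	proof -
		have d: "x \<in> D j" using o j y by (simp add: D_iff)
		have f: "real j * ep + ep * xi j x = fst x" using o pos by (simp add: xi_def)
		have "R \<psi> j x = u2 x * (\<alpha> * (G (snd x) * \<psi> (fst x))) + u x * (\<alpha> * (G' (snd x) * \<psi> (fst x)))"
			unfolding A2_def A1_def A0_def f using d pos by (simp add: o)
		hence "T \<psi> x = R \<psi> j x * (indicator Lo x + indicator Up x)"
			using i(1) by (simp add: T_def algebra_simps)
		thus ?thesis using i(2) Err0(1) by simp
	qed
	consider "snd x < - h" | "L * ep + h < snd x" | "0 < snd x" "snd x < L * ep" | "snd x \<in> Fan" using x(3) by (force simp: Fan_def)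
	hence "\<bar>T \<psi> x - R \<psi> j x\<bar> <= Err M \<tau> x"
	proof cases
		case 1
		show ?thesis
			by (rule out) (use 1 h(1) Le W_values(1)[of "snd x"] W'_values(1)[of "snd x"] y in "auto simp: Ce_iff Lo_def Up_def O0_iff Se_iff")
	next
		case 2
		show ?thesis
			by (rule out) (use 2 h(1) Le W_values(2)[of "snd x"] W'_values(2)[of "snd x"] y in "auto simp: Ce_iff Lo_def Up_def O0_iff Se_iff")
	next
		case 3
		have c: "x \<in> Ce" using x(1) 3 by (auto simp: Om_eq O0_iff Se_iff)
		then obtain k where k: "k < N" "real k * ep < fst x" "fst x < real k * ep + \<delta>" by (auto simp: Ce_iff)
		have Wd: "W (snd x) = \<delta>" "W' (snd x) = 0" "G (snd x) = 1" "G' (snd x) = 0"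
			using W_values(3)[of "snd x"] W'_values(3)[of "snd x"] G_values[of "snd x"] 3 h(1) by auto
		have d: "x \<in> D k" using k y by (simp add: D_iff Wd)
		hence "k = j" using uniq by blast
		with d k have d: "x \<in> D j" and k: "real j * ep < fst x" "fst x < real j * ep + \<delta>" by auto
		have L: "x \<notin> Lo" "x \<notin> Up" using 3 h(1) by (auto simp: Lo_def Up_def)
		have r: "\<alpha> * ep / \<delta> = 1 / ep^2" using pos by (simp add: \<delta>_def power3_eq_cube power2_eq_square)
		define z where "z = real j * ep + ep * xi j x"
		have "R \<psi> j x = u2 x * (\<alpha> * ep / \<delta> * \<psi> z)" using d by (simp add: A2_def A1_def A0_def Wd z_def)
		hence e: "T \<psi> x - R \<psi> j x = 1 / ep^2 * u2 x * (\<psi> (fst x) - \<psi> z)"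
			unfolding r using c L by (simp add: T_def algebra_simps diff_divide_distrib)
		have zf: "\<bar>fst x - z\<bar> <= ep"
		proof -
			have "0 < ep * xi j x" "ep * xi j x < ep * 1" using xi_bounds[OF d] pos by (auto intro: mult_strict_left_mono simp del: mult_1_right)
			thus ?thesis using j unfolding z_def by linarith
		qed
		have "norm (\<psi> (fst x) - \<psi> z) <= M * norm (fst x - z)"
			by (rule field_differentiable_bound[of UNIV \<psi> \<gamma>]) (use \<psi> M(2) in auto)
		also have "... <= M * ep" using zf M0 by (intro mult_left_mono) auto
		finally have "\<bar>\<psi> (fst x) - \<psi> z\<bar> <= M * ep" by simp
		hence "\<bar>1 / ep^2 * u2 x\<bar> * \<bar>\<psi> (fst x) - \<psi> z\<bar> <= \<bar>1 / ep^2 * u2 x\<bar> * (M * ep)" by (rule mult_left_mono) simp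
		also have "... = M / ep * (indicator Ce x * \<bar>u2 x\<bar>)" using c pos by (simp add: abs_mult power2_eq_square)
		finally show ?thesis unfolding e abs_mult[of "1 / ep^2 * u2 x"] using Err0(2) by linarith
	next
		case 4
		have c: "x \<notin> Ce" "x \<notin> Lo" "x \<notin> Up" using 4 Le h(1) by (auto simp: Fan_def Ce_iff Lo_def Up_def)
		hence T0: "T \<psi> x = 0" by (simp add: T_def)
		show ?thesis
		proof (cases "x \<in> D j")
			case False
			hence "R \<psi> j x = 0" by (simp add: A2_def A1_def A0_def)
			thus ?thesis using T0 Err0(1) by simp
		next
			case True
			have "1 / (W (snd x))^2 = (\<Sum>k\<in>{j}. fw k x)" using True 4 by simp
			also have "... <= (\<Sum>k<N. fw k x)"
				by (rule sum_mono2) (use j nn(5) in auto)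
			finally have s: "1 / (W (snd x))^2 <= (\<Sum>k<N. fw k x)" .
			have "\<bar>R \<psi> j x\<bar> <= \<alpha> * ep * M * (\<tau> * grad2 x + 1 / (2 * \<tau>) * (1 / (W (snd x))^2))"
				by (rule fan_term_bound[OF M(1) \<tau> True]) (use 4 h(1) Le in "auto simp: Fan_def")
			also have "... <= \<alpha> * ep * M * (\<tau> * grad2 x + 1 / (2 * \<tau>) * (\<Sum>k<N. fw k x))"
				by (intro mult_left_mono[OF _ nn(2)] add_left_mono mult_left_mono[OF s nn(4)])
			finally show ?thesis unfolding T0 Err_def using nn(3) by simp
		qed
	qed
	thus ?thesis unfolding S .
qed

lemma Err_integral:
	assumes "M \<ge> 0" "\<tau> > 0"
	shows "lint Om (Err M \<tau>)"
		and "(LBINT x:Om. Err M \<tau> x) <= err M \<tau>"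
proof -
	let ?F = "%k x. fw k x"
	have iC: "lint Om (%x. \<bar>u2 x\<bar> * indicator Ce x)"
	proof (rule set_integrable_mult_bounded[of _ _ _ 1])
		show "lint Om (%x. \<bar>u2 x\<bar>)" by (rule abs_integrable) simp
		have [measurable]: "Om \<in> sets borel" "Ce \<in> sets borel" by (rule Om_sets Ce_sets)+
		show "lmeas Om (indicator Ce :: plane => real)" unfolding smeas_def by measurable
	qed (auto simp: indicator_def)
	have i2: "lint Om (%x. (u2 x)^2)" "lint Om (%x. (u1 x)^2)" using u_L2 Lp2_square by (auto simp: Lp_def)
	note iF = fan_integral(1)
	note iS = set_integral_sum_zero[of N Om ?F, OF iF]
	have iQ: "lint Om (%x. grad2 x)" by (intro set_integral_add(1) set_integrable_mult_right i2)
	have C: "(LBINT x:Om. \<bar>u2 x\<bar> * indicator Ce x) = (LBINT x:Ce. \<bar>u2 x\<bar>)"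
	proof -
		have "(LBINT x:Om. \<bar>u2 x\<bar> * indicator Ce x) = (LBINT x:Ce. \<bar>u2 x\<bar> * indicator Ce x)" by (rule set_integral_mult_support[OF Ce_sets(3)]) simp
		also have "... = (LBINT x:Ce. \<bar>u2 x\<bar>)" by (rule set_integral_cong_simple) simp
		finally show ?thesis .
	qed
	have iX: "lint Om (%x. M / ep * (\<bar>u2 x\<bar> * indicator Ce x))" by (intro set_integrable_mult_right iC)
	have iY: "lint Om (%x. \<tau> * grad2 x)" by (intro set_integrable_mult_right iQ)
	have iZ: "lint Om (%x. 1 / (2 * \<tau>) * (\<Sum>k<N. ?F k x))" by (rule set_integrable_mult_right) (rule iS(1), assumption)
	have iYZ: "lint Om (%x. \<alpha> * ep * M * (\<tau> * grad2 x + 1 / (2 * \<tau>) * (\<Sum>k<N. ?F k x)))"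
		by (intro set_integrable_mult_right set_integral_add(1) iY iZ)
	have eE: "Err M \<tau> = (%x. M / ep * (\<bar>u2 x\<bar> * indicator Ce x) + \<alpha> * ep * M * (\<tau> * grad2 x + 1 / (2 * \<tau>) * (\<Sum>k<N. ?F k x)))"
		unfolding Err_def mult.commute[of "indicator Ce _"] ..
	show "lint Om (Err M \<tau>)" unfolding eE by (rule set_integral_add(1)[OF iX iYZ])
	have sum_eq: "(LBINT x:Om. (\<Sum>k<N. ?F k x)) = (\<Sum>k<N. LBINT x:Om. ?F k x)" by (rule iS(2))
	have "(LBINT x:Om. Err M \<tau> x) = M / ep * (LBINT x:Ce. \<bar>u2 x\<bar>) + \<alpha> * ep * M * (\<tau> * ((LBINT x:Om. (u2 x)^2) + 4 / V^2 * (LBINT x:Om. (u1 x)^2)) + 1 / (2 * \<tau>) * (LBINT x:Om. (\<Sum>k<N. ?F k x)))"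
		unfolding eE set_integral_add(2)[OF iX iYZ] set_integral_mult_right set_integral_add(2)[OF iY iZ] C
			set_integral_add(2)[OF i2(1) set_integrable_mult_right[OF i2(2)]] ..
	also note sum_eq
	also have "M / ep * (LBINT x:Ce. \<bar>u2 x\<bar>) + \<alpha> * ep * M * (\<tau> * ((LBINT x:Om. (u2 x)^2) + 4 / V^2 * (LBINT x:Om. (u1 x)^2)) + 1 / (2 * \<tau>) * (\<Sum>k<N. LBINT x:Om. ?F k x)) <= M / ep * (LBINT x:Ce. \<bar>u2 x\<bar>) + \<alpha> * ep * M * (\<tau> * (K^2 + 4 / V^2 * K^2) + 1 / (2 * \<tau>) * (\<Sum>k<N. 2 * V * ln (1 / (\<alpha> * ep^2))))"
		using assms pos by (intro add_mono order_refl mult_left_mono u_bounds sum_mono fan_integral(2)) auto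
	also have "... = M / ep * (LBINT x:Ce. \<bar>u2 x\<bar>) + \<alpha> * M * (ep * \<tau> * (K^2 * (1 + 4 / V^2)) + (real N * ep) * V / \<tau> * ln (1 / (\<alpha> * ep^2)))"
		by (simp add: algebra_simps)
	finally show "(LBINT x:Om. Err M \<tau> x) <= err M \<tau>"
		unfolding N[symmetric] .
qed

text \<open>
	The flux through the channels is the difference of the averages of the solution above and
	below the array of channels, up to errors that vanish in the limit.
\<close>
lemma cell_sum:
	fixes \<psi> \<gamma> :: "real => real"
	assumes \<psi>: "!!s. DERIV \<psi> s :> \<gamma> s" and M: "!!s. \<bar>\<psi> s\<bar> <= M" "!!s. \<bar>\<gamma> s\<bar> <= M" and \<tau>: "\<tau> > 0"
	shows "\<bar>(1 / ep^2 * (LBINT x:Ce. u2 x * \<psi> (fst x))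
			+ \<alpha> / (b - h) * ((LBINT x:Lo. u2 x * ((snd x + b) * \<psi> (fst x))) + (LBINT x:Lo. u x * \<psi> (fst x))))
			- \<alpha> * (LBINT s:interval_I a. resonator_average L V ep u s * \<psi> s)\<bar>
		 <= err M \<tau>
			 + 2 * \<alpha> * M * (LBINT x:Se. \<bar>u2 x\<bar>)"
proof -
	have M0: "0 <= M" using M(1)[of 0] by linarith
	have c\<psi>: "continuous_on UNIV \<psi>" using DERIV_isCont[OF \<psi>] by (auto simp: continuous_on_eq_continuous_at)
	have [measurable]: "\<psi> \<in> borel_measurable borel" using c\<psi> by (rule borel_measurable_continuous_onI)
	have [measurable]: "Om \<in> sets borel" "Ce \<in> sets borel" "Se \<in> sets borel" "Lo \<in> sets borel" "Up \<in> sets borel" by (rule Om_sets Ce_sets Se_sets Lo_sets)+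
	have G'b: "\<bar>G' y\<bar> <= 1 / (- h - - b) + 1 / ((L + V) * ep - (L * ep + h))" for y unfolding G'_def by (rule trapezoid.trap_deriv_bound[OF tzG])
	define B where "B = 1 / (- h - - b) + 1 / ((L + V) * ep - (L * ep + h))"
	have bd: "\<bar>indicator E x * (\<alpha> * (G (snd x) * \<psi> (fst x)))\<bar> <= \<alpha> * (1 * M)" "\<bar>indicator E x * (\<alpha> * (G' (snd x) * \<psi> (fst x)))\<bar> <= \<alpha> * (B * M)"
			"\<bar>indicator E x * (1 / ep^2 * \<psi> (fst x))\<bar> <= 1 / ep^2 * M" for E and x :: "plane"
	proof -
		have I: "\<bar>indicator E x * (c * z)\<bar> <= c * Z" if "\<bar>z\<bar> <= Z" "0 <= c" for c z Z :: real
		proof -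
			have "\<bar>c * z\<bar> <= c * Z" using that by (simp add: abs_mult mult_left_mono)
			thus ?thesis by (auto simp: indicator_def)
		qed
		have 1: "\<bar>G (snd x) * \<psi> (fst x)\<bar> <= 1 * M" "\<bar>G' (snd x) * \<psi> (fst x)\<bar> <= B * M"
			unfolding abs_mult using h by (intro mult_mono G_bound G'b[folded B_def] M; simp add: B_def)+
		show "\<bar>indicator E x * (\<alpha> * (G (snd x) * \<psi> (fst x)))\<bar> <= \<alpha> * (1 * M)" "\<bar>indicator E x * (\<alpha> * (G' (snd x) * \<psi> (fst x)))\<bar> <= \<alpha> * (B * M)"
			"\<bar>indicator E x * (1 / ep^2 * \<psi> (fst x))\<bar> <= 1 / ep^2 * M"
			using I[OF 1(1), of \<alpha>] I[OF 1(2), of \<alpha>] I[OF M(1), of "1 / ep^2"] pos by auto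
	qed
	have m: "lmeas Om (%x. indicator E x * (\<alpha> * (G (snd x) * \<psi> (fst x))))"
		"lmeas Om (%x. indicator E x * (\<alpha> * (G' (snd x) * \<psi> (fst x))))"
		"lmeas Om (%x. indicator E x * (1 / ep^2 * \<psi> (fst x)))" if [measurable]: "E \<in> sets borel" for E :: "(plane) set"
		unfolding smeas_def by measurable
	note j = set_integrable_mult_bounded[OF u_int(3) m(3)[OF Ce_sets(2)] bd(3)]
		set_integrable_mult_bounded[OF u_int(3) m(1)[OF Lo_sets(1)] bd(1)] set_integrable_mult_bounded[OF u_int(1) m(2)[OF Lo_sets(1)] bd(2)]
		set_integrable_mult_bounded[OF u_int(3) m(1)[OF Lo_sets(3)] bd(1)] set_integrable_mult_bounded[OF u_int(1) m(2)[OF Lo_sets(3)] bd(2)]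
	note a1 = set_integral_add[OF j(2,3)] note a2 = set_integral_add[OF j(4,5)] note a3 = set_integral_add[OF a1(1) a2(1)] note a4 = set_integral_add[OF j(1) a3(1)]
	have iT: "lint Om (T \<psi>)" unfolding T_def[abs_def] by (rule a4(1))
	have to: "(LBINT x:Om. g x * (indicator E x * (c * z x))) = c * (LBINT x:E. g x * z x)" if "E \<subseteq> Om" for E and g z :: "plane => real" and c
	proof -
		have "(LBINT x:Om. g x * (indicator E x * (c * z x))) = (LBINT x:E. g x * (indicator E x * (c * z x)))"
			by (rule set_integral_mult_support[OF that]) simp
		also have "... = (LBINT x:E. c * (g x * z x))" by (rule set_integral_cong_simple) simp
		finally show ?thesis by simp
	qed
	have IT: "(LBINT x:Om. T \<psi> x) = 1 / ep^2 * (LBINT x:Ce. u2 x * \<psi> (fst x))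
		 + ((\<alpha> * (LBINT x:Lo. u2 x * (G (snd x) * \<psi> (fst x))) + \<alpha> * (LBINT x:Lo. u x * (G' (snd x) * \<psi> (fst x))))
		 + (\<alpha> * (LBINT x:Up. u2 x * (G (snd x) * \<psi> (fst x))) + \<alpha> * (LBINT x:Up. u x * (G' (snd x) * \<psi> (fst x)))))"
		unfolding T_def a4(2) a3(2) a2(2) a1(2) to[OF Ce_sets(3)] to[OF Lo_sets(2)] to[OF Lo_sets(4)] ..
	have Lo1: "(LBINT x:Lo. u2 x * (G (snd x) * \<psi> (fst x))) = 1 / (b - h) * (LBINT x:Lo. u2 x * ((snd x + b) * \<psi> (fst x)))"
		"(LBINT x:Lo. u x * (G' (snd x) * \<psi> (fst x))) = 1 / (b - h) * (LBINT x:Lo. u x * \<psi> (fst x))"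
	proof -
		have g: "G (snd x) = 1 / (b - h) * (snd x + b)" "G' (snd x) = 1 / (b - h)" if "x \<in> Lo" for x
			using that trapezoid.trap_up[OF tzG, of "snd x"] by (auto simp: G_def G'_def Lo_def O0_iff trap_deriv_def)
		show "(LBINT x:Lo. u2 x * (G (snd x) * \<psi> (fst x))) = 1 / (b - h) * (LBINT x:Lo. u2 x * ((snd x + b) * \<psi> (fst x)))"
			unfolding set_integral_mult_right[symmetric] by (rule set_integral_cong_simple) (simp add: g)
		show "(LBINT x:Lo. u x * (G' (snd x) * \<psi> (fst x))) = 1 / (b - h) * (LBINT x:Lo. u x * \<psi> (fst x))"
			unfolding set_integral_mult_right[symmetric] by (rule set_integral_cong_simple) (simp add: g)
	qed
	have Up1: "(LBINT x:Up. u x * (G' (snd x) * \<psi> (fst x))) = - (1 / h * (LBINT x:Se. u x * \<psi> (fst x) * indicator {x. L * ep + h < snd x} x))"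
	proof -
		have g: "G' (snd x) = - (1 / h)" if "x \<in> Up" for x
			using that h Le by (auto simp: G'_def Up_def Se_iff trap_deriv_def)
		have "(LBINT x:Up. u x * (G' (snd x) * \<psi> (fst x))) = (LBINT x:Up. - (1 / h) * (u x * \<psi> (fst x) * indicator {x. L * ep + h < snd x} x))"
			by (rule set_integral_cong_simple) (auto simp: g Up_def)
		also have "... = - (1 / h) * (LBINT x:Up. u x * \<psi> (fst x) * indicator {x. L * ep + h < snd x} x)" by (rule set_integral_mult_right)
		also have "(LBINT x:Up. u x * \<psi> (fst x) * indicator {x. L * ep + h < snd x} x) = (LBINT x:Se. u x * \<psi> (fst x) * indicator {x. L * ep + h < snd x} x)"
			unfolding sint_def by (rule Bochner_Integration.integral_cong[OF refl]) (auto simp: Up_def indicator_def)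
		finally show ?thesis by simp
	qed
	have av: "\<bar>1 / h * (LBINT x:Se. u x * \<psi> (fst x) * indicator {x. L * ep + h < snd x} x) - 1 / (ep * V) * (LBINT x:Se. u x * \<psi> (fst x))\<bar> <= M * (LBINT x:Se. \<bar>u2 x\<bar>)"
		by (rule upper_half_average) (use c\<psi> continuous_on_subset M in auto)
	have avI: "1 / (ep * V) * (LBINT x:Se. u x * \<psi> (fst x)) = (LBINT s:interval_I a. resonator_average L V ep u s * \<psi> s)"
	proof -
		have "(LBINT x:Se. u x * \<psi> (fst x)) = ep * V * (LBINT s:interval_I a. resonator_average L V ep u s * \<psi> s)"
			by (rule Se_average[OF continuous_on_subset[OF c\<psi> subset_UNIV] M(1)])
		thus ?thesis using pos by simp
	qed
	have U2: "\<bar>LBINT x:Up. u2 x * (G (snd x) * \<psi> (fst x))\<bar> <= M * (LBINT x:Se. \<bar>u2 x\<bar>)"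
	proof -
		have iS: "lint Se (%x. M * \<bar>u2 x\<bar>)" by (intro set_integrable_mult_right set_integrable_abs set_integrable_subset[OF u_int(3) Se_sets(1,4)])
		have Ul: "Up \<in> sets lborel" using Lo_sets(3) by simp
		have gb: "\<bar>G (snd x) * \<psi> (fst x)\<bar> <= 1 * M" for x unfolding abs_mult by (intro mult_mono G_bound M) auto
		have "\<bar>LBINT x:Up. u2 x * (G (snd x) * \<psi> (fst x))\<bar> <= (LBINT x:Up. M * \<bar>u2 x\<bar>)"
		proof (rule set_integral_abs_le)
			show "lint Up (%x. u2 x * (G (snd x) * \<psi> (fst x)))"
				by (rule set_integrable_mult_bounded[OF set_integrable_subset[OF u_int(3) Ul Lo_sets(4)] _ gb]) (unfold smeas_def, measurable)
			show "lint Up (%x. M * \<bar>u2 x\<bar>)" by (rule set_integrable_subset[OF iS Ul Lo_sets(5)])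
			show "\<bar>u2 x * (G (snd x) * \<psi> (fst x))\<bar> <= M * \<bar>u2 x\<bar>" for x
				unfolding abs_mult[of "u2 x"] using mult_left_mono[OF gb[of x], of "\<bar>u2 x\<bar>"] by (simp add: mult.commute)
		qed
		also have "... <= (LBINT x:Se. M * \<bar>u2 x\<bar>)" by (rule L2_set_integral_subset_le[OF iS Ul Lo_sets(5)]) (use M0 in simp)
		finally show ?thesis by simp
	qed
	have iR: "lint Om (R \<psi> k)" "(LBINT x:Om. R \<psi> k x) = 0" if "k < N" for k
		using cell_identity[OF that c\<psi> M(1)] by auto
	note sR = set_integral_sum_zero[of N Om "R \<psi>", OF iR(1)]
	have iSR: "lint Om (%x. \<Sum>k<N. R \<psi> k x)" by (rule sR(1))
	have "(LBINT x:Om. (\<Sum>k<N. R \<psi> k x)) = (\<Sum>k<N. LBINT x:Om. R \<psi> k x)" by (rule sR(2))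
	also have "... = 0" using iR(2) by simp
	finally have z: "(LBINT x:Om. (\<Sum>k<N. R \<psi> k x)) = 0" .
	note iD = set_integral_diff[OF iT iSR]
	have ae: "AE x in lborel. x \<in> Om --> \<bar>T \<psi> x - (\<Sum>k<N. R \<psi> k x)\<bar> <= Err M \<tau> x"
	proof -
		have f: "AE x in (lborel :: (plane) measure). fst x \<notin> (%k. real k * ep) ` {..<N}" by (rule AE_fst_finite) simp
		have s: "AE x in (lborel :: (plane) measure). snd x \<notin> {- h, 0, L * ep, L * ep + h}" by (rule AE_snd_finite) simp
		from f s show ?thesis
		proof eventually_elim
			case (elim x)
			show ?case by (rule impI, rule cell_sum_pointwise[OF \<psi> M \<tau> _ _ elim(2)]) (use elim(1) in auto)
		qed
	qed
	have "\<bar>LBINT x:Om. (T \<psi> x - (\<Sum>k<N. R \<psi> k x))\<bar> <= (LBINT x. \<bar>indicator Om x *R (T \<psi> x - (\<Sum>k<N. R \<psi> k x))\<bar>)"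
		unfolding sint_def by (rule integral_abs_bound)
	also have "... <= (LBINT x:Om. Err M \<tau> x)"
		unfolding sint_def
	proof (rule integral_mono_AE)
		show "integrable lborel (%x. \<bar>indicator Om x *R (T \<psi> x - (\<Sum>k<N. R \<psi> k x))\<bar>)"
			using iD(1) unfolding set_integrable_def by (rule integrable_abs)
		show "integrable lborel (%x. indicator Om x *R Err M \<tau> x)" using Err_integral(1)[OF M0 \<tau>] unfolding set_integrable_def .
		show "AE x in lborel. \<bar>indicator Om x *R (T \<psi> x - (\<Sum>k<N. R \<psi> k x))\<bar> <= indicator Om x *R Err M \<tau> x"
			using ae
		proof eventually_elim
			case (elim x)
			thus ?case by (cases "x \<in> Om") simp_all
		qed
	qed
	also note Err_integral(2)[OF M0 \<tau>]
	finally have F: "\<bar>LBINT x:Om. T \<psi> x\<bar> <= err M \<tau>"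
		unfolding iD(2) z by simp
	define S where "S = (LBINT x:Se. \<bar>u2 x\<bar>)"
	define P where "P = (LBINT x:Up. u2 x * (G (snd x) * \<psi> (fst x)))"
	define Q where "Q = 1 / h * (LBINT x:Se. u x * \<psi> (fst x) * indicator {x. L * ep + h < snd x} x)"
	define v where "v = (LBINT s:interval_I a. resonator_average L V ep u s * \<psi> s)"
	have 1: "\<bar>P\<bar> <= M * S" "\<bar>Q - v\<bar> <= M * S" using U2 av unfolding avI P_def S_def Q_def v_def by auto
	have 2: "\<bar>\<alpha> * (P - (Q - v))\<bar> <= 2 * \<alpha> * M * S"
	proof -
		have "\<bar>P - (Q - v)\<bar> <= 2 * (M * S)" using 1 by linarith
		hence "\<alpha> * \<bar>P - (Q - v)\<bar> <= \<alpha> * (2 * (M * S))" using pos by (intro mult_left_mono) auto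
		thus ?thesis using pos by (simp add: abs_mult)
	qed
	have 3: "1 / ep^2 * (LBINT x:Ce. u2 x * \<psi> (fst x))
			+ \<alpha> / (b - h) * ((LBINT x:Lo. u2 x * ((snd x + b) * \<psi> (fst x))) + (LBINT x:Lo. u x * \<psi> (fst x))) - \<alpha> * v
		 = (LBINT x:Om. T \<psi> x) - \<alpha> * (P - (Q - v))"
		unfolding IT Lo1 Up1 P_def[symmetric] Q_def[symmetric] by (simp add: algebra_simps add_divide_distrib)
	show ?thesis unfolding v_def[symmetric] 3 S_def[symmetric] using F 2 by linarith
qed

end

section \<open>Rates for a single value of the parameter\<close>

lemma continuous_on_closure_bounded:
	fixes k :: "'a::euclidean_space => real"
	assumes S: "bounded S" "S \<in> sets borel" and k: "continuous_on (closure S) k"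
	obtains B where "B \<ge> 0" "!!x. x \<in> S ==> \<bar>k x\<bar> <= B" "lmeas S k"
proof -
	have "compact (closure S)" using S(1) by (simp add: compact_closure)
	hence "bounded (k ` closure S)" using compact_continuous_image[OF k] compact_imp_bounded by blast
	then obtain B where B: "B > 0" "!!x. x \<in> closure S ==> \<bar>k x\<bar> <= B" by (auto simp: bounded_pos)
	have "(%x. indicator S x *R k x) \<in> borel_measurable borel"
		by (rule borel_measurable_continuous_on_indicator[OF S(2) continuous_on_subset[OF k closure_subset]])
	hence "lmeas S k" by (simp add: smeas_def)
	thus ?thesis using that[of B] B closure_subset[of S] by auto
qed

text \<open>The first-order remainder \<open>rest\<close>, which is to converge to \<open>w\<close>, for a single parameter.\<close>
locale resonator_rate = resonator_solution +
	fixes u0 :: "plane => real" and C C2 :: real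
	assumes u0: "u0 \<in> sobolev 1 2 (Omega0 a b)"
		and w: "(%x. (u x - u0 x) / ep) \<in> sobolev 1 1 (Omega0 a b)"
		and C: "W11_norm (Omega0 a b) (%x. (u x - u0 x) / ep) <= C"
		and C2: "1 / ep^2 * (LBINT x:C_eps a L \<alpha> ep. \<bar>wpd (Omega_eps a b L V \<alpha> ep) (0, 1) u x\<bar>) <= C2"
begin

definition rest where "rest x = (u x - u0 x) / ep"
abbreviation "u01 \<equiv> wpd O0 (1, 0) u0"
abbreviation "u02 \<equiv> wpd O0 (0, 1) u0"
abbreviation "r1 \<equiv> wpd O0 (1, 0) rest"
abbreviation "r2 \<equiv> wpd O0 (0, 1) rest"
abbreviation "average \<kappa> \<equiv> (LBINT s:interval_I a. resonator_average L V ep u s * \<kappa> s)"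

lemma rest_sobolev: "rest \<in> sobolev 1 1 O0" using w by (simp add: rest_def[abs_def] O0_def)
lemma O0_finite: "emeasure lborel O0 < \<infinity>" unfolding O0_def by (rule Omega0_sets)
lemma O0_bounded: "bounded O0" unfolding O0_def by (rule bounded_Omega0)

lemma rest_integrable: "lint O0 rest" "lint O0 r1" "lint O0 r2"
proof -
	show "lint O0 rest" using sobolev1D(1)[OF rest_sobolev O0_sets(3) Basis2(1)] by (simp add: Lp1_iff[symmetric])
	show "lint O0 r1" using sobolev1D(3)[OF rest_sobolev O0_sets(3) Basis2(1)] by (simp add: Lp1_iff[symmetric])
	show "lint O0 r2" using sobolev1D(3)[OF rest_sobolev O0_sets(3) Basis2(2)] by (simp add: Lp1_iff[symmetric])
qed

lemma u0_integrable: "lint O0 u0" "lint O0 u01" "lint O0 u02"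
proof -
	note s = u0[folded O0_def]
	show "lint O0 u0" by (rule Lp2_integrable[OF O0_sets(1) O0_finite sobolev1D(1)[OF s O0_sets(3) Basis2(1)]])
	show "lint O0 u01" by (rule Lp2_integrable[OF O0_sets(1) O0_finite sobolev1D(3)[OF s O0_sets(3) Basis2(1)]])
	show "lint O0 u02" by (rule Lp2_integrable[OF O0_sets(1) O0_finite sobolev1D(3)[OF s O0_sets(3) Basis2(2)]])
qed

lemma u_O0_integrable: "lint O0 u" "lint O0 u1" "lint O0 u2"
	using u_int set_integrable_subset[OF _ O0_sets(1,4)] by auto

lemma pd_rest:
	"AE x in lborel. x \<in> O0 --> r1 x = (u1 x - u01 x) / ep"
	"AE x in lborel. x \<in> O0 --> r2 x = (u2 x - u02 x) / ep"
proof -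
	have pd: "AE x in lborel. x \<in> O0 --> wpd O0 i rest x = (g x - wpd O0 i u0 x) / ep"
		if g: "has_weak_pd Om i u g" and i: "i \<in> Basis" for i g
	proof -
		have "has_weak_pd O0 i (%x. 1 / ep * u x + - (1 / ep) * u0 x) (%x. 1 / ep * g x + - (1 / ep) * wpd O0 i u0 x)"
			by (rule has_weak_pd_lincomb[OF has_weak_pd_subset[OF g O0_sets(4,1)] sobolev1D(2)[OF u0[folded O0_def] O0_sets(3) i] i])
		moreover have "(%x. 1 / ep * u x + - (1 / ep) * u0 x) = rest" by (auto simp: rest_def diff_divide_distrib)
		ultimately have "has_weak_pd O0 i rest (%x. 1 / ep * g x + - (1 / ep) * wpd O0 i u0 x)" by simp
		from wpd_AE_eq[OF O0_sets(3) this] show ?thesis by eventually_elim (simp add: diff_divide_distrib)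
	qed
	show "AE x in lborel. x \<in> O0 --> r1 x = (u1 x - u01 x) / ep" by (rule pd[OF u_weak(1) Basis2(1)])
	show "AE x in lborel. x \<in> O0 --> r2 x = (u2 x - u02 x) / ep" by (rule pd[OF u_weak(2) Basis2(2)])
qed

lemma split_aux:
	assumes i: "lint O0 g" "lint O0 g0" "lint O0 r"
		and ae: "AE x in lborel. x \<in> O0 --> r x = (g x - g0 x) / ep"
		and k: "lmeas O0 k" "!!x. x \<in> O0 ==> \<bar>k x\<bar> <= B"
	shows "(LBINT x:O0. g x * k x) = (LBINT x:O0. g0 x * k x) + ep * (LBINT x:O0. r x * k x)"
proof -
	have j: "lint O0 (%x. g x * k x)" "lint O0 (%x. g0 x * k x)" "lint O0 (%x. r x * k x)"
		by (rule set_integrable_mult_bounded[OF i(1) k], assumption, rule set_integrable_mult_bounded[OF i(2) k], assumption, rule set_integrable_mult_bounded[OF i(3) k])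
	have j3: "lint O0 (%x. ep * (r x * k x))" by (intro set_integrable_mult_right j(3))
	have "(LBINT x:O0. g x * k x) = (LBINT x:O0. g0 x * k x + ep * (r x * k x))"
	proof (rule set_integral_cong_AE_simple)
		show "AE x in lborel. x \<in> O0 --> g x * k x = g0 x * k x + ep * (r x * k x)"
			using ae
		proof eventually_elim
			case (elim x)
			show ?case
			proof
				assume "x \<in> O0"
				hence "g x = g0 x + ep * r x" using elim pos by simp
				thus "g x * k x = g0 x * k x + ep * (r x * k x)" by (simp add: distrib_right)
			qed
		qed
		show "lmeas O0 (%x. g x * k x)" "lmeas O0 (%x. g0 x * k x + ep * (r x * k x))"
			using j(1) set_integral_add(1)[OF j(2) j3] by (auto simp: set_integrable_def smeas_def)
	qed
	also have "... = (LBINT x:O0. g0 x * k x) + ep * (LBINT x:O0. r x * k x)"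
		unfolding set_integral_add(2)[OF j(2) j3] by simp
	finally show ?thesis .
qed

lemma lower_split:
	assumes k: "lmeas O0 k" "\<forall>x\<in>O0. \<bar>k x\<bar> <= B"
	shows "(LBINT x:O0. u1 x * k x) = (LBINT x:O0. u01 x * k x) + ep * (LBINT x:O0. r1 x * k x)"
		"(LBINT x:O0. u2 x * k x) = (LBINT x:O0. u02 x * k x) + ep * (LBINT x:O0. r2 x * k x)"
		"(LBINT x:O0. u x * k x) = (LBINT x:O0. u0 x * k x) + ep * (LBINT x:O0. rest x * k x)"
proof -
	have b: "\<bar>k x\<bar> <= B" if "x \<in> O0" for x using k(2) that by blast
	show "(LBINT x:O0. u1 x * k x) = (LBINT x:O0. u01 x * k x) + ep * (LBINT x:O0. r1 x * k x)"
		by (rule split_aux[OF u_O0_integrable(2) u0_integrable(2) rest_integrable(2) pd_rest(1) k(1) b])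
	show "(LBINT x:O0. u2 x * k x) = (LBINT x:O0. u02 x * k x) + ep * (LBINT x:O0. r2 x * k x)"
		by (rule split_aux[OF u_O0_integrable(3) u0_integrable(3) rest_integrable(3) pd_rest(2) k(1) b])
	show "(LBINT x:O0. u x * k x) = (LBINT x:O0. u0 x * k x) + ep * (LBINT x:O0. rest x * k x)"
		by (rule split_aux[OF u_O0_integrable(1) u0_integrable(1) rest_integrable(1) _ k(1) b]) (auto simp: rest_def)
qed

lemma rest_bounds: "(LBINT x:O0. \<bar>rest x\<bar>) <= C" "(LBINT x:O0. \<bar>r2 x\<bar>) <= C" "C \<ge> 0"
proof -
	have W: "(LBINT x:O0. \<bar>rest x\<bar>) + (LBINT x:O0. norm (r1 x, r2 x)) <= C"
		using C by (simp add: W11_norm_def rest_def[abs_def] O0_def wgrad_real2)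
	have nn: "0 <= (LBINT x:O0. \<bar>rest x\<bar>)" "0 <= (LBINT x:O0. norm (r1 x, r2 x))" by (rule set_integral_nonneg_simple; simp)+
	show "(LBINT x:O0. \<bar>rest x\<bar>) <= C" "C \<ge> 0" using W nn by linarith+
	have i: "lint O0 (%x. norm (r1 x, r2 x))"
		unfolding set_integrable_def
	proof (rule Bochner_Integration.integrable_bound)
		show "integrable lborel (%x. indicator O0 x *R (\<bar>r1 x\<bar> + \<bar>r2 x\<bar>))"
			using set_integral_add(1)[OF set_integrable_abs[OF rest_integrable(2)] set_integrable_abs[OF rest_integrable(3)]] by (simp only: set_integrable_def)
		have m: "(%x. indicator O0 x *R r1 x) \<in> borel_measurable lborel" "(%x. indicator O0 x *R r2 x) \<in> borel_measurable lborel"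
			using rest_integrable(2,3) by (auto simp: set_integrable_def)
		have "(%x. sqrt ((indicator O0 x *R r1 x)^2 + (indicator O0 x *R r2 x)^2)) \<in> borel_measurable lborel"
			using m by measurable
		moreover have "(%x. sqrt ((indicator O0 x *R r1 x)^2 + (indicator O0 x *R r2 x)^2)) = (%x. indicator O0 x *R norm (r1 x, r2 x))"
			by (auto simp: norm_Pair indicator_def)
		ultimately show "(%x. indicator O0 x *R norm (r1 x, r2 x)) \<in> borel_measurable lborel" by simp
		show "AE x in lborel. norm (indicator O0 x *R norm (r1 x, r2 x)) <= norm (indicator O0 x *R (\<bar>r1 x\<bar> + \<bar>r2 x\<bar>))"
			by (rule AE_I2) (auto simp: indicator_def norm_Pair intro: order_trans[OF sqrt_sum_squares_le_sum_abs])
	qed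
	have "(LBINT x:O0. \<bar>r2 x\<bar>) <= (LBINT x:O0. norm (r1 x, r2 x))"
	proof (rule set_integral_mono[OF set_integrable_abs[OF rest_integrable(3)] i])
		fix x
		show "\<bar>r2 x\<bar> <= norm (r1 x, r2 x)" using norm_snd_le[of "r2 x" "r1 x"] by simp
	qed
	thus "(LBINT x:O0. \<bar>r2 x\<bar>) <= C" using W nn by linarith
qed

lemma channel_rest: "leak <= ep * rate"
proof -
	have "measure lborel Ce * K^2 <= a * \<alpha> * L * ep ^ 3 * K^2" by (rule mult_right_mono[OF measure_Ce]) simp
	also have "... = ep^2 * (a * \<alpha> * L * K^2 * ep)" by (simp add: power3_eq_cube power2_eq_square)
	finally have "sqrt (measure lborel Ce * K^2) <= sqrt (ep^2 * (a * \<alpha> * L * K^2 * ep))" by simp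
	also have "... = ep * sqrt (a * \<alpha> * L * K^2 * ep)" using pos by (simp add: real_sqrt_mult)
	finally have s: "sqrt (measure lborel Ce * K^2) <= ep * sqrt (a * \<alpha> * L * K^2 * ep)" .
	have 1: "(LBINT x:Ce. \<bar>u1 x\<bar>) <= ep * sqrt (a * \<alpha> * L * K^2 * ep)" "(LBINT x:Ce. \<bar>u x\<bar>) <= ep * sqrt (a * \<alpha> * L * K^2 * ep)"
		using L1_small[OF u_L2(2) Ce_sets(1,3) u_bounds(2)] L1_small[OF u_L2(1) Ce_sets(1,3) u_bounds(1)] s by linarith+
	have "\<omega>^2 * (LBINT x:Ce. \<bar>u x\<bar>) <= \<omega>^2 * (ep * sqrt (a * \<alpha> * L * K^2 * ep))" by (rule mult_left_mono[OF 1(2)]) simp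
	with 1(1) show ?thesis by (simp add: distrib_left distrib_right mult_ac)
qed

lemma Se_terms:
	fixes \<psi> \<gamma> :: "real => real"
	assumes \<gamma>: "\<gamma> \<in> test_functions (interval_I a)" and c\<psi>: "continuous_on UNIV \<psi>" and B: "!!s. \<bar>\<psi> s\<bar> <= M"
	shows "upper \<psi> \<gamma> = - (ep * (V * (average (pd 1 \<gamma>) + \<omega>^2 * average \<psi>)))"
proof -
	have t: "pd 1 \<gamma> \<in> test_functions (interval_I a)" by (rule pd_test_function[OF \<gamma>]) simp
	have c: "continuous_on UNIV (pd 1 \<gamma>)" using t by (auto simp: test_functions_def dest: spec[of _ 0])
	obtain Q where Q: "!!s. \<bar>pd 1 \<gamma> s\<bar> <= Q" using test_function_bounded[OF t] by metis
	have "(LBINT x:Se. u x * pd 1 \<gamma> (fst x)) = ep * V * average (pd 1 \<gamma>)"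
		by (rule Se_average[OF continuous_on_subset[OF c subset_UNIV] Q])
	moreover have "(LBINT x:Se. u x * \<psi> (fst x)) = ep * V * average \<psi>"
		by (rule Se_average[OF continuous_on_subset[OF c\<psi> subset_UNIV] B])
	ultimately show ?thesis unfolding Se_ibp[OF \<gamma>] by (simp add: algebra_simps)
qed

text \<open>The equation tested with \<open>\<phi>\<close>, expanded in powers of $\varepsilon$: the equation of \<open>u0\<close> in order zero, and that of \<open>w\<close> in order one.\<close>
lemma lower_rate:
	fixes \<psi> \<gamma> :: "real => real"
	assumes \<gamma>: "\<gamma> \<in> test_functions (interval_I a)" and \<psi>: "!!s. DERIV \<psi> s :> \<gamma> s"
		and B: "!!s. \<bar>\<psi> s\<bar> <= M" "!!s. \<bar>\<gamma> s\<bar> <= M"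
		and \<phi>: "continuous_on (closure (Omega0 a b)) \<phi>" "continuous_on (closure (Omega0 a b)) H" "!!x. x \<in> Omega0 a b ==> GDERIV \<phi> x :> H x"
		and tr: "!!s. s \<in> interval_I a ==> \<phi> (s, 0) = \<psi> s"
	shows "\<bar>((LBINT x:Omega0 a b. wpd (Omega0 a b) (1, 0) u0 x * fst (H x)) + (LBINT x:Omega0 a b. wpd (Omega0 a b) (0, 1) u0 x * snd (H x))
					- \<omega>^2 * (LBINT x:Omega0 a b. u0 x * \<phi> x) - (LBINT x:Omega0 a b. f x * \<phi> x))
			 + ep * (((LBINT x:Omega0 a b. wgrad (Omega0 a b) (%x. (u x - u0 x) / ep) x \<bullet> H x) - \<omega>^2 * (LBINT x:Omega0 a b. (u x - u0 x) / ep * \<phi> x))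
					- V * (average (pd 1 \<gamma>) + \<omega>^2 * average \<psi>))\<bar>
		 <= ep * (M * rate)"
	unfolding O0_def[symmetric] rest_def[symmetric, abs_def]
proof -
	have M0: "M \<ge> 0" using B(1)[of 0] by linarith
	note \<phi>' = \<phi>[folded O0_def]
	have c\<psi>: "continuous_on UNIV \<psi>" using DERIV_isCont[OF \<psi>] by (auto simp: continuous_on_eq_continuous_at)
	have c\<gamma>: "continuous_on UNIV \<gamma>" using \<gamma> by (auto simp: test_functions_def dest: spec[of _ 0])
	obtain B1 where B1: "\<forall>x\<in>O0. \<bar>fst (H x)\<bar> <= B1" "lmeas O0 (%x. fst (H x))"
		using continuous_on_closure_bounded[OF O0_bounded O0_sets(2) continuous_on_fst[OF \<phi>'(2)]] by metis
	obtain B2 where B2: "\<forall>x\<in>O0. \<bar>snd (H x)\<bar> <= B2" "lmeas O0 (%x. snd (H x))"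
		using continuous_on_closure_bounded[OF O0_bounded O0_sets(2) continuous_on_snd[OF \<phi>'(2)]] by metis
	obtain B3 where B3: "\<forall>x\<in>O0. \<bar>\<phi> x\<bar> <= B3" "lmeas O0 \<phi>"
		using continuous_on_closure_bounded[OF O0_bounded O0_sets(2) \<phi>'(1)] by metis
	have g: "(LBINT x:O0. wgrad O0 rest x \<bullet> H x) = (LBINT x:O0. r1 x * fst (H x)) + (LBINT x:O0. r2 x * snd (H x))"
		unfolding wgrad_real2 inner_prod_def fst_conv snd_conv inner_real_def
		by (rule set_integral_add(2); rule set_integrable_mult_bounded[OF _ B1(2)] set_integrable_mult_bounded[OF _ B2(2)])
			 (use rest_integrable B1(1) B2(1) in auto)
	have "\<bar>((LBINT x:O0. u1 x * fst (H x)) + (LBINT x:O0. u2 x * snd (H x)) - \<omega>^2 * (LBINT x:O0. u x * \<phi> x) - (LBINT x:O0. f x * \<phi> x))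
			 + (upper \<psi> \<gamma>)\<bar>
		 <= M * leak"
		by (rule pde_lower[OF \<psi> c\<gamma> B \<phi>' tr]; assumption)
	also have "... <= M * (ep * rate)" by (rule mult_left_mono[OF channel_rest M0])
	finally have "\<bar>((LBINT x:O0. u1 x * fst (H x)) + (LBINT x:O0. u2 x * snd (H x)) - \<omega>^2 * (LBINT x:O0. u x * \<phi> x) - (LBINT x:O0. f x * \<phi> x))
			 + (upper \<psi> \<gamma>)\<bar> <= M * (ep * rate)" .
	moreover have "((LBINT x:O0. u1 x * fst (H x)) + (LBINT x:O0. u2 x * snd (H x)) - \<omega>^2 * (LBINT x:O0. u x * \<phi> x) - (LBINT x:O0. f x * \<phi> x))
			 + (upper \<psi> \<gamma>)
		 = ((LBINT x:O0. u01 x * fst (H x)) + (LBINT x:O0. u02 x * snd (H x)) - \<omega>^2 * (LBINT x:O0. u0 x * \<phi> x) - (LBINT x:O0. f x * \<phi> x))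
			 + ep * (((LBINT x:O0. wgrad O0 rest x \<bullet> H x) - \<omega>^2 * (LBINT x:O0. rest x * \<phi> x)) - V * (average (pd 1 \<gamma>) + \<omega>^2 * average \<psi>))"
		unfolding g Se_terms[OF \<gamma> c\<psi> B(1)] lower_split(1)[OF B1(2,1)] lower_split(2)[OF B2(2,1)] lower_split(3)[OF B3(2,1)]
		by (simp add: algebra_simps)
	ultimately show "\<bar>((LBINT x:O0. u01 x * fst (H x)) + (LBINT x:O0. u02 x * snd (H x)) - \<omega>^2 * (LBINT x:O0. u0 x * \<phi> x) - (LBINT x:O0. f x * \<phi> x))
			 + ep * (((LBINT x:O0. wgrad O0 rest x \<bullet> H x) - \<omega>^2 * (LBINT x:O0. rest x * \<phi> x)) - V * (average (pd 1 \<gamma>) + \<omega>^2 * average \<psi>))\<bar>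
		 <= ep * (M * rate)" by (simp add: mult.left_commute[of M])
qed

lemma lower_average_rate:
	fixes \<psi> :: "real => real"
	assumes c\<psi>: "continuous_on UNIV \<psi>" and B: "!!s. \<bar>\<psi> s\<bar> <= M"
	shows "\<bar>((LBINT x:Lo. u2 x * ((snd x + b) * \<psi> (fst x))) + (LBINT x:Lo. u x * \<psi> (fst x)))
			- ((LBINT x:O0. u02 x * (indicator {x. snd x < - h} x * ((snd x + b) * \<psi> (fst x)))) + (LBINT x:O0. u0 x * (indicator {x. snd x < - h} x * \<psi> (fst x))))\<bar>
		 <= ep * ((b + 1) * M * C)"
proof -
	have M0: "M \<ge> 0" using B[of 0] by linarith
	have [measurable]: "\<psi> \<in> borel_measurable borel" using c\<psi> by (rule borel_measurable_continuous_onI)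
	have [measurable]: "O0 \<in> sets borel" by (rule O0_sets)
	let ?X = "{x::plane. snd x < - h}"
	let ?k2 = "%x. indicator ?X x * ((snd x + b) * \<psi> (fst x))" and ?k = "%x. indicator ?X x * \<psi> (fst x)"
	have m: "lmeas O0 ?k2" "lmeas O0 ?k" unfolding smeas_def by measurable
	have bd': "\<bar>?k2 x\<bar> <= b * M" "\<bar>?k x\<bar> <= M" if "x \<in> O0" for x
	proof -
		have y: "\<bar>snd x + b\<bar> <= b" using that by (auto simp: O0_iff)
		have "\<bar>(snd x + b) * \<psi> (fst x)\<bar> <= b * M" unfolding abs_mult by (intro mult_mono y B) (use pos in auto)
		thus "\<bar>?k2 x\<bar> <= b * M" "\<bar>?k x\<bar> <= M" using B[of "fst x"] M0 pos by (auto simp: indicator_def)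
	qed
	have bd: "\<forall>x\<in>O0. \<bar>?k2 x\<bar> <= b * M" "\<forall>x\<in>O0. \<bar>?k x\<bar> <= M" using bd' by blast+
	have to: "(LBINT x:Lo. g x * z x) = (LBINT x:O0. g x * (indicator ?X x * z x))" for g z :: "plane => real"
		unfolding sint_def by (rule Bochner_Integration.integral_cong[OF refl]) (auto simp: Lo_def indicator_def)
	have e: "((LBINT x:Lo. u2 x * ((snd x + b) * \<psi> (fst x))) + (LBINT x:Lo. u x * \<psi> (fst x)))
			- ((LBINT x:O0. u02 x * ?k2 x) + (LBINT x:O0. u0 x * ?k x)) = ep * ((LBINT x:O0. r2 x * ?k2 x) + (LBINT x:O0. rest x * ?k x))"
		unfolding to lower_split(2)[OF m(1) bd(1)] lower_split(3)[OF m(2) bd(2)] by (simp add: distrib_left)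
	have le: "\<bar>LBINT x:O0. g x * k x\<bar> <= Q * C" if i: "lint O0 g" and gC: "(LBINT x:O0. \<bar>g x\<bar>) <= C"
		and k: "lmeas O0 k" "\<forall>x\<in>O0. \<bar>k x\<bar> <= Q" and Q: "Q \<ge> 0" for g k Q
	proof -
		have "\<bar>LBINT x:O0. g x * k x\<bar> <= (LBINT x:O0. Q * \<bar>g x\<bar>)"
		proof (rule set_integral_abs_le)
			show "lint O0 (%x. g x * k x)" by (rule set_integrable_mult_bounded[OF i k(1)]) (use k(2) in blast)
			show "lint O0 (%x. Q * \<bar>g x\<bar>)" by (intro set_integrable_mult_right set_integrable_abs i)
			show "\<bar>g x * k x\<bar> <= Q * \<bar>g x\<bar>" if "x \<in> O0" for x using mult_left_mono[OF bspec[OF k(2) that], of "\<bar>g x\<bar>"] by (simp add: abs_mult mult.commute)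
		qed
		also have "... = Q * (LBINT x:O0. \<bar>g x\<bar>)" by simp
		also have "... <= Q * C" by (rule mult_left_mono[OF gC Q])
		finally show ?thesis .
	qed
	have bM: "0 <= b * M" using pos M0 by simp
	have "\<bar>(LBINT x:O0. r2 x * ?k2 x) + (LBINT x:O0. rest x * ?k x)\<bar> <= (b + 1) * M * C"
		using le[OF rest_integrable(3) rest_bounds(2) m(1) bd(1) bM] le[OF rest_integrable(1) rest_bounds(1) m(2) bd(2) M0]
		by (simp add: distrib_right)
	hence "ep * \<bar>(LBINT x:O0. r2 x * ?k2 x) + (LBINT x:O0. rest x * ?k x)\<bar> <= ep * ((b + 1) * M * C)"
		using pos by (intro mult_left_mono) auto
	thus ?thesis unfolding e abs_mult[of ep] using pos by simp
qed

text \<open>The flux through the channels is eliminated between the equation tested in the layer and the sum over the cells.\<close>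
lemma channel_rate:
	fixes \<psi> \<gamma> :: "real => real"
	assumes \<gamma>: "\<gamma> \<in> test_functions (interval_I a)" and \<psi>: "!!s. DERIV \<psi> s :> \<gamma> s"
		and B: "!!s. \<bar>\<psi> s\<bar> <= M" "!!s. \<bar>\<gamma> s\<bar> <= M"
	shows "\<bar>- (V * (average (pd 1 \<gamma>) + \<omega>^2 * average \<psi>)) + \<alpha> / L * (average \<psi> - 1 / (b - V * ep / 2) *
			((LBINT x:Omega0 a b. wpd (Omega0 a b) (0, 1) u0 x * (indicator {x. snd x < - (V * ep / 2)} x * ((snd x + b) * \<psi> (fst x))))
			 + (LBINT x:Omega0 a b. u0 x * (indicator {x. snd x < - (V * ep / 2)} x * \<psi> (fst x)))))\<bar>
		<= M * rate
			+ 1 / L * (M * C2 * ep + \<alpha> * M * (K^2 * (1 + 4 / V^2) * sqrt ep + a * V * (sqrt ep * ln (1 / (\<alpha> * ep^2))))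
				+ 2 * \<alpha> * M * sqrt (a * V * K^2 * ep) + 2 * \<alpha> / b * ((b + 1) * M * C) * ep)"
proof -
	have M0: "M \<ge> 0" using B(1)[of 0] by linarith
	have c\<psi>: "continuous_on UNIV \<psi>" using DERIV_isCont[OF \<psi>] by (auto simp: continuous_on_eq_continuous_at)
	have c\<gamma>: "continuous_on UNIV \<gamma>" using \<gamma> by (auto simp: test_functions_def dest: spec[of _ 0])
	define F where "F = 1 / ep^2 * (LBINT x:Ce. u2 x * \<psi> (fst x))"
	define S where "S = V * (average (pd 1 \<gamma>) + \<omega>^2 * average \<psi>)"
	define Z where "Z = (LBINT x:Lo. u2 x * ((snd x + b) * \<psi> (fst x))) + (LBINT x:Lo. u x * \<psi> (fst x))"
	define Z0 where "Z0 = (LBINT x:O0. u02 x * (indicator {x. snd x < - h} x * ((snd x + b) * \<psi> (fst x)))) + (LBINT x:O0. u0 x * (indicator {x. snd x < - h} x * \<psi> (fst x)))"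
	define m where "m = average \<psi>"
	have 1: "\<bar>- S + 1 / L * F\<bar> <= M * rate"
	proof -
		have "\<bar>(upper \<psi> \<gamma>) + 1 / (L * ep) * (LBINT x:Ce. u2 x * \<psi> (fst x))\<bar>
			 <= M * leak" by (rule pde_channel[OF \<psi> c\<gamma> B])
		also have "... <= M * (ep * rate)" by (rule mult_left_mono[OF channel_rest M0])
		finally have "\<bar>- (ep * S) + 1 / (L * ep) * (LBINT x:Ce. u2 x * \<psi> (fst x))\<bar> <= ep * (M * rate)"
			unfolding Se_terms[OF \<gamma> c\<psi> B(1)] S_def[symmetric] by (simp only: mult.left_commute[of M])
		moreover have "- (ep * S) + 1 / (L * ep) * (LBINT x:Ce. u2 x * \<psi> (fst x)) = ep * (- S + 1 / L * F)"
			using pos by (simp add: F_def power2_eq_square algebra_simps)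
		ultimately have "ep * \<bar>- S + 1 / L * F\<bar> <= ep * (M * rate)"
			using pos by (simp add: abs_mult)
		thus ?thesis using pos by simp
	qed
	have 2: "\<bar>F + \<alpha> / (b - h) * Z - \<alpha> * m\<bar> <= M * C2 * ep + \<alpha> * M * (K^2 * (1 + 4 / V^2) * sqrt ep + a * V * (sqrt ep * ln (1 / (\<alpha> * ep^2)))) + 2 * \<alpha> * M * sqrt (a * V * K^2 * ep)"
	proof -
		\<comment> \<open>With $\tau=\varepsilon^{-1/2}$ both $\varepsilon\tau$ and $\ln(1/\varepsilon)/\tau$ tend to zero.\<close>
	have "1 / sqrt ep > 0" using pos by simp
		from cell_sum[OF \<psi> B this]
		have "\<bar>F + \<alpha> / (b - h) * Z - \<alpha> * m\<bar> <= M / ep * (LBINT x:Ce. \<bar>u2 x\<bar>) + \<alpha> * M * (ep * (1 / sqrt ep) * (K^2 * (1 + 4 / V^2)) + a * V / (1 / sqrt ep) * ln (1 / (\<alpha> * ep^2)))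
			 + 2 * \<alpha> * M * (LBINT x:Se. \<bar>u2 x\<bar>)" unfolding F_def Z_def m_def .
		also have "... <= M * C2 * ep + \<alpha> * M * (K^2 * (1 + 4 / V^2) * sqrt ep + a * V * (sqrt ep * ln (1 / (\<alpha> * ep^2)))) + 2 * \<alpha> * M * sqrt (a * V * K^2 * ep)"
		proof (intro add_mono)
			have "M * ep * (1 / ep^2 * (LBINT x:Ce. \<bar>u2 x\<bar>)) <= M * ep * C2"
				using C2 M0 pos by (intro mult_left_mono) (auto simp: Ce_def u2_def Om_def)
			thus "M / ep * (LBINT x:Ce. \<bar>u2 x\<bar>) <= M * C2 * ep" using pos by (simp add: power2_eq_square mult_ac)
			have "ep * (1 / sqrt ep) = sqrt ep" using pos by (simp add: real_div_sqrt)
			thus "\<alpha> * M * (ep * (1 / sqrt ep) * (K^2 * (1 + 4 / V^2)) + a * V / (1 / sqrt ep) * ln (1 / (\<alpha> * ep^2)))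
				<= \<alpha> * M * (K^2 * (1 + 4 / V^2) * sqrt ep + a * V * (sqrt ep * ln (1 / (\<alpha> * ep^2))))"
				by (simp only: mult.commute[of "sqrt ep" "K^2 * _"]) (simp add: mult.assoc)
			have "(LBINT x:Se. \<bar>u2 x\<bar>) <= sqrt (a * V * K^2 * ep)"
				using L1_small[OF u_L2(3) Se_sets(1,4) u_bounds(3)] by (simp add: measure_Se mult_ac)
			thus "2 * \<alpha> * M * (LBINT x:Se. \<bar>u2 x\<bar>) <= 2 * \<alpha> * M * sqrt (a * V * K^2 * ep)" using pos M0 by (intro mult_left_mono) auto
		qed
		finally show ?thesis .
	qed
	have 3: "\<bar>\<alpha> / (b - h) * (Z - Z0)\<bar> <= 2 * \<alpha> / b * ((b + 1) * M * C) * ep"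
	proof -
		have z: "\<bar>Z - Z0\<bar> <= ep * ((b + 1) * M * C)" unfolding Z_def Z0_def by (rule lower_average_rate[OF c\<psi> B(1)])
		have "\<alpha> / (b - h) <= \<alpha> / (b / 2)" using h pos by (intro divide_left_mono) auto
		moreover have "0 <= \<alpha> / (b - h)" using h pos by simp
		moreover have "\<alpha> / (b / 2) = 2 * \<alpha> / b" by simp
		ultimately have q: "\<bar>\<alpha> / (b - h)\<bar> <= 2 * \<alpha> / b" by (simp only: abs_of_nonneg)
		have "\<bar>\<alpha> / (b - h)\<bar> * \<bar>Z - Z0\<bar> <= 2 * \<alpha> / b * (ep * ((b + 1) * M * C))" by (intro mult_mono q z) (use pos in auto)
		thus ?thesis unfolding abs_mult[of "\<alpha> / (b - h)"] by (simp add: mult_ac)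
	qed
	have 4: "\<bar>F - \<alpha> * (m - 1 / (b - h) * Z0)\<bar> <= M * C2 * ep + \<alpha> * M * (K^2 * (1 + 4 / V^2) * sqrt ep + a * V * (sqrt ep * ln (1 / (\<alpha> * ep^2)))) + 2 * \<alpha> * M * sqrt (a * V * K^2 * ep)
			+ 2 * \<alpha> / b * ((b + 1) * M * C) * ep" (is "_ <= ?E")
	proof -
		have "F - \<alpha> * (m - 1 / (b - h) * Z0) = (F + \<alpha> / (b - h) * Z - \<alpha> * m) - \<alpha> / (b - h) * (Z - Z0)" by (simp add: right_diff_distrib)
		note e = this
		show ?thesis unfolding e by (rule order_trans[OF abs_triangle_ineq4 add_mono[OF 2 3]])
	qed
	have "1 / L * \<bar>F - \<alpha> * (m - 1 / (b - h) * Z0)\<bar> <= 1 / L * ?E" using 4 pos by (intro mult_left_mono) auto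
	hence 5: "\<bar>1 / L * (F - \<alpha> * (m - 1 / (b - h) * Z0))\<bar> <= 1 / L * ?E" using pos by (simp only: abs_mult) simp
	have "- S + \<alpha> / L * (m - 1 / (b - h) * Z0) = (- S + 1 / L * F) - 1 / L * (F - \<alpha> * (m - 1 / (b - h) * Z0))"
		by (simp add: right_diff_distrib)
	note e = this
	have "\<bar>- S + \<alpha> / L * (m - 1 / (b - h) * Z0)\<bar> <= M * rate + 1 / L * ?E"
		unfolding e by (rule order_trans[OF abs_triangle_ineq4 add_mono[OF 1 5]])
	thus ?thesis unfolding S_def m_def Z0_def h_def O0_def .
qed

end

section \<open>Passage to the limit\<close>

lemma set_integral_tendsto_bounded_set:
	fixes u :: "'a::euclidean_space => real"
	assumes u: "lint K u" and b: "!!n x. x \<in> K ==> \<bar>\<phi> n x\<bar> <= B" and K: "K \<in> sets lborel"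
		and m: "!!n. lmeas K (\<phi> n)" "lmeas K \<phi>'"
		and lim: "!!x. x \<in> K ==> (%n. \<phi> n x) -->> \<phi>' x"
	shows "(%n. LBINT x:K. u x * \<phi> n x) -->> (LBINT x:K. u x * \<phi>' x)"
proof -
	have e: "(LBINT x:K. u x * (indicator K x * g x)) = (LBINT x:K. u x * g x)" for g
		by (rule set_integral_cong_simple) simp
	have "(%n. LBINT x:K. u x * (indicator K x * \<phi> n x)) -->> (LBINT x:K. u x * (indicator K x * \<phi>' x))"
		by (rule set_integral_tendsto_bounded[OF u _ K, of _ B]) (use b m lim in "auto simp: smeas_def")
	thus ?thesis unfolding e .
qed

lemma L1_tendsto_mult_bounded:
	fixes g :: "nat => 'a::euclidean_space => real"
	assumes g: "!!n. lint S (g n)" "lint S g0"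
		and k: "lmeas S k" "!!x. x \<in> S ==> \<bar>k x\<bar> <= B"
		and lim: "(%n. LBINT x:S. \<bar>g n x - g0 x\<bar>) -->> 0"
	shows "(%n. LBINT x:S. g n x * k x) -->> (LBINT x:S. g0 x * k x)"
proof -
	have i: "lint S (%x. g n x * k x)" for n by (rule set_integrable_mult_bounded[OF g(1) k])
	have i0: "lint S (%x. g0 x * k x)" by (rule set_integrable_mult_bounded[OF g(2) k])
	have "\<bar>(LBINT x:S. g n x * k x) - (LBINT x:S. g0 x * k x)\<bar> <= B * (LBINT x:S. \<bar>g n x - g0 x\<bar>)" for n
	proof -
		have e: "(LBINT x:S. g n x * k x) - (LBINT x:S. g0 x * k x) = (LBINT x:S. g n x * k x - g0 x * k x)"
			by (rule set_integral_diff(2)[OF i i0, symmetric])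
		have "\<bar>LBINT x:S. g n x * k x - g0 x * k x\<bar> <= (LBINT x:S. B * \<bar>g n x - g0 x\<bar>)"
		proof (rule set_integral_abs_le)
			show "lint S (%x. g n x * k x - g0 x * k x)" by (rule set_integral_diff(1)[OF i i0])
			show "lint S (%x. B * \<bar>g n x - g0 x\<bar>)" by (intro set_integrable_mult_right set_integrable_abs set_integral_diff(1) g)
			show "\<bar>g n x * k x - g0 x * k x\<bar> <= B * \<bar>g n x - g0 x\<bar>" if "x \<in> S" for x
			proof -
				have "\<bar>g n x * k x - g0 x * k x\<bar> = \<bar>g n x - g0 x\<bar> * \<bar>k x\<bar>" by (simp only: left_diff_distrib[symmetric] abs_mult)
				also have "... <= \<bar>g n x - g0 x\<bar> * B" by (rule mult_left_mono[OF k(2)[OF that]]) simp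
				finally show ?thesis by (simp only: mult.commute)
			qed
		qed
		thus ?thesis unfolding e set_integral_mult_right .
	qed
	moreover have "(%n. B * (LBINT x:S. \<bar>g n x - g0 x\<bar>)) -->> 0" using tendsto_mult_right_zero[OF lim] .
	ultimately have "(%n. (LBINT x:S. g n x * k x) - (LBINT x:S. g0 x * k x)) -->> 0"
		unfolding real_norm_def[symmetric] by (rule Lim_null_comparison[OF always_eventually[OF allI]])
	thus ?thesis by (simp add: LIM_zero_iff)
qed

lemma sqrt_times_ln_tendsto_0:
	fixes ep :: "nat => real"
	assumes e: "!!n. ep n > 0" "ep -->> 0" and c: "\<alpha> > 0"
	shows "(%n. sqrt (ep n) * ln (1 / (\<alpha> * (ep n)^2))) -->> 0"
proof -
	define s where "s n = 1 / sqrt (ep n)" for n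
	have sq: "(%n. sqrt (ep n)) -->> 0" using tendsto_real_sqrt[OF e(2)] by simp
	have s: "filterlim s at_top sequentially"
		unfolding s_def[abs_def] divide_inverse mult_1
		by (rule filterlim_inverse_at_top[OF sq]) (use e(1) in simp)
	have 1: "(%n. ln (s n) / s n) -->> 0" by (rule filterlim_compose[OF ln_x_over_x_tendsto_0 s])
	have "(%n. 4 * (ln (s n) / s n) - ln \<alpha> * sqrt (ep n)) -->> 4 * 0 - ln \<alpha> * 0" by (intro tendsto_intros 1 sq)
	moreover have "4 * (ln (s n) / s n) - ln \<alpha> * sqrt (ep n) = sqrt (ep n) * ln (1 / (\<alpha> * (ep n)^2))" for n
	proof -
		have "ln (s n) = - (ln (ep n) / 2)" using e(1)[of n] by (simp add: s_def ln_div ln_sqrt)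
		moreover have "ln (1 / (\<alpha> * (ep n)^2)) = - ln \<alpha> - 2 * ln (ep n)" using e(1)[of n] c by (simp add: ln_div ln_mult ln_realpow)
		ultimately show ?thesis unfolding s_def by (simp only:) (simp add: right_diff_distrib mult.commute)
	qed
	ultimately show ?thesis by simp
qed

lemma continuous_Lp2_interval:
	fixes g :: "real => real"
	assumes "continuous_on UNIV g" "!!s. \<bar>g s\<bar> <= B"
	shows "g \<in> Lp 2 (interval_I a)"
proof (rule bounded_Lp2[OF _ interval_I_sets(2) _ assms(2)])
	have [measurable]: "g \<in> borel_measurable borel" by (rule borel_measurable_continuous_onI[OF assms(1)])
	have [measurable]: "interval_I a \<in> sets borel" by (rule interval_I_sets)
	show "interval_I a \<in> sets lborel" by simp
	show "lmeas (interval_I a) g" unfolding smeas_def by measurable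
qed

text \<open>The constants of the a priori bounds are parameters.\<close>
locale resonator_sequence =
	fixes a b L V \<alpha> \<omega> K C C2 :: real and f :: "plane => real" and ep :: "nat => real"
		and u :: "nat => plane => real" and u0 w :: "plane => real" and v :: "real => real"
	assumes pos: "a > 0" "b > 0" "L > 0" "V > 0" "\<alpha> > 0"
		and f: "f \<in> Lp 2 UNIV" "AE x in lborel. x \<notin> Omega0 a b --> f x = 0"
		and ep: "!!n. ep n > 0" "!!n. a / ep n \<in> \<nat>" "ep -->> 0"
		and ws: "!!n. weak_solution (Omega_eps a b L V \<alpha> (ep n)) \<omega> f (u n)"
		and K: "!!n. H1_norm (Omega_eps a b L V \<alpha> (ep n)) (u n) <= K"
		and u0: "u0 \<in> H1 (Omega0 a b)"
		and v: "v \<in> H1 (interval_I a)"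
		and v_lim: "weakly_L2 (interval_I a) (%n. resonator_average L V (ep n) (u n)) v"
		and w_bound: "!!n. W11_norm (Omega0 a b) (%x. (u n x - u0 x) / ep n) <= C"
		and w_lim: "weakly_star_BV (Omega0 a b) (%n x. (u n x - u0 x) / ep n) w"
		and C2: "!!n. 1 / (ep n)^2 * (LBINT x:C_eps a L \<alpha> (ep n). \<bar>wpd (Omega_eps a b L V \<alpha> (ep n)) (0, 1) (u n) x\<bar>) <= C2"
begin

abbreviation "O0 \<equiv> Omega0 a b"
abbreviation "I \<equiv> interval_I a"
abbreviation "v1 \<equiv> wpd I 1 v"

lemma eventually_rate: "\<forall>\<^sub>F n in sequentially. \<exists>N. resonator_rate a b L V \<alpha> (ep n) N \<omega> K f (u n) u0 C C2"
proof -
	have "(%n. \<alpha> * (ep n)^2) -->> \<alpha> * 0^2" "(%n. V * ep n / 2) -->> V * 0 / 2" by (intro tendsto_intros ep(3); simp)+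
	hence "\<forall>\<^sub>F n in sequentially. \<alpha> * (ep n)^2 < 1/2" "\<forall>\<^sub>F n in sequentially. V * ep n / 2 < b / 2"
		using pos by (auto intro!: order_tendstoD(2)[where y=0])
	thus ?thesis
	proof eventually_elim
		case (elim n)
		obtain N where "a / ep n = real N" using ep(2)[of n] by (auto elim: Nats_cases)
		hence N: "a = real N * ep n" using ep(1)[of n] by (simp add: divide_eq_eq)
		have "(%x. (u n x - u0 x) / ep n) \<in> sobolev 1 1 O0" using w_lim by (simp add: weakly_star_BV_def)
		hence "resonator_rate a b L V \<alpha> (ep n) N \<omega> K f (u n) u0 C C2"
			using pos f ep(1)[of n] N elim ws[of n] K[of n] u0 w_bound[of n] C2[of n] by unfold_locales auto
		thus ?case by blast
	qed
qed

lemma v_props: "v \<in> Lp 2 I" "v1 \<in> Lp 2 I" "has_weak_pd I 1 v v1" "lint I v" "lint I v1"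
proof -
	have B: "(1::real) \<in> Basis" by simp
	show a: "v \<in> Lp 2 I" "v1 \<in> Lp 2 I" "has_weak_pd I 1 v v1" using sobolev1D[OF v interval_I_sets(3) B] by auto
	show "lint I v" "lint I v1"
		using a(1,2) Lp2_integrable[OF _ interval_I_sets(2)] interval_I_sets(1) by auto
qed

lemma average_tendsto:
	assumes "continuous_on UNIV \<kappa>" "!!s. \<bar>\<kappa> s\<bar> <= B"
	shows "(%n. LBINT s:I. resonator_average L V (ep n) (u n) s * \<kappa> s) -->> (LBINT s:I. v s * \<kappa> s)"
	using v_lim continuous_Lp2_interval[OF assms] by (auto simp: weakly_L2_def)

lemma pd_test:
	assumes \<gamma>: "\<gamma> \<in> test_functions I"
	obtains Q where "continuous_on UNIV (pd 1 \<gamma>)" "!!s. \<bar>pd 1 \<gamma> s\<bar> <= Q" "(LBINT s:I. v s * pd 1 \<gamma> s) = - (LBINT s:I. v1 s * \<gamma> s)"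
proof -
	have t: "pd 1 \<gamma> \<in> test_functions I" by (rule pd_test_function[OF \<gamma>]) simp
	obtain Q where "!!s. \<bar>pd 1 \<gamma> s\<bar> <= Q" using test_function_bounded[OF t] by metis
	moreover have "continuous_on UNIV (pd 1 \<gamma>)" using t by (auto simp: test_functions_def dest: spec[of _ 0])
	ultimately show ?thesis using that v_props(3) \<gamma> by (auto simp: has_weak_pd_def)
qed

text \<open>The term of order zero vanishes in the limit; the remaining inequality can then be divided by $\varepsilon$.\<close>
lemma lower_equation_test:
	fixes \<psi> \<gamma> :: "real => real"
	assumes \<gamma>: "\<gamma> \<in> test_functions I" and \<psi>: "!!s. DERIV \<psi> s :> \<gamma> s"
		and B: "!!s. \<bar>\<psi> s\<bar> <= M" "!!s. \<bar>\<gamma> s\<bar> <= M"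
		and \<phi>: "continuous_on (closure O0) \<phi>" "continuous_on (closure O0) H" "!!x. x \<in> O0 ==> GDERIV \<phi> x :> H x"
		and tr: "!!s. s \<in> I ==> \<phi> (s, 0) = \<psi> s"
	shows "(LBINT x:O0. wgrad O0 w x \<bullet> H x) - \<omega>^2 * (LBINT x:O0. w x * \<phi> x) + V * ((LBINT s:I. v1 s * \<gamma> s) - \<omega>^2 * (LBINT s:I. v s * \<psi> s)) = 0"
proof -
	obtain Q where Q: "continuous_on UNIV (pd 1 \<gamma>)" "!!s. \<bar>pd 1 \<gamma> s\<bar> <= Q" "(LBINT s:I. v s * pd 1 \<gamma> s) = - (LBINT s:I. v1 s * \<gamma> s)"
		by (rule pd_test[OF \<gamma>]) blast
	have c\<psi>: "continuous_on UNIV \<psi>" using DERIV_isCont[OF \<psi>] by (auto simp: continuous_on_eq_continuous_at)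
	define rest where "rest n x = (u n x - u0 x) / ep n" for n x
	define av where "av n \<kappa> = (LBINT s:I. resonator_average L V (ep n) (u n) s * \<kappa> s)" for n \<kappa>
	define X where "X = (LBINT x:O0. wpd O0 (1, 0) u0 x * fst (H x)) + (LBINT x:O0. wpd O0 (0, 1) u0 x * snd (H x))
					- \<omega>^2 * (LBINT x:O0. u0 x * \<phi> x) - (LBINT x:O0. f x * \<phi> x)"
	define Y where "Y n = ((LBINT x:O0. wgrad O0 (rest n) x \<bullet> H x) - \<omega>^2 * (LBINT x:O0. rest n x * \<phi> x)) - V * (av n (pd 1 \<gamma>) + \<omega>^2 * av n \<psi>)" for n
	define Z where "Z = ((LBINT x:O0. wgrad O0 w x \<bullet> H x) - \<omega>^2 * (LBINT x:O0. w x * \<phi> x)) - V * ((LBINT s:I. v s * pd 1 \<gamma> s) + \<omega>^2 * (LBINT s:I. v s * \<psi> s))"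
	define E where "E n = M * ((1 + \<omega>^2) * sqrt (a * \<alpha> * L * K^2 * ep n))" for n
	have lw: "!!n. rest n \<in> sobolev 1 1 O0" "w \<in> sobolev 1 1 O0" "(%n. LBINT x:O0. \<bar>rest n x - w x\<bar>) -->> 0"
		 "(%n. LBINT x:O0. wgrad O0 (rest n) x \<bullet> H x) -->> (LBINT x:O0. wgrad O0 w x \<bullet> H x)"
		using w_lim \<phi>(2) unfolding weakly_star_BV_def rest_def[abs_def] by blast+
	have B2: "(1, 0) \<in> (Basis :: (plane) set)" by (simp add: Basis_real2)
	have ri: "lint O0 (rest n)" "lint O0 w" for n
		using sobolev1D(1)[OF lw(1) open_Omega0 B2] sobolev1D(1)[OF lw(2) open_Omega0 B2] by (auto simp: Lp1_iff[symmetric])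
	have O0b: "O0 \<in> sets borel" using Omega0_sets(1) by simp
	obtain B3 where B3: "\<forall>x\<in>O0. \<bar>\<phi> x\<bar> <= B3" "lmeas O0 \<phi>"
		using continuous_on_closure_bounded[OF bounded_Omega0 O0b \<phi>(1)] by metis
	have wl: "(%n. LBINT x:O0. rest n x * \<phi> x) -->> (LBINT x:O0. w x * \<phi> x)"
		by (rule L1_tendsto_mult_bounded[OF ri B3(2) _ lw(3)]) (use B3(1) in blast)
	have al: "(%n. av n (pd 1 \<gamma>)) -->> (LBINT s:I. v s * pd 1 \<gamma> s)" "(%n. av n \<psi>) -->> (LBINT s:I. v s * \<psi> s)"
		unfolding av_def by (rule average_tendsto[OF Q(1,2)], rule average_tendsto[OF c\<psi> B(1)])
	have YZ: "Y -->> Z" unfolding Y_def[abs_def] Z_def by (intro tendsto_intros lw(4) wl al)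
	have "E -->> M * ((1 + \<omega>^2) * sqrt (a * \<alpha> * L * K^2 * 0))" unfolding E_def[abs_def] by (intro tendsto_intros ep(3))
	hence E0: "E -->> 0" by simp
	have ev: "\<forall>\<^sub>F n in sequentially. \<bar>X + ep n * Y n\<bar> <= ep n * E n"
		using eventually_rate
	proof eventually_elim
		case (elim n)
		then obtain N where "resonator_rate a b L V \<alpha> (ep n) N \<omega> K f (u n) u0 C C2" by blast
		from resonator_rate.lower_rate[OF this \<gamma> \<psi> B \<phi> tr]
		show ?case unfolding X_def Y_def E_def av_def rest_def[abs_def] .
	qed
	have X0: "X = 0"
	proof -
		have "(%n. \<bar>X + ep n * Y n\<bar>) -->> \<bar>X + 0 * Z\<bar>" "(%n. ep n * E n) -->> 0 * 0" by (intro tendsto_intros ep(3) YZ E0)+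
		from tendsto_le[OF sequentially_bot this(2,1) ev] show ?thesis by simp
	qed
	have ev2: "\<forall>\<^sub>F n in sequentially. \<bar>Y n\<bar> <= E n"
		using ev
	proof eventually_elim
		case (elim n)
		hence "ep n * \<bar>Y n\<bar> <= ep n * E n" using ep(1)[of n] X0 by (simp add: abs_mult)
		thus ?case using ep(1)[of n] by simp
	qed
	have "(%n. \<bar>Y n\<bar>) -->> \<bar>Z\<bar>" by (intro tendsto_intros YZ)
	from tendsto_le[OF sequentially_bot E0 this ev2] have "Z = 0" by simp
	thus ?thesis unfolding Z_def Q(3) by (simp add: algebra_simps)
qed

lemma channel_equation_test:
	fixes \<psi> \<gamma> :: "real => real"
	assumes \<gamma>: "\<gamma> \<in> test_functions I" and \<psi>: "!!s. DERIV \<psi> s :> \<gamma> s"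
		and B: "!!s. \<bar>\<psi> s\<bar> <= M" "!!s. \<bar>\<gamma> s\<bar> <= M"
	shows "V * ((LBINT s:I. v1 s * \<gamma> s) - \<omega>^2 * (LBINT s:I. v s * \<psi> s)) + \<alpha> / L * ((LBINT s:I. v s * \<psi> s) - (LBINT s:I. trace0 a b u0 s * \<psi> s)) = 0"
proof -
	obtain Q where Q: "continuous_on UNIV (pd 1 \<gamma>)" "!!s. \<bar>pd 1 \<gamma> s\<bar> <= Q" "(LBINT s:I. v s * pd 1 \<gamma> s) = - (LBINT s:I. v1 s * \<gamma> s)"
		by (rule pd_test[OF \<gamma>]) blast
	have c\<psi>: "continuous_on UNIV \<psi>" using DERIV_isCont[OF \<psi>] by (auto simp: continuous_on_eq_continuous_at)
	have M0: "0 <= M" using B(1)[of 0] by linarith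
	have [measurable]: "\<psi> \<in> borel_measurable borel" by (rule borel_measurable_continuous_onI[OF c\<psi>])
	have O0l: "O0 \<in> sets lborel" by (rule Omega0_sets)
	have [measurable]: "O0 \<in> sets borel" using O0l by simp
	define av where "av n \<kappa> = (LBINT s:I. resonator_average L V (ep n) (u n) s * \<kappa> s)" for n \<kappa>
	define X where "X n = {x::plane. snd x < - (V * ep n / 2)}" for n
	have [measurable]: "X n \<in> sets borel" for n unfolding X_def by measurable
	define T where "T n = (LBINT x:O0. wpd O0 (0, 1) u0 x * (indicator (X n) x * ((snd x + b) * \<psi> (fst x)))) + (LBINT x:O0. u0 x * (indicator (X n) x * \<psi> (fst x)))" for n
	define T0 where "T0 = (LBINT x:O0. wpd O0 (0, 1) u0 x * ((snd x + b) * \<psi> (fst x))) + (LBINT x:O0. u0 x * \<psi> (fst x))"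
	define Y where "Y n = - (V * (av n (pd 1 \<gamma>) + \<omega>^2 * av n \<psi>)) + \<alpha> / L * (av n \<psi> - 1 / (b - V * ep n / 2) * T n)" for n
	define Z where "Z = - (V * ((LBINT s:I. v s * pd 1 \<gamma> s) + \<omega>^2 * (LBINT s:I. v s * \<psi> s))) + \<alpha> / L * ((LBINT s:I. v s * \<psi> s) - 1 / (b - V * 0 / 2) * T0)"
	define E where "E n = M * ((1 + \<omega>^2) * sqrt (a * \<alpha> * L * K^2 * ep n))
			+ 1 / L * (M * C2 * ep n + \<alpha> * M * (K^2 * (1 + 4 / V^2) * sqrt (ep n) + a * V * (sqrt (ep n) * ln (1 / (\<alpha> * (ep n)^2))))
				+ 2 * \<alpha> * M * sqrt (a * V * K^2 * ep n) + 2 * \<alpha> / b * ((b + 1) * M * C) * ep n)" for n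
	have B2: "(0, 1) \<in> (Basis :: (plane) set)" by (simp add: Basis_real2)
	have ui: "lint O0 u0" "lint O0 (wpd O0 (0, 1) u0)"
		using Lp2_integrable[OF Omega0_sets] sobolev1D(1,3)[OF u0 open_Omega0 B2] by auto
	have Xl: "(%n. indicator (X n) x :: real) -->> 1" if "x \<in> O0" for x
	proof -
		have "(%n. - (V * ep n / 2)) -->> - (V * 0 / 2)" by (intro tendsto_intros ep(3); simp)
		moreover have "snd x < 0" using that by (auto simp: Omega0_def)
		ultimately have "\<forall>\<^sub>F n in sequentially. snd x < - (V * ep n / 2)" by (intro order_tendstoD(1)) auto
		hence "\<forall>\<^sub>F n in sequentially. (indicator (X n) x :: real) = 1" by eventually_elim (simp add: X_def)
		thus ?thesis by (rule tendsto_eventually)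
	qed
	have "T -->> T0" unfolding T_def[abs_def] T0_def
	proof (rule tendsto_add; rule set_integral_tendsto_bounded_set[OF _ _ O0l])
		show "lint O0 u0" "lint O0 (wpd O0 (0, 1) u0)" by (rule ui)+
		show "lmeas O0 (%x. indicator (X n) x * ((snd x + b) * \<psi> (fst x)))"
			"lmeas O0 (%x. indicator (X n) x * \<psi> (fst x))"
			"lmeas O0 (%x. (snd x + b) * \<psi> (fst x))"
			"lmeas O0 (%x. \<psi> (fst x))" for n unfolding smeas_def by measurable
		show "\<bar>indicator (X n) x * ((snd x + b) * \<psi> (fst x))\<bar> <= b * M" if "x \<in> O0" for n x
		proof -
			have "\<bar>snd x + b\<bar> <= b" using that by (auto simp: Omega0_def)
			hence "\<bar>(snd x + b) * \<psi> (fst x)\<bar> <= b * M" unfolding abs_mult by (intro mult_mono B) (use pos in auto)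
			thus ?thesis using M0 pos by (auto simp: indicator_def)
		qed
		show "\<bar>indicator (X n) x * \<psi> (fst x)\<bar> <= M" for n x using B(1)[of "fst x"] M0 by (auto simp: indicator_def)
		show "(%n. indicator (X n) x * ((snd x + b) * \<psi> (fst x))) -->> (snd x + b) * \<psi> (fst x)" if "x \<in> O0" for x
			using tendsto_mult[OF Xl[OF that] tendsto_const] by simp
		show "(%n. indicator (X n) x * \<psi> (fst x)) -->> \<psi> (fst x)" if "x \<in> O0" for x
			using tendsto_mult[OF Xl[OF that] tendsto_const] by simp
	qed
	note Tl = this
	have al: "(%n. av n (pd 1 \<gamma>)) -->> (LBINT s:I. v s * pd 1 \<gamma> s)" "(%n. av n \<psi>) -->> (LBINT s:I. v s * \<psi> s)"
		unfolding av_def by (rule average_tendsto[OF Q(1,2)], rule average_tendsto[OF c\<psi> B(1)])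
	have YZ: "Y -->> Z" unfolding Y_def[abs_def] Z_def
		by (intro tendsto_intros Tl al ep(3)) (use pos in auto)
	have "E -->> M * ((1 + \<omega>^2) * sqrt (a * \<alpha> * L * K^2 * 0))
			+ 1 / L * (M * C2 * 0 + \<alpha> * M * (K^2 * (1 + 4 / V^2) * sqrt 0 + a * V * 0)
				+ 2 * \<alpha> * M * sqrt (a * V * K^2 * 0) + 2 * \<alpha> / b * ((b + 1) * M * C) * 0)"
		unfolding E_def[abs_def]
		by (intro tendsto_add tendsto_mult tendsto_const tendsto_real_sqrt ep(3) sqrt_times_ln_tendsto_0[OF ep(1,3) pos(5)])
	hence E0: "E -->> 0" by simp
	have ev: "\<forall>\<^sub>F n in sequentially. \<bar>Y n\<bar> <= E n"
		using eventually_rate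
	proof eventually_elim
		case (elim n)
		then obtain N where "resonator_rate a b L V \<alpha> (ep n) N \<omega> K f (u n) u0 C C2" by blast
		from resonator_rate.channel_rate[OF this \<gamma> \<psi> B]
		show ?case unfolding Y_def T_def E_def av_def X_def .
	qed
	have "(%n. \<bar>Y n\<bar>) -->> \<bar>Z\<bar>" by (intro tendsto_intros YZ)
	from tendsto_le[OF sequentially_bot E0 this ev] have Z0: "Z = 0" by simp
	have e: "1 / (b - V * 0 / 2) * T0 = (LBINT s:I. trace0 a b u0 s * \<psi> s)"
		using trace0_identity(2)[OF pos(1,2) u0 continuous_on_subset[OF c\<psi> subset_UNIV] B(1)] by (simp add: T0_def add.commute)
	show ?thesis using Z0 unfolding Z_def Q(3) e by (simp add: algebra_simps)
qed

end

section \<open>General test functions\<close>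

text \<open>Primitives of test functions that converge to the derivative pointwise and boundedly.\<close>
lemma C1_interval_approximation:
	fixes \<psi> D :: "real => real"
	assumes a: "a > 0" and c: "continuous_on {0..a} \<psi>" "continuous_on {0..a} D"
		and d: "!!s. s \<in> {0<..<a} ==> DERIV \<psi> s :> D s"
	obtains \<Psi> \<gamma> M where "!!k::nat. \<gamma> k \<in> test_functions {0<..<a}" "!!k s. DERIV (\<Psi> k) s :> \<gamma> k s"
		"!!k s. \<bar>\<Psi> k s\<bar> <= M" "!!k s. \<bar>\<gamma> k s\<bar> <= M"
		"!!s. s \<in> {0<..<a} ==> (%k. \<gamma> k s) -->> D s" "!!s. s \<in> {0..a} ==> (%k. \<Psi> k s) -->> \<psi> s"
proof -
	obtain B where B: "B > 0" "!!s. s \<in> {0..a} ==> \<bar>D s\<bar> <= B"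
		using compact_imp_bounded[OF compact_continuous_image[OF c(2) compact_Icc]] by (auto simp: bounded_pos)
	have cD: "continuous_on {0<..<a} D" by (rule continuous_on_subset[OF c(2)]) auto
	obtain \<gamma> where \<gamma>: "!!k::nat. \<gamma> k \<in> test_functions {0<..<a}" "!!k s. \<bar>\<gamma> k s\<bar> <= B" "!!s. s \<in> {0<..<a} ==> (%k. \<gamma> k s) -->> D s"
	proof (rule test_dense_interval[OF cD])
		show "\<bar>D s\<bar> <= B" if "s \<in> {0<..<a}" for s using B(2)[of s] that by auto
		show "B \<ge> 0" using B(1) by simp
	qed blast
	have c\<gamma>: "continuous_on UNIV (\<gamma> k)" for k using \<gamma>(1)[of k] by (auto simp: test_functions_def dest: spec[of _ 0])
	have z\<gamma>: "\<gamma> k s = 0" if "s \<notin> {0<..<a}" for k s using \<gamma>(1)[of k] that by (auto simp: test_functions_def)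
	have "\<exists>F. \<forall>s. DERIV F s :> \<gamma> k s" for k
	proof -
		have "\<exists>F. \<forall>x::real. (-\<infinity>::ereal) < x --> x < (\<infinity>::ereal) --> (F has_vector_derivative \<gamma> k x) (at x)"
			by (rule einterval_antiderivative) (use c\<gamma>[of k] in "auto simp: continuous_on_eq_continuous_at")
		thus ?thesis by (auto simp: has_real_derivative_iff_has_vector_derivative)
	qed
	then obtain F where F: "!!k s. DERIV (F k) s :> \<gamma> k s" by metis
	define \<Psi> where "\<Psi> k s = \<psi> 0 + (F k s - F k 0)" for k s
	have d\<Psi>: "DERIV (\<Psi> k) s :> \<gamma> k s" for k s
		unfolding \<Psi>_def[abs_def] by (auto intro!: derivative_eq_intros F)
	have lip: "\<bar>\<Psi> k s - \<Psi> k t\<bar> <= Q * \<bar>s - t\<bar>" if "convex S" "s \<in> S" "t \<in> S" "!!r. r \<in> S ==> \<bar>\<gamma> k r\<bar> <= Q" for S k s t Q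
		using field_differentiable_bound[of S "\<Psi> k" "\<gamma> k" Q s t] that d\<Psi> has_field_derivative_at_within by (simp add: has_field_derivative_at_within)
	have b\<Psi>: "\<bar>\<Psi> k s\<bar> <= \<bar>\<psi> 0\<bar> + B * a" for k s
	proof -
		have 0: "\<Psi> k 0 = \<psi> 0" by (simp add: \<Psi>_def)
		consider "s < 0" | "s \<in> {0..a}" | "a < s" by force
		hence "\<bar>\<Psi> k s - \<Psi> k 0\<bar> <= B * a"
		proof cases
			case 1
			have "\<bar>\<Psi> k s - \<Psi> k 0\<bar> <= 0 * \<bar>s - 0\<bar>" by (rule lip[of "{..0}"]) (use 1 z\<gamma> in auto)
			thus ?thesis using B a by simp
		next
			case 2
			have "\<bar>\<Psi> k s - \<Psi> k 0\<bar> <= B * \<bar>s - 0\<bar>" by (rule lip[of UNIV]) (use \<gamma>(2) in auto)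
			also have "... <= B * a" using 2 B by (intro mult_left_mono) auto
			finally show ?thesis .
		next
			case 3
			have "\<bar>\<Psi> k s - \<Psi> k a\<bar> <= 0 * \<bar>s - a\<bar>" by (rule lip[of "{a..}"]) (use 3 z\<gamma> in auto)
			moreover have "\<bar>\<Psi> k a - \<Psi> k 0\<bar> <= B * \<bar>a - 0\<bar>" by (rule lip[of UNIV]) (use \<gamma>(2) in auto)
			ultimately show ?thesis using a by simp
		qed
		thus ?thesis unfolding 0 by linarith
	qed
	have lim: "(%k. \<Psi> k s) -->> \<psi> s" if s: "s \<in> {0..a}" for s
	proof -
		define D0 where "D0 t = (if t \<in> {0<..<a} then D t else 0)" for t
		have 1: "(D0 has_integral (\<psi> s - \<psi> 0)) {0..s}"
		proof (rule fundamental_theorem_of_calculus_interior)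
			show "0 <= s" using s by simp
			show "continuous_on {0..s} \<psi>" by (rule continuous_on_subset[OF c(1)]) (use s in auto)
			fix t assume "t \<in> {0<..<s}"
			hence "t \<in> {0<..<a}" using s by auto
			thus "(\<psi> has_vector_derivative D0 t) (at t)"
				using d[of t] by (simp add: D0_def has_real_derivative_iff_has_vector_derivative)
		qed
		have 2: "(\<gamma> k has_integral (\<Psi> k s - \<Psi> k 0)) {0..s}" for k
		proof (rule fundamental_theorem_of_calculus_interior)
			show "0 <= s" using s by simp
			show "continuous_on {0..s} (\<Psi> k)" using DERIV_isCont[OF d\<Psi>] by (auto intro: continuous_at_imp_continuous_on)
			show "(\<Psi> k has_vector_derivative \<gamma> k t) (at t)" for t
				using d\<Psi>[of k t] by (simp add: has_real_derivative_iff_has_vector_derivative)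
		qed
		have "(%k. integral {0..s} (\<gamma> k)) -->> integral {0..s} D0"
		proof (rule dominated_convergence(2))
			show "\<gamma> k integrable_on {0..s}" for k using 2 by blast
			show "(%_. B) integrable_on {0..s}" by (rule integrable_const_ivl)
			show "norm (\<gamma> k t) <= B" for k t using \<gamma>(2) by simp
			show "(%k. \<gamma> k t) -->> D0 t" for t using \<gamma>(3)[of t] z\<gamma>[of t] by (auto simp: D0_def)
		qed
		hence "(%k. \<Psi> k s - \<Psi> k 0) -->> \<psi> s - \<psi> 0" using integral_unique[OF 1] integral_unique[OF 2] by simp
		hence "(%k. \<Psi> k s - \<psi> 0) -->> \<psi> s - \<psi> 0" by (simp add: \<Psi>_def)
		from tendsto_add[OF this tendsto_const[of "\<psi> 0"]] show ?thesis by simp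
	qed
	define M where "M = \<bar>\<psi> 0\<bar> + B * a + B"
	have "\<bar>\<Psi> k s\<bar> <= M" "\<bar>\<gamma> k s\<bar> <= M" for k s
		using b\<Psi>[of k s] \<gamma>(2)[of k s] B(1) a mult_nonneg_nonneg[of B a] unfolding M_def by linarith+
	thus ?thesis using that[of \<gamma> \<Psi> M] \<gamma>(1,3) d\<Psi> lim by blast
qed

text \<open>
	A function in $C^1$ up to the upper boundary has a differentiable trace, the tangential
	derivative of which is the boundary value of the first component of the gradient.
\<close>
lemma trace_derivative:
	fixes \<phi> :: "plane => real"
	assumes ab: "a > 0" "b > 0" and c: "continuous_on (closure (Omega0 a b)) \<phi>" "continuous_on (closure (Omega0 a b)) D"
		and d: "!!x. x \<in> Omega0 a b ==> GDERIV \<phi> x :> D x" and s: "s \<in> interval_I a"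
	shows "((%s. \<phi> (s, 0)) has_real_derivative fst (D (s, 0))) (at s)"
proof -
	have cl: "closure (Omega0 a b) = {0..a} \<times> {-b..0}" by (rule closure_Omega0[OF ab])
	have I: "interval_I a = {0<..<a}" by (simp add: interval_I_def)
	define A where "A = fst (D (s, 0))"
	have "((%s. \<phi> (s, 0)) has_derivative (%t. A * t)) (at s)"
		unfolding has_derivative_at_alt
	proof (intro conjI allI impI)
		show "bounded_linear (%t. A * t)" by (rule bounded_linear_mult_right)
		fix e :: real assume e: "e > 0"
		have "(s, 0) \<in> closure (Omega0 a b)" using s ab by (auto simp: cl I)
		from c(2)[unfolded continuous_on_iff, rule_format, OF this e]
		obtain r where r: "r > 0" "!!x. x \<in> closure (Omega0 a b) ==> dist x (s, 0) < r ==> dist (D x) (D (s, 0)) < e" by metis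
		define q where "q = min (r / 2) (min s (a - s))"
		have q: "q > 0" "q <= r / 2" "q <= s" "q <= a - s" using r(1) s min.cobounded1[of "r / 2" "min s (a - s)"] by (auto simp: q_def I)
		show "\<exists>d>0. \<forall>t. norm (t - s) < d --> norm (\<phi> (t, 0) - \<phi> (s, 0) - A * (t - s)) <= e * norm (t - s)"
		proof (intro exI[of _ q] conjI allI impI q(1))
			fix t assume t: "norm (t - s) < q"
			have in_I: "t' \<in> {0<..<a}" if "\<bar>t' - s\<bar> < q" for t' using that q by auto
			\<comment> \<open>The estimate holds on the segments below the boundary, by the mean value theorem.\<close>
			have below: "\<bar>\<phi> (t, y) - \<phi> (s, y) - A * (t - s)\<bar> <= e * \<bar>t - s\<bar>" if y: "- min b (r / 2) < y" "y < 0" for y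
			proof -
				let ?S = "{s - q<..<s + q}"
				have "norm ((\<phi> (t, y) - A * t) - (\<phi> (s, y) - A * s)) <= e * norm (t - s)"
				proof (rule field_differentiable_bound[of ?S "%t. \<phi> (t, y) - A * t" "%t. fst (D (t, y)) - A"])
					fix t' assume t': "t' \<in> ?S"
					hence x: "(t', y) \<in> Omega0 a b" using in_I[of t'] y by (auto simp: Omega0_def I)
					have "((%t. \<phi> ((0, y) + t *R (1, 0))) has_real_derivative inner (1, 0) (D (t', y))) (at t')"
						by (rule line_derivative) (use d[OF x] in "simp add: gderiv_def")
					hence "((%t. \<phi> (t, y)) has_real_derivative fst (D (t', y))) (at t')" by (simp add: inner_prod_def)
					from DERIV_diff[OF this DERIV_cmult[OF DERIV_ident, of A]]
					have "((%t. \<phi> (t, y) - A * t) has_real_derivative fst (D (t', y)) - A) (at t')" by simp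
					thus "((%t. \<phi> (t, y) - A * t) has_real_derivative fst (D (t', y)) - A) (at t' within ?S)"
						by (rule has_field_derivative_at_within)
					have "dist (t', y) (s, 0) <= \<bar>t' - s\<bar> + \<bar>y\<bar>"
						using norm_Pair_le[of "t' - s" y] by (simp add: dist_norm)
					also have "... < r" using t' y q by auto
					finally have "dist (D (t', y)) (D (s, 0)) < e" using r(2)[of "(t', y)"] x closure_subset[of "Omega0 a b"] by blast
					moreover have "\<bar>fst (D (t', y)) - A\<bar> <= dist (D (t', y)) (D (s, 0))"
						unfolding A_def using dist_fst_le[of "D (t', y)" "D (s, 0)"] by (simp add: dist_real_def)
					ultimately show "norm (fst (D (t', y)) - A) <= e" by simp
				qed (use t q in auto)
				thus ?thesis by (simp add: algebra_simps)
			qed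
			define yn where "yn k = - (min b (r / 2) / 2) / real (Suc k)" for k
			have yn: "- min b (r / 2) < yn k" "yn k < 0" for k
			proof -
				have m: "0 < min b (r / 2)" using ab r by simp
				thus "yn k < 0" by (simp add: yn_def)
				have "min b (r / 2) / 2 / real (Suc k) <= min b (r / 2) / 2 / 1" by (rule divide_left_mono) (use m in auto)
				thus "- min b (r / 2) < yn k" using m unfolding yn_def by linarith
			qed
			have "(%k. - (min b (r / 2) / 2) * inverse (real (Suc k))) -->> - (min b (r / 2) / 2) * 0"
				by (intro tendsto_intros LIMSEQ_inverse_real_of_nat)
			hence yl: "yn -->> 0" unfolding yn_def[abs_def] divide_inverse mult_zero_right .
			have lim: "(%k. \<phi> (t', yn k)) -->> \<phi> (t', 0)" if "\<bar>t' - s\<bar> < q" for t'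
			proof (rule continuous_on_tendsto_compose[OF c(1)])
				show "(%k. (t', yn k)) -->> (t', 0)" by (intro tendsto_intros yl)
				show "(t', 0) \<in> closure (Omega0 a b)" using in_I[OF that] ab by (auto simp: cl)
				show "\<forall>\<^sub>F k in sequentially. (t', yn k) \<in> closure (Omega0 a b)"
					using in_I[OF that] yn by (auto simp: cl less_imp_le intro!: always_eventually) (meson less_le_trans min.cobounded1 neg_le_iff_le order.trans less_imp_le)
			qed
			have "(%k. \<bar>\<phi> (t, yn k) - \<phi> (s, yn k) - A * (t - s)\<bar>) -->> \<bar>\<phi> (t, 0) - \<phi> (s, 0) - A * (t - s)\<bar>"
				by (intro tendsto_intros lim) (use t q in auto)
			from LIMSEQ_le_const2[OF this] below[OF yn]
			show "norm (\<phi> (t, 0) - \<phi> (s, 0) - A * (t - s)) <= e * norm (t - s)" by auto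
		qed
	qed
	thus ?thesis unfolding A_def has_field_derivative_def .
qed

lemma grad_eq: "GDERIV \<phi> x :> D ==> grad \<phi> x = D"
proof -
	assume "GDERIV \<phi> x :> D"
	hence "(%h. inner h D) = frechet_derivative \<phi> (at x)" unfolding gderiv_def by (rule frechet_derivative_at)
	hence "pd i \<phi> x = inner D i" for i by (metis pd_def inner_commute)
	thus "grad \<phi> x = D" by (simp add: grad_def euclidean_representation)
qed

context resonator_sequence
begin

lemma closure_I: "closure I = {0..a}" using pos by (simp add: interval_I_def)

lemma I_alt: "I = {0<..<a}" by (simp add: interval_I_def)

lemma I_meas: "I \<in> sets lborel" using interval_I_sets by simp

lemma interval_tendsto:
	fixes g :: "real => real"
	assumes "lint I g" "!!k s. \<bar>\<kappa> k s\<bar> <= M" "!!k. continuous_on UNIV (\<kappa> k)" "continuous_on {0..a} \<kappa>0"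
		"!!s. s \<in> {0<..<a} ==> (%k. \<kappa> k s) -->> \<kappa>0 s"
	shows "(%k. LBINT s:I. g s * \<kappa> k s) -->> (LBINT s:I. g s * \<kappa>0 s)"
proof (rule set_integral_tendsto_bounded_set[OF assms(1,2) I_meas])
	have [measurable]: "I \<in> sets borel" using interval_I_sets by simp
	show "lmeas I (\<kappa> k)" for k
	proof -
		have [measurable]: "\<kappa> k \<in> borel_measurable borel" by (rule borel_measurable_continuous_onI[OF assms(3)])
		show ?thesis unfolding smeas_def by measurable
	qed
	have "(%s. indicator I s *R \<kappa>0 s) \<in> borel_measurable borel"
		by (rule borel_measurable_continuous_on_indicator[OF _ continuous_on_subset[OF assms(4)]]) (auto simp: I_alt)
	thus "lmeas I \<kappa>0" by (simp add: smeas_def)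
	show "(%k. \<kappa> k s) -->> \<kappa>0 s" if "s \<in> I" for s using assms(5) that by (simp add: I_alt)
qed

lemma trace_integrable: "trace0 a b u0 \<in> Lp 2 I" "lint I (trace0 a b u0)"
proof -
	show "trace0 a b u0 \<in> Lp 2 I" by (rule trace0_identity(1)[OF pos(1,2) u0, of "%_. 0" 0]) auto
	thus "lint I (trace0 a b u0)" by (rule Lp2_integrable[OF I_meas interval_I_sets(2)])
qed

lemma channel_equation:
	assumes "\<psi> \<in> C1_closure I"
	shows "(LBINT s:I. v1 s * deriv \<psi> s) + (LBINT s:I. (\<alpha> / (L * V) - \<omega>^2) * v s * \<psi> s) = (LBINT s:I. \<alpha> / (L * V) * trace0 a b u0 s * \<psi> s)"
proof -
	obtain D where c: "continuous_on {0..a} \<psi>" "continuous_on {0..a} D" and d: "!!s. s \<in> {0<..<a} ==> DERIV \<psi> s :> D s"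
		using assms unfolding C1_closure_def closure_I I_alt[symmetric] by auto
	obtain \<Psi> \<gamma> M where A: "!!k::nat. \<gamma> k \<in> test_functions {0<..<a}" "!!k s. DERIV (\<Psi> k) s :> \<gamma> k s"
		"!!k s. \<bar>\<Psi> k s\<bar> <= M" "!!k s. \<bar>\<gamma> k s\<bar> <= M"
		"!!s. s \<in> {0<..<a} ==> (%k. \<gamma> k s) -->> D s" "!!s. s \<in> {0..a} ==> (%k. \<Psi> k s) -->> \<psi> s"
		by (rule C1_interval_approximation[OF pos(1) c d]) blast+
	have cc: "continuous_on UNIV (\<gamma> k)" "continuous_on UNIV (\<Psi> k)" for k
		using A(1)[of k] DERIV_isCont[OF A(2)] by (auto simp: test_functions_def continuous_on_eq_continuous_at dest: spec[of _ 0])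
	have 1: "(%k. LBINT s:I. v1 s * \<gamma> k s) -->> (LBINT s:I. v1 s * D s)"
		by (rule interval_tendsto[OF v_props(5) A(4) cc(1) c(2) A(5)])
	have 2: "(%k. LBINT s:I. g s * \<Psi> k s) -->> (LBINT s:I. g s * \<psi> s)" if "lint I g" for g
		by (rule interval_tendsto[OF that A(3) cc(2) c(1)]) (use A(6) in auto)
	have "(%k. V * ((LBINT s:I. v1 s * \<gamma> k s) - \<omega>^2 * (LBINT s:I. v s * \<Psi> k s)) + \<alpha> / L * ((LBINT s:I. v s * \<Psi> k s) - (LBINT s:I. trace0 a b u0 s * \<Psi> k s)))
		-->> V * ((LBINT s:I. v1 s * D s) - \<omega>^2 * (LBINT s:I. v s * \<psi> s)) + \<alpha> / L * ((LBINT s:I. v s * \<psi> s) - (LBINT s:I. trace0 a b u0 s * \<psi> s))"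
		by (intro tendsto_intros 1 2 v_props(4) trace_integrable(2))
	moreover have "V * ((LBINT s:I. v1 s * \<gamma> k s) - \<omega>^2 * (LBINT s:I. v s * \<Psi> k s)) + \<alpha> / L * ((LBINT s:I. v s * \<Psi> k s) - (LBINT s:I. trace0 a b u0 s * \<Psi> k s)) = 0" for k
		by (rule channel_equation_test[OF A(1)[of k, folded I_alt] A(2,3,4)])
	ultimately have "V * ((LBINT s:I. v1 s * D s) - \<omega>^2 * (LBINT s:I. v s * \<psi> s)) + \<alpha> / L * ((LBINT s:I. v s * \<psi> s) - (LBINT s:I. trace0 a b u0 s * \<psi> s)) = 0"
		by (simp add: LIMSEQ_const_iff)
	hence "1 / V * (V * ((LBINT s:I. v1 s * D s) - \<omega>^2 * (LBINT s:I. v s * \<psi> s)) + \<alpha> / L * ((LBINT s:I. v s * \<psi> s) - (LBINT s:I. trace0 a b u0 s * \<psi> s))) = 0" by simp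
	hence e: "(LBINT s:I. v1 s * D s) + (\<alpha> / (L * V) - \<omega>^2) * (LBINT s:I. v s * \<psi> s) = \<alpha> / (L * V) * (LBINT s:I. trace0 a b u0 s * \<psi> s)"
		using pos by (simp add: field_simps)
	have "(LBINT s:I. v1 s * deriv \<psi> s) = (LBINT s:I. v1 s * D s)"
		by (rule set_integral_cong_simple) (use d DERIV_imp_deriv in "auto simp: I_alt")
	thus ?thesis using e by (simp add: mult.assoc)
qed

text \<open>The function \<open>\<phi>\<close> is corrected by a function of $x_1$ so that its trace becomes the primitive of a test function.\<close>
lemma lower_equation:
	assumes "\<phi> \<in> C1_closure O0"
	shows "(LBINT x:O0. wgrad O0 w x \<bullet> grad \<phi> x) - \<omega>^2 * (LBINT x:O0. w x * \<phi> x)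
		= - V * (LBINT s:I. v1 s * deriv (%s. \<phi> (s, 0)) s - \<omega>^2 * v s * \<phi> (s, 0))"
proof -
	obtain D where c\<phi>: "continuous_on (closure O0) \<phi>" "continuous_on (closure O0) D" and d\<phi>: "!!x. x \<in> O0 ==> GDERIV \<phi> x :> D x"
		using assms unfolding C1_closure_def by auto
	have cl: "closure O0 = {0..a} \<times> {-b..0}" by (rule closure_Omega0[OF pos(1,2)])
	define \<psi> where "\<psi> s = \<phi> (s, 0)" for s
	define D1 where "D1 s = fst (D (s, 0))" for s
	have seg: "continuous_on {0..a} (%s::real. (s, 0::real))" "(%s::real. (s, 0::real)) ` {0..a} \<subseteq> closure O0"
		using pos by (auto simp: cl intro!: continuous_intros)
	have c: "continuous_on {0..a} \<psi>" "continuous_on {0..a} D1"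
		unfolding \<psi>_def[abs_def] D1_def[abs_def]
		by (rule continuous_on_compose2[OF c\<phi>(1) seg], rule continuous_on_compose2[OF continuous_on_fst[OF c\<phi>(2)] seg])
	have d: "DERIV \<psi> s :> D1 s" if "s \<in> {0<..<a}" for s
		unfolding \<psi>_def[abs_def] D1_def by (rule trace_derivative[OF pos(1,2) c\<phi> d\<phi>]) (use that in "auto simp: I_alt")
	obtain \<Psi> \<gamma> M where A: "!!k::nat. \<gamma> k \<in> test_functions {0<..<a}" "!!k s. DERIV (\<Psi> k) s :> \<gamma> k s"
		"!!k s. \<bar>\<Psi> k s\<bar> <= M" "!!k s. \<bar>\<gamma> k s\<bar> <= M"
		"!!s. s \<in> {0<..<a} ==> (%k. \<gamma> k s) -->> D1 s" "!!s. s \<in> {0..a} ==> (%k. \<Psi> k s) -->> \<psi> s"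
		by (rule C1_interval_approximation[OF pos(1) c d]) blast+
	have cc: "continuous_on UNIV (\<gamma> k)" "continuous_on UNIV (\<Psi> k)" for k
		using A(1)[of k] DERIV_isCont[OF A(2)] by (auto simp: test_functions_def continuous_on_eq_continuous_at dest: spec[of _ 0])
	define \<Phi> where "\<Phi> k x = \<phi> x + (\<Psi> k (fst x) - \<psi> (fst x))" for k x
	define H where "H k x = D x + (\<gamma> k (fst x) - D1 (fst x), 0)" for k x
	have f: "continuous_on (closure O0) (fst :: plane => real)" "(fst :: plane => real) ` closure O0 \<subseteq> {0..a}"
		by (auto simp: cl intro!: continuous_intros)
	have cf: "continuous_on (closure O0) (%x. \<Psi> k (fst x))" "continuous_on (closure O0) (%x. \<gamma> k (fst x))"
		"continuous_on (closure O0) (%x. \<psi> (fst x))" "continuous_on (closure O0) (%x. D1 (fst x))" for k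
		by (rule continuous_on_compose2[OF cc(2) f(1) subset_UNIV], rule continuous_on_compose2[OF cc(1) f(1) subset_UNIV],
				rule continuous_on_compose2[OF c(1) f], rule continuous_on_compose2[OF c(2) f])
	have c\<Phi>: "continuous_on (closure O0) (\<Phi> k)" "continuous_on (closure O0) (H k)" for k
		unfolding \<Phi>_def[abs_def] H_def[abs_def] by (intro continuous_intros c\<phi> cf)+
	have dstrip: "GDERIV (%x::plane. g (fst x)) x :> (g', 0)" if "(g has_real_derivative g') (at (fst x))" for g g' x
	proof -
		have "((%x::plane. g (fst x)) has_derivative (%h. g' * fst h)) (at x)"
			using has_derivative_compose[OF has_derivative_fst[OF has_derivative_ident] that[unfolded has_field_derivative_def]] by simp
		moreover have "(%h::plane. g' * fst h) = (%h. inner h (g', 0))" by (auto simp: inner_prod_def)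
		ultimately show ?thesis by (simp add: gderiv_def)
	qed
	have d\<Phi>: "GDERIV (\<Phi> k) x :> H k x" if x: "x \<in> O0" for k x
	proof -
		have "fst x \<in> {0<..<a}" using x by (auto simp: Omega0_def I_alt)
		from GDERIV_add[OF d\<phi>[OF x] GDERIV_diff[OF dstrip[OF A(2)] dstrip[OF d[OF this]]]]
		show ?thesis by (simp add: \<Phi>_def[abs_def] H_def)
	qed
	have tr: "\<Phi> k (s, 0) = \<Psi> k s" for k s by (simp add: \<Phi>_def \<psi>_def)
	have eq: "(LBINT x:O0. wgrad O0 w x \<bullet> H k x) - \<omega>^2 * (LBINT x:O0. w x * \<Phi> k x) + V * ((LBINT s:I. v1 s * \<gamma> k s) - \<omega>^2 * (LBINT s:I. v s * \<Psi> k s)) = 0" for k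
		by (rule lower_equation_test[OF A(1)[of k, folded I_alt] A(2,3,4) c\<Phi> d\<Phi> tr])
	have O0b: "O0 \<in> sets borel" "O0 \<in> sets lborel" using Omega0_sets(1) by simp_all
	note bnd = continuous_on_closure_bounded[OF bounded_Omega0 O0b(1)]
	obtain B1 where B1: "!!x. x \<in> O0 ==> \<bar>fst (D x)\<bar> <= B1" "lmeas O0 (%x. fst (D x))"
		using bnd[OF continuous_on_fst[OF c\<phi>(2)]] by metis
	obtain B2 where B2: "!!x. x \<in> O0 ==> \<bar>snd (D x)\<bar> <= B2" "lmeas O0 (%x. snd (D x))"
		using bnd[OF continuous_on_snd[OF c\<phi>(2)]] by metis
	obtain B3 where B3: "!!x. x \<in> O0 ==> \<bar>\<phi> x\<bar> <= B3" "lmeas O0 \<phi>"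
		using bnd[OF c\<phi>(1)] by metis
	obtain B4 where B4: "!!x. x \<in> O0 ==> \<bar>\<psi> (fst x)\<bar> <= B4" using bnd[OF cf(3)] by metis
	obtain B5 where B5: "!!x. x \<in> O0 ==> \<bar>D1 (fst x)\<bar> <= B5" using bnd[OF cf(4)] by metis
	have mH: "lmeas O0 (%x. fst (H k x))" "lmeas O0 (\<Phi> k)" for k
		using bnd[OF continuous_on_fst[OF c\<Phi>(2)]] bnd[OF c\<Phi>(1)] by metis+
	have w: "w \<in> sobolev 1 1 O0" using w_lim by (simp add: weakly_star_BV_def)
	have Bs: "(1, 0) \<in> (Basis :: (plane) set)" "(0, 1) \<in> (Basis :: (plane) set)" by (auto simp: Basis_real2)
	have wi: "lint O0 w" "lint O0 (wpd O0 (1, 0) w)" "lint O0 (wpd O0 (0, 1) w)"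
		using sobolev1D(1,3)[OF w open_Omega0 Bs(1)] sobolev1D(3)[OF w open_Omega0 Bs(2)] by (auto simp: Lp1_iff[symmetric])
	have strip: "fst x \<in> {0<..<a}" if "x \<in> O0" for x using that by (auto simp: Omega0_def I_alt)
	have bH: "\<bar>fst (H k x)\<bar> <= B1 + M + B5" "\<bar>\<Phi> k x\<bar> <= B3 + M + B4" if "x \<in> O0" for k x
		using B1(1)[OF that] B5[OF that] B3(1)[OF that] B4[OF that] A(3)[of k "fst x"] A(4)[of k "fst x"] by (auto simp: H_def \<Phi>_def)
	have l1: "(%k. LBINT x:O0. wpd O0 (1, 0) w x * fst (H k x)) -->> (LBINT x:O0. wpd O0 (1, 0) w x * fst (D x))"
	proof (rule set_integral_tendsto_bounded_set[OF wi(2) bH(1) O0b(2) mH(1) B1(2)])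
		fix x assume x: "x \<in> O0"
		have "(%k. fst (D x) + (\<gamma> k (fst x) - D1 (fst x))) -->> fst (D x) + (D1 (fst x) - D1 (fst x))" by (intro tendsto_intros A(5) strip[OF x])
		thus "(%k. fst (H k x)) -->> fst (D x)" by (simp add: H_def)
	qed
	have l2: "(%k. LBINT x:O0. w x * \<Phi> k x) -->> (LBINT x:O0. w x * \<phi> x)"
	proof (rule set_integral_tendsto_bounded_set[OF wi(1) bH(2) O0b(2) mH(2) B3(2)])
		fix x assume x: "x \<in> O0"
		have "(%k. \<phi> x + (\<Psi> k (fst x) - \<psi> (fst x))) -->> \<phi> x + (\<psi> (fst x) - \<psi> (fst x))" by (intro tendsto_intros A(6)) (use strip[OF x] in auto)
		thus "(%k. \<Phi> k x) -->> \<phi> x" by (simp add: \<Phi>_def)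
	qed
	have g: "(LBINT x:O0. wgrad O0 w x \<bullet> J x) = (LBINT x:O0. wpd O0 (1, 0) w x * fst (J x)) + (LBINT x:O0. wpd O0 (0, 1) w x * snd (J x))"
		if i: "lint O0 (%x. wpd O0 (1, 0) w x * fst (J x))" "lint O0 (%x. wpd O0 (0, 1) w x * snd (J x))" for J
		unfolding wgrad_real2 inner_prod_def fst_conv snd_conv inner_real_def by (rule set_integral_add(2)[OF i])
	have i2: "lint O0 (%x. wpd O0 (0, 1) w x * snd (D x))" by (rule set_integrable_mult_bounded[OF wi(3) B2(2,1)])
	have gH: "(LBINT x:O0. wgrad O0 w x \<bullet> H k x) = (LBINT x:O0. wpd O0 (1, 0) w x * fst (H k x)) + (LBINT x:O0. wpd O0 (0, 1) w x * snd (D x))" for k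
	proof -
		have e: "snd (H k x) = snd (D x)" for x by (simp add: H_def)
		have "lint O0 (%x. wpd O0 (1, 0) w x * fst (H k x))" by (rule set_integrable_mult_bounded[OF wi(2) mH(1) bH(1)])
		from g[OF this] i2 show ?thesis unfolding e by blast
	qed
	have gD: "(LBINT x:O0. wgrad O0 w x \<bullet> D x) = (LBINT x:O0. wpd O0 (1, 0) w x * fst (D x)) + (LBINT x:O0. wpd O0 (0, 1) w x * snd (D x))"
		by (rule g[OF set_integrable_mult_bounded[OF wi(2) B1(2,1)] i2])
	have l3: "(%k. LBINT s:I. v1 s * \<gamma> k s) -->> (LBINT s:I. v1 s * D1 s)"
		by (rule interval_tendsto[OF v_props(5) A(4) cc(1) c(2) A(5)])
	have l4: "(%k. LBINT s:I. v s * \<Psi> k s) -->> (LBINT s:I. v s * \<psi> s)"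
		by (rule interval_tendsto[OF v_props(4) A(3) cc(2) c(1)]) (use A(6) in auto)
	have "(%k. (LBINT x:O0. wgrad O0 w x \<bullet> H k x) - \<omega>^2 * (LBINT x:O0. w x * \<Phi> k x) + V * ((LBINT s:I. v1 s * \<gamma> k s) - \<omega>^2 * (LBINT s:I. v s * \<Psi> k s)))
		 -->> (LBINT x:O0. wgrad O0 w x \<bullet> D x) - \<omega>^2 * (LBINT x:O0. w x * \<phi> x) + V * ((LBINT s:I. v1 s * D1 s) - \<omega>^2 * (LBINT s:I. v s * \<psi> s))"
		unfolding gH gD by (intro tendsto_intros l1 l2 l3 l4)
	hence e: "(LBINT x:O0. wgrad O0 w x \<bullet> D x) - \<omega>^2 * (LBINT x:O0. w x * \<phi> x) = - V * ((LBINT s:I. v1 s * D1 s) - \<omega>^2 * (LBINT s:I. v s * \<psi> s))"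
		unfolding eq by (simp add: LIMSEQ_const_iff)
	have 1: "(LBINT x:O0. wgrad O0 w x \<bullet> grad \<phi> x) = (LBINT x:O0. wgrad O0 w x \<bullet> D x)"
		by (rule set_integral_cong_simple) (simp add: grad_eq[OF d\<phi>])
	have bI: "bounded I" "I \<in> sets borel" by (simp_all add: I_alt)
	obtain Q1 where Q1: "!!s. s \<in> I ==> \<bar>D1 s\<bar> <= Q1" "lmeas I D1"
		using continuous_on_closure_bounded[OF bI, unfolded closure_I, OF c(2)] by metis
	obtain Q2 where Q2: "!!s. s \<in> I ==> \<bar>\<psi> s\<bar> <= Q2" "lmeas I \<psi>"
		using continuous_on_closure_bounded[OF bI, unfolded closure_I, OF c(1)] by metis
	have i: "lint I (%s. v1 s * D1 s)" "lint I (%s. v s * \<psi> s)"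
		by (rule set_integrable_mult_bounded[OF v_props(5) Q1(2,1)], assumption, rule set_integrable_mult_bounded[OF v_props(4) Q2(2,1)])
	have "(LBINT s:I. v1 s * deriv (%s. \<phi> (s, 0)) s - \<omega>^2 * v s * \<phi> (s, 0)) = (LBINT s:I. v1 s * D1 s - \<omega>^2 * (v s * \<psi> s))"
		by (rule set_integral_cong_simple) (use DERIV_imp_deriv[OF d] in \<open>auto simp: I_alt \<psi>_def[abs_def]\<close>)
	also have "... = (LBINT s:I. v1 s * D1 s) - \<omega>^2 * (LBINT s:I. v s * \<psi> s)"
		unfolding set_integral_diff(2)[OF i(1) set_integrable_mult_right[OF i(2)]] by simp
	finally show ?thesis using e unfolding 1 by simp
qed

lemma test_function_C1: "\<phi> \<in> test_functions I ==> \<phi> \<in> C1_closure I & (\<forall>s. DERIV \<phi> s :> pd 1 \<phi> s)"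
proof
	assume t: "\<phi> \<in> test_functions I"
	hence k: "Ck (Suc 0) \<phi>" by (auto simp: test_functions_def)
	show d: "\<forall>s. DERIV \<phi> s :> pd 1 \<phi> s" using Ck_has_real_derivative[OF k] by blast
	have "continuous_on UNIV \<phi>" "continuous_on UNIV (pd 1 \<phi>)"
		using t pd_test_function[OF t, of 1] by (auto simp: test_functions_def dest: spec[of _ 0])
	thus "\<phi> \<in> C1_closure I" using d by (auto simp: C1_closure_def intro: continuous_on_subset exI[of _ "pd 1 \<phi>"])
qed

text \<open>The equation for \<open>v\<close>, tested with test functions, identifies the weak derivative of \<open>v1\<close>.\<close>
lemma v_W21: "v \<in> sobolev 2 1 I"
proof -
	define g where "g s = (\<alpha> / (L * V) - \<omega>^2) * v s - \<alpha> / (L * V) * trace0 a b u0 s" for s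
	have gi: "lint I g" unfolding g_def[abs_def]
		by (intro set_integral_diff(1) set_integrable_mult_right v_props(4) trace_integrable(2))
	have gw: "has_weak_pd I 1 v1 g"
		unfolding has_weak_pd_def
	proof (intro conjI ballI)
		show "v1 \<in> L1loc I" "g \<in> L1loc I" by (rule integrable_L1loc[OF v_props(5)], rule integrable_L1loc[OF gi])
		fix \<phi> assume t: "\<phi> \<in> test_functions I"
		note C = test_function_C1[OF t]
		have i: "lint I (%s. v s * \<phi> s)" "lint I (%s. trace0 a b u0 s * \<phi> s)"
			by (rule L1loc_mult_test_integrable[OF integrable_L1loc[OF v_props(4)] t], rule L1loc_mult_test_integrable[OF integrable_L1loc[OF trace_integrable(2)] t])
		have "deriv \<phi> = pd 1 \<phi>" using C DERIV_imp_deriv by blast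
		hence "(LBINT s:I. v1 s * pd 1 \<phi> s) + (\<alpha> / (L * V) - \<omega>^2) * (LBINT s:I. v s * \<phi> s) = \<alpha> / (L * V) * (LBINT s:I. trace0 a b u0 s * \<phi> s)"
			using channel_equation[of \<phi>] C by (simp add: mult.assoc)
		moreover have "(LBINT s:I. g s * \<phi> s) = (\<alpha> / (L * V) - \<omega>^2) * (LBINT s:I. v s * \<phi> s) - \<alpha> / (L * V) * (LBINT s:I. trace0 a b u0 s * \<phi> s)"
			unfolding g_def left_diff_distrib[of "_ * v _"] mult.assoc
				set_integral_diff(2)[OF set_integrable_mult_right[OF i(1)] set_integrable_mult_right[OF i(2)]] by simp
		ultimately show "(LBINT s:I. v1 s * pd 1 \<phi> s) = - (LBINT s:I. g s * \<phi> s)" by simp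
	qed
	have L: "v1 \<in> Lp 1 I" "g \<in> Lp 1 I" "v \<in> Lp 1 I" unfolding Lp1_iff by (rule v_props(5) gi v_props(4))+
	have "v1 \<in> sobolev 1 1 I"
		by (rule sobolev1I[where g="%_. g"]) (use L gw in auto)
	thus ?thesis using v_props(3) L(3) by (auto simp: numeral_2_eq_2)
qed

end

theorem theorem1p4:
  fixes a b L V \<alpha> \<omega> :: real
    and f :: "real \<times> real \<Rightarrow> real"
    and \<epsilon> :: "nat \<Rightarrow> real"
    and u :: "nat \<Rightarrow> real \<times> real \<Rightarrow> real"
    and u0 w :: "real \<times> real \<Rightarrow> real"
    and v :: "real \<Rightarrow> real"
  assumes "a > 0" and "b > 0" and "L > 0" and "V > 0" and "\<alpha> > 0" and "\<omega> > 0"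
    and "f \<in> Lp 2 UNIV"
    and "AE x in lborel. x \<notin> Omega0 a b \<longrightarrow> f x = 0"
    and "\<And>n. \<epsilon> n > 0" and "\<And>n. a / \<epsilon> n \<in> \<nat>" and "\<epsilon> \<longlonglongrightarrow> 0"
    and "\<And>n. weak_solution (Omega_eps a b L V \<alpha> (\<epsilon> n)) \<omega> f (u n)"
    and "\<exists>C. \<forall>n. H1_norm (Omega_eps a b L V \<alpha> (\<epsilon> n)) (u n) \<le> C"
    and "u0 \<in> H1 (Omega0 a b)"
    and "weakly_H1 (Omega0 a b) u u0"
    and "v \<in> H1 (interval_I a)"
    and "weakly_L2 (interval_I a) (\<lambda>n. resonator_average L V (\<epsilon> n) (u n)) v"
    and "\<exists>C. \<forall>n. (\<lambda>x. (u n x - u0 x) / \<epsilon> n) \<in> sobolev 1 1 (Omega0 a b) \<and>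
           W11_norm (Omega0 a b) (\<lambda>x. (u n x - u0 x) / \<epsilon> n) \<le> C"
    and "w \<in> sobolev 1 1 (Omega0 a b)"
    and "weakly_star_BV (Omega0 a b) (\<lambda>n x. (u n x - u0 x) / \<epsilon> n) w"
    and "\<exists>C>0. \<forall>n. 1 / (\<epsilon> n)\<^sup>2 *
           (LBINT x:C_eps a L \<alpha> (\<epsilon> n). \<bar>wpd (Omega_eps a b L V \<alpha> (\<epsilon> n)) (0, 1) (u n) x\<bar>) \<le> C"
  shows "v \<in> sobolev 2 1 (interval_I a) \<and>
    (\<forall>\<phi>\<in>C1_closure (Omega0 a b).
       (LBINT x:Omega0 a b. wgrad (Omega0 a b) w x \<bullet> grad \<phi> x)
         - \<omega>\<^sup>2 * (LBINT x:Omega0 a b. w x * \<phi> x)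
       = - V * (LBINT s:interval_I a.
           wpd (interval_I a) 1 v s * deriv (\<lambda>s. \<phi> (s, 0)) s - \<omega>\<^sup>2 * v s * \<phi> (s, 0))) \<and>
    (\<forall>\<psi>\<in>C1_closure (interval_I a).
       (LBINT s:interval_I a. wpd (interval_I a) 1 v s * deriv \<psi> s)
         + (LBINT s:interval_I a. (\<alpha> / (L * V) - \<omega>\<^sup>2) * v s * \<psi> s)
       = (LBINT s:interval_I a. \<alpha> / (L * V) * trace0 a b u0 s * \<psi> s))"
proof -
	from assms(13) obtain K where K: "!!n. H1_norm (Omega_eps a b L V \<alpha> (\<epsilon> n)) (u n) <= K" by blast
	from assms(18) obtain C where C: "!!n. W11_norm (Omega0 a b) (%x. (u n x - u0 x) / \<epsilon> n) <= C" by blast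
	from assms(21) obtain C2 where C2: "!!n. 1 / (\<epsilon> n)^2 *
			(LBINT x:C_eps a L \<alpha> (\<epsilon> n). \<bar>wpd (Omega_eps a b L V \<alpha> (\<epsilon> n)) (0, 1) (u n) x\<bar>) <= C2" by blast
	interpret resonator_sequence a b L V \<alpha> \<omega> K C C2 f \<epsilon> u u0 w v
		by (rule resonator_sequence.intro) (rule assms K C C2)+
	show ?thesis using v_W21 lower_equation channel_equation by blast
qed

end
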